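(* Let $\alpha\in(0,1)$, $T>0$, let $\Omega\subset\mathbb R^d$, $d\ge1$, be a bounded convex polygonal domain, let $u_0\in H_0^1(\Omega)\cap H^2(\Omega)$, and let $f:\mathbb R\to\mathbb R$ be Lipschitz continuous. Let $\tau=T/N$ and $t_n=n\tau$. Let $u_h\in C([0,T];S_h)$ be the solution of the semidiscrete problem $$\partial_t^\alpha u_h(t)-\Delta_hu_h(t)=P_hf(u_h(t)),\quad t\in(0,T],\qquad u_h(0)=R_hu_0.$$ Then the fully discrete scheme: given $u_h^0=R_hu_0$, find $u_h^n$, $n=1,\dots,N$, such that $$\bar\partial_\tau^\alpha(u_h^n-u_h^0)-\Delta_hu_h^n=P_hf(u_h^{n-1}),$$ with $\bar\partial_\tau^\alpha$ either the L1 scheme or the backward Euler convolution quadrature, has a unique solution $u_h^n\in S_h$, $n=1,\dots,N$, and the solutions satisfy $$\max_{1\le n\le N}\|u_h(t_n)-u_h^n\|_{L^2(\Omega)}\le c\,\tau^\alpha,$$ where the constant $c$ is independent of the mesh size $h$ and the time step size $\tau$.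
   Context: $\partial_t^\alpha u(t)=\frac1{\Gamma(1-\alpha)}\int_0^t(t-s)^{-\alpha}\frac{\mathrm d}{\mathrm ds}u(s)\,\mathrm ds$ is the Caputo derivative in time. $S_h\subset H_0^1(\Omega)$ is the continuous piecewise linear finite element space on a quasi-uniform shape regular triangulation of $\Omega$ with mesh size $h$. $\Delta_h:S_h\to S_h$ is defined by $(\Delta_hw_h,v_h)=-(\nabla w_h,\nabla v_h)$ for all $w_h,v_h\in S_h$; $P_h$ is the $L^2(\Omega)$ projection onto $S_h$; $R_h:H_0^1(\Omega)\to S_h$ is the Ritz projection, $(\nabla R_hw,\nabla v_h)=(\nabla w,\nabla v_h)$ for all $v_h\in S_h$. The semidiscrete problem has a unique solution $u_h$. $\bar\partial_\tau^\alpha w^n=\frac1{\tau^\alpha}\sum_{j=0}^nK_{n-j}w^j$, where the weights are given by $(1-\zeta)^\alpha=\sum_{j\ge0}K_j\zeta^j$ for the backward Euler convolution quadrature and by $\frac{(1-\zeta)^2}{\zeta\,\Gamma(2-\alpha)}\mathrm{Li}_{\alpha-1}(\zeta)=\sum_{j\ge0}K_j\zeta^j$ for the L1 scheme, with $\mathrm{Li}_p(z)=\sum_{j\ge1}z^j/j^p$ the polylogarithm. The expression $\bar\partial_\tau^\alpha(u_h^n-u_h^0)$ means $\bar\partial_\tau^\alpha$ applied to the sequence $w^n=u_h^n-u_h^0$. *)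

theory Defs
  imports "HOL-Analysis.Analysis"
begin

section \<open>Lebesgue and Sobolev spaces\<close>

text \<open>Elements of these spaces are represented by functions on the whole ambient space;
  only their values on \<open>\<Omega>\<close> matter, up to null sets.\<close>

definition L2_space :: "'a::euclidean_space set \<Rightarrow> ('a \<Rightarrow> real) set" where
  "L2_space \<Omega> = {f. f \<in> borel_measurable (lebesgue_on \<Omega>) \<and>
                     integrable (lebesgue_on \<Omega>) (\<lambda>x. (f x)\<^sup>2)}"

definition L2_inner :: "'a::euclidean_space set \<Rightarrow> ('a \<Rightarrow> real) \<Rightarrow> ('a \<Rightarrow> real) \<Rightarrow> real" where
  "L2_inner \<Omega> f g = (LINT x|lebesgue_on \<Omega>. f x * g x)"

definition L2_norm :: "'a::euclidean_space set \<Rightarrow> ('a \<Rightarrow> real) \<Rightarrow> real" where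
  "L2_norm \<Omega> f = sqrt (L2_inner \<Omega> f f)"

definition pderiv_dir :: "'a::euclidean_space \<Rightarrow> ('a \<Rightarrow> real) \<Rightarrow> 'a \<Rightarrow> real" where
  "pderiv_dir b f x = frechet_derivative f (at x) b"

primrec iterated_pderiv :: "'a::euclidean_space list \<Rightarrow> ('a \<Rightarrow> real) \<Rightarrow> 'a \<Rightarrow> real" where
  "iterated_pderiv [] f = f"
| "iterated_pderiv (b # bs) f = pderiv_dir b (iterated_pderiv bs f)"

definition smooth :: "('a::euclidean_space \<Rightarrow> real) \<Rightarrow> bool" where
  "smooth f \<longleftrightarrow> (\<forall>bs\<in>lists Basis. \<forall>x. iterated_pderiv bs f differentiable (at x))"

definition test_functions :: "'a::euclidean_space set \<Rightarrow> ('a \<Rightarrow> real) set" where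
  "test_functions \<Omega> = {\<phi>. smooth \<phi> \<and> compact (closure {x. \<phi> x \<noteq> 0}) \<and>
                            closure {x. \<phi> x \<noteq> 0} \<subseteq> \<Omega>}"

definition is_weak_pderiv ::
  "'a::euclidean_space set \<Rightarrow> 'a \<Rightarrow> ('a \<Rightarrow> real) \<Rightarrow> ('a \<Rightarrow> real) \<Rightarrow> bool" where
  "is_weak_pderiv \<Omega> b f g \<longleftrightarrow>
     (\<forall>\<phi>\<in>test_functions \<Omega>. L2_inner \<Omega> f (pderiv_dir b \<phi>) = - L2_inner \<Omega> g \<phi>)"

text \<open>\<open>sobolev_H k \<Omega>\<close> is the space \<open>H\<^sup>k(\<Omega>)\<close>.\<close>

primrec sobolev_H :: "nat \<Rightarrow> 'a::euclidean_space set \<Rightarrow> ('a \<Rightarrow> real) set" where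
  "sobolev_H 0 \<Omega> = L2_space \<Omega>"
| "sobolev_H (Suc k) \<Omega> =
     {f \<in> L2_space \<Omega>. \<forall>b\<in>Basis. \<exists>g\<in>sobolev_H k \<Omega>. is_weak_pderiv \<Omega> b f g}"

text \<open>For \<open>f \<in> H\<^sup>1(\<Omega>)\<close> the weak derivative is unique up to null sets, so the choice
  below does not affect any of the integrals in which it is used.\<close>

definition weak_pderiv :: "'a::euclidean_space set \<Rightarrow> 'a \<Rightarrow> ('a \<Rightarrow> real) \<Rightarrow> 'a \<Rightarrow> real" where
  "weak_pderiv \<Omega> b f = (SOME g. g \<in> L2_space \<Omega> \<and> is_weak_pderiv \<Omega> b f g)"

definition grad_inner :: "'a::euclidean_space set \<Rightarrow> ('a \<Rightarrow> real) \<Rightarrow> ('a \<Rightarrow> real) \<Rightarrow> real" where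
  "grad_inner \<Omega> f g = (\<Sum>b\<in>Basis. L2_inner \<Omega> (weak_pderiv \<Omega> b f) (weak_pderiv \<Omega> b g))"

definition H1_norm :: "'a::euclidean_space set \<Rightarrow> ('a \<Rightarrow> real) \<Rightarrow> real" where
  "H1_norm \<Omega> f = sqrt (L2_inner \<Omega> f f + grad_inner \<Omega> f f)"

definition sobolev_H10 :: "'a::euclidean_space set \<Rightarrow> ('a \<Rightarrow> real) set" where
  "sobolev_H10 \<Omega> =
     {f \<in> sobolev_H 1 \<Omega>. \<forall>\<epsilon>>0. \<exists>\<phi>\<in>test_functions \<Omega>. H1_norm \<Omega> (\<lambda>x. f x - \<phi> x) < \<epsilon>}"


section \<open>Domain, triangulations and finite element space\<close>

definition convex_polytopal_domain :: "'a::euclidean_space set \<Rightarrow> bool" where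
  "convex_polytopal_domain \<Omega> \<longleftrightarrow>
     open \<Omega> \<and> \<Omega> \<noteq> {} \<and> bounded \<Omega> \<and> convex \<Omega> \<and> polytope (closure \<Omega>)"

definition triangulates :: "'a::euclidean_space set set \<Rightarrow> 'a set \<Rightarrow> bool" where
  "triangulates \<T> \<Omega> \<longleftrightarrow>
     triangulation \<T> \<and> (\<forall>K\<in>\<T>. int DIM('a) simplex K) \<and> \<Union>\<T> = closure \<Omega>"

definition mesh_size :: "'a::euclidean_space set set \<Rightarrow> real" where
  "mesh_size \<T> = Max (diameter ` \<T>)"

text \<open>The ratio of the diameter to the inradius is at most \<open>\<kappa>\<close> on each element.\<close>

definition shape_regular :: "real \<Rightarrow> 'a::euclidean_space set set \<Rightarrow> bool" where
  "shape_regular \<kappa> \<T> \<longleftrightarrow> 0 < \<kappa> \<and> (\<forall>K\<in>\<T>. \<exists>x. cball x (diameter K / \<kappa>) \<subseteq> K)"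

definition quasi_uniform :: "real \<Rightarrow> 'a::euclidean_space set set \<Rightarrow> bool" where
  "quasi_uniform \<sigma> \<T> \<longleftrightarrow> 0 < \<sigma> \<and> (\<forall>K\<in>\<T>. mesh_size \<T> \<le> \<sigma> * diameter K)"

text \<open>Finite element functions are extended by zero outside the open set \<open>\<Omega>\<close>. This includes
  the homogeneous boundary condition, and it makes equality of functions coincide
  with equality of elements of \<open>S\<^sub>h\<close>.\<close>

definition fe_space :: "'a::euclidean_space set \<Rightarrow> 'a set set \<Rightarrow> ('a \<Rightarrow> real) set" where
  "fe_space \<Omega> \<T> = {v. continuous_on (closure \<Omega>) v \<and> (\<forall>x. x \<notin> \<Omega> \<longrightarrow> v x = 0) \<and>
                        (\<forall>K\<in>\<T>. \<exists>a c. \<forall>x\<in>K. v x = a \<bullet> x + c)}"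

definition discrete_laplacian ::
  "'a::euclidean_space set \<Rightarrow> 'a set set \<Rightarrow> ('a \<Rightarrow> real) \<Rightarrow> 'a \<Rightarrow> real" where
  "discrete_laplacian \<Omega> \<T> w =
     (THE z. z \<in> fe_space \<Omega> \<T> \<and> (\<forall>v\<in>fe_space \<Omega> \<T>. L2_inner \<Omega> z v = - grad_inner \<Omega> w v))"

definition L2_projection ::
  "'a::euclidean_space set \<Rightarrow> 'a set set \<Rightarrow> ('a \<Rightarrow> real) \<Rightarrow> 'a \<Rightarrow> real" where
  "L2_projection \<Omega> \<T> w =
     (THE z. z \<in> fe_space \<Omega> \<T> \<and> (\<forall>v\<in>fe_space \<Omega> \<T>. L2_inner \<Omega> z v = L2_inner \<Omega> w v))"

definition ritz_projection ::
  "'a::euclidean_space set \<Rightarrow> 'a set set \<Rightarrow> ('a \<Rightarrow> real) \<Rightarrow> 'a \<Rightarrow> real" where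
  "ritz_projection \<Omega> \<T> w =
     (THE z. z \<in> fe_space \<Omega> \<T> \<and> (\<forall>v\<in>fe_space \<Omega> \<T>. grad_inner \<Omega> z v = grad_inner \<Omega> w v))"


section \<open>Caputo derivative and the semidiscrete problem\<close>

text \<open>The time derivative of an \<open>S\<^sub>h\<close>-valued function is taken pointwise in \<open>x\<close>. Since
  \<open>S\<^sub>h\<close> is finite-dimensional, this agrees with the derivative in any norm on \<open>S\<^sub>h\<close>.\<close>

definition caputo_integrand ::
  "real \<Rightarrow> (real \<Rightarrow> 'a \<Rightarrow> real) \<Rightarrow> real \<Rightarrow> 'a \<Rightarrow> real \<Rightarrow> real" where
  "caputo_integrand \<alpha> u t x s = (t - s) powr (- \<alpha>) * deriv (\<lambda>r. u r x) s"

definition caputo_deriv :: "real \<Rightarrow> (real \<Rightarrow> 'a \<Rightarrow> real) \<Rightarrow> real \<Rightarrow> 'a \<Rightarrow> real" where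
  "caputo_deriv \<alpha> u t x =
     1 / Gamma (1 - \<alpha>) * (LINT s:{0<..<t}|lebesgue. caputo_integrand \<alpha> u t x s)"

text \<open>The formula for the Caputo derivative is meaningful on \<open>(0,T]\<close>: the classical derivative
  exists on \<open>(0,T)\<close> and the integrals converge absolutely. A derivative that
  merely exists almost everywhere would not do, because of Cantor-type functions.\<close>

definition caputo_differentiable :: "real \<Rightarrow> real \<Rightarrow> (real \<Rightarrow> 'a \<Rightarrow> real) \<Rightarrow> bool" where
  "caputo_differentiable \<alpha> T u \<longleftrightarrow>
     (\<forall>x. \<forall>s\<in>{0<..<T}. (\<lambda>r. u r x) differentiable (at s)) \<and>
     (\<forall>x. \<forall>t\<in>{0<..T}. caputo_integrand \<alpha> u t x absolutely_integrable_on {0<..<t})"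

definition semidiscrete_solution ::
  "real \<Rightarrow> real \<Rightarrow> 'a::euclidean_space set \<Rightarrow> 'a set set \<Rightarrow> (real \<Rightarrow> real) \<Rightarrow> ('a \<Rightarrow> real) \<Rightarrow>
   (real \<Rightarrow> 'a \<Rightarrow> real) \<Rightarrow> bool" where
  "semidiscrete_solution \<alpha> T \<Omega> \<T> f u0 u \<longleftrightarrow>
     (\<forall>t\<in>{0..T}. u t \<in> fe_space \<Omega> \<T>) \<and>
     (\<forall>t\<in>{0..T}. ((\<lambda>s. L2_norm \<Omega> (\<lambda>x. u s x - u t x)) \<longlongrightarrow> 0) (at t within {0..T})) \<and>
     caputo_differentiable \<alpha> T u \<and>
     u 0 = ritz_projection \<Omega> \<T> u0 \<and>
     (\<forall>t\<in>{0<..T}. (\<lambda>x. caputo_deriv \<alpha> u t x - discrete_laplacian \<Omega> \<T> (u t) x)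
                     = L2_projection \<Omega> \<T> (\<lambda>x. f (u t x)))"


section \<open>Time stepping schemes\<close>

datatype time_scheme = L1_Scheme | Backward_Euler_CQ

definition polylog :: "real \<Rightarrow> complex \<Rightarrow> complex" where
  "polylog p z = (\<Sum>j. z ^ Suc j / of_real (real (Suc j) powr p))"

fun generating_function :: "time_scheme \<Rightarrow> real \<Rightarrow> complex \<Rightarrow> complex" where
  "generating_function Backward_Euler_CQ \<alpha> \<zeta> = (1 - \<zeta>) powr of_real \<alpha>"
| "generating_function L1_Scheme \<alpha> \<zeta> =
     (1 - \<zeta>)\<^sup>2 / (\<zeta> * of_real (Gamma (2 - \<alpha>))) * polylog (\<alpha> - 1) \<zeta>"

text \<open>The weights are the power series coefficients of the generating function on the unit
  disc. The centre is excluded since the L1 generating function has a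
  removable singularity there.\<close>

definition cq_weight :: "time_scheme \<Rightarrow> real \<Rightarrow> nat \<Rightarrow> real" where
  "cq_weight sch \<alpha> =
     (THE K. \<forall>\<zeta>. 0 < norm \<zeta> \<and> norm \<zeta> < 1 \<longrightarrow>
               (\<lambda>j. of_real (K j) * \<zeta> ^ j) sums generating_function sch \<alpha> \<zeta>)"

definition discrete_frac_deriv ::
  "time_scheme \<Rightarrow> real \<Rightarrow> real \<Rightarrow> (nat \<Rightarrow> 'a \<Rightarrow> real) \<Rightarrow> nat \<Rightarrow> 'a \<Rightarrow> real" where
  "discrete_frac_deriv sch \<alpha> \<tau> w n x =
     1 / \<tau> powr \<alpha> * (\<Sum>j=0..n. cq_weight sch \<alpha> (n - j) * w j x)"

definition fully_discrete_solution ::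
  "time_scheme \<Rightarrow> real \<Rightarrow> real \<Rightarrow> nat \<Rightarrow> 'a::euclidean_space set \<Rightarrow> 'a set set \<Rightarrow>
   (real \<Rightarrow> real) \<Rightarrow> ('a \<Rightarrow> real) \<Rightarrow> (nat \<Rightarrow> 'a \<Rightarrow> real) \<Rightarrow> bool" where
  "fully_discrete_solution sch \<alpha> \<tau> N \<Omega> \<T> f u0 U \<longleftrightarrow>
     U 0 = ritz_projection \<Omega> \<T> u0 \<and>
     (\<forall>n\<in>{1..N}. U n \<in> fe_space \<Omega> \<T> \<and>
        (\<lambda>x. discrete_frac_deriv sch \<alpha> \<tau> (\<lambda>j y. U j y - U 0 y) n x
              - discrete_laplacian \<Omega> \<T> (U n) x)
          = L2_projection \<Omega> \<T> (\<lambda>x. f (U (n - 1) x)))"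

end

theory Submission
  imports Defs "HOL-Computational_Algebra.Formal_Power_Series"
begin

text \<open>In an \<open>L\<^sup>2\<close>-orthonormal eigenbasis of \<open>- \<Delta>\<^sub>h\<close> both problems become systems of scalar equations, solved
  by the kernel \<open>t\<^sup>\<alpha>\<^sup>-\<^sup>1 E\<^bsub>\<alpha>,\<alpha>\<^esub>(- \<lambda> t\<^sup>\<alpha>)\<close> and by the discrete resolvent of the quadrature weights. The kernel is
  nonnegative, at most \<open>t\<^sup>\<alpha>\<^sup>-\<^sup>1 / \<Gamma>(\<alpha>)\<close>, and its increments are controlled by \<open>t\<^sup>\<alpha>\<^sup>-\<^sup>2\<close>, all uniformly in
  \<open>\<lambda> \<ge> 0\<close>; hence the mesh never enters. Uniformly in \<open>\<lambda>\<close>, the integrated continuous and discrete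
  resolvents at time \<open>n\<close> differ by some \<open>\<epsilon>\<^sub>n\<close> with \<open>\<Sum>\<^sub>n\<^sub>\<le>\<^sub>N \<epsilon>\<^sub>n = O(N\<^sup>\<alpha>)\<close>. For backward Euler the discrete
  resolvent is a Gamma average of the continuous one; for L1 the truncation error is
  estimated cell by cell. The solution is Hoelder continuous with exponent \<open>\<alpha>\<close>, and summation by parts
  with a discrete fractional Gronwall inequality gives the rate \<open>\<tau>\<^sup>\<alpha>\<close>.

  The only information on the data is \<open>\<parallel>\<Delta>\<^sub>h R\<^sub>h u\<^sub>0\<parallel> \<le> \<parallel>\<Delta> u\<^sub>0\<parallel>\<close>, which is an integration by parts against finite
  element functions. These are limits of test functions, by dilation and mollification.\<close>

section \<open>Fractional integral kernels\<close>

text \<open>The eigenvalues of - \<Delta>_h are unbounded under mesh refinement, so no step may lose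
  a factor \<open>lam\<close>. The initial value is therefore subtracted: u - R_h u_0 has the source
  P_h f(u) + \<Delta>_h R_h u_0, whose size at time zero depends on the data only. No bound on the
  time derivative of u is ever used; Hoelder continuity alone controls the source. In the error, the
  source is frozen at the left end of each step. This costs \<tau>^\<alpha> and matches the explicit
  treatment of f. After rescaling to unit steps, \<tau>^\<alpha> times the sum of \<epsilon>_n up to
  N is O(T^\<alpha>), which is why a sum growing like N^\<alpha> is good enough.\<close>

definition kern :: "real \<Rightarrow> real \<Rightarrow> real" where
  "kern g t = (if t > 0 then t powr (g - 1) / Gamma g else 0)"

lemma kern_nonneg: "0 < g \<Longrightarrow> 0 \<le> kern g t"
  by (simp add: kern_def Gamma_real_pos less_imp_le)

lemma kern_nonpos_arg [simp]: "t \<le> 0 \<Longrightarrow> kern g t = 0"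
  by (simp add: kern_def)

lemma kern_1 [simp]: "kern 1 t = (if t > 0 then 1 else 0)"
  by (simp add: kern_def)

lemma borel_measurable_kern [measurable]: "kern g \<in> borel_measurable borel"
  unfolding kern_def [abs_def] by measurable

lemma kern_scale: "0 < c \<Longrightarrow> kern g (c * t) = c powr (g - 1) * kern g t"
  by (simp add: kern_def powr_mult zero_less_mult_iff)

text \<open>The semigroup law of fractional integration. Kernels vanish on nonpositive arguments, so
  the integral over the line is the convolution over [0,t]; the substitution s = t x turns it into
  the Beta integral B(b,a) = \<Gamma>(a) \<Gamma>(b) / \<Gamma>(a+b).\<close>

lemma nn_integral_kern_conv:
  assumes a: "0 < a" and b: "0 < b"
  shows "(\<integral>\<^sup>+s. ennreal (kern a (t - s) * kern b s) \<partial>lborel) = ennreal (kern (a + b) t)"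
proof (cases "t > 0")
  case False
  then have 0: "kern a (t - s) * kern b s = 0" for s
    by (simp add: kern_def)
  have "(\<integral>\<^sup>+s. ennreal (kern a (t - s) * kern b s) \<partial>lborel) = (\<integral>\<^sup>+s. 0 \<partial>lborel)"
    unfolding 0 by simp
  then show ?thesis using False by simp
next
  case True
  have eq: "ennreal \<bar>t\<bar> * ennreal (kern a (t - (0 + t * x)) * kern b (0 + t * x)) =
      ennreal (t powr (a + b - 1) / (Gamma a * Gamma b)) *
        ennreal (indicator {0..1} x * (x powr (b - 1) * (1 - x) powr (a - 1)))"
    if "x \<noteq> 0" "x \<noteq> 1" for x
  proof -
    have "t - t * x = t * (1 - x)" by (simp add: algebra_simps)
    then have "\<bar>t\<bar> * (kern a (t - (0 + t * x)) * kern b (0 + t * x))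
      = (t * t powr (a - 1) * t powr (b - 1)) * (kern a (1 - x) * kern b x)"
      using True by (simp add: kern_scale)
    also have "t * t powr (a - 1) * t powr (b - 1) = t powr (a + b - 1)"
      using True by (simp add: powr_add [symmetric] powr_mult_base add_diff_eq)
    also have "kern a (1 - x) * kern b x =
      1 / (Gamma a * Gamma b) * (indicator {0..1} x * (x powr (b - 1) * (1 - x) powr (a - 1)))"
      using that by (auto simp: kern_def indicator_def)
    finally have *: "\<bar>t\<bar> * (kern a (t - (0 + t * x)) * kern b (0 + t * x))
      = t powr (a + b - 1) / (Gamma a * Gamma b) *
          (indicator {0..1} x * (x powr (b - 1) * (1 - x) powr (a - 1)))"
      by simp
    have nn: "0 \<le> t powr (a + b - 1) / (Gamma a * Gamma b)"
      using a b by (simp add: Gamma_real_pos less_imp_le)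
    have "ennreal \<bar>t\<bar> * ennreal (kern a (t - (0 + t * x)) * kern b (0 + t * x))
      = ennreal (\<bar>t\<bar> * (kern a (t - (0 + t * x)) * kern b (0 + t * x)))"
      using a b by (intro ennreal_mult [symmetric]) (auto intro!: mult_nonneg_nonneg kern_nonneg)
    also note *
    finally show ?thesis by (simp only: ennreal_mult'[OF nn])
  qed
  have "(\<integral>\<^sup>+s. ennreal (kern a (t - s) * kern b s) \<partial>lborel)
      = (\<integral>\<^sup>+x. ennreal \<bar>t\<bar> * ennreal (kern a (t - (0 + t * x)) * kern b (0 + t * x)) \<partial>lborel)"
    using True by (subst nn_integral_real_affine[where c = t and t = 0])
      (auto intro: nn_integral_cmult [symmetric])
  also have "\<dots> = (\<integral>\<^sup>+x. ennreal (t powr (a + b - 1) / (Gamma a * Gamma b)) *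
        ennreal (indicator {0..1} x * (x powr (b - 1) * (1 - x) powr (a - 1))) \<partial>lborel)"
  proof (rule nn_integral_cong_AE)
    have "AE x in lborel. x \<noteq> (0::real) \<and> x \<noteq> 1"
      using AE_lborel_singleton[of 0] AE_lborel_singleton[of "1::real"] by auto
    then show "AE x in lborel. ennreal \<bar>t\<bar> * ennreal (kern a (t - (0 + t * x)) * kern b (0 + t * x)) =
      ennreal (t powr (a + b - 1) / (Gamma a * Gamma b)) *
        ennreal (indicator {0..1} x * (x powr (b - 1) * (1 - x) powr (a - 1)))"
      by (rule eventually_mono) (use eq in blast)
  qed
  also have "\<dots> = ennreal (t powr (a + b - 1) / (Gamma a * Gamma b)) * ennreal (Beta b a)"
    using nn_integral_has_integral_lebesgue[OF _ has_integral_Beta_real[OF b a]]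
    by (subst nn_integral_cmult) simp_all
  also have "\<dots> = ennreal (t powr (a + b - 1) / (Gamma a * Gamma b) * Beta b a)"
    using a b by (intro ennreal_mult [symmetric]) (auto simp: Beta_def Gamma_real_pos less_imp_le)
  also have "t powr (a + b - 1) / (Gamma a * Gamma b) * Beta b a = kern (a + b) t"
    using a b True Gamma_real_pos[OF a, THEN less_imp_neq] Gamma_real_pos[OF b, THEN less_imp_neq]
    by (simp add: kern_def Beta_def add.commute)
  finally show ?thesis .
qed

lemma nn_integral_kern_conv_shift:
  assumes "0 < a" "0 < b"
  shows "(\<integral>\<^sup>+s. ennreal (kern a (t - s) * kern b (s - r)) \<partial>lborel) = ennreal (kern (a + b) (t - r))"
proof -
  have "(\<integral>\<^sup>+s. ennreal (kern a (t - s) * kern b (s - r)) \<partial>lborel) =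
     (\<integral>\<^sup>+s. ennreal (kern a (t - r - s) * kern b s) \<partial>lborel)"
    by (subst nn_integral_real_affine[where c = 1 and t = r]) (simp_all add: algebra_simps)
  then show ?thesis using nn_integral_kern_conv[OF assms, of "t - r"] by simp
qed

lemma has_bochner_integral_kern_conv:
  assumes "0 < a" "0 < b"
  shows "has_bochner_integral lborel (\<lambda>s. kern a (t - s) * kern b s) (kern (a + b) t)"
  using assms nn_integral_kern_conv[OF assms]
  by (intro has_bochner_integral_nn_integral) (auto intro!: mult_nonneg_nonneg kern_nonneg)

lemma conv_commute:
  fixes f g :: "real \<Rightarrow> real"
  shows "(\<integral>s. f (t - s) * g s \<partial>lborel) = (\<integral>s. g (t - s) * f s \<partial>lborel)"
  by (subst lborel_integral_real_affine[where c = "-1" and t = t]) (simp_all add: mult.commute)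

lemma conv_integrable_commute:
  fixes f g :: "real \<Rightarrow> real"
  assumes "integrable lborel (\<lambda>s. f (t - s) * g s)"
  shows "integrable lborel (\<lambda>s. g (t - s) * f s)"
  using lborel_integrable_real_affine[OF assms, of "-1" t] by (simp add: mult.commute)

text \<open>Domination by power kernels reduces integrability and size of the later convolutions to
  the semigroup law. The bounds also force \<open>f\<close> and \<open>h\<close> to vanish on the
  nonpositive half line.\<close>

lemma integrable_kern_bounded:
  assumes "0 < a" "0 < b" and [measurable]: "f \<in> borel_measurable borel" "h \<in> borel_measurable borel"
    and f: "\<And>s. \<bar>f s\<bar> \<le> F * kern a s" and h: "\<And>s. \<bar>h s\<bar> \<le> H * kern b s"
  shows "integrable lborel (\<lambda>s. f (t - s) * h s)"
    and "\<bar>\<integral>s. f (t - s) * h s \<partial>lborel\<bar> \<le> F * H * kern (a + b) t"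
proof -
  note hb = has_bochner_integral_kern_conv[OF assms(1,2), of t]
  have le: "\<bar>f (t - s) * h s\<bar> \<le> F * H * (kern a (t - s) * kern b s)" for s
    using mult_mono[OF f[of "t - s"] h[of s]] order_trans[OF abs_ge_zero f[of "t - s"]]
    by (simp add: abs_mult mult_ac)
  have i: "integrable lborel (\<lambda>s. F * H * (kern a (t - s) * kern b s))"
    using hb by (auto simp: has_bochner_integral_iff)
  show 1: "integrable lborel (\<lambda>s. f (t - s) * h s)"
    using le by (intro Bochner_Integration.integrable_bound[OF i]) (auto intro!: AE_I2 order_trans[OF le])
  have "\<bar>\<integral>s. f (t - s) * h s \<partial>lborel\<bar> \<le> (\<integral>s. \<bar>f (t - s) * h s\<bar> \<partial>lborel)"
    by (rule integral_abs_bound)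
  also have "\<dots> \<le> (\<integral>s. F * H * (kern a (t - s) * kern b s) \<partial>lborel)"
    using 1 i le by (intro integral_mono) auto
  finally show "\<bar>\<integral>s. f (t - s) * h s \<partial>lborel\<bar> \<le> F * H * kern (a + b) t"
    using hb by (simp add: has_bochner_integral_iff)
qed

text \<open>Fubini. The absolute double integral is finite because integrating over \<open>s\<close>
  first produces \<open>kern (a + b)\<close> by the semigroup law. Hence \<open>h\<close> itself
  needs no pointwise bound, which matters when it is a derivative that is merely integrable.\<close>

lemma conv_assoc:
  fixes f g h :: "real \<Rightarrow> real"
  assumes [measurable]: "f \<in> borel_measurable borel" "g \<in> borel_measurable borel" "h \<in> borel_measurable borel"
    and a: "0 < a" and b: "0 < b"
    and f: "\<And>s. \<bar>f s\<bar> \<le> F * kern a s" and g: "\<And>s. \<bar>g s\<bar> \<le> G * kern b s"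
    and h: "integrable lborel (\<lambda>r. kern (a + b) (t - r) * h r)"
  shows "(\<integral>s. f (t - s) * (\<integral>r. g (s - r) * h r \<partial>lborel) \<partial>lborel)
       = (\<integral>r. (\<integral>s. f (t - r - s) * g s \<partial>lborel) * h r \<partial>lborel)"
proof -
  define Q where "Q s r = f (t - s) * (g (s - r) * h r)" for s r
  have Qm [measurable]: "case_prod Q \<in> borel_measurable (lborel \<Otimes>\<^sub>M lborel)"
    unfolding Q_def [abs_def] by measurable
  have le: "ennreal (norm (Q s r)) \<le> ennreal (F * G * \<bar>h r\<bar>) * ennreal (kern a (t - s) * kern b (s - r))" for s r
  proof -
    have FG: "0 \<le> F * kern a (t - s)" "0 \<le> G * kern b (s - r)"
      using f[of "t-s"] g[of "s-r"] by linarith+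
    have F: "0 \<le> F" "0 \<le> G"
      using order_trans[OF abs_ge_zero f[of 1]] order_trans[OF abs_ge_zero g[of 1]] a b
      by (simp_all add: kern_def zero_le_mult_iff Gamma_real_pos zero_le_divide_iff not_le less_imp_le)
        (metis Gamma_real_pos less_le_not_le)+
    have "norm (Q s r) \<le> (F * kern a (t - s)) * ((G * kern b (s - r)) * \<bar>h r\<bar>)"
      unfolding Q_def real_norm_def abs_mult
      using f[of "t - s"] g[of "s - r"] FG by (intro mult_mono) auto
    then show ?thesis
      using F a b by (subst ennreal_mult [symmetric]) (auto intro!: mult_nonneg_nonneg kern_nonneg ennreal_leI simp: mult_ac)
  qed
  have "(\<integral>\<^sup>+p. ennreal (norm (case p of (s, r) \<Rightarrow> Q s r)) \<partial>(lborel \<Otimes>\<^sub>M lborel))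
     = (\<integral>\<^sup>+r. \<integral>\<^sup>+s. ennreal (norm (Q s r)) \<partial>lborel \<partial>lborel)"
    by (subst lborel_pair.nn_integral_snd [symmetric]) auto
  also have "\<dots> \<le> (\<integral>\<^sup>+r. \<integral>\<^sup>+s. ennreal (F * G * \<bar>h r\<bar>) * ennreal (kern a (t - s) * kern b (s - r)) \<partial>lborel \<partial>lborel)"
    by (intro nn_integral_mono le)
  also have "\<dots> = (\<integral>\<^sup>+r. ennreal (F * G * \<bar>h r\<bar>) * ennreal (kern (a + b) (t - r)) \<partial>lborel)"
    using nn_integral_kern_conv_shift[OF a b] by (subst nn_integral_cmult) auto
  also have "\<dots> = (\<integral>\<^sup>+r. ennreal (norm (F * G * (kern (a + b) (t - r) * h r))) \<partial>lborel)"
  proof (rule nn_integral_cong)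
    fix r
    have F: "0 \<le> F" "0 \<le> G"
      using order_trans[OF abs_ge_zero f[of 1]] order_trans[OF abs_ge_zero g[of 1]] a b
      by (simp_all add: kern_def zero_le_mult_iff Gamma_real_pos zero_le_divide_iff not_le less_imp_le)
        (metis Gamma_real_pos less_le_not_le)+
    have "0 \<le> kern (a + b) (t - r)" using a b by (simp add: kern_nonneg)
    then show "ennreal (F * G * \<bar>h r\<bar>) * ennreal (kern (a + b) (t - r)) = ennreal (norm (F * G * (kern (a + b) (t - r) * h r)))"
      using F by (simp add: ennreal_mult [symmetric] abs_mult mult_ac)
  qed
  also have "\<dots> < \<infinity>"
    using iffD1[OF integrable_iff_bounded integrable_mult_right[OF h, of "F * G"]] by (rule conjunct2)
  finally have int: "integrable (lborel \<Otimes>\<^sub>M lborel) (case_prod Q)"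
    by (intro integrableI_bounded) auto
  have "(\<integral>s. f (t - s) * (\<integral>r. g (s - r) * h r \<partial>lborel) \<partial>lborel) = (\<integral>s. \<integral>r. Q s r \<partial>lborel \<partial>lborel)"
    unfolding Q_def by simp
  also have "\<dots> = (\<integral>r. \<integral>s. Q s r \<partial>lborel \<partial>lborel)"
    by (rule lborel_pair.Fubini_integral [symmetric, OF int])
  also have "\<dots> = (\<integral>r. (\<integral>s. f (t - r - s) * g s \<partial>lborel) * h r \<partial>lborel)"
  proof (rule Bochner_Integration.integral_cong)
    fix r
    have "(\<integral>s. Q s r \<partial>lborel) = (\<integral>s. (f (t - s) * g (s - r)) * h r \<partial>lborel)"
      by (simp add: Q_def mult_ac)
    also have "\<dots> = (\<integral>s. f (t - s) * g (s - r) \<partial>lborel) * h r"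
      by simp
    also have "(\<integral>s. f (t - s) * g (s - r) \<partial>lborel) = (\<integral>s. f (t - r - s) * g s \<partial>lborel)"
      by (subst lborel_integral_real_affine[where c = 1 and t = r]) (simp_all add: algebra_simps)
    finally show "(\<integral>s. Q s r \<partial>lborel) = (\<integral>s. f (t - r - s) * g s \<partial>lborel) * h r" .
  qed simp
  finally show ?thesis .
qed

section \<open>The Mittag-Leffler resolvent kernel\<close>

text \<open>Euler's integral restricted to the interval from \<open>M\<close> to
  \<open>M + 1\<close>. As \<open>M\<close> is free, this already gives growth faster than any
  geometric sequence, all that the Mittag-Leffler series need.\<close>

lemma Gamma_ge_powr_exp:
  fixes M y :: real
  assumes "1 \<le> M" "1 \<le> y"
  shows "M powr (y - 1) * exp (- (M + 1)) \<le> Gamma y"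
proof -
  have "((\<lambda>t. M powr (y - 1) * exp (- (M + 1))) has_integral
      Henstock_Kurzweil_Integration.content {M..M+1} *\<^sub>R (M powr (y - 1) * exp (- (M + 1)))) {M..M+1}"
    by (rule has_integral_const_real)
  then have 1: "((\<lambda>t. M powr (y - 1) * exp (- (M + 1))) has_integral
      M powr (y - 1) * exp (- (M + 1))) {M..M+1}" by simp
  have "continuous_on {M..M+1} (\<lambda>t. t powr (y - 1) / exp t)"
    using assms by (intro continuous_intros) auto
  then obtain I where I: "((\<lambda>t. t powr (y - 1) / exp t) has_integral I) {M..M+1}"
    using integrable_continuous_real integrable_on_def by blast
  have "M powr (y - 1) * exp (- (M + 1)) \<le> I"
  proof (rule has_integral_le[OF 1 I])
    fix t assume t: "t \<in> {M..M+1}"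
    have "M powr (y - 1) * exp (- (M + 1)) \<le> t powr (y - 1) * exp (- t)"
      using t assms by (intro mult_mono powr_mono2) auto
    then show "M powr (y - 1) * exp (- (M + 1)) \<le> t powr (y - 1) / exp t"
      by (simp add: exp_minus divide_inverse)
  qed
  also have "I \<le> Gamma y"
    using assms by (intro has_integral_subset_le[OF _ I Gamma_integral_real]) auto
  finally show ?thesis .
qed

lemma summable_powser_Gamma:
  assumes a: "0 < (a::real)"
  shows "summable (\<lambda>k. x ^ k / Gamma (a * real k + c))"
proof -
  \<comment> \<open>Chosen so that the ratio of the dominating geometric series, \<bar>x\<bar> / M
    powr a, is below 1/2.\<close>
  define M where "M = (2 * \<bar>x\<bar> + 2) powr (1 / a)"
  have Ma: "M powr a = 2 * \<bar>x\<bar> + 2" using a by (simp add: M_def powr_powr)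
  have M1: "1 \<le> M" using a by (auto simp: M_def intro!: ge_one_powr_ge_zero)
  have "eventually (\<lambda>k. norm (x ^ k / Gamma (a * real k + c)) \<le>
      exp (M + 1) * M powr (1 - c) * (1 / 2) ^ k) sequentially"
  proof (rule eventually_sequentiallyI[of "nat \<lceil>(1 - c) / a\<rceil>"])
    fix k assume "nat \<lceil>(1 - c) / a\<rceil> \<le> k"
    then have "(1 - c) / a \<le> real k" by linarith
    then have k: "1 \<le> a * real k + c" using a by (simp add: field_simps)
    have G: "M powr (a * real k + c - 1) * exp (- (M + 1)) \<le> Gamma (a * real k + c)"
      by (rule Gamma_ge_powr_exp[OF M1 k])
    have p: "0 < M powr (a * real k + c - 1) * exp (- (M + 1))" using M1 by simp
    then have "norm (x ^ k / Gamma (a * real k + c)) = \<bar>x\<bar> ^ k / Gamma (a * real k + c)"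
      using G by (simp add: power_abs)
    also have "\<dots> \<le> \<bar>x\<bar> ^ k / (M powr (a * real k + c - 1) * exp (- (M + 1)))"
      using G p by (intro divide_left_mono mult_pos_pos) auto
    also have "M powr (a * real k + c - 1) = M powr (c - 1) * (M powr a) ^ k"
      using M1 by (simp add: powr_add [symmetric] powr_realpow [symmetric] powr_powr algebra_simps)
    also have "\<bar>x\<bar> ^ k / (M powr (c - 1) * (M powr a) ^ k * exp (- (M + 1)))
      = exp (M + 1) * M powr (1 - c) * (\<bar>x\<bar> / M powr a) ^ k"
      using powr_minus_divide[of M "c - 1"] unfolding exp_minus[of "M + 1"]
      by (simp add: power_divide field_simps)
    also have "\<dots> \<le> exp (M + 1) * M powr (1 - c) * (1 / 2) ^ k"
      unfolding Ma by (intro mult_left_mono power_mono) (auto simp: field_simps)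
    finally show "norm (x ^ k / Gamma (a * real k + c)) \<le> exp (M + 1) * M powr (1 - c) * (1 / 2) ^ k" .
  qed
  then show ?thesis
    by (rule summable_comparison_test_ev) (intro summable_mult summable_geometric, simp)
qed

lemma summable_kern:
  assumes a: "0 < a"
  shows "summable (\<lambda>k. x ^ k * kern (a * real k + c) t)"
proof (cases "t > 0")
  case True
  have "summable (\<lambda>k. t powr (c - 1) * ((x * t powr a) ^ k / Gamma (a * real k + c)))"
    by (intro summable_mult summable_powser_Gamma a)
  moreover have "t powr (c - 1) * ((x * t powr a) ^ k / Gamma (a * real k + c)) = x ^ k * kern (a * real k + c) t" for k
  proof -
    have "t powr (c - 1) * (t powr a) ^ k = t powr (a * real k + c - 1)"
      using True by (simp add: powr_realpow [symmetric] powr_powr powr_add [symmetric] algebra_simps)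
    then show ?thesis using True by (simp add: kern_def power_mult_distrib field_simps)
  qed
  ultimately show ?thesis by simp
qed simp

lemma isCont_pos_nbhd:
  fixes f :: "real \<Rightarrow> real"
  assumes "isCont f x" "0 < f x"
  obtains d where "0 < d" "\<And>y. \<bar>y - x\<bar> < d \<Longrightarrow> 0 < f y"
proof -
  have "eventually (\<lambda>y. 0 < f y) (at x)"
    using order_tendstoD(1)[OF isContD[OF assms(1)] assms(2)] .
  then obtain d where d: "0 < d" "\<And>y. y \<noteq> x \<Longrightarrow> dist y x < d \<Longrightarrow> 0 < f y"
    by (auto simp: eventually_at)
  show ?thesis
  proof (rule that[OF d(1)])
    fix y assume "\<bar>y - x\<bar> < d"
    then show "0 < f y" using d(2)[of y] assms(2) by (cases "y = x") (auto simp: dist_real_def)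
  qed
qed

locale frac_order =
  fixes \<alpha> :: real
  assumes alpha_pos: "0 < \<alpha>" and alpha_less_1: "\<alpha> < 1"
begin

text \<open>In the notation of Mittag-Leffler functions, \<open>psi x\<close> is \<open>E\<^bsub>\<alpha>,\<alpha>\<^esub>(- x)\<close>, and \<open>ml lam\<close> is the kernel
  of the solution operator of \<open>\<partial>\<^sub>t\<^sup>\<alpha> w + lam w = g\<close>, \<open>w(0) = 0\<close>.\<close>

definition psi :: "real \<Rightarrow> real" where
  "psi x = (\<Sum>k. inverse (Gamma (\<alpha> * real k + \<alpha>)) * (- x) ^ k)"

definition ml :: "real \<Rightarrow> real \<Rightarrow> real" where
  "ml lam t = (if t > 0 then t powr (\<alpha> - 1) * psi (lam * t powr \<alpha>) else 0)"

lemma psi_sums: "(\<lambda>k. inverse (Gamma (\<alpha> * real k + \<alpha>)) * (- x) ^ k) sums psi x"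
  unfolding psi_def using summable_powser_Gamma[OF alpha_pos, of "- x" \<alpha>]
  by (intro summable_sums) (simp add: field_simps)

lemma isCont_psi: "isCont psi x"
proof -
  have "isCont (\<lambda>x. \<Sum>k. inverse (Gamma (\<alpha> * real k + \<alpha>)) * x ^ k) (- x)"
    using summable_powser_Gamma[OF alpha_pos]
    by (intro isCont_powser_converges_everywhere) (simp add: field_simps)
  moreover have "isCont (\<lambda>x::real. - x) x" by (intro continuous_intros)
  ultimately show ?thesis unfolding psi_def [abs_def] by (rule isCont_o2[rotated])
qed

lemma continuous_on_psi [continuous_intros]:
  "continuous_on S f \<Longrightarrow> continuous_on S (\<lambda>x. psi (f x))"
  by (rule continuous_on_compose2[of UNIV psi])
    (auto simp: continuous_at_imp_continuous_on isCont_psi)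

lemma psi_0: "psi 0 = 1 / Gamma \<alpha>"
  using sums_unique[OF psi_sums[of 0]] powser_zero[of "\<lambda>k. inverse (Gamma (\<alpha> * real k + \<alpha>))"]
  by (simp add: inverse_eq_divide)

lemma Gamma_alpha_pos: "0 < Gamma \<alpha>"
  using alpha_pos by (simp add: Gamma_real_pos)

lemma ml_nonpos_arg [simp]: "t \<le> 0 \<Longrightarrow> ml lam t = 0"
  by (simp add: ml_def)

lemma ml_0 [simp]: "ml 0 t = kern \<alpha> t"
  by (simp add: ml_def kern_def psi_0)

lemma borel_measurable_psi [measurable]: "psi \<in> borel_measurable borel"
  by (intro borel_measurable_continuous_onI continuous_at_imp_continuous_on ballI isCont_psi)

lemma borel_measurable_ml [measurable]: "ml lam \<in> borel_measurable borel"
  unfolding ml_def [abs_def] by measurable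

lemma continuous_on_ml: "continuous_on {0<..} (ml lam)"
proof -
  have "continuous_on {0<..} (\<lambda>t::real. t powr (\<alpha> - 1) * psi (lam * t powr \<alpha>))"
    by (intro continuous_intros) auto
  then show ?thesis by (rule continuous_on_cong[THEN iffD1, rotated -1]) (auto simp: ml_def)
qed

lemma ml_sums: "(\<lambda>k. (- lam) ^ k * kern (\<alpha> * real k + \<alpha>) t) sums ml lam t"
proof (cases "t > 0")
  case True
  have "(\<lambda>k. t powr (\<alpha> - 1) * (inverse (Gamma (\<alpha> * real k + \<alpha>)) * (- (lam * t powr \<alpha>)) ^ k)) sums ml lam t"
    using sums_mult[OF psi_sums[of "lam * t powr \<alpha>"], of "t powr (\<alpha> - 1)"] True by (simp add: ml_def)
  moreover have "t powr (\<alpha> - 1) * (inverse (Gamma (\<alpha> * real k + \<alpha>)) * (- (lam * t powr \<alpha>)) ^ k)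
     = (- lam) ^ k * kern (\<alpha> * real k + \<alpha>) t" for k
  proof -
    have "(- (lam * t powr \<alpha>)) ^ k = (- lam) ^ k * (t powr \<alpha>) ^ k"
      by (simp flip: power_mult_distrib)
    moreover have "t powr (\<alpha> - 1) * (t powr \<alpha>) ^ k = t powr (\<alpha> * real k + \<alpha> - 1)"
      using True by (simp add: powr_realpow [symmetric] powr_powr powr_add [symmetric] algebra_simps)
    ultimately show ?thesis using True by (simp add: kern_def field_simps)
  qed
  ultimately show ?thesis by simp
qed simp

text \<open>Termwise integration by the semigroup law. The series of absolute values is the same one
  with \<bar>lam\<bar> in place of - lam, and \<open>summable_kern\<close> covers every
  base.\<close>

lemma kern_ml_sums:
  assumes c: "0 < c"
  shows "integrable lborel (\<lambda>s. kern c (t - s) * ml lam s)"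
    and "(\<lambda>k. (- lam) ^ k * kern (\<alpha> * real k + (c + \<alpha>)) t) sums (\<integral>s. kern c (t - s) * ml lam s \<partial>lborel)"
proof -
  define f where "f k s = (- lam) ^ k * (kern c (t - s) * kern (\<alpha> * real k + \<alpha>) s)" for k s
  have pos: "0 < \<alpha> * real k + \<alpha>" for k using alpha_pos by (simp add: add_nonneg_pos)
  have hb: "has_bochner_integral lborel (\<lambda>s. kern c (t - s) * kern (\<alpha> * real k + \<alpha>) s) (kern (\<alpha> * real k + (c + \<alpha>)) t)" for k
    using has_bochner_integral_kern_conv[OF c pos, of t k] by (simp add: algebra_simps)
  have 1: "integrable lborel (f k)" for k
    unfolding f_def using hb by (auto simp: has_bochner_integral_iff)
  have nf: "norm (f k s) = \<bar>lam\<bar> ^ k * (kern c (t - s) * kern (\<alpha> * real k + \<alpha>) s)" for k s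
    using c pos[of k] by (simp add: f_def abs_mult power_abs kern_nonneg)
  have 2: "summable (\<lambda>k. norm (f k s))" for s
    unfolding nf using summable_mult[OF summable_kern[OF alpha_pos, of "\<bar>lam\<bar>" \<alpha> s], of "kern c (t - s)"]
    by (simp add: mult_ac)
  have 3: "summable (\<lambda>k. \<integral>s. norm (f k s) \<partial>lborel)"
    unfolding nf using hb summable_kern[OF alpha_pos, of "\<bar>lam\<bar>" "c + \<alpha>" t]
    by (simp add: has_bochner_integral_iff)
  have s: "(\<Sum>k. f k s) = kern c (t - s) * ml lam s" for s
    using sums_unique[OF sums_mult[OF ml_sums[of lam s], of "kern c (t - s)"]]
    by (simp add: f_def mult_ac)
  show "integrable lborel (\<lambda>s. kern c (t - s) * ml lam s)"
    using integrable_suminf[OF 1 AE_I2 3] 2 by (simp add: s)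
  have "(\<lambda>k. integral\<^sup>L lborel (f k)) sums (\<integral>s. (\<Sum>k. f k s) \<partial>lborel)"
    using sums_integral[OF 1 AE_I2 3] 2 by simp
  moreover have "integral\<^sup>L lborel (f k) = (- lam) ^ k * kern (\<alpha> * real k + (c + \<alpha>)) t" for k
    using hb[of k] by (simp add: f_def [abs_def] has_bochner_integral_iff)
  ultimately show "(\<lambda>k. (- lam) ^ k * kern (\<alpha> * real k + (c + \<alpha>)) t) sums (\<integral>s. kern c (t - s) * ml lam s \<partial>lborel)"
    by (simp add: s)
qed

text \<open>Convolution with \<open>kern \<alpha>\<close> raises the index of each term by one, so
  multiplying by - lam reproduces the series without its first term \<open>kern \<alpha> t\<close>.
  This equation, rather than the series, carries the estimates below.\<close>

lemma ml_volterra: "ml lam t = kern \<alpha> t - lam * (\<integral>s. kern \<alpha> (t - s) * ml lam s \<partial>lborel)"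
proof -
  have "(\<lambda>k. (- lam) ^ Suc k * kern (\<alpha> * real (Suc k) + \<alpha>) t) sums (- lam * (\<integral>s. kern \<alpha> (t - s) * ml lam s \<partial>lborel))"
    using sums_mult[OF kern_ml_sums(2)[OF alpha_pos, of lam t], of "- lam"] by (simp add: algebra_simps)
  from sums_Suc[OF this] have "(\<lambda>k. (- lam) ^ k * kern (\<alpha> * real k + \<alpha>) t) sums
      (- lam * (\<integral>s. kern \<alpha> (t - s) * ml lam s \<partial>lborel) + kern \<alpha> t)" by simp
  from sums_unique2[OF this ml_sums] show ?thesis by simp
qed

text \<open>The factor is the exact ratio of the kernels for s = 0, and (t1 - s) / (t0 - s)
  decreases in s. So from \<open>t1\<close> to \<open>t0\<close> the kernel inside the Volterra
  integral loses at least as much as the inhomogeneity \<open>kern \<alpha>\<close>; this is what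
  lets positivity propagate.\<close>

lemma kern_alpha_ratio:
  assumes "0 < s" "s < t1" "t1 \<le> t0"
  shows "kern \<alpha> (t0 - s) \<le> (t1 / t0) powr (1 - \<alpha>) * kern \<alpha> (t1 - s)"
proof -
  have "(t0 - s) powr (\<alpha> - 1) = ((t1 - s) / (t0 - s)) powr (1 - \<alpha>) * (t1 - s) powr (\<alpha> - 1)"
    using assms powr_minus_divide[of "t0 - s" "1 - \<alpha>"] powr_minus_divide[of "t1 - s" "1 - \<alpha>"]
    by (simp add: powr_divide)
  also have "\<dots> \<le> (t1 / t0) powr (1 - \<alpha>) * (t1 - s) powr (\<alpha> - 1)"
    using assms alpha_less_1 by (intro mult_right_mono powr_mono2) (auto simp: field_simps)
  finally show ?thesis
    using assms Gamma_alpha_pos by (simp add: kern_def divide_right_mono)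
qed

text \<open>A first zero is impossible. The Volterra equation at \<open>t0\<close> is compared with
  \<open>r\<close> times the one at an earlier \<open>t1\<close>: the ratio lemma handles s < t1,
  and on the short remainder \<open>ml lam\<close> is at most its value at \<open>t1\<close>, the
  maximum over the last stretch of length \<open>d\<close>. The kernel mass of the remainder is too
  small to cancel r * ml lam t1.\<close>

lemma ml_pos_aux:
  assumes l: "0 \<le> lam" and t0: "0 < t0" and pos: "\<And>t. 0 < t \<Longrightarrow> t < t0 \<Longrightarrow> 0 < ml lam t"
  shows "0 < ml lam t0"
proof (rule ccontr)
  assume neg: "\<not> 0 < ml lam t0"
  \<comment> \<open>With \<open>d powr \<alpha>\<close> at most \<open>c\<close>, the remainder has
    weight at most lam / (4 (lam + 1)) < 1/2, while d \<le> t0 / 2 gives r \<ge> 1/2. These two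
    bounds are the contradiction.\<close>
  define c where "c = 1 / (4 * (lam + 1)) * Gamma (\<alpha> + 1)"
  have G1: "0 < Gamma (\<alpha> + 1)" using alpha_pos by (simp add: Gamma_real_pos)
  have c: "0 < c" using l G1 by (simp add: c_def)
  define d where "d = min (t0 / 2) (c powr (1 / \<alpha>))"
  have d: "0 < d" "d \<le> t0 / 2" using t0 c by (auto simp: d_def)
  have "d powr \<alpha> \<le> (c powr (1 / \<alpha>)) powr \<alpha>"
    using d alpha_pos by (intro powr_mono2) (auto simp: d_def)
  also have "\<dots> = c" using c alpha_pos by (simp add: powr_powr)
  finally have dc: "d powr \<alpha> \<le> c" .
  have "continuous_on {t0 - d..t0} (ml lam)"
    using d t0 by (intro continuous_on_subset[OF continuous_on_ml]) auto
  then obtain t1 where t1: "t1 \<in> {t0 - d..t0}" and max: "\<And>t. t \<in> {t0 - d..t0} \<Longrightarrow> ml lam t \<le> ml lam t1"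
    using continuous_attains_sup[of "{t0 - d..t0}" "ml lam"] d by auto
  have "0 < ml lam (t0 - d)" using d t0 by (intro pos) auto
  then have x1: "0 < ml lam t1" using max[of "t0 - d"] d by auto
  then have t1': "0 < t1" "t1 < t0" using neg t1 d t0 by (auto simp: less_le)
  define r where "r = (t1 / t0) powr (1 - \<alpha>)"
  have "1 / 2 \<le> t1 / t0" using t1 d t0 by (auto simp: field_simps)
  also have "t1 / t0 \<le> r" unfolding r_def
    using powr_mono'[of "1 - \<alpha>" 1 "t1 / t0"] t1' alpha_pos by simp
  finally have r: "1 / 2 \<le> r" .
  have kr: "kern \<alpha> t0 = r * kern \<alpha> t1"
  proof -
    have "t0 powr (\<alpha> - 1) = (t1 / t0) powr (1 - \<alpha>) * t1 powr (\<alpha> - 1)"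
      using t1' powr_minus_divide[of t0 "1 - \<alpha>"] powr_minus_divide[of t1 "1 - \<alpha>"]
      by (simp add: powr_divide)
    then show ?thesis using t1' t0 by (simp add: kern_def r_def)
  qed
  note i0 = kern_ml_sums(1)[OF alpha_pos, of t0 lam] and i1 = kern_ml_sums(1)[OF alpha_pos, of t1 lam]
  have hb: "has_bochner_integral lborel (\<lambda>s. kern \<alpha> (t0 - s) * kern 1 (s - t1)) (kern (\<alpha> + 1) (t0 - t1))"
    using nn_integral_kern_conv_shift[OF alpha_pos, of 1 t0 t1] alpha_pos
    by (intro has_bochner_integral_nn_integral) (auto intro!: mult_nonneg_nonneg kern_nonneg)
  have "(\<integral>s. kern \<alpha> (t0 - s) * ml lam s \<partial>lborel)
    \<le> (\<integral>s. r * (kern \<alpha> (t1 - s) * ml lam s) + ml lam t1 * (kern \<alpha> (t0 - s) * kern 1 (s - t1)) \<partial>lborel)"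
  proof (rule integral_mono_AE[OF i0])
    show "integrable lborel (\<lambda>s. r * (kern \<alpha> (t1 - s) * ml lam s) + ml lam t1 * (kern \<alpha> (t0 - s) * kern 1 (s - t1)))"
      using i1 hb by (intro Bochner_Integration.integrable_add integrable_mult_right) (auto simp: has_bochner_integral_iff)
    have "kern \<alpha> (t0 - s) * ml lam s \<le> r * (kern \<alpha> (t1 - s) * ml lam s) + ml lam t1 * (kern \<alpha> (t0 - s) * kern 1 (s - t1))"
      if "s \<noteq> t1" for s
    proof (cases "0 < s \<and> s < t1")
      case True
      then have "kern \<alpha> (t0 - s) * ml lam s \<le> r * kern \<alpha> (t1 - s) * ml lam s"
        using pos[of s] t1' kern_alpha_ratio[of s t1 t0] by (intro mult_right_mono) (auto simp: r_def)
      moreover have "0 \<le> ml lam t1 * (kern \<alpha> (t0 - s) * kern 1 (s - t1))"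
        using x1 alpha_pos by (intro mult_nonneg_nonneg kern_nonneg) auto
      ultimately show ?thesis by simp
    next
      case False
      show ?thesis
      proof (cases "s \<le> 0 \<or> t0 \<le> s")
        case True
        then show ?thesis using t1' by auto
      next
        case F2: False
        with False that have s: "t1 < s" "s < t0" by auto
        then have "ml lam s \<le> ml lam t1" using t1 by (intro max) auto
        then have "kern \<alpha> (t0 - s) * ml lam s \<le> kern \<alpha> (t0 - s) * ml lam t1"
          using alpha_pos by (intro mult_left_mono kern_nonneg) auto
        then show ?thesis using s by (simp add: mult_ac)
      qed
    qed
    then show "AE s in lborel. kern \<alpha> (t0 - s) * ml lam s \<le> r * (kern \<alpha> (t1 - s) * ml lam s) + ml lam t1 * (kern \<alpha> (t0 - s) * kern 1 (s - t1))"
      using AE_lborel_singleton[of t1] by (rule eventually_mono[rotated])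
  qed
  also have "\<dots> = r * (\<integral>s. kern \<alpha> (t1 - s) * ml lam s \<partial>lborel) + ml lam t1 * kern (\<alpha> + 1) (t0 - t1)"
    using i1 hb by (subst Bochner_Integration.integral_add) (auto simp: has_bochner_integral_iff)
  finally have le: "(\<integral>s. kern \<alpha> (t0 - s) * ml lam s \<partial>lborel)
     \<le> r * (\<integral>s. kern \<alpha> (t1 - s) * ml lam s \<partial>lborel) + ml lam t1 * kern (\<alpha> + 1) (t0 - t1)" .
  have "0 \<ge> ml lam t0" using neg by simp
  also have "ml lam t0 = r * kern \<alpha> t1 - lam * (\<integral>s. kern \<alpha> (t0 - s) * ml lam s \<partial>lborel)"
    by (subst ml_volterra) (simp add: kr)
  also have "\<dots> \<ge> r * kern \<alpha> t1 - lam * (r * (\<integral>s. kern \<alpha> (t1 - s) * ml lam s \<partial>lborel) + ml lam t1 * kern (\<alpha> + 1) (t0 - t1))"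
    using le l by (intro diff_left_mono mult_left_mono)
  also have "r * kern \<alpha> t1 - lam * (r * (\<integral>s. kern \<alpha> (t1 - s) * ml lam s \<partial>lborel) + ml lam t1 * kern (\<alpha> + 1) (t0 - t1))
      = r * ml lam t1 - lam * (ml lam t1 * kern (\<alpha> + 1) (t0 - t1))"
    by (subst (3) ml_volterra) (simp add: algebra_simps)
  finally have "r * ml lam t1 \<le> (lam * kern (\<alpha> + 1) (t0 - t1)) * ml lam t1" by (simp add: mult_ac)
  then have "r \<le> lam * kern (\<alpha> + 1) (t0 - t1)" using x1 by simp
  also have "kern (\<alpha> + 1) (t0 - t1) \<le> c / Gamma (\<alpha> + 1)"
  proof -
    have "(t0 - t1) powr \<alpha> \<le> d powr \<alpha>" using t1 t1' alpha_pos by (intro powr_mono2) auto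
    then show ?thesis using dc G1 t1' by (simp add: kern_def divide_right_mono)
  qed
  then have "lam * kern (\<alpha> + 1) (t0 - t1) \<le> lam * (c / Gamma (\<alpha> + 1))" using l by (rule mult_left_mono)
  also have "\<dots> = lam / (4 * (lam + 1))" using G1 by (simp add: c_def)
  also have "\<dots> < 1 / 2" using l by (simp add: field_simps)
  finally show False using r by simp
qed

text \<open>The infimum of the times at which the kernel is not positive would be a first zero. That
  infimum is a positive time because \<open>psi\<close> is continuous and positive at 0.\<close>

lemma ml_pos:
  assumes l: "0 \<le> lam" and t: "0 < t"
  shows "0 < ml lam t"
proof (rule ccontr)
  assume neg: "\<not> 0 < ml lam t"
  define S where "S = {s. 0 < s \<and> ml lam s \<le> 0}"
  define t0 where "t0 = Inf S"
  have tS: "t \<in> S" using neg t by (simp add: S_def)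
  have bdd: "bdd_below S" by (rule bdd_belowI[of _ 0]) (simp add: S_def)
  have "isCont (\<lambda>x. psi x) 0" by (rule isCont_psi)
  moreover have "0 < psi 0" using Gamma_alpha_pos by (simp add: psi_0)
  ultimately obtain e where e: "0 < e" "\<And>x. \<bar>x\<bar> < e \<Longrightarrow> 0 < psi x"
    using isCont_pos_nbhd[where f = psi and x = 0] by (metis diff_zero)
  have far: "((e / (2 * (lam + 1))) powr (1 / \<alpha>)) \<le> s" if "s \<in> S" for s
  proof (rule ccontr)
    assume "\<not> (e / (2 * (lam + 1))) powr (1 / \<alpha>) \<le> s"
    then have "s powr \<alpha> < ((e / (2 * (lam + 1))) powr (1 / \<alpha>)) powr \<alpha>"
      using that alpha_pos by (intro powr_less_mono2) (auto simp: S_def)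
    also have "\<dots> = e / (2 * (lam + 1))" using alpha_pos e l by (simp add: powr_powr)
    finally have "lam * s powr \<alpha> \<le> lam * (e / (2 * (lam + 1)))" using l by (intro mult_left_mono) auto
    also have "\<dots> < e" using l e(1) by (simp add: field_simps add_nonneg_pos)
    finally have "0 < psi (lam * s powr \<alpha>)" using l by (intro e) auto
    then show False using that by (auto simp: S_def ml_def mult_le_0_iff zero_less_mult_iff)
  qed
  have t0pos: "0 < t0"
  proof -
    have "(e / (2 * (lam + 1))) powr (1 / \<alpha>) \<le> t0"
      unfolding t0_def using tS far by (intro cInf_greatest) auto
    moreover have "0 < (e / (2 * (lam + 1))) powr (1 / \<alpha>)" using e l by simp
    ultimately show ?thesis by linarith
  qed
  have pos: "0 < ml lam s" if "0 < s" "s < t0" for s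
    using that cInf_lower[OF _ bdd, of s] by (force simp: S_def t0_def)
  have "0 < ml lam t0" by (rule ml_pos_aux[OF l t0pos pos])
  moreover have "isCont (ml lam) t0"
    using continuous_on_ml t0pos by (simp add: continuous_on_eq_continuous_at)
  ultimately obtain d where d: "0 < d" "\<And>x. \<bar>x - t0\<bar> < d \<Longrightarrow> 0 < ml lam x"
    using isCont_pos_nbhd by blast
  obtain s where s: "s \<in> S" "s < t0 + d"
    using cInf_lessD[of S "t0 + d"] tS d by (auto simp: t0_def)
  have "t0 \<le> s" unfolding t0_def by (rule cInf_lower[OF s(1) bdd])
  then have "0 < ml lam s" using s d by auto
  then show False using s by (simp add: S_def)
qed

lemma ml_nonneg: "0 \<le> lam \<Longrightarrow> 0 \<le> ml lam t"
  using ml_pos[of lam t] by (cases "t > 0") (auto simp: less_imp_le)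

lemma ml_le_kern:
  assumes "0 \<le> lam"
  shows "ml lam t \<le> kern \<alpha> t"
proof -
  have "0 \<le> (\<integral>s. kern \<alpha> (t - s) * ml lam s \<partial>lborel)"
    using assms alpha_pos by (intro Bochner_Integration.integral_nonneg mult_nonneg_nonneg kern_nonneg ml_nonneg)
  then show ?thesis using assms by (subst ml_volterra) (simp add: mult_nonneg_nonneg)
qed

lemma abs_ml_le: "0 \<le> lam \<Longrightarrow> \<bar>ml lam t\<bar> \<le> 1 * kern \<alpha> t"
  using ml_le_kern ml_nonneg by simp

end

section \<open>The integrated kernel, the resolvent identity and increments of the kernel\<close>

context frac_order begin

text \<open>The solution of the scalar problem with right-hand side 1 and initial value 0, in
  Mittag-Leffler notation t^\<alpha> E_{\<alpha>,1+\<alpha>}(- lam t^\<alpha>). Its differences are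
  integrals of \<open>ml lam\<close> over time steps.\<close>

definition Aml :: "real \<Rightarrow> real \<Rightarrow> real" where
  "Aml lam t = (\<integral>s. kern 1 (t - s) * ml lam s \<partial>lborel)"

lemma abs_kern_le: "0 < c \<Longrightarrow> \<bar>kern c t\<bar> \<le> 1 * kern c t"
  by (simp add: kern_nonneg)

lemma integrable_kern_ml: "0 < c \<Longrightarrow> integrable lborel (\<lambda>s. kern c (t - s) * ml lam s)"
  by (rule kern_ml_sums)

lemma Aml_nonneg: "0 \<le> lam \<Longrightarrow> 0 \<le> Aml lam t"
  unfolding Aml_def by (intro Bochner_Integration.integral_nonneg mult_nonneg_nonneg kern_nonneg ml_nonneg) auto

lemma Aml_nonpos_arg [simp]:
  assumes "t \<le> 0" shows "Aml lam t = 0"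
proof -
  have 0: "kern 1 (t - s) * ml lam s = 0" for s using assms by (cases "s > 0") auto
  show ?thesis unfolding Aml_def 0 by simp
qed

lemma Aml_le: "0 \<le> lam \<Longrightarrow> Aml lam t \<le> kern (1 + \<alpha>) t"
  using integrable_kern_bounded(2)[where a = 1 and f = "kern 1" and h = "ml lam" and F = 1 and H = 1 and t = t,
    OF _ alpha_pos _ _ abs_kern_le abs_ml_le] by (simp add: Aml_def)

lemma abs_Aml_le: "0 \<le> lam \<Longrightarrow> \<bar>Aml lam t\<bar> \<le> 1 * kern (1 + \<alpha>) t"
  using Aml_le Aml_nonneg by simp

lemma borel_measurable_Aml [measurable]: "Aml lam \<in> borel_measurable borel"
  unfolding Aml_def [abs_def] by measurable

lemma Aml_shift: "(\<integral>s. ml lam (t - s) * kern 1 (s - a) \<partial>lborel) = Aml lam (t - a)"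
  and integrable_Aml_shift: "integrable lborel (\<lambda>s. ml lam (t - s) * kern 1 (s - a))"
proof -
  have "(\<integral>s. ml lam (t - s) * kern 1 (s - a) \<partial>lborel) = (\<integral>s. ml lam (t - a - s) * kern 1 s \<partial>lborel)"
    by (subst lborel_integral_real_affine[where c = 1 and t = a]) (simp_all add: algebra_simps)
  also have "\<dots> = (\<integral>s. kern 1 (t - a - s) * ml lam s \<partial>lborel)" by (rule conv_commute)
  finally show "(\<integral>s. ml lam (t - s) * kern 1 (s - a) \<partial>lborel) = Aml lam (t - a)"
    by (simp add: Aml_def)
  have "integrable lborel (\<lambda>s. kern 1 (t - a - s) * ml lam s)" by (rule integrable_kern_ml) simp
  then have "integrable lborel (\<lambda>s. ml lam (t - a - s) * kern 1 s)" by (rule conv_integrable_commute)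
  from lborel_integrable_real_affine[OF this, of 1 "- a"]
  show "integrable lborel (\<lambda>s. ml lam (t - s) * kern 1 (s - a))" by (simp add: algebra_simps)
qed

lemma ml_conv_assoc:
  assumes l: "0 \<le> lam" and a: "0 < a" and b: "0 < b"
  shows "(\<integral>s. kern a (t - s) * (\<integral>r. kern b (s - r) * ml lam r \<partial>lborel) \<partial>lborel)
     = (\<integral>s. kern (a + b) (t - s) * ml lam s \<partial>lborel)"
proof -
  have "(\<integral>s. kern a (t - s) * (\<integral>r. kern b (s - r) * ml lam r \<partial>lborel) \<partial>lborel)
     = (\<integral>r. (\<integral>s. kern a (t - r - s) * kern b s \<partial>lborel) * ml lam r \<partial>lborel)"
    using a b by (intro conv_assoc[OF _ _ _ a b abs_kern_le abs_kern_le] integrable_kern_ml) auto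
  then show ?thesis
    using has_bochner_integral_kern_conv[OF a b] by (simp add: has_bochner_integral_iff)
qed

lemma kern_conv_ml_eq:
  assumes l: "0 \<le> lam" and a: "0 < a"
  shows "(\<integral>s. kern a (t - s) * ml lam s \<partial>lborel) =
     kern (a + \<alpha>) t - lam * (\<integral>s. kern (a + \<alpha>) (t - s) * ml lam s \<partial>lborel)"
proof -
  let ?v = "\<lambda>s. (\<integral>r. kern \<alpha> (s - r) * ml lam r \<partial>lborel)"
  have hb: "has_bochner_integral lborel (\<lambda>s. kern a (t - s) * kern \<alpha> s) (kern (a + \<alpha>) t)"
    by (rule has_bochner_integral_kern_conv[OF a alpha_pos])
  have bd: "\<bar>?v s\<bar> \<le> 1 * 1 * kern (\<alpha> + \<alpha>) s" for s
    using integrable_kern_bounded(2)[OF alpha_pos alpha_pos _ _ abs_kern_le[OF alpha_pos] abs_ml_le[OF l], of s]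
    by simp
  have i: "integrable lborel (\<lambda>s. kern a (t - s) * ?v s)"
    using alpha_pos by (intro integrable_kern_bounded(1)[OF a _ _ _ abs_kern_le[OF a] bd]) auto
  have "(\<integral>s. kern a (t - s) * ml lam s \<partial>lborel) = (\<integral>s. kern a (t - s) * kern \<alpha> s - lam * (kern a (t - s) * ?v s) \<partial>lborel)"
  proof (rule Bochner_Integration.integral_cong)
    fix s show "kern a (t - s) * ml lam s = kern a (t - s) * kern \<alpha> s - lam * (kern a (t - s) * ?v s)"
      using ml_volterra[of lam s] by algebra
  qed simp
  also have "\<dots> = kern (a + \<alpha>) t - lam * (\<integral>s. kern a (t - s) * ?v s \<partial>lborel)"
    using hb i by (subst Bochner_Integration.integral_diff) (auto simp: has_bochner_integral_iff)
  finally show ?thesis using ml_conv_assoc[OF l a alpha_pos] by simp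
qed

text \<open>For lam = 0 this is Sonine's identity for the orders \<alpha> and 1 - \<alpha>. In
  general the convolution is the Caputo derivative of \<open>Aml lam\<close>, whose derivative is
  \<open>ml lam\<close>, so this is the equation that \<open>Aml lam\<close> solves.\<close>

lemma sonine:
  assumes l: "0 \<le> lam" and t: "0 < t"
  shows "(\<integral>s. kern (1 - \<alpha>) (t - s) * ml lam s \<partial>lborel) + lam * Aml lam t = 1"
  using kern_conv_ml_eq[OF l, of "1 - \<alpha>" t] alpha_less_1 t by (simp add: Aml_def)

lemma lam_Aml_le:
  assumes l: "0 \<le> lam" shows "lam * Aml lam t \<le> 1"
proof (cases "t > 0")
  case True
  have "0 \<le> (\<integral>s. kern (1 - \<alpha>) (t - s) * ml lam s \<partial>lborel)"
    using l alpha_less_1 by (intro Bochner_Integration.integral_nonneg mult_nonneg_nonneg kern_nonneg ml_nonneg) auto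
  then show ?thesis using sonine[OF l True] by linarith
qed simp

lemma Aml_volterra:
  assumes l: "0 \<le> lam"
  shows "Aml lam t = kern (1 + \<alpha>) t - lam * (\<integral>s. kern \<alpha> (t - s) * Aml lam s \<partial>lborel)"
  using kern_conv_ml_eq[OF l, of 1 t] ml_conv_assoc[OF l alpha_pos, of 1 t]
  by (simp add: Aml_def add.commute)

lemma ml_scale: "0 < c \<Longrightarrow> ml lam (c * t) = c powr (\<alpha> - 1) * ml (lam * c powr \<alpha>) t"
  by (simp add: ml_def powr_mult zero_less_mult_iff mult_ac)

lemma Aml_scale:
  assumes c: "0 < c" shows "Aml lam (c * t) = c powr \<alpha> * Aml (lam * c powr \<alpha>) t"
proof -
  have "Aml lam (c * t) = c * (\<integral>s. kern 1 (c * t - c * s) * ml lam (c * s) \<partial>lborel)"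
    unfolding Aml_def using c by (subst lborel_integral_real_affine[where c = c and t = 0]) simp_all
  also have "(\<integral>s. kern 1 (c * t - c * s) * ml lam (c * s) \<partial>lborel)
    = (\<integral>s. c powr (\<alpha> - 1) * (kern 1 (t - s) * ml (lam * c powr \<alpha>) s) \<partial>lborel)"
    using c by (intro Bochner_Integration.integral_cong) (auto simp: ml_scale)
  also have "\<dots> = c powr (\<alpha> - 1) * Aml (lam * c powr \<alpha>) t" by (simp add: Aml_def)
  finally show ?thesis using c by (simp add: powr_mult_base)
qed

text \<open>The Laplace transform of \<open>ml lam\<close> is 1 / (p^\<alpha> + lam), and this is
  the formula for a difference of two such reciprocals. It is reached without transforms: the
  Volterra equation of one kernel is inserted into the convolution, which is then reassociated with
  \<open>kern \<alpha>\<close> in the middle.\<close>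

lemma ml_resolvent:
  assumes l: "0 \<le> lam" and m: "0 \<le> mu"
  shows "(lam - mu) * (\<integral>s. ml lam (t - s) * ml mu s \<partial>lborel) = ml mu t - ml lam t"
proof -
  let ?c = "\<integral>s. ml lam (t - s) * ml mu s \<partial>lborel"
  let ?v = "\<lambda>s. (\<integral>r. kern \<alpha> (s - r) * ml mu r \<partial>lborel)"
  let ?w = "\<lambda>s. (\<integral>r. ml lam (s - r) * kern \<alpha> r \<partial>lborel)"
  have w: "lam * ?w s = kern \<alpha> s - ml lam s" for s
    unfolding conv_commute[of "ml lam" s "kern \<alpha>"] using ml_volterra[of lam s] by linarith
  have v: "mu * ?v s = kern \<alpha> s - ml mu s" for s
    using ml_volterra[of mu s] by linarith
  have bd: "\<bar>?v s\<bar> \<le> 1 * 1 * kern (\<alpha> + \<alpha>) s" for s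
    using integrable_kern_bounded(2)[OF alpha_pos alpha_pos _ _ abs_kern_le[OF alpha_pos] abs_ml_le[OF m], of s]
    by simp
  have iv: "integrable lborel (\<lambda>s. ml lam (t - s) * ?v s)"
    by (rule integrable_kern_bounded(1)[where f = "ml lam" and h = ?v, OF alpha_pos _ _ _ abs_ml_le[OF l] bd])
      (use alpha_pos in auto)
  have ik: "integrable lborel (\<lambda>s. ml lam (t - s) * kern \<alpha> s)"
    by (rule conv_integrable_commute[where f = "kern \<alpha>", OF integrable_kern_ml[OF alpha_pos]])
  have im: "integrable lborel (\<lambda>s. ml lam (t - s) * ml mu s)"
    by (rule integrable_kern_bounded(1)[where f = "ml lam" and h = "ml mu", OF alpha_pos alpha_pos _ _ abs_ml_le[OF l] abs_ml_le[OF m]]) auto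
  have as: "(\<integral>s. ml lam (t - s) * ?v s \<partial>lborel) = (\<integral>s. ?w (t - s) * ml mu s \<partial>lborel)"
    by (rule conv_assoc[where f = "ml lam" and g = "kern \<alpha>" and h = "ml mu" and F = 1 and G = 1,
          OF _ _ _ alpha_pos alpha_pos abs_ml_le[OF l] abs_kern_le[OF alpha_pos] integrable_kern_ml])
      (use alpha_pos in auto)
  have 1: "?c = ?w t - mu * (\<integral>s. ml lam (t - s) * ?v s \<partial>lborel)"
  proof -
    have "(\<integral>s. ml lam (t - s) * kern \<alpha> s - mu * (ml lam (t - s) * ?v s) \<partial>lborel) = ?w t - mu * (\<integral>s. ml lam (t - s) * ?v s \<partial>lborel)"
      by (subst Bochner_Integration.integral_diff[OF ik integrable_mult_right[OF iv]]) (simp only: Bochner_Integration.integral_mult_right_zero)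
    moreover have "?c = (\<integral>s. ml lam (t - s) * kern \<alpha> s - mu * (ml lam (t - s) * ?v s) \<partial>lborel)"
    proof (rule Bochner_Integration.integral_cong)
      fix s
      have "ml mu s = kern \<alpha> s - mu * ?v s" using v[of s] by linarith
      then show "ml lam (t - s) * ml mu s = ml lam (t - s) * kern \<alpha> s - mu * (ml lam (t - s) * ?v s)"
        by (simp only: right_diff_distrib mult.left_commute)
    qed simp
    ultimately show ?thesis by (rule trans[rotated])
  qed
  have 2: "lam * (\<integral>s. ml lam (t - s) * ?v s \<partial>lborel) = ?v t - ?c"
  proof -
    have "lam * (\<integral>s. ml lam (t - s) * ?v s \<partial>lborel) = (\<integral>s. lam * (?w (t - s) * ml mu s) \<partial>lborel)"
      unfolding as by (rule Bochner_Integration.integral_mult_right_zero [symmetric])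
    also have "\<dots> = (\<integral>s. kern \<alpha> (t - s) * ml mu s - ml lam (t - s) * ml mu s \<partial>lborel)"
    proof (rule Bochner_Integration.integral_cong)
      fix s show "lam * (?w (t - s) * ml mu s) = kern \<alpha> (t - s) * ml mu s - ml lam (t - s) * ml mu s"
        by (simp only: mult.assoc [symmetric] w left_diff_distrib)
    qed simp
    also have "\<dots> = ?v t - ?c"
      by (rule Bochner_Integration.integral_diff[OF integrable_kern_ml[OF alpha_pos] im])
    finally show ?thesis .
  qed
  \<comment> \<open>Linear elimination of the triple convolution I and of the two convolutions V and
    W with \<open>kern \<alpha>\<close>.\<close>
  have elim: "(lam - mu) * c = m - l"
    if "c = W - mu * I" "lam * I = V - c" "mu * V = k - m" "lam * W = k - l" for c W I V k l m :: real
    using that by algebra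
  show ?thesis by (rule elim[OF 1 2 v w])
qed

text \<open>One of the arguments s and 1 - s is at least 1/2. The kernel taken there is at most
  \<open>kern \<alpha> (1/2)\<close>, and the other kernel is integrated, which yields 1 / lam or 1
  / mu by \<open>lam_Aml_le\<close>.\<close>

lemma ml_conv_ml_le:
  assumes l: "0 < lam" and m: "0 < mu"
  shows "(\<integral>s. ml lam (1 - s) * ml mu s \<partial>lborel) \<le> (1 / lam + 1 / mu) * kern \<alpha> (1 / 2)"
proof -
  have l': "0 \<le> lam" "0 \<le> mu" using l m by auto
  have k: "kern \<alpha> s \<le> kern \<alpha> (1/2)" if "1/2 \<le> s" for s
  proof -
    have "s powr (\<alpha> - 1) \<le> (1/2) powr (\<alpha> - 1)"
      using that alpha_less_1 by (intro powr_mono2') auto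
    then show ?thesis using that Gamma_alpha_pos by (simp add: kern_def divide_right_mono)
  qed
  have im: "integrable lborel (\<lambda>s. ml lam (1 - s) * ml mu s)"
    by (intro integrable_kern_bounded(1)[OF alpha_pos alpha_pos _ _ abs_ml_le[OF l'(1)] abs_ml_le[OF l'(2)]]) auto
  have i1: "integrable lborel (\<lambda>s. ml lam (1 - s) * kern 1 s)" using integrable_Aml_shift[of lam 1 0] by simp
  have i2: "integrable lborel (\<lambda>s. kern 1 (1 - s) * ml mu s)" by (rule integrable_kern_ml) simp
  have "(\<integral>s. ml lam (1 - s) * ml mu s \<partial>lborel)
      \<le> (\<integral>s. kern \<alpha> (1/2) * (ml lam (1 - s) * kern 1 s) + kern \<alpha> (1/2) * (kern 1 (1 - s) * ml mu s) \<partial>lborel)"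
  proof (rule integral_mono[OF im])
    show "integrable lborel (\<lambda>s. kern \<alpha> (1/2) * (ml lam (1 - s) * kern 1 s) + kern \<alpha> (1/2) * (kern 1 (1 - s) * ml mu s))"
      using i1 i2 by (intro Bochner_Integration.integrable_add integrable_mult_right)
    fix s :: real
    have nn: "0 \<le> kern \<alpha> (1/2)" "0 \<le> ml lam (1 - s)" "0 \<le> ml mu s"
      using l' alpha_pos by (auto intro: kern_nonneg ml_nonneg)
    show "ml lam (1 - s) * ml mu s
      \<le> kern \<alpha> (1/2) * (ml lam (1 - s) * kern 1 s) + kern \<alpha> (1/2) * (kern 1 (1 - s) * ml mu s)"
    proof (cases "0 < s \<and> s < 1")
      case True
      show ?thesis
      proof (cases "s \<le> 1/2")
        case s: True
        have "ml lam (1 - s) * ml mu s \<le> kern \<alpha> (1/2) * ml mu s"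
          using nn s k[of "1 - s"] ml_le_kern[OF l'(1), of "1 - s"] by (intro mult_right_mono) auto
        moreover have "0 \<le> kern \<alpha> (1/2) * (ml lam (1 - s) * kern 1 s)" using nn by simp
        ultimately show ?thesis using True by simp
      next
        case s: False
        have "ml lam (1 - s) * ml mu s \<le> ml lam (1 - s) * kern \<alpha> (1/2)"
          using nn s k[of "s"] ml_le_kern[OF l'(2), of "s"] by (intro mult_left_mono) auto
        moreover have "0 \<le> kern \<alpha> (1/2) * (kern 1 (1 - s) * ml mu s)" using nn by simp
        ultimately show ?thesis using True by (simp add: mult_ac)
      qed
    qed auto
  qed
  also have "\<dots> = kern \<alpha> (1/2) * Aml lam 1 + kern \<alpha> (1/2) * Aml mu 1"
    using i1 i2 Aml_shift[of lam 1 0] by (subst Bochner_Integration.integral_add) (auto simp: Aml_def)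
  also have "\<dots> \<le> kern \<alpha> (1/2) * (1 / lam) + kern \<alpha> (1/2) * (1 / mu)"
    using lam_Aml_le[of lam 1] lam_Aml_le[of mu 1] l m alpha_pos
    by (intro add_mono mult_left_mono kern_nonneg) (auto simp: field_simps)
  finally show ?thesis by (simp add: algebra_simps)
qed

lemma psi_eq_ml: "psi x = ml x 1"
  by (simp add: ml_def)

lemma psi_bounds: "0 \<le> x \<Longrightarrow> 0 \<le> psi x \<and> psi x \<le> 1 / Gamma \<alpha>"
  using ml_nonneg[of x 1] ml_le_kern[of x 1] by (simp add: psi_eq_ml kern_def)

text \<open>The resolvent identity at time 1 takes the place of differentiating the alternating
  series. The result has the form |psi'(x)| \<le> C / x, and this homogeneity is what removes
  \<open>lam\<close> after the substitution x = lam t^\<alpha>.\<close>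

lemma psi_diff_le:
  assumes "0 < x" "0 < y"
  shows "\<bar>psi x - psi y\<bar> \<le> \<bar>x - y\<bar> * ((1 / x + 1 / y) * kern \<alpha> (1 / 2))"
proof -
  have nn: "0 \<le> (\<integral>s. ml x (1 - s) * ml y s \<partial>lborel)"
    using assms by (intro Bochner_Integration.integral_nonneg mult_nonneg_nonneg ml_nonneg) auto
  have "psi x - psi y = - ((x - y) * (\<integral>s. ml x (1 - s) * ml y s \<partial>lborel))"
    using ml_resolvent[of x y 1] assms by (simp add: psi_eq_ml)
  then have "\<bar>psi x - psi y\<bar> = \<bar>x - y\<bar> * (\<integral>s. ml x (1 - s) * ml y s \<partial>lborel)"
    using nn by (simp add: abs_mult)
  also have "\<dots> \<le> \<bar>x - y\<bar> * ((1 / x + 1 / y) * kern \<alpha> (1 / 2))"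
    using ml_conv_ml_le[OF assms] by (intro mult_left_mono) auto
  finally show ?thesis .
qed

definition ml_lip :: real where "ml_lip = 1 / Gamma \<alpha> + 2 * kern \<alpha> (1 / 2)"

lemma ml_lip_nonneg: "0 \<le> ml_lip"
  unfolding ml_lip_def using Gamma_alpha_pos kern_nonneg[OF alpha_pos] by simp

text \<open>The estimate |ml'(t)| \<le> C t^(\<alpha>-2), uniform in \<open>lam\<close>, in
  difference form. In the product t^(\<alpha>-1) psi(lam t^\<alpha>) the first factor varies as for
  lam = 0, and the variation of the second is scale invariant.\<close>

lemma ml_lipschitz:
  assumes l: "0 \<le> lam" and s: "0 < s" and st: "s \<le> t"
  shows "\<bar>ml lam t - ml lam s\<bar> \<le> ml_lip * (s powr (\<alpha> - 2) * (t - s))"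
proof -
  have t: "0 < t" using s st by simp
  have ps: "s powr (\<alpha> - 1) = s powr (\<alpha> - 2) * s" using s powr_mult_base[of s "\<alpha> - 2"] by (simp add: mult.commute)
  have psi1: "\<bar>psi (lam * t powr \<alpha>) - psi (lam * s powr \<alpha>)\<bar> \<le> 2 * kern \<alpha> (1 / 2) * ((t - s) / s)"
  proof (cases "lam = 0")
    case True
    then show ?thesis using s st kern_nonneg[OF alpha_pos, of "1/2"] by simp
  next
    case False
    with l have l: "0 < lam" by simp
    have mono: "s powr \<alpha> \<le> t powr \<alpha>" using s st alpha_pos by (intro powr_mono2) auto
    have "\<bar>psi (lam * t powr \<alpha>) - psi (lam * s powr \<alpha>)\<bar>
        \<le> \<bar>lam * t powr \<alpha> - lam * s powr \<alpha>\<bar> * ((1 / (lam * t powr \<alpha>) + 1 / (lam * s powr \<alpha>)) * kern \<alpha> (1 / 2))"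
      using l s t by (intro psi_diff_le) auto
    \<comment> \<open>Both reciprocals are replaced by the larger one; then \<open>lam\<close>
      cancels and only (t/s)^\<alpha> - 1 remains.\<close>
    also have "\<dots> \<le> (lam * t powr \<alpha> - lam * s powr \<alpha>) * ((2 / (lam * s powr \<alpha>)) * kern \<alpha> (1 / 2))"
    proof (intro mult_mono mult_right_mono)
      have "1 / (lam * t powr \<alpha>) \<le> 1 / (lam * s powr \<alpha>)"
        using mono l s t by (intro divide_left_mono mult_left_mono mult_pos_pos) auto
      moreover have "2 / (lam * s powr \<alpha>) = 1 / (lam * s powr \<alpha>) + 1 / (lam * s powr \<alpha>)" by simp
      ultimately show "1 / (lam * t powr \<alpha>) + 1 / (lam * s powr \<alpha>) \<le> 2 / (lam * s powr \<alpha>)"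
        by (simp only: add_right_mono)
    qed (use mono l alpha_pos in \<open>auto intro!: mult_nonneg_nonneg add_nonneg_nonneg kern_nonneg\<close>)
    also have "\<dots> = 2 * kern \<alpha> (1 / 2) * ((t / s) powr \<alpha> - 1)"
      using l s t by (simp add: powr_divide field_simps)
    also have "\<dots> \<le> 2 * kern \<alpha> (1 / 2) * (t / s - 1)"
    proof -
      have "(t / s) powr \<alpha> \<le> (t / s) powr 1"
        using s st alpha_less_1 by (intro powr_mono) auto
      then show ?thesis using s t kern_nonneg[OF alpha_pos, of "1/2"] by (intro mult_left_mono) auto
    qed
    also have "t / s - 1 = (t - s) / s" using s by (simp add: field_simps)
    finally show ?thesis .
  qed
  have "s powr (\<alpha> - 1) - t powr (\<alpha> - 1) \<le> s powr (\<alpha> - 2) * (t - s)"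
  proof -
    have "s / t \<le> (s / t) powr (1 - \<alpha>)"
      using powr_mono'[of "1 - \<alpha>" 1 "s / t"] s t st alpha_pos by simp
    then have "1 - (s / t) powr (1 - \<alpha>) \<le> 1 - s / t" by simp
    also have "1 - s / t = (t - s) / t" using t by (simp add: diff_divide_distrib)
    also have "\<dots> \<le> (t - s) / s" using s st by (intro divide_left_mono) auto
    finally have "s powr (\<alpha> - 1) * (1 - (s / t) powr (1 - \<alpha>)) \<le> s powr (\<alpha> - 1) * ((t - s) / s)"
      by (intro mult_left_mono) auto
    moreover have "s powr (\<alpha> - 1) * (s / t) powr (1 - \<alpha>) = t powr (\<alpha> - 1)"
      using s t powr_minus_divide[of s "1 - \<alpha>"] powr_minus_divide[of t "1 - \<alpha>"] by (simp add: powr_divide)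
    moreover have "s powr (\<alpha> - 1) * ((t - s) / s) = s powr (\<alpha> - 2) * (t - s)" using ps s by simp
    ultimately show ?thesis by (simp add: algebra_simps)
  qed
  moreover have "t powr (\<alpha> - 1) \<le> s powr (\<alpha> - 1)"
    using s st alpha_less_1 by (intro powr_mono2') auto
  ultimately have p: "\<bar>t powr (\<alpha> - 1) - s powr (\<alpha> - 1)\<bar> \<le> s powr (\<alpha> - 2) * (t - s)" by simp
  have "ml lam t - ml lam s = (t powr (\<alpha> - 1) - s powr (\<alpha> - 1)) * psi (lam * t powr \<alpha>)
     + s powr (\<alpha> - 1) * (psi (lam * t powr \<alpha>) - psi (lam * s powr \<alpha>))"
    using s t by (simp add: ml_def algebra_simps)
  also have "\<bar>\<dots>\<bar> \<le> (s powr (\<alpha> - 2) * (t - s)) * (1 / Gamma \<alpha>) + s powr (\<alpha> - 1) * (2 * kern \<alpha> (1 / 2) * ((t - s) / s))"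
  proof (rule order_trans[OF abs_triangle_ineq add_mono])
    show "\<bar>(t powr (\<alpha> - 1) - s powr (\<alpha> - 1)) * psi (lam * t powr \<alpha>)\<bar> \<le> (s powr (\<alpha> - 2) * (t - s)) * (1 / Gamma \<alpha>)"
      unfolding abs_mult using p psi_bounds[of "lam * t powr \<alpha>"] l s st
      by (intro mult_mono) auto
    show "\<bar>s powr (\<alpha> - 1) * (psi (lam * t powr \<alpha>) - psi (lam * s powr \<alpha>))\<bar> \<le> s powr (\<alpha> - 1) * (2 * kern \<alpha> (1 / 2) * ((t - s) / s))"
      unfolding abs_mult abs_of_nonneg[OF powr_ge_zero] by (intro mult_left_mono psi1) simp
  qed
  also have "s powr (\<alpha> - 1) * (2 * kern \<alpha> (1 / 2) * ((t - s) / s)) = s powr (\<alpha> - 2) * (2 * kern \<alpha> (1 / 2) * (t - s))"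
    using s by (simp add: ps)
  also have "(s powr (\<alpha> - 2) * (t - s)) * (1 / Gamma \<alpha>) + s powr (\<alpha> - 2) * (2 * kern \<alpha> (1 / 2) * (t - s))
     = ml_lip * (s powr (\<alpha> - 2) * (t - s))"
    unfolding ml_lip_def by (simp add: ring_distribs mult_ac)
  finally show ?thesis .
qed

end

section \<open>Discrete resolvents and the discrete Gronwall inequality\<close>

text \<open>Young's inequality for summable sequences: the substitution m = n - j, then a triangle
  enlarged to a rectangle.\<close>

lemma sum_convolution_le:
  fixes a d :: "nat \<Rightarrow> real"
  assumes a: "\<And>m. 0 \<le> a m" and d: "\<And>j. 0 \<le> d j"
  shows "(\<Sum>n=1..N. \<Sum>j=1..n. a (n - j) * d j) \<le> (\<Sum>m<N. a m) * (\<Sum>j=1..N. d j)"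
proof -
  have "(\<Sum>n=1..N. \<Sum>j=1..n. a (n - j) * d j) = (\<Sum>(n,j)\<in>(SIGMA n:{1..N}. {1..n}). a (n - j) * d j)"
    by (rule sum.Sigma) auto
  also have "\<dots> = (\<Sum>(m,j)\<in>{(m,j). j \<in> {1..N} \<and> m + j \<le> N}. a m * d j)"
    by (rule sum.reindex_bij_witness[where i = "\<lambda>(m,j). (m + j, j)" and j = "\<lambda>(n,j). (n - j, j)"]) auto
  also have "\<dots> \<le> (\<Sum>(m,j)\<in>{..<N} \<times> {1..N}. a m * d j)"
    using a d by (intro sum_mono2) auto
  also have "\<dots> = (\<Sum>m<N. a m) * (\<Sum>j=1..N. d j)"
    by (simp add: sum_product sum.cartesian_product)
  finally show ?thesis .
qed

lemma sum_swap_triangle: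
  fixes f :: "nat \<Rightarrow> nat \<Rightarrow> 'b::comm_monoid_add"
  shows "(\<Sum>j=1..n. \<Sum>i=1..j. f j i) = (\<Sum>i=1..n. \<Sum>j=i..n. f j i)"
proof -
  have "(\<Sum>j=1..n. \<Sum>i=1..j. f j i) = (\<Sum>(j,i)\<in>(SIGMA j:{1..n}. {1..j}). f j i)"
    by (rule sum.Sigma) auto
  also have "\<dots> = (\<Sum>(i,j)\<in>(SIGMA i:{1..n}. {i..n}). f j i)"
    by (rule sum.reindex_bij_witness[where i = "\<lambda>(i,j). (j,i)" and j = "\<lambda>(i,j). (j,i)"]) auto
  also have "\<dots> = (\<Sum>i=1..n. \<Sum>j=i..n. f j i)"
    by (rule sum.Sigma [symmetric]) auto
  finally show ?thesis .
qed

text \<open>What the two schemes have in common: the sign pattern of an M-matrix, and partial sums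
  that decay no faster than the kernel of order 1 - \<alpha>, up to the constant
  \<open>c0\<close>.\<close>

locale cq_weights = frac_order +
  fixes K :: "nat \<Rightarrow> real" and c0 :: real
  assumes K0_pos: "0 < K 0" and K_nonpos: "\<And>j. 1 \<le> j \<Longrightarrow> K j \<le> 0"
    and c0_pos: "0 < c0" and K_sum_ge: "\<And>n. c0 * (real n + 1) powr (- \<alpha>) \<le> (\<Sum>j\<le>n. K j)"
begin

definition P :: "nat \<Rightarrow> real" where "P n = (\<Sum>j\<le>n. K j)"

text \<open>The power series coefficients of \<open>1 / (\<Sum>j. K j * \<zeta>^j + lam)\<close>.\<close>

fun res :: "real \<Rightarrow> nat \<Rightarrow> real" where
  "res lam n = (if n = 0 then 1 else (\<Sum>j<n. - K (n - j) * res lam j)) / (K 0 + lam)"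

declare res.simps [simp del]

text \<open>The counterpart of \<open>kern \<alpha>\<close>, as \<open>P\<close> is of
  \<open>kern (1 - \<alpha>)\<close>. It dominates every \<open>res lam\<close> with lam \<ge> 0,
  which is how uniformity in \<open>lam\<close> enters on the discrete side.\<close>

abbreviation omega :: "nat \<Rightarrow> real" where "omega \<equiv> res 0"

lemma P_0: "P 0 = K 0" by (simp add: P_def)

lemma P_pos: "0 < P n"
proof -
  have "0 < c0 * (real n + 1) powr (- \<alpha>)" using c0_pos by simp
  then show ?thesis using K_sum_ge[of n] unfolding P_def by (rule less_le_trans)
qed

lemma P_antimono: "m \<le> n \<Longrightarrow> P n \<le> P m"
proof (induction n rule: dec_induct)
  case (step n)
  then show ?case using K_nonpos[of "Suc n"] by (simp add: P_def)
qed simp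

lemma res_nonneg: "0 \<le> lam \<Longrightarrow> 0 \<le> res lam n"
proof (induction n rule: less_induct)
  case (less n)
  then have "0 \<le> - K (n - j) * res lam j" if "j < n" for j
    using K_nonpos[of "n - j"] that by (intro mult_nonneg_nonneg) auto
  then show ?case using K0_pos less.prems by (subst res.simps) (auto intro!: divide_nonneg_pos sum_nonneg)
qed

text \<open>The recursion has nonnegative coefficients - K (n - j), and its divisor K 0 + lam is
  smallest for lam = 0.\<close>

lemma res_le_omega: "0 \<le> lam \<Longrightarrow> res lam n \<le> omega n"
proof (induction n rule: less_induct)
  case (less n)
  have le: "- K (n - j) * res lam j \<le> - K (n - j) * omega j" if "j < n" for j
    using K_nonpos[of "n - j"] that less by (intro mult_left_mono) auto
  have nn: "0 \<le> - K (n - j) * omega j" if "j < n" for j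
    using K_nonpos[of "n - j"] that res_nonneg[of 0 j] by (intro mult_nonneg_nonneg) auto
  show ?case
    using K0_pos less.prems le nn unfolding res.simps[of lam n] res.simps[of 0 n]
    by (intro frac_le) (auto intro!: sum_mono sum_nonneg)
qed

lemma res_conv:
  assumes "0 \<le> lam"
  shows "(\<Sum>j\<le>n. K (n - j) * res lam j) + lam * res lam n = (if n = 0 then 1 else 0)"
proof -
  have s: "{..n} = insert n {..<n}" by auto
  have "(K 0 + lam) * res lam n = (if n = 0 then 1 else (\<Sum>j<n. - K (n - j) * res lam j))"
    using K0_pos assms by (subst res.simps) simp
  then show ?thesis by (simp add: s sum_negf algebra_simps split: if_splits)
qed

text \<open>The discrete Sonine identity: \<open>omega\<close> inverts \<open>K\<close>, and
  \<open>P\<close> is \<open>K\<close> convolved with the constant sequence 1.\<close>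

lemma omega_P: "(\<Sum>m\<le>n. omega m * P (n - m)) = 1"
proof (induction n)
  case 0
  show ?case using K0_pos by (simp add: P_0 res.simps)
next
  case (Suc n)
  have "P (Suc n - m) = P (n - m) + K (Suc n - m)" if "m \<le> n" for m
    using that by (simp add: P_def Suc_diff_le)
  then have "(\<Sum>m\<le>Suc n. omega m * P (Suc n - m)) =
     (\<Sum>m\<le>n. omega m * P (n - m)) + ((\<Sum>m\<le>n. omega m * K (Suc n - m)) + omega (Suc n) * P 0)"
    by (simp add: sum.distrib [symmetric] distrib_left)
  also have "(\<Sum>m\<le>n. omega m * K (Suc n - m)) + omega (Suc n) * P 0 = 0"
    using res_conv[of 0 "Suc n"] by (simp add: P_0 mult.commute)
  finally show ?case using Suc by simp
qed

text \<open>As \<open>P\<close> is nonincreasing, the sum times the last value of \<open>P\<close>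
  is at most the convolution in \<open>omega_P\<close>, which is 1.\<close>

lemma sum_omega_le: "(\<Sum>m<n. omega m) \<le> real n powr \<alpha> / c0"
proof (cases n)
  case (Suc k)
  have "(\<Sum>m\<le>k. omega m) * P k \<le> (\<Sum>m\<le>k. omega m * P (k - m))"
    unfolding sum_distrib_right using res_nonneg[of 0]
    by (intro sum_mono mult_left_mono P_antimono) auto
  then have "(\<Sum>m\<le>k. omega m) \<le> 1 / P k" using P_pos[of k] by (simp add: omega_P field_simps)
  also have "\<dots> \<le> 1 / (c0 * (real k + 1) powr (- \<alpha>))"
    using K_sum_ge[of k] c0_pos P_pos[of k] by (intro divide_left_mono mult_pos_pos) (auto simp: P_def)
  also have "\<dots> = real n powr \<alpha> / c0"
    using Suc powr_minus_divide[of "real k + 1" \<alpha>] by (simp add: add.commute)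
  finally show ?thesis by (simp add: Suc lessThan_Suc_atMost)
qed simp

lemma omega_le: "omega n \<le> 1 / K 0"
proof -
  have "omega n * P 0 \<le> (\<Sum>m\<le>n. omega m * P (n - m))"
    using res_nonneg[of 0] P_pos less_imp_le
    by (intro order_trans[OF _ member_le_sum[of n]]) (auto intro!: mult_nonneg_nonneg)
  then show ?thesis using K0_pos by (simp add: omega_P P_0 field_simps)
qed

text \<open>Convolving the equations with \<open>res lam\<close> and interchanging the sums leaves
  the unit sequence of \<open>res_conv\<close>. This serves the scheme itself as well as the scheme
  applied to other sequences such as the values of \<open>Aml lam\<close>.\<close>

lemma solution_formula:
  assumes l: "0 \<le> lam" and n: "1 \<le> n"
    and eq: "\<And>k. 1 \<le> k \<Longrightarrow> k \<le> n \<Longrightarrow> (\<Sum>j=1..k. K (k - j) * x j) + lam * x k = r k"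
  shows "x n = (\<Sum>j=1..n. res lam (n - j) * r j)"
proof -
  have "(\<Sum>j=1..n. res lam (n - j) * r j)
      = (\<Sum>j=1..n. \<Sum>i=1..j. res lam (n - j) * K (j - i) * x i) + (\<Sum>j=1..n. lam * res lam (n - j) * x j)"
    unfolding sum.distrib [symmetric]
    by (intro sum.cong) (auto simp: eq [symmetric] sum_distrib_left algebra_simps)
  also have "(\<Sum>j=1..n. \<Sum>i=1..j. res lam (n - j) * K (j - i) * x i)
     = (\<Sum>i=1..n. \<Sum>j=i..n. res lam (n - j) * K (j - i) * x i)"
    by (rule sum_swap_triangle)
  also have "\<dots> + (\<Sum>j=1..n. lam * res lam (n - j) * x j)
     = (\<Sum>i=1..n. x i * ((\<Sum>j=i..n. res lam (n - j) * K (j - i)) + lam * res lam (n - i)))"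
    unfolding sum.distrib [symmetric]
    by (intro sum.cong) (auto simp: sum_distrib_left algebra_simps)
  also have "\<dots> = (\<Sum>i=1..n. x i * (if i = n then 1 else 0))"
  proof (intro sum.cong refl)
    fix i assume i: "i \<in> {1..n}"
    have "(\<Sum>j=i..n. res lam (n - j) * K (j - i)) = (\<Sum>j\<le>n - i. K (n - i - j) * res lam j)"
      by (rule sum.reindex_bij_witness[where i = "\<lambda>j. n - j" and j = "\<lambda>j. n - j"]) (use i in auto)
    then show "x i * ((\<Sum>j=i..n. res lam (n - j) * K (j - i)) + lam * res lam (n - i)) = x i * (if i = n then 1 else 0)"
      using res_conv[OF l, of "n - i"] i by auto
  qed
  also have "\<dots> = x n"
    using n by (subst sum.remove[where x = n]) (auto intro!: sum.neutral)
  finally show ?thesis by simp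
qed

text \<open>\<open>K\<close> consists of the differences of \<open>P\<close>, so the quadrature
  becomes a sum over increments, the form in which the L1 weights are integrals over cells.\<close>

lemma conv_by_parts:
  assumes "x 0 = 0"
  shows "(\<Sum>j=1..n. K (n - j) * x j) = (\<Sum>j=1..n. P (n - j) * (x j - x (j - 1)))"
proof -
  have "(\<Sum>j=1..n. P (n - j) * x j) = (\<Sum>j=1..n. K (n - j) * x j) + (\<Sum>j=1..n. P (n - j) * x (j - 1))"
  proof (induction n)
    case (Suc n)
    have Ps: "P (Suc n - j) = P (n - j) + K (Suc n - j)" if "j \<le> n" for j
      using that by (simp add: P_def Suc_diff_le)
    have "(\<Sum>j=1..Suc n. P (Suc n - j) * x (j - 1)) = (\<Sum>j=0..n. P (n - j) * x j)"
      by (rule sum.reindex_bij_witness[where i = "Suc" and j = "\<lambda>j. j - 1"]) auto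
    also have "\<dots> = (\<Sum>j=1..n. P (n - j) * x j)"
      using assms by (simp add: sum.atLeast_Suc_atMost)
    finally have 1: "(\<Sum>j=1..Suc n. P (Suc n - j) * x (j - 1)) = (\<Sum>j=1..n. P (n - j) * x j)" .
    have "(\<Sum>j=1..Suc n. P (Suc n - j) * x j) = (\<Sum>j=1..n. (P (n - j) + K (Suc n - j)) * x j) + K 0 * x (Suc n)"
      using Ps by (simp add: P_0)
    also have "\<dots> = (\<Sum>j=1..Suc n. K (Suc n - j) * x j) + (\<Sum>j=1..n. P (n - j) * x j)"
      by (simp add: sum.distrib algebra_simps)
    finally show ?case unfolding 1 .
  qed simp
  then show ?thesis by (simp add: sum_subtractf right_diff_distrib)
qed

text \<open>One summand for each regime of \<open>sum_omega_geometric_le\<close>: 1 / K 0 serves y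
  \<ge> 1, the other serves y < 1.\<close>

definition gron :: real where "gron = 1 / K 0 + exp 2 / c0"

lemma gron_pos: "0 < gron" unfolding gron_def using K0_pos c0_pos by (simp add: add_pos_pos)

text \<open>At q = 1 / (1 + y) the generating function of \<open>omega\<close> should be of size (1
  - q)^(-\<alpha>). By \<open>omega_P\<close> its product with that of \<open>P\<close> is 1 / (1 -
  q), and finitely many terms of the latter give a lower bound.\<close>

lemma sum_omega_geometric_le:
  assumes y: "0 < y"
  shows "(\<Sum>m<n. omega m * (1 / (1 + y)) ^ m) \<le> gron * (1 + y) * y powr (- \<alpha>)"
proof -
  define q where "q = 1 / (1 + y)"
  have q: "0 < q" "q < 1" using y by (auto simp: q_def)
  define W where "W = (\<Sum>m<n. omega m * q ^ m)"
  have W0: "0 \<le> W" unfolding W_def using q res_nonneg[of 0] by (intro sum_nonneg mult_nonneg_nonneg) auto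
  have key: "W * (\<Sum>i<M. P i * q ^ i) \<le> (1 + y) / y" for M
  proof -
    have "W * (\<Sum>i<M. P i * q ^ i) = (\<Sum>(m,i)\<in>{..<n} \<times> {..<M}. (omega m * q ^ m) * (P i * q ^ i))"
      unfolding W_def by (simp add: sum_product sum.cartesian_product)
    also have "\<dots> \<le> (\<Sum>(m,i)\<in>{(m,i). m + i < n + M}. (omega m * q ^ m) * (P i * q ^ i))"
    proof (rule sum_mono2)
      have "{(m,i). m + i < n + M} \<subseteq> {..<n+M} \<times> {..<n+M}" by auto
      then show "finite {(m,i). m + i < n + M}" by (rule finite_subset) simp
    qed (use q res_nonneg[of 0] P_pos less_imp_le in \<open>auto intro!: mult_nonneg_nonneg\<close>)
    also have "\<dots> = (\<Sum>k<n + M. \<Sum>i\<le>k. (omega i * q ^ i) * (P (k - i) * q ^ (k - i)))"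
      by (rule sum.triangle_reindex)
    also have "\<dots> = (\<Sum>k<n + M. q ^ k * (\<Sum>i\<le>k. omega i * P (k - i)))"
    proof (intro sum.cong refl)
      fix k
      show "(\<Sum>i\<le>k. (omega i * q ^ i) * (P (k - i) * q ^ (k - i))) = q ^ k * (\<Sum>i\<le>k. omega i * P (k - i))"
        unfolding sum_distrib_left
        by (intro sum.cong refl) (auto simp: power_add [symmetric] mult_ac)
    qed
    also have "\<dots> = (\<Sum>k<n + M. q ^ k)" by (simp add: omega_P)
    also have "\<dots> \<le> (\<Sum>k. q ^ k)"
      using q by (intro sum_le_suminf summable_geometric) auto
    also have "\<dots> = 1 / (1 - q)" using q by (intro suminf_geometric) auto
    also have "\<dots> = (1 + y) / y" using y by (simp add: q_def field_simps)
    finally show ?thesis .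
  qed
  have "W \<le> gron * (1 + y) * y powr (- \<alpha>)"
  proof (cases "y \<ge> 1")
    case True
    have "W * K 0 \<le> (1 + y) / y" using key[of 1] by (simp add: P_0)
    also have "\<dots> \<le> (1 + y) * y powr (- \<alpha>)"
    proof -
      have "y powr (-1) \<le> y powr (- \<alpha>)" using True alpha_less_1 by (intro powr_mono) auto
      then have "(1 + y) * y powr (-1) \<le> (1 + y) * y powr (- \<alpha>)" using y by (intro mult_left_mono) auto
      then show ?thesis using y by (simp add: powr_minus_divide)
    qed
    finally have "W \<le> 1 / K 0 * ((1 + y) * y powr (- \<alpha>))" using K0_pos by (simp add: field_simps)
    also have "\<dots> \<le> gron * ((1 + y) * y powr (- \<alpha>))"
      using y c0_pos by (intro mult_right_mono) (auto simp: gron_def)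
    finally show ?thesis by (simp add: mult_ac)
  next
    case False
    \<comment> \<open>About 1 / y terms: on this range q^i stays above exp(-2), and M terms of size
      M^(-\<alpha>) already add up to y^(\<alpha>-1).\<close>
    define M where "M = nat \<lceil>1 / y\<rceil>"
    have M: "1 / y \<le> real M" "real M \<le> 1 / y + 1"
    proof -
      have "0 \<le> \<lceil>1 / y\<rceil>" using y by (simp add: le_ceiling_iff less_le_trans[of _ 0])
      then have "real M = of_int \<lceil>1 / y\<rceil>" by (simp add: M_def)
      then show "1 / y \<le> real M" "real M \<le> 1 / y + 1" by linarith+
    qed
    have "1 < 1 / y" using False y by simp
    then have M1: "1 \<le> real M" "0 < real M" using M(1) by linarith+
    have "y * real M \<le> y * (1 / y + 1)" using M y by (intro mult_left_mono) auto
    then have My: "y * real M \<le> 2" using y False by (simp add: distrib_left)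
    have qM: "exp (- 2) \<le> q ^ i" if "i < M" for i
    proof -
      have "(1 + y) ^ i \<le> exp y ^ i" using y by (intro power_mono) auto
      also have "\<dots> = exp (real i * y)" by (simp add: exp_of_nat_mult)
      also have "\<dots> \<le> exp (real M * y)" using that y by simp
      also have "\<dots> \<le> exp 2" using My by (simp add: mult.commute)
      finally show ?thesis using y by (simp add: q_def exp_minus power_divide field_simps)
    qed
    have "c0 * exp (- 2) * y powr (\<alpha> - 1) \<le> (\<Sum>i<M. P i * q ^ i)"
    proof -
      have "y powr (\<alpha> - 1) = (1 / y) powr (1 - \<alpha>)" using y powr_minus_divide[of y "1 - \<alpha>"] by (simp add: powr_divide)
      also have "\<dots> \<le> real M powr (1 - \<alpha>)" using M y alpha_less_1 by (intro powr_mono2) auto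
      also have "\<dots> = real M * real M powr (- \<alpha>)" using M1 powr_mult_base[of "real M" "- \<alpha>"] by simp
      finally have "c0 * exp (- 2) * y powr (\<alpha> - 1) \<le> (\<Sum>i<M. (c0 * real M powr (- \<alpha>)) * exp (- 2))"
        using c0_pos by (simp add: field_simps)
      also have "\<dots> \<le> (\<Sum>i<M. P i * q ^ i)"
      proof (intro sum_mono mult_mono qM)
        fix i assume i: "i \<in> {..<M}"
        have "c0 * real M powr (- \<alpha>) \<le> c0 * (real i + 1) powr (- \<alpha>)"
          using i alpha_pos c0_pos by (intro mult_left_mono powr_mono2') auto
        also have "\<dots> \<le> P i" using K_sum_ge[of i] by (simp add: P_def)
        finally show "c0 * real M powr (- \<alpha>) \<le> P i" .
      qed (use P_pos less_imp_le in auto)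
      finally show ?thesis .
    qed
    then have "W * (c0 * exp (- 2) * y powr (\<alpha> - 1)) \<le> (1 + y) / y"
      using key[of M] W0 by (meson mult_left_mono order_trans)
    then have "W \<le> (1 + y) / y / (c0 * exp (- 2) * y powr (\<alpha> - 1))"
      using c0_pos y by (simp add: field_simps)
    also have "\<dots> = exp 2 / c0 * ((1 + y) / (y * y powr (\<alpha> - 1)))"
      by (simp add: exp_minus field_simps)
    also have "y * y powr (\<alpha> - 1) = y powr \<alpha>" using y by (simp add: powr_mult_base)
    also have "exp 2 / c0 * ((1 + y) / y powr \<alpha>) = exp 2 / c0 * ((1 + y) * y powr (- \<alpha>))"
      by (simp add: powr_minus_divide)
    also have "\<dots> \<le> gron * ((1 + y) * y powr (- \<alpha>))"
      using y K0_pos by (intro mult_right_mono) (auto simp: gron_def)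
    finally show ?thesis by (simp add: mult_ac)
  qed
  then show ?thesis by (simp add: W_def q_def)
qed

text \<open>Induction with the majorant 2 Q (1 + z)^n. The rate \<open>mu\<close> makes the
  convolution contribute at most half of it. The sum uses the previous level j - 1, and this shift
  absorbs the spare factor 1 + z of \<open>sum_omega_geometric_le\<close>, so no restriction on the
  step size arises.\<close>

lemma discrete_gronwall:
  assumes L: "0 < L" and tau: "0 < \<tau>" and Q: "0 \<le> Q" and y0: "y 0 = 0"
    and y: "\<And>n. 1 \<le> n \<Longrightarrow> n \<le> N \<Longrightarrow> y n \<le> Q + \<tau> powr \<alpha> * L * (\<Sum>j=1..n. omega (n - j) * y (j - 1))"
    and n: "n \<le> N"
  shows "y n \<le> 2 * Q * exp ((2 * L * gron) powr (1 / \<alpha>) * (real n * \<tau>))"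
proof -
  define mu where "mu = (2 * L * gron) powr (1 / \<alpha>)"
  have mu: "0 < mu" "mu powr \<alpha> = 2 * L * gron"
    using L gron_pos alpha_pos by (auto simp: mu_def powr_powr)
  define z where "z = mu * \<tau>"
  have z: "0 < z" using mu tau by (simp add: z_def)
  have "y n \<le> 2 * Q * (1 + z) ^ n" using n
  proof (induction n rule: less_induct)
    case (less n)
    show ?case
    proof (cases "n = 0")
      case True
      then show ?thesis using Q y0 by simp
    next
      case False
      have "(\<Sum>j=1..n. omega (n - j) * y (j - 1)) \<le> (\<Sum>j=1..n. omega (n - j) * (2 * Q * (1 + z) ^ (j - 1)))"
        using less res_nonneg[of 0] False by (intro sum_mono mult_left_mono) auto
      also have "\<dots> = (\<Sum>m<n. omega m * (2 * Q * (1 + z) ^ (n - m - 1)))"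
        by (rule sum.reindex_bij_witness[where i = "\<lambda>m. n - m" and j = "\<lambda>j. n - j"]) auto
      also have "\<dots> = 2 * Q * (1 + z) ^ (n - 1) * (\<Sum>m<n. omega m * (1 / (1 + z)) ^ m)"
        unfolding sum_distrib_left
      proof (intro sum.cong refl)
        fix m assume "m \<in> {..<n}"
        then have "n - 1 = (n - m - 1) + m" by auto
        then have "(1 + z) ^ (n - 1) = (1 + z) ^ (n - m - 1) * (1 + z) ^ m" by (metis power_add)
        then show "omega m * (2 * Q * (1 + z) ^ (n - m - 1)) = 2 * Q * (1 + z) ^ (n - 1) * (omega m * (1 / (1 + z)) ^ m)"
          using z by (simp add: power_divide)
      qed
      also have "\<dots> \<le> 2 * Q * (1 + z) ^ (n - 1) * (gron * (1 + z) * z powr (- \<alpha>))"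
        using Q z sum_omega_geometric_le[OF z] by (intro mult_left_mono) auto
      also have "\<dots> = 2 * Q * gron * z powr (- \<alpha>) * (1 + z) ^ n"
        using False by (cases n) (auto simp: mult_ac)
      finally have "\<tau> powr \<alpha> * L * (\<Sum>j=1..n. omega (n - j) * y (j - 1))
        \<le> \<tau> powr \<alpha> * L * (2 * Q * gron * z powr (- \<alpha>) * (1 + z) ^ n)"
        using L by (intro mult_left_mono) auto
      also have "\<dots> = Q * (1 + z) ^ n"
      proof -
        have "z powr (- \<alpha>) = 1 / ((2 * L * gron) * \<tau> powr \<alpha>)"
          using mu tau by (simp add: z_def powr_mult powr_minus_divide)
        then show ?thesis using L tau gron_pos by simp
      qed
      finally have "y n \<le> Q + Q * (1 + z) ^ n" using y[of n] less.prems False by auto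
      moreover have "Q * 1 \<le> Q * (1 + z) ^ n" using Q z by (intro mult_left_mono) auto
      ultimately show ?thesis by simp
    qed
  qed
  also have "(1 + z) ^ n \<le> exp z ^ n" using z by (intro power_mono) auto
  also have "exp z ^ n = exp (mu * (real n * \<tau>))" by (simp add: exp_of_nat_mult [symmetric] z_def mult_ac)
  finally show ?thesis using Q by (simp add: mu_def mult_left_mono)
qed

end

section \<open>Resolvent comparison for the L1 scheme\<close>

text \<open>A cell written as a difference of two step kernels makes integrals over cells instances
  of the semigroup law.\<close>

lemma indicator_kern:
  "a \<le> b \<Longrightarrow> indicator {a<..b} s = kern 1 (s - a) - kern 1 (s - b)"
  by (auto simp: indicator_def)

lemma has_bochner_integral_kern_indicator:
  assumes c: "0 < c" and ab: "a \<le> b"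
  shows "has_bochner_integral lborel (\<lambda>s. indicator {a<..b} s * kern c (t - s)) (kern (c + 1) (t - a) - kern (c + 1) (t - b))"
proof -
  have "has_bochner_integral lborel (\<lambda>s. kern 1 (s - r) * kern c (t - s)) (kern (c + 1) (t - r))" for r
    using nn_integral_kern_conv_shift[OF c, of 1 t r] c
    by (intro has_bochner_integral_nn_integral) (auto intro!: mult_nonneg_nonneg kern_nonneg simp: mult.commute)
  from has_bochner_integral_diff[OF this[of a] this[of b]]
  show ?thesis unfolding indicator_kern[OF ab] left_diff_distrib .
qed

lemma has_bochner_integral_indicator_Ioc:
  fixes a b :: real
  assumes "a \<le> b"
  shows "has_bochner_integral lborel (\<lambda>s. indicator {a<..b} s * c) ((b - a) * c)"
  using has_bochner_integral_mult_left[OF has_bochner_integral_real_indicator[of "{a<..b}" lborel], of c] assms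
  by simp

context frac_order begin

lemma Aml_diff:
  assumes ab: "a \<le> b"
  shows "has_bochner_integral lborel (\<lambda>s. indicator {a<..b} s * ml lam s) (Aml lam b - Aml lam a)"
proof -
  have "has_bochner_integral lborel (\<lambda>s. kern 1 (t - s) * ml lam s) (Aml lam t)" for t
    using integrable_kern_ml[of 1 t lam] by (simp add: has_bochner_integral_iff Aml_def)
  from has_bochner_integral_diff[OF this[of b] this[of a]]
  have 1: "has_bochner_integral lborel (\<lambda>s. kern 1 (b - s) * ml lam s - kern 1 (a - s) * ml lam s) (Aml lam b - Aml lam a)" .
  have "AE s in lborel. s \<noteq> a \<and> s \<noteq> b" using AE_lborel_singleton[of a] AE_lborel_singleton[of b] by auto
  then have "AE s in lborel. kern 1 (b - s) * ml lam s - kern 1 (a - s) * ml lam s = indicator {a<..b} s * ml lam s"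
    by (rule eventually_mono) (use ab in \<open>auto simp: indicator_def\<close>)
  from has_bochner_integral_cong_AE[OF _ _ this] 1 show ?thesis by simp
qed

lemma Aml_mono: "0 \<le> lam \<Longrightarrow> a \<le> b \<Longrightarrow> Aml lam a \<le> Aml lam b"
  using Aml_diff[of a b lam] Bochner_Integration.integral_nonneg[of lborel "\<lambda>s. indicator {a<..b} s * ml lam s"]
  by (auto simp: has_bochner_integral_iff intro!: mult_nonneg_nonneg ml_nonneg)

lemma Aml_increment:
  assumes ab: "a \<le> b" and D: "\<And>r. a < r \<Longrightarrow> r \<le> b \<Longrightarrow> \<bar>ml lam r - c\<bar> \<le> D"
  shows "\<bar>Aml lam b - Aml lam a - c * (b - a)\<bar> \<le> D * (b - a)"
proof -
  note h = has_bochner_integral_diff[OF Aml_diff[OF ab, of lam] has_bochner_integral_indicator_Ioc[OF ab, of c]]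
  have "\<bar>Aml lam b - Aml lam a - (b - a) * c\<bar> = \<bar>\<integral>s. indicator {a<..b} s * ml lam s - indicator {a<..b} s * c \<partial>lborel\<bar>"
    using h by (simp add: has_bochner_integral_iff)
  also have "\<dots> \<le> (\<integral>s. \<bar>indicator {a<..b} s * ml lam s - indicator {a<..b} s * c\<bar> \<partial>lborel)"
    by (rule integral_abs_bound)
  also have "\<dots> \<le> (\<integral>s. indicator {a<..b} s * D \<partial>lborel)"
    using h has_bochner_integral_indicator_Ioc[OF ab, of D] D
    by (intro integral_mono) (auto simp: has_bochner_integral_iff indicator_def)
  also have "\<dots> = (b - a) * D"
    using has_bochner_integral_indicator_Ioc[OF ab, of D] by (simp add: has_bochner_integral_iff)
  finally show ?thesis by (simp add: mult.commute)
qed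

end

context cq_weights begin

text \<open>The bound is uniform in the eigenvalue \<open>lam\<close>. Its growth in the number of time levels, rescaled
  by \<open>\<tau>\<close>, is what limits the rate to \<open>\<tau> powr \<alpha>\<close>.\<close>

definition comparable :: "(nat \<Rightarrow> real) \<Rightarrow> real \<Rightarrow> bool" where
  "comparable eps C \<longleftrightarrow> (\<forall>lam n. 0 \<le> lam \<longrightarrow> 1 \<le> n \<longrightarrow> \<bar>Aml lam (real n) - (\<Sum>m<n. res lam m)\<bar> \<le> eps n) \<and>
     (\<forall>n\<ge>1. 0 \<le> eps n \<and> eps n \<le> C) \<and> (\<forall>N. (\<Sum>n=1..N. eps n) \<le> C * real N powr \<alpha>)"

end

text \<open>The partial sums are the integrals of \<open>kern (1 - \<alpha>)\<close> over unit
  cells. In other words, the scheme applies the Caputo derivative exactly to the piecewise linear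
  interpolant.\<close>

locale l1_weights = cq_weights +
  assumes K_sum_l1: "\<And>n. (\<Sum>j\<le>n. K j) = kern (2 - \<alpha>) (real n + 1) - kern (2 - \<alpha>) (real n)"
begin

definition cell :: "nat \<Rightarrow> real \<Rightarrow> real" where
  "cell j s = indicator {real j - 1<..real j} s"

text \<open>With unit steps the difference of \<open>Aml lam\<close> is the mean of
  \<open>ml lam\<close> over cell \<open>j\<close>. So this is the derivative of the interpolation
  error, and it has mean zero on the cell.\<close>

definition defect :: "real \<Rightarrow> nat \<Rightarrow> real \<Rightarrow> real" where
  "defect lam j s = Aml lam (real j) - Aml lam (real (j - 1)) - ml lam s"

text \<open>For positive \<open>m\<close> the oscillation of \<open>kern (1 - \<alpha>)\<close> over
  the cell at distance \<open>m\<close>. In the cell of the singularity the oscillation is infinite,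
  and the full integral K 0 replaces it.\<close>

definition wgt :: "nat \<Rightarrow> real" where
  "wgt m = (if m = 0 then K 0 else kern (1 - \<alpha>) (real m) - kern (1 - \<alpha>) (real m + 1))"

text \<open>On the first cell only the integral of the defect is controlled, by 2 * kern (1 +
  \<alpha>) 1, since \<open>ml lam\<close> is singular at 0. The extra 1 / K 0 pays for n = j = 1,
  where kernel and solution are singular in the same cell.\<close>

definition Dcon :: "nat \<Rightarrow> real" where
  "Dcon j = (if j \<le> 1 then 1 / K 0 + 2 * kern (1 + \<alpha>) 1 else ml_lip * real (j - 1) powr (\<alpha> - 2))"

definition Rb :: "nat \<Rightarrow> real" where "Rb n = (\<Sum>j=1..n. wgt (n - j) * Dcon j)"

lemma one_minus_alpha_pos: "0 < 1 - \<alpha>" using alpha_less_1 by simp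

lemma cell_kern:
  assumes "1 \<le> j" "j \<le> n"
  shows "has_bochner_integral lborel (\<lambda>s. cell j s * kern (1 - \<alpha>) (real n - s)) (P (n - j))"
proof -
  have "has_bochner_integral lborel (\<lambda>s. cell j s * kern (1 - \<alpha>) (real n - s))
      (kern (1 - \<alpha> + 1) (real n - (real j - 1)) - kern (1 - \<alpha> + 1) (real n - real j))"
    unfolding cell_def by (rule has_bochner_integral_kern_indicator[OF one_minus_alpha_pos]) simp
  moreover have "real n - (real j - 1) = real (n - j) + 1" "real n - real j = real (n - j)" "1 - \<alpha> + 1 = 2 - \<alpha>"
    using assms by auto
  ultimately show ?thesis unfolding P_def K_sum_l1 by (simp only:)
qed

lemma cell_ml:
  assumes "1 \<le> j"
  shows "has_bochner_integral lborel (\<lambda>s. cell j s * ml lam s) (Aml lam (real j) - Aml lam (real (j - 1)))"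
  using Aml_diff[of "real j - 1" "real j" lam] assms by (simp add: cell_def of_nat_diff)

lemma cell_const: "has_bochner_integral lborel (\<lambda>s. cell j s * c) c"
  using has_bochner_integral_indicator_Ioc[of "real j - 1" "real j" c] by (simp add: cell_def)

lemma cell_defect:
  assumes "1 \<le> j"
  shows "has_bochner_integral lborel (\<lambda>s. cell j s * defect lam j s) 0"
proof -
  have "has_bochner_integral lborel (\<lambda>s. cell j s * (Aml lam (real j) - Aml lam (real (j - 1))) - cell j s * ml lam s) 0"
    using has_bochner_integral_diff[OF cell_const[of j "Aml lam (real j) - Aml lam (real (j - 1))"] cell_ml[OF assms, of lam]] by simp
  then show ?thesis by (simp only: defect_def right_diff_distrib)
qed

lemma cell_kern_ml_integrable: "0 \<le> lam \<Longrightarrow> integrable lborel (\<lambda>s. cell j s * kern (1 - \<alpha>) (real n - s) * ml lam s)"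
  by (rule Bochner_Integration.integrable_bound[OF integrable_kern_ml[OF one_minus_alpha_pos, of "real n" lam]])
    (auto simp: cell_def indicator_def abs_mult)

lemma measurable_cell [measurable]: "cell j \<in> borel_measurable borel"
  unfolding cell_def by measurable

lemma defect_bound:
  assumes l: "0 \<le> lam" and j: "2 \<le> j" and s: "cell j s \<noteq> 0"
  shows "\<bar>defect lam j s\<bar> \<le> Dcon j"
proof -
  have s: "real j - 1 < s" "s \<le> real j" using s by (auto simp: cell_def indicator_def split: if_splits)
  have j1: "real (j - 1) = real j - 1" using j by auto
  have le: "\<bar>ml lam r - ml lam s\<bar> \<le> Dcon j" if r: "real j - 1 < r" "r \<le> real j" for r
  proof -
    have aux: "\<bar>ml lam y - ml lam x\<bar> \<le> Dcon j" if "real j - 1 < x" "x \<le> y" "y \<le> real j" for x y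
    proof -
      have "\<bar>ml lam y - ml lam x\<bar> \<le> ml_lip * (x powr (\<alpha> - 2) * (y - x))"
        using that j by (intro ml_lipschitz l) auto
      also have "\<dots> \<le> ml_lip * (real (j - 1) powr (\<alpha> - 2) * 1)"
        using that j alpha_less_1 unfolding j1 by (intro mult_left_mono mult_mono powr_mono2' ml_lip_nonneg) auto
      finally show ?thesis using j by (simp add: Dcon_def)
    qed
    show ?thesis using aux[of s r] aux[of r s] s r by (cases "s \<le> r") (auto simp: abs_minus_commute)
  qed
  have "\<bar>Aml lam (real j) - Aml lam (real j - 1) - ml lam s * (real j - (real j - 1))\<bar> \<le> Dcon j * (real j - (real j - 1))"
    using le by (intro Aml_increment) auto
  then show ?thesis using j1 by (simp add: defect_def)
qed

lemma defect_integral_bound: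
  assumes l: "0 \<le> lam" and j: "1 \<le> j"
  shows "(\<integral>s. \<bar>cell j s * defect lam j s\<bar> \<partial>lborel) \<le> Dcon j"
proof (cases "j \<le> 1")
  case False
  have "(\<integral>s. \<bar>cell j s * defect lam j s\<bar> \<partial>lborel) \<le> (\<integral>s. cell j s * Dcon j \<partial>lborel)"
    using cell_defect[OF j, of lam] cell_const[of j "Dcon j"] defect_bound[OF l, of j] False
    by (intro integral_mono) (auto simp: has_bochner_integral_iff cell_def indicator_def)
  also have "\<dots> = Dcon j" by (rule has_bochner_integral_integral_eq[OF cell_const])
  finally show ?thesis .
next
  case True
  with j have j1: "j = 1" by simp
  have "(\<integral>s. \<bar>cell j s * defect lam j s\<bar> \<partial>lborel) \<le> (\<integral>s. cell j s * Aml lam 1 + cell j s * ml lam s \<partial>lborel)"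
    using cell_defect[OF j, of lam] cell_const[of j "Aml lam 1"] cell_ml[OF j, of lam] Aml_nonneg[OF l, of 1] ml_nonneg[OF l]
    by (intro integral_mono)
      (auto simp: has_bochner_integral_iff cell_def indicator_def defect_def j1
        intro!: order_trans[OF abs_triangle_ineq4])
  also have "\<dots> = Aml lam 1 + Aml lam 1"
    using cell_const[of j "Aml lam 1"] cell_ml[OF j, of lam]
    by (subst Bochner_Integration.integral_add) (auto simp: has_bochner_integral_iff j1)
  also have "\<dots> \<le> 2 * kern (1 + \<alpha>) 1" using Aml_le[OF l, of 1] by simp
  also have "\<dots> \<le> Dcon j" using K0_pos by (simp add: Dcon_def j1)
  finally show ?thesis .
qed

lemma cell_kern_defect:
  assumes l: "0 \<le> lam" and j: "1 \<le> j" "j \<le> n"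
  shows "has_bochner_integral lborel (\<lambda>s. cell j s * kern (1 - \<alpha>) (real n - s) * defect lam j s)
     (P (n - j) * (Aml lam (real j) - Aml lam (real (j - 1))) - (\<integral>s. cell j s * kern (1 - \<alpha>) (real n - s) * ml lam s \<partial>lborel))"
proof -
  have "has_bochner_integral lborel (\<lambda>s. cell j s * kern (1 - \<alpha>) (real n - s) * (Aml lam (real j) - Aml lam (real (j - 1))))
    (P (n - j) * (Aml lam (real j) - Aml lam (real (j - 1))))"
    by (rule has_bochner_integral_mult_left) (rule cell_kern[OF j])
  moreover have "has_bochner_integral lborel (\<lambda>s. cell j s * kern (1 - \<alpha>) (real n - s) * ml lam s)
     (\<integral>s. cell j s * kern (1 - \<alpha>) (real n - s) * ml lam s \<partial>lborel)"
    using cell_kern_ml_integrable[OF l] by (simp add: has_bochner_integral_iff)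
  ultimately show ?thesis unfolding defect_def right_diff_distrib by (rule has_bochner_integral_diff)
qed

lemma cell_kern_defect_bound:
  assumes l: "0 \<le> lam" and j: "1 \<le> j" "j \<le> n"
  shows "\<bar>\<integral>s. cell j s * kern (1 - \<alpha>) (real n - s) * defect lam j s \<partial>lborel\<bar> \<le> wgt (n - j) * Dcon j"
proof -
  note hb = cell_kern_defect[OF l j]
  have k0: "0 \<le> kern (1 - \<alpha>) s" for s by (rule kern_nonneg[OF one_minus_alpha_pos])
  consider "n = j" "j \<le> 1" | "n = j" "2 \<le> j" | "j < n" using j by linarith
  then show ?thesis
  proof cases
    case 1
    with j have nj: "n = 1" "j = 1" by auto
    \<comment> \<open>Both singularities meet here. The identity \<open>sonine\<close> bounds the
      integral of the product by 1, which is wgt 0 times the summand 1 / K 0 of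
      \<open>Dcon 1\<close>.\<close>
    have "(\<integral>s. cell 1 s * kern (1 - \<alpha>) (1 - s) * ml lam s \<partial>lborel) \<le> (\<integral>s. kern (1 - \<alpha>) (1 - s) * ml lam s \<partial>lborel)"
      using cell_kern_ml_integrable[OF l, of 1 1] integrable_kern_ml[OF one_minus_alpha_pos, of 1 lam] k0 ml_nonneg[OF l]
      by (intro integral_mono) (auto simp: cell_def indicator_def)
    also have "\<dots> \<le> 1" using sonine[OF l, of 1] Aml_nonneg[OF l, of 1] l mult_nonneg_nonneg[of lam "Aml lam 1"] by linarith
    finally have a: "(\<integral>s. cell 1 s * kern (1 - \<alpha>) (1 - s) * ml lam s \<partial>lborel) \<le> 1" .
    have b: "0 \<le> (\<integral>s. cell 1 s * kern (1 - \<alpha>) (1 - s) * ml lam s \<partial>lborel)"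
      using k0 ml_nonneg[OF l] by (intro Bochner_Integration.integral_nonneg mult_nonneg_nonneg) (auto simp: cell_def)
    have c: "0 \<le> K 0 * Aml lam 1" "K 0 * Aml lam 1 \<le> K 0 * kern (1 + \<alpha>) 1"
      using K0_pos Aml_nonneg[OF l, of 1] Aml_le[OF l, of 1] by auto
    have "wgt 0 * Dcon 1 = 1 + 2 * (K 0 * kern (1 + \<alpha>) 1)"
      using K0_pos by (simp add: wgt_def Dcon_def distrib_left)
    then show ?thesis using hb a b c by (simp add: nj has_bochner_integral_iff P_0)
  next
    case 2
    have "\<bar>\<integral>s. cell j s * kern (1 - \<alpha>) (real n - s) * defect lam j s \<partial>lborel\<bar>
      \<le> (\<integral>s. \<bar>cell j s * kern (1 - \<alpha>) (real n - s) * defect lam j s\<bar> \<partial>lborel)" by (rule integral_abs_bound)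
    also have "\<dots> \<le> (\<integral>s. cell j s * kern (1 - \<alpha>) (real n - s) * Dcon j \<partial>lborel)"
    proof (rule integral_mono)
      show "integrable lborel (\<lambda>s. \<bar>cell j s * kern (1 - \<alpha>) (real n - s) * defect lam j s\<bar>)"
        using hb by (auto simp: has_bochner_integral_iff)
      show "integrable lborel (\<lambda>s. cell j s * kern (1 - \<alpha>) (real n - s) * Dcon j)"
        using has_bochner_integral_mult_left[OF cell_kern[OF j], of "Dcon j"] by (auto simp: has_bochner_integral_iff)
      fix s
      show "\<bar>cell j s * kern (1 - \<alpha>) (real n - s) * defect lam j s\<bar> \<le> cell j s * kern (1 - \<alpha>) (real n - s) * Dcon j"
        using defect_bound[OF l 2(2), of s] k0[of "real n - s"]
        by (cases "cell j s = 0") (auto simp: abs_mult cell_def indicator_def intro!: mult_left_mono split: if_splits)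
    qed
    also have "\<dots> = wgt (n - j) * Dcon j"
      using has_bochner_integral_mult_left[OF cell_kern[OF j], of "Dcon j"] 2
      by (simp add: has_bochner_integral_iff wgt_def P_0)
    finally show ?thesis .
  next
    case 3
    define m where "m = n - j"
    have m: "1 \<le> m" "real n = real j + real m" using 3 by (auto simp: m_def)
    \<comment> \<open>The defect has mean zero on the cell, so the kernel may be replaced by its
      deviation from the constant \<open>k1\<close>, which is at most \<open>wgt m\<close>.\<close>
    define k1 where "k1 = kern (1 - \<alpha>) (real m)"
    have id: "has_bochner_integral lborel (\<lambda>s. k1 * (cell j s * defect lam j s)) 0"
      using has_bochner_integral_mult_right[OF cell_defect[OF j(1), of lam], of k1] by simp
    have "(\<integral>s. cell j s * kern (1 - \<alpha>) (real n - s) * defect lam j s \<partial>lborel)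
       = (\<integral>s. cell j s * kern (1 - \<alpha>) (real n - s) * defect lam j s - k1 * (cell j s * defect lam j s) \<partial>lborel)"
      using has_bochner_integral_integral_eq[OF has_bochner_integral_diff[OF hb id]] has_bochner_integral_integral_eq[OF hb]
      by (simp only: diff_zero)
    then have "\<bar>\<integral>s. cell j s * kern (1 - \<alpha>) (real n - s) * defect lam j s \<partial>lborel\<bar>
       \<le> (\<integral>s. \<bar>cell j s * kern (1 - \<alpha>) (real n - s) * defect lam j s - k1 * (cell j s * defect lam j s)\<bar> \<partial>lborel)"
      by (simp only: integral_abs_bound)
    also have "\<dots> \<le> (\<integral>s. wgt m * \<bar>cell j s * defect lam j s\<bar> \<partial>lborel)"
    proof (rule integral_mono)
      show "integrable lborel (\<lambda>s. \<bar>cell j s * kern (1 - \<alpha>) (real n - s) * defect lam j s - k1 * (cell j s * defect lam j s)\<bar>)"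
        using hb id by (auto simp: has_bochner_integral_iff)
      show "integrable lborel (\<lambda>s. wgt m * \<bar>cell j s * defect lam j s\<bar>)"
        using cell_defect[OF j(1), of lam] by (auto simp: has_bochner_integral_iff)
      fix s
      show "\<bar>cell j s * kern (1 - \<alpha>) (real n - s) * defect lam j s - k1 * (cell j s * defect lam j s)\<bar>
        \<le> wgt m * \<bar>cell j s * defect lam j s\<bar>"
      proof (cases "cell j s = 0")
        case False
        then have s: "real j - 1 < s" "s \<le> real j" by (auto simp: cell_def indicator_def split: if_splits)
        have anti: "kern (1 - \<alpha>) y \<le> kern (1 - \<alpha>) x" if "0 < x" "x \<le> y" for x y
          using that alpha_pos alpha_less_1
          by (auto simp: kern_def Gamma_real_pos less_imp_le intro!: divide_right_mono powr_mono2')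
        have "\<bar>kern (1 - \<alpha>) (real n - s) - k1\<bar> \<le> wgt m"
          using anti[of "real m" "real n - s"] anti[of "real n - s" "real m + 1"] s m
          by (auto simp: k1_def wgt_def)
        then have "\<bar>kern (1 - \<alpha>) (real n - s) - k1\<bar> * \<bar>cell j s * defect lam j s\<bar> \<le> wgt m * \<bar>cell j s * defect lam j s\<bar>"
          by (intro mult_right_mono) auto
        then show ?thesis by (simp add: abs_mult [symmetric] algebra_simps)
      qed auto
    qed
    also have "\<dots> \<le> wgt m * Dcon j"
    proof -
      have "0 \<le> wgt m"
        using m alpha_pos alpha_less_1 K0_pos
        by (auto simp: wgt_def kern_def Gamma_real_pos less_imp_le intro!: divide_right_mono powr_mono2')
      then show ?thesis using defect_integral_bound[OF l j(1)] by (simp add: mult_left_mono)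
    qed
    finally show ?thesis by (simp add: m_def)
  qed
qed

text \<open>By \<open>sonine\<close> the exact equation holds for \<open>Aml lam\<close> with
  right-hand side 1. Subtracting it from the scheme leaves, cell by cell, the kernel of order 1 -
  \<alpha> integrated against the defect.\<close>

lemma truncation_bound:
  assumes l: "0 \<le> lam" and n: "1 \<le> n"
  shows "\<bar>(\<Sum>j=1..n. K (n - j) * Aml lam (real j)) + lam * Aml lam (real n) - 1\<bar> \<le> Rb n"
proof -
  have cells: "(\<Sum>j=1..n. cell j s) = indicator {0<..real n} s" for s
  proof (induction n)
    case (Suc n)
    then show ?case by (auto simp: cell_def indicator_def)
  qed simp
  have "(\<integral>s. kern (1 - \<alpha>) (real n - s) * ml lam s \<partial>lborel)
     = (\<integral>s. (\<Sum>j=1..n. cell j s * kern (1 - \<alpha>) (real n - s) * ml lam s) \<partial>lborel)"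
  proof (rule Bochner_Integration.integral_cong)
    fix s
    show "kern (1 - \<alpha>) (real n - s) * ml lam s = (\<Sum>j=1..n. cell j s * kern (1 - \<alpha>) (real n - s) * ml lam s)"
      unfolding sum_distrib_right [symmetric] cells by (cases "0 < s \<and> s \<le> real n") auto
  qed simp
  also have "\<dots> = (\<Sum>j=1..n. \<integral>s. cell j s * kern (1 - \<alpha>) (real n - s) * ml lam s \<partial>lborel)"
    by (rule Bochner_Integration.integral_sum) (rule cell_kern_ml_integrable[OF l])
  finally have 1: "lam * Aml lam (real n) - 1 = - (\<Sum>j=1..n. \<integral>s. cell j s * kern (1 - \<alpha>) (real n - s) * ml lam s \<partial>lborel)"
    using sonine[OF l, of "real n"] n by simp
  have 2: "(\<Sum>j=1..n. K (n - j) * Aml lam (real j)) = (\<Sum>j=1..n. P (n - j) * (Aml lam (real j) - Aml lam (real (j - 1))))"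
    by (rule conv_by_parts) simp
  have "(\<Sum>j=1..n. K (n - j) * Aml lam (real j)) + lam * Aml lam (real n) - 1
     = (\<Sum>j=1..n. \<integral>s. cell j s * kern (1 - \<alpha>) (real n - s) * defect lam j s \<partial>lborel)"
    unfolding add_diff_eq [symmetric] 1 2 sum_negf [symmetric] sum.distrib [symmetric]
    using cell_kern_defect[OF l] by (intro sum.cong) (auto simp: has_bochner_integral_iff)
  also have "\<bar>\<dots>\<bar> \<le> Rb n"
    unfolding Rb_def using cell_kern_defect_bound[OF l]
    by (intro order_trans[OF sum_abs] sum_mono) auto
  finally show ?thesis .
qed

lemma wgt_nonneg: "0 \<le> wgt m"
  using alpha_pos alpha_less_1 K0_pos
  by (cases "m = 0") (auto simp: wgt_def kern_def Gamma_real_pos less_imp_le intro!: divide_right_mono powr_mono2')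

lemma Dcon_nonneg: "0 \<le> Dcon j"
  using K0_pos ml_lip_nonneg alpha_pos by (auto simp: Dcon_def intro!: add_nonneg_nonneg kern_nonneg)

lemma sum_wgt: "(\<Sum>m<N. wgt m) \<le> K 0 + kern (1 - \<alpha>) 1"
proof (cases N)
  case (Suc M)
  have "(\<Sum>m<Suc M. wgt m) = K 0 + kern (1 - \<alpha>) 1 - kern (1 - \<alpha>) (real M + 1)"
  proof (induction M)
    case (Suc M)
    have "(\<Sum>m<Suc (Suc M). wgt m) = (\<Sum>m<Suc M. wgt m) + wgt (Suc M)" by simp
    then show ?case using Suc by (simp add: wgt_def add_ac)
  qed (simp add: wgt_def)
  then show ?thesis using kern_nonneg[OF one_minus_alpha_pos, of "real M + 1"] Suc by simp
qed (use K0_pos kern_nonneg[OF one_minus_alpha_pos, of 1] in simp)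

text \<open>A convolution of two summable sequences: \<open>wgt\<close> telescopes, and
  \<open>Dcon\<close> decays with exponent \<alpha> - 2 < -1.\<close>

lemma sum_Rb_bounded: obtains C where "0 \<le> C" "\<And>N. (\<Sum>n=1..N. Rb n) \<le> C"
proof -
  have sm: "summable (\<lambda>n. real n powr (\<alpha> - 2))"
    using alpha_less_1 by (simp add: summable_real_powr_iff)
  define C where "C = (K 0 + kern (1 - \<alpha>) 1) * (Dcon 1 + ml_lip * (\<Sum>n. real n powr (\<alpha> - 2)))"
  have "0 \<le> (\<Sum>n. real n powr (\<alpha> - 2))" by (intro suminf_nonneg sm) auto
  then have "0 \<le> C" unfolding C_def using K0_pos kern_nonneg[OF one_minus_alpha_pos, of 1] Dcon_nonneg[of 1] ml_lip_nonneg
    by (intro mult_nonneg_nonneg add_nonneg_nonneg) auto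
  moreover have "(\<Sum>n=1..N. Rb n) \<le> C" for N
  proof -
    have "(\<Sum>n=1..N. Rb n) \<le> (\<Sum>m<N. wgt m) * (\<Sum>j=1..N. Dcon j)"
      unfolding Rb_def by (rule sum_convolution_le[OF wgt_nonneg Dcon_nonneg])
    also have "\<dots> \<le> C" unfolding C_def
    proof (rule mult_mono[OF sum_wgt])
      have "(\<Sum>j=1..N. Dcon j) \<le> (\<Sum>j\<in>insert 1 (Suc ` {1..<N}). Dcon j)"
      proof (rule sum_mono2)
        show "{1..N} \<subseteq> insert 1 (Suc ` {1..<N})"
        proof
          fix j assume "j \<in> {1..N}"
          then show "j \<in> insert 1 (Suc ` {1..<N})" by (cases j) (auto simp: image_iff)
        qed
      qed (use Dcon_nonneg in auto)
      also have "\<dots> = Dcon 1 + (\<Sum>j\<in>Suc ` {1..<N}. Dcon j)"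
        by (rule sum.insert) auto
      also have "(\<Sum>j\<in>Suc ` {1..<N}. Dcon j) = (\<Sum>j\<in>{1..<N}. ml_lip * real j powr (\<alpha> - 2))"
        by (subst sum.reindex) (auto simp: Dcon_def intro!: sum.cong)
      also have "(\<Sum>j\<in>{1..<N}. ml_lip * real j powr (\<alpha> - 2)) \<le> ml_lip * (\<Sum>n. real n powr (\<alpha> - 2))"
        unfolding sum_distrib_left [symmetric] using ml_lip_nonneg
        by (intro mult_left_mono sum_le_suminf sm) auto
      finally show "(\<Sum>j=1..N. Dcon j) \<le> Dcon 1 + ml_lip * (\<Sum>n. real n powr (\<alpha> - 2))" by simp
    qed (use K0_pos kern_nonneg[OF one_minus_alpha_pos, of 1] Dcon_nonneg in \<open>auto intro!: sum_nonneg\<close>)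
    finally show ?thesis .
  qed
  ultimately show ?thesis by (rule that)
qed

lemma l1_comparable: "\<exists>eps C. comparable eps C"
proof -
  obtain C where C: "0 \<le> C" "\<And>N. (\<Sum>n=1..N. Rb n) \<le> C" using sum_Rb_bounded by blast
  have Rb0: "0 \<le> Rb n" for n unfolding Rb_def using wgt_nonneg Dcon_nonneg by (intro sum_nonneg mult_nonneg_nonneg)
  \<comment> \<open>Truncation errors travel with the discrete resolvent, which \<open>omega\<close>
    dominates. Its mass of order N^\<alpha> against the bounded total of \<open>Rb\<close> gives
    exactly the growth allowed in \<open>comparable\<close>.\<close>
  define eps where "eps n = (\<Sum>j=1..n. omega (n - j) * Rb j)" for n
  define C' where "C' = C / K 0 + C / c0"
  have "\<bar>Aml lam (real n) - (\<Sum>m<n. res lam m)\<bar> \<le> eps n" if l: "0 \<le> lam" and n: "1 \<le> n" for lam n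
  proof -
    define R where "R k = (\<Sum>j=1..k. K (k - j) * Aml lam (real j)) + lam * Aml lam (real k) - 1" for k
    have "Aml lam (real n) = (\<Sum>j=1..n. res lam (n - j) * (1 + R j))"
      by (rule solution_formula[OF l n]) (simp add: R_def)
    also have "\<dots> = (\<Sum>j=1..n. res lam (n - j)) + (\<Sum>j=1..n. res lam (n - j) * R j)"
      by (simp add: distrib_left sum.distrib)
    also have "(\<Sum>j=1..n. res lam (n - j)) = (\<Sum>m<n. res lam m)"
      by (rule sum.reindex_bij_witness[where i = "\<lambda>m. n - m" and j = "\<lambda>j. n - j"]) auto
    finally have "Aml lam (real n) - (\<Sum>m<n. res lam m) = (\<Sum>j=1..n. res lam (n - j) * R j)" by simp
    also have "\<bar>\<dots>\<bar> \<le> eps n" unfolding eps_def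
    proof (intro order_trans[OF sum_abs] sum_mono)
      fix j assume "j \<in> {1..n}"
      then have "\<bar>R j\<bar> \<le> Rb j" using truncation_bound[OF l, of j] by (simp add: R_def)
      then show "\<bar>res lam (n - j) * R j\<bar> \<le> omega (n - j) * Rb j"
        using res_le_omega[OF l, of "n - j"] res_nonneg[OF l, of "n - j"] unfolding abs_mult
        by (intro mult_mono) auto
    qed
    finally show ?thesis .
  qed
  moreover have "0 \<le> eps n \<and> eps n \<le> C'" for n
  proof
    show "0 \<le> eps n" unfolding eps_def using Rb0 res_nonneg[of 0] by (intro sum_nonneg mult_nonneg_nonneg) auto
    have "eps n \<le> (\<Sum>j=1..n. 1 / K 0 * Rb j)"
      unfolding eps_def using Rb0 omega_le by (intro sum_mono mult_right_mono)
    also have "\<dots> \<le> 1 / K 0 * C" unfolding sum_distrib_left [symmetric] using C K0_pos by (intro mult_left_mono) auto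
    also have "\<dots> \<le> C'" using C c0_pos by (simp add: C'_def)
    finally show "eps n \<le> C'" .
  qed
  moreover have "(\<Sum>n=1..N. eps n) \<le> C' * real N powr \<alpha>" for N
  proof -
    have "(\<Sum>n=1..N. eps n) \<le> (\<Sum>m<N. omega m) * (\<Sum>j=1..N. Rb j)"
      unfolding eps_def using Rb0 res_nonneg[of 0] by (intro sum_convolution_le) auto
    also have "\<dots> \<le> (real N powr \<alpha> / c0) * C"
      using Rb0 C c0_pos by (intro mult_mono sum_omega_le) (auto intro!: sum_nonneg)
    also have "\<dots> \<le> C' * real N powr \<alpha>"
    proof -
      have "0 \<le> C / K 0 * real N powr \<alpha>" using C K0_pos by simp
      then show ?thesis unfolding C'_def distrib_right by (simp add: mult.commute)
    qed
    finally show ?thesis .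
  qed
  ultimately show ?thesis unfolding comparable_def by blast
qed

end

section \<open>Resolvent comparison for backward Euler\<close>

lemma kern_Suc: "0 < t \<Longrightarrow> kern (real m + 1) t = t ^ m / fact m"
  using Gamma_fact[of m, where 'a = real] by (simp add: kern_def powr_realpow add.commute)

lemma kern_Suc_add:
  assumes "0 < x" "0 < y"
  shows "kern (real m + 1) (x + y) = (\<Sum>i\<le>m. kern (real i + 1) x * kern (real (m - i) + 1) y)"
proof -
  have "kern (real m + 1) (x + y) = (x + y) ^ m / fact m" using assms by (intro kern_Suc) simp
  also have "\<dots> = (\<Sum>i\<le>m. of_nat (m choose i) * x ^ i * y ^ (m - i) / fact m)"
    by (simp add: binomial_ring sum_divide_distrib)
  also have "\<dots> = (\<Sum>i\<le>m. kern (real i + 1) x * kern (real (m - i) + 1) y)"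
  proof (intro sum.cong refl)
    fix i assume "i \<in> {..m}"
    then have "real (m choose i) = fact m / (fact i * fact (m - i))" by (intro binomial_fact) simp
    then show "of_nat (m choose i) * x ^ i * y ^ (m - i) / fact m = kern (real i + 1) x * kern (real (m - i) + 1) y"
      using assms by (simp add: kern_Suc del: of_nat_diff)
  qed
  finally show ?thesis .
qed

text \<open>Averages against Gamma distributions turn convolutions on the half line into convolutions of
  sequences, and the continuous resolvents into those of backward Euler.\<close>

definition gam :: "nat \<Rightarrow> (real \<Rightarrow> real) \<Rightarrow> ennreal" where
  "gam m f = (\<integral>\<^sup>+s. ennreal (exp (- s) * kern (real m + 1) s * f s) \<partial>lborel)"

text \<open>By \<open>gamma_ratio\<close> these numbers are the coefficients of (1 - \<zeta>)^(-c);
  for c = \<alpha> they form the backward Euler resolvent with lam = 0.\<close>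

lemma gam_kern:
  assumes c: "0 < c"
  shows "gam m (kern c) = ennreal (Gamma (real m + c) / (fact m * Gamma c))"
proof -
  have G: "0 < Gamma c" "0 < Gamma (real m + c)" using c by (auto intro!: Gamma_real_pos)
  have "ennreal (exp (- s) * kern (real m + 1) s * kern c s) =
      ennreal (1 / (fact m * Gamma c)) * ennreal (indicator {0..} s * (s powr (real m + c - 1) / exp s))"
    if "s \<noteq> 0" for s
  proof -
    have "exp (- s) * kern (real m + 1) s * kern c s = 1 / (fact m * Gamma c) * (indicator {0..} s * (s powr (real m + c - 1) / exp s))"
    proof (cases "s > 0")
      case True
      have "s powr (real m + c - 1) = s ^ m * s powr (c - 1)"
        using True by (simp add: powr_realpow [symmetric] powr_add [symmetric] algebra_simps)
      then show ?thesis using True by (simp add: kern_Suc, simp add: kern_def exp_minus field_simps)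
    qed (use that in auto)
    then show ?thesis using G by (simp only: ennreal_mult' divide_nonneg_pos zero_le_one mult_pos_pos fact_gt_zero)
  qed
  then have "gam m (kern c) = (\<integral>\<^sup>+s. ennreal (1 / (fact m * Gamma c)) * ennreal (indicator {0..} s * (s powr (real m + c - 1) / exp s)) \<partial>lborel)"
    unfolding gam_def by (intro nn_integral_cong_AE eventually_mono[OF AE_lborel_singleton[of 0]]) auto
  also have "\<dots> = ennreal (1 / (fact m * Gamma c)) * ennreal (Gamma (real m + c))"
    using nn_integral_has_integral_lebesgue[OF _ Gamma_integral_real[of "real m + c"]] c
    by (subst nn_integral_cmult) auto
  also have "\<dots> = ennreal (Gamma (real m + c) / (fact m * Gamma c))"
    using G by (subst ennreal_mult [symmetric]) auto
  finally show ?thesis .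
qed

text \<open>The binomial theorem splits the Gamma density at s + r into products of densities at s
  and at r, the exponential being multiplicative. Extended nonnegative integrals allow the
  interchange without integrability.\<close>

lemma gam_conv:
  assumes [measurable]: "f \<in> borel_measurable borel" "g \<in> borel_measurable borel"
    and f: "\<And>s. 0 \<le> f s" "\<And>s. s \<le> 0 \<Longrightarrow> f s = 0" and g: "\<And>s. 0 \<le> g s" "\<And>s. s \<le> 0 \<Longrightarrow> g s = 0"
    and h: "\<And>s. 0 \<le> h s" "\<And>s. ennreal (h s) = (\<integral>\<^sup>+r. ennreal (f (s - r) * g r) \<partial>lborel)"
  shows "gam m h = (\<Sum>i\<le>m. gam i f * gam (m - i) g)"
proof -
  have k0: "0 \<le> kern (real i + 1) s" for i s by (rule kern_nonneg) simp
  have "gam m h = (\<integral>\<^sup>+s. \<integral>\<^sup>+r. ennreal (exp (- s) * kern (real m + 1) s) * ennreal (f (s - r) * g r) \<partial>lborel \<partial>lborel)"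
    unfolding gam_def
  proof (rule nn_integral_cong)
    fix s
    have "ennreal (exp (- s) * kern (real m + 1) s * h s) = ennreal (exp (- s) * kern (real m + 1) s) * ennreal (h s)"
      using k0 h by (intro ennreal_mult) auto
    then show "ennreal (exp (- s) * kern (real m + 1) s * h s) =
      (\<integral>\<^sup>+r. ennreal (exp (- s) * kern (real m + 1) s) * ennreal (f (s - r) * g r) \<partial>lborel)"
      by (simp add: h(2) nn_integral_cmult)
  qed
  also have "\<dots> = (\<integral>\<^sup>+r. \<integral>\<^sup>+s. ennreal (exp (- s) * kern (real m + 1) s) * ennreal (f (s - r) * g r) \<partial>lborel \<partial>lborel)"
    by (rule lborel_pair.Fubini') measurable
  also have "\<dots> = (\<integral>\<^sup>+r. \<integral>\<^sup>+s. ennreal (exp (- (s + r)) * kern (real m + 1) (s + r)) * ennreal (f s * g r) \<partial>lborel \<partial>lborel)"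
  proof (rule nn_integral_cong)
    fix r :: real
    show "(\<integral>\<^sup>+s. ennreal (exp (- s) * kern (real m + 1) s) * ennreal (f (s - r) * g r) \<partial>lborel)
      = (\<integral>\<^sup>+s. ennreal (exp (- (s + r)) * kern (real m + 1) (s + r)) * ennreal (f s * g r) \<partial>lborel)"
      by (subst nn_integral_real_affine[where c = 1 and t = r]) (simp_all add: add.commute)
  qed
  also have "\<dots> = (\<integral>\<^sup>+r. \<integral>\<^sup>+s. (\<Sum>i\<le>m. ennreal (exp (- s) * kern (real i + 1) s * f s) * ennreal (exp (- r) * kern (real (m - i) + 1) r * g r)) \<partial>lborel \<partial>lborel)"
  proof (intro nn_integral_cong)
    fix r s :: real
    show "ennreal (exp (- (s + r)) * kern (real m + 1) (s + r)) * ennreal (f s * g r)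
      = (\<Sum>i\<le>m. ennreal (exp (- s) * kern (real i + 1) s * f s) * ennreal (exp (- r) * kern (real (m - i) + 1) r * g r))"
    proof (cases "0 < s \<and> 0 < r")
      case True
      have "(\<Sum>i\<le>m. ennreal (exp (- s) * kern (real i + 1) s * f s) * ennreal (exp (- r) * kern (real (m - i) + 1) r * g r))
         = (\<Sum>i\<le>m. ennreal (exp (- s) * exp (- r) * f s * g r * (kern (real i + 1) s * kern (real (m - i) + 1) r)))"
        using f g k0 by (intro sum.cong refl) (simp add: ennreal_mult [symmetric] mult_ac del: of_nat_diff)
      also have "\<dots> = ennreal (\<Sum>i\<le>m. exp (- s) * exp (- r) * f s * g r * (kern (real i + 1) s * kern (real (m - i) + 1) r))"
        using f g k0 by (intro sum_ennreal) (auto intro!: mult_nonneg_nonneg simp del: of_nat_diff)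
      also have "\<dots> = ennreal (exp (- s) * exp (- r) * f s * g r * kern (real m + 1) (s + r))"
        using True by (simp only: sum_distrib_left [symmetric] kern_Suc_add)
      also have "\<dots> = ennreal (exp (- (s + r)) * kern (real m + 1) (s + r)) * ennreal (f s * g r)"
        using f g k0 by (subst ennreal_mult [symmetric]) (auto simp: exp_add [symmetric] mult_ac)
      finally show ?thesis by simp
    next
      case False
      then have "f s = 0 \<or> g r = 0" using f g by force
      then show ?thesis by auto
    qed
  qed
  also have "\<dots> = (\<integral>\<^sup>+r. (\<Sum>i\<le>m. gam i f * ennreal (exp (- r) * kern (real (m - i) + 1) r * g r)) \<partial>lborel)"
    by (intro nn_integral_cong) (simp add: nn_integral_sum nn_integral_multc gam_def)
  also have "\<dots> = (\<Sum>i\<le>m. gam i f * gam (m - i) g)"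
    by (simp add: nn_integral_sum nn_integral_cmult gam_def)
  finally show ?thesis .
qed

text \<open>Concavity: the chord from \<open>a\<close> to \<open>b\<close> is at least as steep as
  the tangent at \<open>b\<close>. For a = 0 the power is not differentiable and the bound is
  direct.\<close>

lemma powr_diff_ge:
  fixes a b c :: real
  assumes c: "0 < c" "c \<le> 1" and ab: "0 \<le> a" "a < b"
  shows "c * b powr (c - 1) * (b - a) \<le> b powr c - a powr c"
proof (cases "a = 0")
  case True
  have "c * b powr (c - 1) * (b - a) = c * b powr c"
    using True ab powr_mult_base[of b "c - 1"] by (simp add: mult_ac)
  also have "\<dots> \<le> b powr c - a powr c"
    using True c by (simp add: mult_left_le_one_le)
  finally show ?thesis .
next
  case False
  then have a: "0 < a" using ab by simp
  have "((\<lambda>x. x powr c) has_real_derivative c * x powr (c - 1)) (at x)" if "a \<le> x" for x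
    using that a by (intro has_real_derivative_powr) auto
  then obtain z where z: "a < z" "z < b" "b powr c - a powr c = (b - a) * (c * z powr (c - 1))"
    using MVT2[OF ab(2), of "\<lambda>x. x powr c" "\<lambda>x. c * x powr (c - 1)"] by blast
  have "b powr (c - 1) \<le> z powr (c - 1)" using z a c by (intro powr_mono2') auto
  then show ?thesis using z ab c by (simp add: mult_ac mult_left_mono)
qed

lemma sum_powr_le:
  fixes a :: real
  assumes "0 < a" "a \<le> 1"
  shows "(\<Sum>n=1..N. real n powr (a - 1)) \<le> real N powr a / a"
proof (induction N)
  case (Suc N)
  have "a * real (Suc N) powr (a - 1) * (real (Suc N) - real N) \<le> real (Suc N) powr a - real N powr a"
    using assms by (intro powr_diff_ge) auto
  then have "real (Suc N) powr (a - 1) \<le> (real (Suc N) powr a - real N powr a) / a"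
    using assms by (simp add: field_simps)
  then show ?case using Suc by (simp add: diff_divide_distrib)
qed simp

section \<open>Gamma averages of the integrated kernel and the backward Euler equation\<close>

context frac_order begin

text \<open>The remainder has to be quadratic for every s > 0, since a Gamma average reaches the
  whole half line. For s \<ge> x/2 the Lipschitz bound of \<open>ml\<close> applies; for s < x/2 the
  square is at least x^2 / 4, and the crude size x^\<alpha> of every term suffices.\<close>

lemma Aml_taylor:
  assumes l: "0 \<le> lam" and x: "0 < x" and s: "0 < s"
  shows "\<bar>Aml lam s - Aml lam x - ml lam x * (s - x)\<bar>
     \<le> 4 * (ml_lip + 1 / Gamma (1 + \<alpha>) + 1 / Gamma \<alpha>) * (x powr (\<alpha> - 2) * (s - x)\<^sup>2)"
proof -
  have G: "0 < Gamma \<alpha>" "0 < Gamma (1 + \<alpha>)" using alpha_pos by (auto intro!: Gamma_real_pos)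
  have Q: "0 \<le> x powr (\<alpha> - 2) * (s - x)\<^sup>2" by simp
  show ?thesis
  proof (cases "x / 2 \<le> s")
    case True
    define D where "D = ml_lip * (4 * x powr (\<alpha> - 2)) * \<bar>s - x\<bar>"
    have half: "(x / 2) powr (\<alpha> - 2) \<le> 4 * x powr (\<alpha> - 2)"
    proof -
      have "(1/2) powr (\<alpha> - 2) \<le> (1/2) powr (-2::real)"
        using alpha_pos by (intro powr_mono') auto
      also have "(1/2::real) powr (-2) = 4" by (simp add: powr_minus_divide power2_eq_square)
      finally have "x powr (\<alpha> - 2) * (1/2) powr (\<alpha> - 2) \<le> x powr (\<alpha> - 2) * 4" by (intro mult_left_mono) auto
      then show ?thesis using x by (simp add: powr_mult [symmetric])
    qed
    have D: "\<bar>ml lam r - ml lam x\<bar> \<le> D" if r: "min s x \<le> r" "r \<le> max s x" for r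
    proof -
      have aux: "\<bar>ml lam z - ml lam y\<bar> \<le> D" if y: "x / 2 \<le> y" "y \<le> z" "z - y \<le> \<bar>s - x\<bar>" for y z
      proof -
        have "\<bar>ml lam z - ml lam y\<bar> \<le> ml_lip * (y powr (\<alpha> - 2) * (z - y))"
          using x y by (intro ml_lipschitz l) auto
        also have "\<dots> \<le> ml_lip * ((4 * x powr (\<alpha> - 2)) * \<bar>s - x\<bar>)"
        proof (intro mult_left_mono mult_mono ml_lip_nonneg)
          have "y powr (\<alpha> - 2) \<le> (x / 2) powr (\<alpha> - 2)" using x y alpha_less_1 by (intro powr_mono2') auto
          then show "y powr (\<alpha> - 2) \<le> 4 * x powr (\<alpha> - 2)" using half by linarith
        qed (use y in auto)
        finally show ?thesis by (simp add: D_def mult_ac)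
      qed
      show ?thesis
      proof (cases "r \<le> x")
        case rx: True
        then have "\<bar>ml lam x - ml lam r\<bar> \<le> D" using r True x by (intro aux) auto
        then show ?thesis by (simp add: abs_minus_commute)
      next
        case False
        then show ?thesis using r True x by (intro aux) auto
      qed
    qed
    have "\<bar>Aml lam s - Aml lam x - ml lam x * (s - x)\<bar> \<le> D * \<bar>s - x\<bar>"
    proof (cases "x \<le> s")
      case True
      then show ?thesis using Aml_increment[of x s lam "ml lam x" D] D by auto
    next
      case False
      have "\<bar>Aml lam x - Aml lam s - ml lam x * (x - s)\<bar> \<le> D * (x - s)"
        using D False by (intro Aml_increment) auto
      moreover have "Aml lam s - Aml lam x - ml lam x * (s - x) = - (Aml lam x - Aml lam s - ml lam x * (x - s))"
        by (simp add: algebra_simps)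
      ultimately show ?thesis using False by (simp only: abs_minus_cancel) auto
    qed
    also have "\<dots> = 4 * ml_lip * (x powr (\<alpha> - 2) * (s - x)\<^sup>2)"
      by (simp add: D_def power2_eq_square abs_mult [symmetric] mult_ac)
    also have "\<dots> \<le> 4 * (ml_lip + 1 / Gamma (1 + \<alpha>) + 1 / Gamma \<alpha>) * (x powr (\<alpha> - 2) * (s - x)\<^sup>2)"
      using G Q by (intro mult_right_mono) auto
    finally show ?thesis .
  next
    case False
    then have sx: "s < x / 2" "s < x" using x by auto
    have xa: "x powr \<alpha> \<le> 4 * (x powr (\<alpha> - 2) * (s - x)\<^sup>2)"
    proof -
      have "(x / 2)\<^sup>2 \<le> (x - s)\<^sup>2" using sx x by (intro power_mono) auto
      then have "x\<^sup>2 \<le> 4 * (s - x)\<^sup>2" unfolding power2_commute[of x s] by (simp add: power_divide)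
      then have "x powr (\<alpha> - 2) * x\<^sup>2 \<le> x powr (\<alpha> - 2) * (4 * (s - x)\<^sup>2)" by (intro mult_left_mono) auto
      moreover have "x powr (\<alpha> - 2) * x\<^sup>2 = x powr \<alpha>" using x powr_add[of x "\<alpha> - 2" 2] by simp
      ultimately show ?thesis by (simp add: mult_ac)
    qed
    have "\<bar>Aml lam s - Aml lam x\<bar> \<le> kern (1 + \<alpha>) x"
      using Aml_mono[OF l, of s x] Aml_nonneg[OF l, of s] Aml_le[OF l, of x] sx by auto
    moreover have "kern (1 + \<alpha>) x = x powr \<alpha> * (1 / Gamma (1 + \<alpha>))" using x by (simp add: kern_def)
    moreover have "\<bar>ml lam x * (s - x)\<bar> \<le> kern \<alpha> x * x"
      unfolding abs_mult using ml_nonneg[OF l, of x] ml_le_kern[OF l, of x] sx s kern_nonneg[OF alpha_pos] by (intro mult_mono) auto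
    moreover have "kern \<alpha> x * x = x powr \<alpha> * (1 / Gamma \<alpha>)"
      using x powr_mult_base[of x "\<alpha> - 1"] by (simp add: kern_def mult.commute)
    ultimately have "\<bar>Aml lam s - Aml lam x - ml lam x * (s - x)\<bar> \<le> x powr \<alpha> * (1 / Gamma (1 + \<alpha>) + 1 / Gamma \<alpha>)"
      unfolding distrib_left by linarith
    also have "\<dots> \<le> 4 * (x powr (\<alpha> - 2) * (s - x)\<^sup>2) * (ml_lip + 1 / Gamma (1 + \<alpha>) + 1 / Gamma \<alpha>)"
      using xa G ml_lip_nonneg by (intro mult_mono) auto
    finally show ?thesis by (simp only: mult_ac)
  qed
qed

definition be_coeff :: "nat \<Rightarrow> real" where "be_coeff j = (-1) ^ j * (\<alpha> gchoose j)"

text \<open>An average of \<open>Aml lam\<close> over a Gamma distribution of mean m + 1. By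
  \<open>gamA_be_equation\<close> it is the backward Euler value at level m + 1 for right-hand side
  1.\<close>

definition gamA :: "real \<Rightarrow> nat \<Rightarrow> real" where "gamA lam m = enn2real (gam m (Aml lam))"

lemma gam_Aml:
  assumes l: "0 \<le> lam" shows "gam m (Aml lam) = ennreal (gamA lam m)"
proof -
  have k0: "0 \<le> kern (real m + 1) s" for s by (rule kern_nonneg) simp
  have "gam m (Aml lam) \<le> gam m (kern (1 + \<alpha>))"
    unfolding gam_def using Aml_le[OF l] k0 by (intro nn_integral_mono ennreal_leI mult_left_mono) auto
  also have "\<dots> < \<infinity>" using alpha_pos by (simp add: gam_kern)
  finally show ?thesis by (simp add: gamA_def less_top)
qed

lemma gamA_nonneg: "0 \<le> gamA lam m" by (simp add: gamA_def)

lemma gamma_ratio: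
  assumes c: "0 < c"
  shows "Gamma (real m + c) / (fact m * Gamma c) = (-1) ^ m * ((- c) gchoose m)"
proof -
  have "c \<notin> \<int>\<^sub>\<le>\<^sub>0" using c by auto
  from pochhammer_Gamma[OF this, of m] show ?thesis
    by (simp add: gbinomial_pochhammer add.commute mult_ac flip: power_add)
qed

text \<open>The Gamma average of \<open>Aml_volterra\<close>: the convolution becomes a Cauchy
  product with the coefficients of (1 - \<zeta>)^(-\<alpha>), and \<open>kern (1 + \<alpha>)\<close>
  becomes the coefficients of (1 - \<zeta>)^(-1-\<alpha>).\<close>

lemma gamA_eq:
  assumes l: "0 \<le> lam"
  shows "(-1) ^ m * ((- (1 + \<alpha>)) gchoose m) = gamA lam m + lam * (\<Sum>i\<le>m. (-1) ^ i * ((- \<alpha>) gchoose i) * gamA lam (m - i))"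
proof -
  have k0: "0 \<le> kern (real m + 1) s" for m s by (rule kern_nonneg) simp
  define h where "h s = (\<integral>r. kern \<alpha> (s - r) * Aml lam r \<partial>lborel)" for s
  have int: "integrable lborel (\<lambda>r. kern \<alpha> (s - r) * Aml lam r)" for s
    using alpha_pos
    by (intro integrable_kern_bounded(1)[where f = "kern \<alpha>" and h = "Aml lam" and b = "1 + \<alpha>", OF alpha_pos _ _ _ abs_kern_le[OF alpha_pos] abs_Aml_le[OF l]]) auto
  have nn: "0 \<le> kern \<alpha> (s - r) * Aml lam r" for s r
    using Aml_nonneg[OF l] kern_nonneg[OF alpha_pos] by simp
  have h0: "0 \<le> h s" for s unfolding h_def using nn by simp
  have hm [measurable]: "h \<in> borel_measurable borel" unfolding h_def [abs_def] by measurable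
  have hn: "ennreal (h s) = (\<integral>\<^sup>+r. ennreal (kern \<alpha> (s - r) * Aml lam r) \<partial>lborel)" for s
    unfolding h_def using nn int by (intro nn_integral_eq_integral [symmetric]) auto
  have om0: "0 \<le> (-1) ^ i * ((- \<alpha>) gchoose i)" for i
    unfolding gamma_ratio[OF alpha_pos, symmetric] using alpha_pos by (simp add: Gamma_real_pos less_imp_le add_nonneg_pos)
  have "gam m h = (\<Sum>i\<le>m. gam i (kern \<alpha>) * gam (m - i) (Aml lam))"
    using Aml_nonneg[OF l] kern_nonneg[OF alpha_pos] h0 hn by (intro gam_conv) auto
  also have "\<dots> = ennreal (\<Sum>i\<le>m. (-1) ^ i * ((- \<alpha>) gchoose i) * gamA lam (m - i))"
    using om0 gamA_nonneg
    by (simp add: gam_kern[OF alpha_pos] gamma_ratio[OF alpha_pos] gam_Aml[OF l] ennreal_mult [symmetric] sum_ennreal del: mult_minus1)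
  finally have gh: "gam m h = ennreal (\<Sum>i\<le>m. (-1) ^ i * ((- \<alpha>) gchoose i) * gamA lam (m - i))" .
  have "gam m (kern (1 + \<alpha>)) = (\<integral>\<^sup>+s. ennreal (exp (- s) * kern (real m + 1) s * Aml lam s) + ennreal lam * ennreal (exp (- s) * kern (real m + 1) s * h s) \<partial>lborel)"
    unfolding gam_def
  proof (rule nn_integral_cong)
    fix s
    have "kern (1 + \<alpha>) s = Aml lam s + lam * h s" using Aml_volterra[OF l, of s] by (simp add: h_def)
    then have "exp (- s) * kern (real m + 1) s * kern (1 + \<alpha>) s
       = exp (- s) * kern (real m + 1) s * Aml lam s + lam * (exp (- s) * kern (real m + 1) s * h s)"
      by (simp add: algebra_simps)
    then show "ennreal (exp (- s) * kern (real m + 1) s * kern (1 + \<alpha>) s) = ennreal (exp (- s) * kern (real m + 1) s * Aml lam s)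
        + ennreal lam * ennreal (exp (- s) * kern (real m + 1) s * h s)"
      using l k0 h0 Aml_nonneg[OF l] by (simp add: ennreal_plus ennreal_mult)
  qed
  also have "\<dots> = gam m (Aml lam) + ennreal lam * gam m h"
    by (simp add: nn_integral_add nn_integral_cmult gam_def)
  also have "\<dots> = ennreal (gamA lam m + lam * (\<Sum>i\<le>m. (-1) ^ i * ((- \<alpha>) gchoose i) * gamA lam (m - i)))"
  proof -
    have "0 \<le> (\<Sum>i\<le>m. (-1) ^ i * ((- \<alpha>) gchoose i) * gamA lam (m - i))"
      by (intro sum_nonneg mult_nonneg_nonneg[OF om0 gamA_nonneg])
    then show ?thesis
      unfolding gh gam_Aml[OF l] using l gamA_nonneg by (simp only: ennreal_plus ennreal_mult mult_nonneg_nonneg)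
  qed
  finally have e: "ennreal ((-1) ^ m * ((- (1 + \<alpha>)) gchoose m)) = ennreal (gamA lam m + lam * (\<Sum>i\<le>m. (-1) ^ i * ((- \<alpha>) gchoose i) * gamA lam (m - i)))"
    using alpha_pos by (simp only: gam_kern gamma_ratio add_pos_pos zero_less_one)
  have "0 \<le> (-1) ^ m * ((- (1 + \<alpha>)) gchoose m)"
    unfolding gamma_ratio[of "1 + \<alpha>", symmetric, OF add_pos_pos[OF zero_less_one alpha_pos]]
    using alpha_pos by (simp add: Gamma_real_pos less_imp_le add_nonneg_pos)
  moreover have "0 \<le> gamA lam m + lam * (\<Sum>i\<le>m. (-1) ^ i * ((- \<alpha>) gchoose i) * gamA lam (m - i))"
    by (intro add_nonneg_nonneg mult_nonneg_nonneg[OF l] sum_nonneg mult_nonneg_nonneg[OF om0 gamA_nonneg] gamA_nonneg)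
  ultimately show ?thesis using e by (simp only: ennreal_inj)
qed

lemma signed_vandermonde:
  "(\<Sum>i=0..n. ((-1) ^ i * (a gchoose i)) * ((-1) ^ (n - i) * ((b::real) gchoose (n - i)))) = (-1) ^ n * ((a + b) gchoose n)"
proof -
  have "(\<Sum>i=0..n. ((-1) ^ i * (a gchoose i)) * ((-1) ^ (n - i) * (b gchoose (n - i)))) = (\<Sum>i=0..n. (-1) ^ n * ((a gchoose i) * (b gchoose (n - i))))"
  proof (intro sum.cong refl)
    fix i assume "i \<in> {0..n}"
    then have "(-1::real) ^ n = (-1) ^ i * (-1) ^ (n - i)" by (simp flip: power_add)
    then show "((-1) ^ i * (a gchoose i)) * ((-1) ^ (n - i) * (b gchoose (n - i))) = (-1) ^ n * ((a gchoose i) * (b gchoose (n - i)))"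
      by (simp only: mult_ac)
  qed
  then show ?thesis by (simp only: sum_distrib_left [symmetric] gbinomial_Vandermonde)
qed

text \<open>As an identity of power series, \<open>gamA_eq\<close> is multiplied by (1 -
  \<zeta>)^\<alpha>. This clears the Cauchy product and turns the left-hand side into 1 / (1 -
  \<zeta>), the sequence of ones.\<close>

lemma gamA_be_equation:
  assumes l: "0 \<le> lam"
  shows "(\<Sum>i=0..n. be_coeff i * gamA lam (n - i)) + lam * gamA lam n = 1"
proof -
  define FK where "FK = Abs_fps be_coeff"
  define Fo where "Fo = Abs_fps (\<lambda>i. (-1) ^ i * ((- \<alpha>) gchoose i))"
  define F1 where "F1 = Abs_fps (\<lambda>i. (-1) ^ i * ((- (1 + \<alpha>)) gchoose i))"
  define Fb where "Fb = Abs_fps (gamA lam)"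
  have 1: "FK * Fo = 1"
    by (rule fps_ext) (simp add: fps_mult_nth FK_def Fo_def be_coeff_def signed_vandermonde gbinomial_0_left)
  have "FK * F1 = Abs_fps (\<lambda>_. 1)"
  proof (rule fps_ext)
    fix n
    have "fps_nth (FK * F1) n = (-1) ^ n * ((\<alpha> + - (1 + \<alpha>)) gchoose n)"
      unfolding fps_mult_nth FK_def F1_def fps_nth_Abs_fps be_coeff_def by (rule signed_vandermonde)
    also have "\<dots> = (-1) ^ n * ((- 1) gchoose n)" by simp
    also have "\<dots> = 1" by (simp add: gbinomial_pochhammer flip: pochhammer_fact power_add)
    finally show "fps_nth (FK * F1) n = fps_nth (Abs_fps (\<lambda>_. 1)) n" by simp
  qed
  moreover have "F1 = Fb + fps_const lam * (Fo * Fb)"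
  proof (rule fps_ext)
    fix n show "fps_nth F1 n = fps_nth (Fb + fps_const lam * (Fo * Fb)) n"
      unfolding fps_add_nth fps_mult_left_const_nth
      using gamA_eq[OF l, of n] by (simp add: F1_def Fb_def Fo_def fps_mult_nth atMost_atLeast0)
  qed
  ultimately have "FK * Fb + fps_const lam * (FK * Fo * Fb) = Abs_fps (\<lambda>_. 1)"
    by (simp add: algebra_simps)
  then have "FK * Fb + fps_const lam * Fb = Abs_fps (\<lambda>_. 1)" by (simp add: 1)
  then have "fps_nth (FK * Fb + fps_const lam * Fb) n = 1" by simp
  then show ?thesis
    unfolding fps_add_nth fps_mult_left_const_nth by (simp add: fps_mult_nth FK_def Fb_def)
qed

text \<open>The Gamma distribution in question has mean x = m + 1 and variance x. The linear Taylor
  term averages to zero and the quadratic one to a multiple of x^(\<alpha>-2) times x.\<close>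

lemma gamA_approx:
  assumes l: "0 \<le> lam"
  shows "\<bar>Aml lam (real m + 1) - gamA lam m\<bar> \<le> 4 * (ml_lip + 1 / Gamma (1 + \<alpha>) + 1 / Gamma \<alpha>) * (real m + 1) powr (\<alpha> - 1)"
proof -
  define x where "x = real m + 1"
  have x: "0 < x" by (simp add: x_def)
  define w where "w s = exp (- s) * kern (real m + 1) s" for s
  have w0: "0 \<le> w s" for s unfolding w_def by (simp add: kern_nonneg)
  have wm [measurable]: "w \<in> borel_measurable borel" unfolding w_def [abs_def] by measurable
  have hk: "has_bochner_integral lborel (\<lambda>s. w s * kern c s) (Gamma (real m + c) / (fact m * Gamma c))" if c: "0 < c" for c
  proof (rule has_bochner_integral_nn_integral)
    show "(\<integral>\<^sup>+s. ennreal (w s * kern c s) \<partial>lborel) = ennreal (Gamma (real m + c) / (fact m * Gamma c))"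
      using gam_kern[OF c, of m] by (simp add: gam_def w_def)
  qed (use w0 kern_nonneg[OF c] c in \<open>auto simp: Gamma_real_pos less_imp_le add_nonneg_pos\<close>)
  \<comment> \<open>Powers of s are multiples of kernels of integer order, so the moments of order
    0, 1 and 2 come from \<open>gam_kern\<close>.\<close>
  have wk: "w s = w s * kern 1 s" "w s * s = w s * kern 2 s" "w s * s\<^sup>2 = 2 * (w s * kern 3 s)" for s
    using kern_Suc[of s 1] kern_Suc[of s 2] by (cases "s > 0"; simp add: w_def fact_2)+
  have h0: "has_bochner_integral lborel w 1"
  proof -
    have "Gamma (real m + 1) = fact m" using Gamma_fact[of m, where 'a = real] by (simp add: add.commute)
    moreover have "(\<lambda>s. w s * kern 1 s) = w" by (rule ext) (rule wk(1) [symmetric])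
    ultimately show ?thesis using hk[of 1] by (simp del: kern_1)
  qed
  have h1: "has_bochner_integral lborel (\<lambda>s. w s * s) x"
  proof -
    have "Gamma (real m + 2) = fact (Suc m)" using Gamma_fact[of "Suc m", where 'a = real] by (simp add: add.commute)
    moreover have "Gamma (2::real) = 1" using Gamma_fact[of 1, where 'a = real] by simp
    ultimately have "Gamma (real m + 2) / (fact m * Gamma 2) = x" by (simp add: x_def)
    then show ?thesis using hk[of 2] unfolding wk(2) by simp
  qed
  have h2: "has_bochner_integral lborel (\<lambda>s. w s * s\<^sup>2) (x * (x + 1))"
  proof -
    have "Gamma (real m + 3) = fact (Suc (Suc m))" using Gamma_fact[of "Suc (Suc m)", where 'a = real] by (simp add: add.commute)
    moreover have "Gamma (3::real) = 2" using Gamma_fact[of 2, where 'a = real] by (simp add: fact_2)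
    ultimately have "2 * (Gamma (real m + 3) / (fact m * Gamma 3)) = (real m + 2) * (real m + 1)" by (simp add: add.commute)
    also have "\<dots> = x * (x + 1)" by (simp add: x_def algebra_simps)
    finally have "2 * (Gamma (real m + 3) / (fact m * Gamma 3)) = x * (x + 1)" .
    then show ?thesis using has_bochner_integral_mult_right[OF hk[of 3], of 2] unfolding wk(3) by simp
  qed
  have hA: "has_bochner_integral lborel (\<lambda>s. w s * Aml lam s) (gamA lam m)"
    using gam_Aml[OF l, of m] w0 Aml_nonneg[OF l] gamA_nonneg
    by (intro has_bochner_integral_nn_integral) (auto simp: gam_def w_def)
  define T where "T = 4 * (ml_lip + 1 / Gamma (1 + \<alpha>) + 1 / Gamma \<alpha>) * x powr (\<alpha> - 2)"
  have d: "has_bochner_integral lborel (\<lambda>s. w s * (Aml lam s - Aml lam x - ml lam x * (s - x))) (gamA lam m - Aml lam x)"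
  proof -
    have "has_bochner_integral lborel (\<lambda>s. w s * Aml lam s - w s * Aml lam x - (w s * s * ml lam x - w s * (x * ml lam x)))
       (gamA lam m - 1 * Aml lam x - (x * ml lam x - 1 * (x * ml lam x)))"
      by (intro has_bochner_integral_diff has_bochner_integral_mult_left hA h0 h1)
    then show ?thesis by (simp add: algebra_simps)
  qed
  have q: "has_bochner_integral lborel (\<lambda>s. w s * (T * (s - x)\<^sup>2)) (T * x)"
  proof -
    have "has_bochner_integral lborel (\<lambda>s. w s * s\<^sup>2 * T - w s * s * (2 * x * T) + w s * (x\<^sup>2 * T))
      (x * (x + 1) * T - x * (2 * x * T) + 1 * (x\<^sup>2 * T))"
      by (intro has_bochner_integral_add has_bochner_integral_diff has_bochner_integral_mult_left h0 h1 h2)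
    then show ?thesis by (simp add: power2_eq_square algebra_simps)
  qed
  have "\<bar>gamA lam m - Aml lam x\<bar> = \<bar>\<integral>s. w s * (Aml lam s - Aml lam x - ml lam x * (s - x)) \<partial>lborel\<bar>"
    using has_bochner_integral_integral_eq[OF d] by simp
  also have "\<dots> \<le> (\<integral>s. \<bar>w s * (Aml lam s - Aml lam x - ml lam x * (s - x))\<bar> \<partial>lborel)"
    by (rule integral_abs_bound)
  also have "\<dots> \<le> (\<integral>s. w s * (T * (s - x)\<^sup>2) \<partial>lborel)"
  proof (rule integral_mono)
    show "integrable lborel (\<lambda>s. \<bar>w s * (Aml lam s - Aml lam x - ml lam x * (s - x))\<bar>)"
      by (rule integrable_abs) (rule integrable.intros[OF d])
    show "integrable lborel (\<lambda>s. w s * (T * (s - x)\<^sup>2))" by (rule integrable.intros[OF q])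
    fix s
    show "\<bar>w s * (Aml lam s - Aml lam x - ml lam x * (s - x))\<bar> \<le> w s * (T * (s - x)\<^sup>2)"
    proof (cases "0 < s")
      case True
      show ?thesis unfolding abs_mult abs_of_nonneg[OF w0]
        using Aml_taylor[OF l x True] w0 by (intro mult_left_mono) (auto simp: T_def mult_ac)
    qed (simp add: w_def)
  qed
  also have "\<dots> = T * x" by (rule has_bochner_integral_integral_eq[OF q])
  also have "\<dots> = 4 * (ml_lip + 1 / Gamma (1 + \<alpha>) + 1 / Gamma \<alpha>) * x powr (\<alpha> - 1)"
    using x powr_mult_base[of x "\<alpha> - 2"] by (simp add: T_def mult_ac)
  finally show ?thesis by (simp add: x_def abs_minus_commute)
qed

end

locale be_weights = cq_weights +
  assumes K_be: "\<And>j. K j = be_coeff j"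
begin

lemma be_comparable: "\<exists>eps C. comparable eps C"
proof -
  have G: "0 < Gamma \<alpha>" "0 < Gamma (1 + \<alpha>)" using alpha_pos by (auto intro!: Gamma_real_pos)
  define T where "T = 4 * (ml_lip + 1 / Gamma (1 + \<alpha>) + 1 / Gamma \<alpha>)"
  have T: "0 \<le> T" using G ml_lip_nonneg by (simp add: T_def)
  define eps where "eps n = T * real n powr (\<alpha> - 1)" for n
  define C where "C = T / \<alpha>"
  have TC: "T \<le> C" "0 \<le> C" using T alpha_pos alpha_less_1 by (auto simp: C_def field_simps mult_left_le)
  have "\<bar>Aml lam (real n) - (\<Sum>m<n. res lam m)\<bar> \<le> eps n" if l: "0 \<le> lam" and n: "1 \<le> n" for lam n
  proof -
    \<comment> \<open>Level n belongs to \<open>gamA lam (n - 1)\<close>, the Gamma average with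
      mean n.\<close>
    have "gamA lam (n - 1) = (\<Sum>j=1..n. res lam (n - j) * 1)"
    proof (rule solution_formula[OF l n])
      fix k :: nat assume k: "1 \<le> k"
      have "(\<Sum>j=1..k. K (k - j) * gamA lam (j - 1)) = (\<Sum>i=0..k - 1. be_coeff i * gamA lam (k - 1 - i))"
        by (rule sum.reindex_bij_witness[where i = "\<lambda>i. k - i" and j = "\<lambda>j. k - j"])
          (use k in \<open>auto simp: K_be\<close>)
      then show "(\<Sum>j=1..k. K (k - j) * gamA lam (j - 1)) + lam * gamA lam (k - 1) = 1"
        using gamA_be_equation[OF l, of "k - 1"] by simp
    qed
    also have "(\<Sum>j=1..n. res lam (n - j) * 1) = (\<Sum>m<n. res lam m)"
      by (rule sum.reindex_bij_witness[where i = "\<lambda>m. n - m" and j = "\<lambda>j. n - j"]) auto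
    finally show ?thesis
      using gamA_approx[OF l, of "n - 1"] n by (simp add: eps_def T_def)
  qed
  moreover have "0 \<le> eps n \<and> eps n \<le> C" if "1 \<le> n" for n
  proof
    show "0 \<le> eps n" using T by (simp add: eps_def)
    have "real n powr (\<alpha> - 1) \<le> 1 powr (\<alpha> - 1)" using that alpha_less_1 by (intro powr_mono2') auto
    then have "eps n \<le> T * 1" unfolding eps_def using T by (intro mult_left_mono) auto
    then show "eps n \<le> C" using TC by simp
  qed
  moreover have "(\<Sum>n=1..N. eps n) \<le> C * real N powr \<alpha>" for N
  proof -
    have "(\<Sum>n=1..N. eps n) \<le> T * (real N powr \<alpha> / \<alpha>)"
      unfolding eps_def sum_distrib_left [symmetric] using T alpha_pos alpha_less_1
      by (intro mult_left_mono sum_powr_le) auto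
    then show ?thesis by (simp add: C_def)
  qed
  ultimately show ?thesis unfolding comparable_def by blast
qed

end

section \<open>The error bound for diagonal systems\<close>

definition nrm :: "nat \<Rightarrow> (nat \<Rightarrow> real) \<Rightarrow> real" where "nrm m x = L2_set x {..<m}"

lemma nrm_nonneg [simp]: "0 \<le> nrm m x" by (simp add: nrm_def)

lemma L2_set_abs: "L2_set (\<lambda>i. \<bar>x i\<bar>) A = L2_set x A"
  by (simp add: L2_set_def)

lemma abs_le_nrm: "i < m \<Longrightarrow> \<bar>x i\<bar> \<le> nrm m x"
  unfolding nrm_def using member_le_L2_set[of "{..<m}" i "\<lambda>i. \<bar>x i\<bar>"] by (simp add: L2_set_abs)

lemma nrm_cong: "(\<And>i. i < m \<Longrightarrow> x i = y i) \<Longrightarrow> nrm m x = nrm m y"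
  unfolding nrm_def by (rule L2_set_cong) auto

lemma nrm_zero [simp]: "nrm m (\<lambda>i. 0) = 0"
  by (simp add: nrm_def L2_set_def)

lemma nrm_scale:
  assumes "0 \<le> c" "\<And>i. i < m \<Longrightarrow> \<bar>x i\<bar> \<le> c * \<bar>y i\<bar>"
  shows "nrm m x \<le> c * nrm m y"
proof -
  have "L2_set (\<lambda>i. \<bar>x i\<bar>) {..<m} \<le> L2_set (\<lambda>i. c * \<bar>y i\<bar>) {..<m}"
    using assms by (intro L2_set_mono) auto
  also have "\<dots> = c * L2_set (\<lambda>i. \<bar>y i\<bar>) {..<m}" using assms by (simp add: L2_set_right_distrib)
  finally show ?thesis by (simp add: nrm_def L2_set_abs)
qed

lemma nrm_triangle: "nrm m (\<lambda>i. x i + y i) \<le> nrm m x + nrm m y"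
  unfolding nrm_def by (rule L2_set_triangle_ineq)

lemma nrm_sum: "finite J \<Longrightarrow> nrm m (\<lambda>i. \<Sum>j\<in>J. x j i) \<le> (\<Sum>j\<in>J. nrm m (x j))"
proof (induction J rule: finite_induct)
  case (insert j J)
  then show ?case using nrm_triangle[of m "x j" "\<lambda>i. \<Sum>j\<in>J. x j i"] by simp
qed simp

lemma nrm_continuous:
  assumes "\<And>i. i < m \<Longrightarrow> continuous_on S (\<lambda>t. x t i)"
  shows "continuous_on S (\<lambda>t. nrm m (x t))"
  unfolding nrm_def L2_set_def using assms by (intro continuous_intros) auto

text \<open>Minkowski's inequality, by testing with the integral itself.\<close>

lemma nrm_integral_le:
  assumes m: "0 < m" and int: "\<And>i. i < m \<Longrightarrow> integrable lborel (\<lambda>s. \<phi> i s * g s i)"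
    and \<phi>: "AE s in lborel. \<forall>i<m. \<bar>\<phi> i s\<bar> \<le> \<Phi> s" and g: "\<And>s. nrm m (g s) \<le> G s"
    and iG: "integrable lborel (\<lambda>s. \<Phi> s * G s)"
  shows "nrm m (\<lambda>i. \<integral>s. \<phi> i s * g s i \<partial>lborel) \<le> (\<integral>s. \<Phi> s * G s \<partial>lborel)"
proof -
  define w where "w i = (\<integral>s. \<phi> i s * g s i \<partial>lborel)" for i
  have "(nrm m w)\<^sup>2 = (\<Sum>i<m. w i * w i)"
    by (simp add: nrm_def L2_set_def sum_nonneg power2_eq_square)
  also have "\<dots> = (\<Sum>i<m. \<integral>s. w i * (\<phi> i s * g s i) \<partial>lborel)"
    by (intro sum.cong refl) (simp add: w_def)
  also have "\<dots> = (\<integral>s. (\<Sum>i<m. w i * (\<phi> i s * g s i)) \<partial>lborel)"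
    using int by (intro Bochner_Integration.integral_sum [symmetric]) auto
  also have "\<dots> \<le> (\<integral>s. nrm m w * (\<Phi> s * G s) \<partial>lborel)"
  proof (rule integral_mono_AE)
    show "integrable lborel (\<lambda>s. \<Sum>i<m. w i * (\<phi> i s * g s i))" using int by auto
    show "integrable lborel (\<lambda>s. nrm m w * (\<Phi> s * G s))" using iG by auto
    show "AE s in lborel. (\<Sum>i<m. w i * (\<phi> i s * g s i)) \<le> nrm m w * (\<Phi> s * G s)"
      using \<phi>
    proof eventually_elim
      case (elim s)
      have P0: "0 \<le> \<Phi> s" using elim m order_trans[OF abs_ge_zero] by blast
      have "(\<Sum>i<m. w i * (\<phi> i s * g s i)) \<le> (\<Sum>i<m. \<Phi> s * (\<bar>w i\<bar> * \<bar>g s i\<bar>))"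
      proof (intro sum_mono)
        fix i assume i: "i \<in> {..<m}"
        have "w i * (\<phi> i s * g s i) \<le> \<bar>w i * (\<phi> i s * g s i)\<bar>" by (rule abs_ge_self)
        also have "\<dots> = \<bar>\<phi> i s\<bar> * (\<bar>w i\<bar> * \<bar>g s i\<bar>)" by (simp add: abs_mult)
        also have "\<dots> \<le> \<Phi> s * (\<bar>w i\<bar> * \<bar>g s i\<bar>)" using elim i by (intro mult_right_mono) auto
        finally show "w i * (\<phi> i s * g s i) \<le> \<Phi> s * (\<bar>w i\<bar> * \<bar>g s i\<bar>)" .
      qed
      also have "\<dots> = \<Phi> s * (\<Sum>i<m. \<bar>w i\<bar> * \<bar>g s i\<bar>)" by (simp add: sum_distrib_left)
      also have "\<dots> \<le> \<Phi> s * (nrm m w * nrm m (g s))"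
        unfolding nrm_def using P0 by (intro mult_left_mono L2_set_mult_ineq)
      also have "\<dots> \<le> \<Phi> s * (nrm m w * G s)"
        using P0 g[of s] by (intro mult_left_mono) auto
      finally show ?case by (simp add: mult_ac)
    qed
  qed
  also have "\<dots> = nrm m w * (\<integral>s. \<Phi> s * G s \<partial>lborel)" by simp
  finally have *: "nrm m w * nrm m w \<le> nrm m w * (\<integral>s. \<Phi> s * G s \<partial>lborel)" by (simp add: power2_eq_square)
  have G0: "0 \<le> G s" for s using g[of s] nrm_nonneg[of m "g s"] by linarith
  have "0 \<le> (\<integral>s. \<Phi> s * G s \<partial>lborel)"
  proof (rule integral_nonneg_AE)
    show "AE s in lborel. 0 \<le> \<Phi> s * G s" using \<phi>
    proof eventually_elim
      case (elim s)
      then have "0 \<le> \<Phi> s" using m order_trans[OF abs_ge_zero] by blast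
      then show ?case using G0 by simp
    qed
  qed
  then show ?thesis using * nrm_nonneg[of m w] unfolding w_def [symmetric]
    by (cases "nrm m w = 0") (auto simp: mult_le_cancel_left)
qed

context frac_order begin

text \<open>The kernel is written as \<open>kern \<alpha>\<close> = \<open>ml lam\<close> plus
  \<open>lam\<close> times \<open>ml lam\<close> convolved with \<open>kern \<alpha>\<close>, and
  the double convolution is reassociated. Up to time \<open>T\<close>, \<open>kern \<alpha>\<close>
  convolved with f - lam q is \<open>q\<close> itself, so the terms with lam q cancel. The bounds by
  \<open>kern 1\<close> mean bounded, and zero for t \<le> 0.\<close>

lemma volterra_resolvent:
  assumes l: "0 \<le> lam" and [measurable]: "f \<in> borel_measurable borel" "q \<in> borel_measurable borel"
    and f: "\<And>s. \<bar>f s\<bar> \<le> Cf * kern 1 s" and q: "\<And>s. \<bar>q s\<bar> \<le> Cq * kern 1 s"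
    and eq: "\<And>t. 0 < t \<Longrightarrow> t \<le> T \<Longrightarrow> q t = (\<integral>s. kern \<alpha> (t - s) * (f s - lam * q s) \<partial>lborel)"
    and t: "0 < t" "t \<le> T"
  shows "q t = (\<integral>s. ml lam (t - s) * f s \<partial>lborel)"
proof -
  define h where "h s = f s - lam * q s" for s
  have hm [measurable]: "h \<in> borel_measurable borel" unfolding h_def [abs_def] by measurable
  have h: "\<bar>h s\<bar> \<le> (Cf + lam * Cq) * kern 1 s" for s
  proof -
    have "\<bar>h s\<bar> \<le> \<bar>f s\<bar> + lam * \<bar>q s\<bar>" unfolding h_def using l by (intro order_trans[OF abs_triangle_ineq4]) (simp add: abs_mult)
    also have "\<dots> \<le> Cf * kern 1 s + lam * (Cq * kern 1 s)" using f q l by (intro add_mono mult_left_mono) auto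
    finally show ?thesis by (simp only: distrib_right mult.assoc)
  qed
  have one: "(0::real) < 1" by simp
  define kh where "kh s = (\<integral>r. kern \<alpha> (s - r) * h r \<partial>lborel)" for s
  have khm [measurable]: "kh \<in> borel_measurable borel" unfolding kh_def [abs_def] by measurable
  have khb: "\<bar>kh s\<bar> \<le> 1 * (Cf + lam * Cq) * kern (\<alpha> + 1) s" for s
    unfolding kh_def
    by (rule integrable_kern_bounded(2)[where f = "kern \<alpha>" and h = h, OF alpha_pos one _ _ abs_kern_le[OF alpha_pos] h]) auto
  have ik: "integrable lborel (\<lambda>s. kern \<alpha> (t - s) * h s)"
    by (rule integrable_kern_bounded(1)[where f = "kern \<alpha>" and h = h, OF alpha_pos one _ _ abs_kern_le[OF alpha_pos] h]) auto
  have iml: "integrable lborel (\<lambda>s. ml lam (t - s) * h s)"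
    by (rule integrable_kern_bounded(1)[where f = "ml lam" and h = h, OF alpha_pos one _ _ abs_ml_le[OF l] h]) auto
  have imk: "integrable lborel (\<lambda>s. ml lam (t - s) * kh s)"
    using alpha_pos by (intro integrable_kern_bounded(1)[where f = "ml lam" and h = kh, OF alpha_pos _ _ _ abs_ml_le[OF l] khb]) auto
  have ih: "integrable lborel (\<lambda>r. kern (\<alpha> + \<alpha>) (t - r) * h r)"
    using alpha_pos
    by (intro integrable_kern_bounded(1)[where f = "kern (\<alpha> + \<alpha>)" and h = h, OF _ one _ _ abs_kern_le h]) auto
  have as: "(\<integral>s. ml lam (t - s) * kh s \<partial>lborel) = (\<integral>r. (\<integral>s. ml lam (t - r - s) * kern \<alpha> s \<partial>lborel) * h r \<partial>lborel)"
    unfolding kh_def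
    by (rule conv_assoc[where f = "ml lam" and g = "kern \<alpha>" and h = h and F = 1 and G = 1,
          OF _ _ _ alpha_pos alpha_pos abs_ml_le[OF l] abs_kern_le[OF alpha_pos] ih]) auto
  have res: "kern \<alpha> s = ml lam s + lam * (\<integral>r. ml lam (s - r) * kern \<alpha> r \<partial>lborel)" for s
    unfolding conv_commute[of "ml lam" s "kern \<alpha>"] using ml_volterra[of lam s] by linarith
  have ire: "integrable lborel (\<lambda>s. lam * ((\<integral>r. ml lam (t - s - r) * kern \<alpha> r \<partial>lborel) * h s))"
  proof -
    have "integrable lborel (\<lambda>s. kern \<alpha> (t - s) * h s - ml lam (t - s) * h s)" using ik iml by (rule Bochner_Integration.integrable_diff)
    moreover have "kern \<alpha> (t - s) * h s - ml lam (t - s) * h s = lam * ((\<integral>r. ml lam (t - s - r) * kern \<alpha> r \<partial>lborel) * h s)" for s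
      using res[of "t - s"] by (simp only: left_diff_distrib [symmetric] mult.assoc [symmetric]) simp
    ultimately show ?thesis by simp
  qed
  have "q t = (\<integral>s. kern \<alpha> (t - s) * h s \<partial>lborel)" using eq[OF t] by (simp add: h_def)
  also have "\<dots> = (\<integral>s. ml lam (t - s) * h s + lam * ((\<integral>r. ml lam (t - s - r) * kern \<alpha> r \<partial>lborel) * h s) \<partial>lborel)"
  proof (rule Bochner_Integration.integral_cong)
    fix s
    show "kern \<alpha> (t - s) * h s = ml lam (t - s) * h s + lam * ((\<integral>r. ml lam (t - s - r) * kern \<alpha> r \<partial>lborel) * h s)"
      by (subst res) (simp only: distrib_right mult.assoc)
  qed simp
  also have "\<dots> = (\<integral>s. ml lam (t - s) * h s \<partial>lborel) + lam * (\<integral>s. ml lam (t - s) * kh s \<partial>lborel)"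
    using iml ire unfolding as by (subst Bochner_Integration.integral_add) simp_all
  also have "\<dots> = (\<integral>s. ml lam (t - s) * h s + lam * (ml lam (t - s) * kh s) \<partial>lborel)"
    using iml imk by (subst Bochner_Integration.integral_add) auto
  also have "\<dots> = (\<integral>s. ml lam (t - s) * f s \<partial>lborel)"
  proof (rule Bochner_Integration.integral_cong)
    fix s
    show "ml lam (t - s) * h s + lam * (ml lam (t - s) * kh s) = ml lam (t - s) * f s"
    proof (cases "s < t")
      case True
      have "kh s = q s"
      proof (cases "0 < s")
        case True
        then show ?thesis using eq[of s] \<open>s < t\<close> t by (simp add: kh_def h_def)
      next
        case False
        then show ?thesis using khb[of s] q[of s] by simp
      qed
      then show ?thesis by (simp add: h_def algebra_simps)
    qed simp
  qed simp
  finally show ?thesis .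
qed

text \<open>The Laplace transform mu^(-\<alpha>) of \<open>kern \<alpha>\<close>. Under the weight
  exp(mu s) the fractional integral becomes small for large \<open>mu\<close>, which replaces a
  Gronwall lemma for weakly singular kernels.\<close>

lemma kern_exp_integral:
  assumes mu: "0 < mu"
  shows "has_bochner_integral lborel (\<lambda>s. kern \<alpha> (t - s) * exp (mu * s)) (exp (mu * t) * mu powr (- \<alpha>))"
proof -
  have "gam 0 (kern \<alpha>) = 1" using gam_kern[OF alpha_pos, of 0] Gamma_alpha_pos by simp
  then have "(\<integral>\<^sup>+s. ennreal (exp (- s) * kern \<alpha> s) \<partial>lborel) = 1"
    unfolding gam_def by (simp add: mult_ac if_distrib[of "\<lambda>x. x * _"] kern_def cong: if_cong)
  then have "has_bochner_integral lborel (\<lambda>s. exp (- s) * kern \<alpha> s) 1"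
    using alpha_pos by (intro has_bochner_integral_nn_integral) (auto intro!: mult_nonneg_nonneg kern_nonneg)
  then have "has_bochner_integral lborel (\<lambda>s. exp (- (mu * t + (- mu) * s)) * kern \<alpha> (mu * t + (- mu) * s)) (1 /\<^sub>R \<bar>- mu\<bar>)"
    by (subst (asm) lborel_has_bochner_integral_real_affine_iff[where c = "- mu" and t = "mu * t"]) (use mu in auto)
  then have "has_bochner_integral lborel (\<lambda>s. exp (mu * t) * mu powr (1 - \<alpha>) * (exp (- (mu * t + (- mu) * s)) * kern \<alpha> (mu * t + (- mu) * s)))
     (exp (mu * t) * mu powr (1 - \<alpha>) * (1 /\<^sub>R \<bar>- mu\<bar>))"
    by (rule has_bochner_integral_mult_right)
  moreover have "exp (mu * t) * mu powr (1 - \<alpha>) * (1 /\<^sub>R \<bar>- mu\<bar>) = exp (mu * t) * mu powr (- \<alpha>)"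
    using mu powr_mult_base[of mu "- \<alpha>"] by (simp add: field_simps)
  moreover have "exp (mu * t) * mu powr (1 - \<alpha>) * (exp (- (mu * t + (- mu) * s)) * kern \<alpha> (mu * t + (- mu) * s)) = kern \<alpha> (t - s) * exp (mu * s)" for s
  proof -
    have "mu * t + (- mu) * s = mu * (t - s)" by (simp add: algebra_simps)
    then have "kern \<alpha> (mu * t + (- mu) * s) = mu powr (\<alpha> - 1) * kern \<alpha> (t - s)"
      using mu by (simp add: kern_scale)
    moreover have "mu powr (1 - \<alpha>) * mu powr (\<alpha> - 1) = 1" using mu by (simp flip: powr_add)
    moreover have "exp (mu * t) * exp (- (mu * t + (- mu) * s)) = exp (mu * s)" by (simp flip: exp_add)
    ultimately show ?thesis by algebra
  qed
  ultimately show ?thesis by (simp only:)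
qed

text \<open>The two summands belong to the cases x < h and h \<le> x of
  \<open>ml_shift_diff\<close>.\<close>

definition ml_var :: real where
  "ml_var = 2 / (1 - 2 powr (\<alpha> - 1)) + ml_lip * Gamma \<alpha> / ((1 - \<alpha>) * 2 powr (\<alpha> - 2))"

lemma ml_var_nonneg: "0 \<le> ml_var"
proof -
  have "2 powr (\<alpha> - 1) \<le> 2 powr (0::real)" using alpha_less_1 by (intro powr_mono) auto
  then show ?thesis unfolding ml_var_def using alpha_less_1 ml_lip_nonneg Gamma_alpha_pos
    by (intro add_nonneg_nonneg divide_nonneg_nonneg mult_nonneg_nonneg) auto
qed

lemma kern_alpha_antimono: "0 < x \<Longrightarrow> x \<le> y \<Longrightarrow> kern \<alpha> y \<le> kern \<alpha> x"
  using Gamma_alpha_pos alpha_less_1 by (auto simp: kern_def intro!: divide_right_mono powr_mono2')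

text \<open>The bound h x^(\<alpha>-2) is not integrable at the singularity, whereas the decrement
  of \<open>kern \<alpha>\<close> is, and it telescopes after integration. If x < h, doubling the
  argument already costs a fixed fraction of the kernel; otherwise the mean value theorem bounds h
  x^(\<alpha>-2) by the decrement.\<close>

lemma ml_shift_diff:
  assumes l: "0 \<le> lam" and x: "0 < x" and h: "0 < h"
  shows "\<bar>ml lam (x + h) - ml lam x\<bar> \<le> ml_var * (kern \<alpha> x - kern \<alpha> (x + h))"
proof -
  have dk: "0 \<le> kern \<alpha> x - kern \<alpha> (x + h)" using kern_alpha_antimono[of x "x + h"] x h by simp
  have "2 powr (\<alpha> - 1) < 2 powr (0::real)" using alpha_less_1 by (intro powr_less_mono) auto
  then have p1: "0 < 1 - 2 powr (\<alpha> - 1)" by simp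
  have c1: "0 \<le> 2 / (1 - 2 powr (\<alpha> - 1))" "0 \<le> ml_lip * Gamma \<alpha> / ((1 - \<alpha>) * 2 powr (\<alpha> - 2))"
    using p1 alpha_less_1 ml_lip_nonneg Gamma_alpha_pos by (auto intro!: divide_nonneg_nonneg mult_nonneg_nonneg)
  show ?thesis
  proof (cases "x < h")
    case True
    have "kern \<alpha> (x + h) \<le> kern \<alpha> (2 * x)" using True x by (intro kern_alpha_antimono) auto
    also have "\<dots> = 2 powr (\<alpha> - 1) * kern \<alpha> x" by (simp add: kern_scale)
    finally have "(1 - 2 powr (\<alpha> - 1)) * kern \<alpha> x \<le> kern \<alpha> x - kern \<alpha> (x + h)" by (simp add: algebra_simps)
    then have k: "2 * kern \<alpha> x \<le> 2 / (1 - 2 powr (\<alpha> - 1)) * (kern \<alpha> x - kern \<alpha> (x + h))"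
      using p1 by (simp add: field_simps)
    have "\<bar>ml lam (x + h) - ml lam x\<bar> \<le> 2 * kern \<alpha> x"
      using ml_nonneg[OF l, of x] ml_nonneg[OF l, of "x + h"] ml_le_kern[OF l, of x] ml_le_kern[OF l, of "x + h"]
        kern_alpha_antimono[of x "x + h"] x h by auto
    also note k
    also have "2 / (1 - 2 powr (\<alpha> - 1)) * (kern \<alpha> x - kern \<alpha> (x + h)) \<le> ml_var * (kern \<alpha> x - kern \<alpha> (x + h))"
      unfolding ml_var_def using dk c1 by (intro mult_right_mono) auto
    finally show ?thesis .
  next
    case False
    obtain z where z: "x < z" "z < x + h" "(x + h) powr (\<alpha> - 1) - x powr (\<alpha> - 1) = h * ((\<alpha> - 1) * z powr (\<alpha> - 1 - 1))"
    proof -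
      have "((\<lambda>y. y powr (\<alpha> - 1)) has_real_derivative (\<alpha> - 1) * y powr (\<alpha> - 1 - 1)) (at y)" if "x \<le> y" for y
        using that x by (intro has_real_derivative_powr) auto
      then show ?thesis
        using MVT2[of x "x + h" "\<lambda>y. y powr (\<alpha> - 1)" "\<lambda>y. (\<alpha> - 1) * y powr (\<alpha> - 1 - 1)"] h that by auto
    qed
    have "2 powr (\<alpha> - 2) * x powr (\<alpha> - 2) = (2 * x) powr (\<alpha> - 2)" using x by (simp add: powr_mult)
    also have "\<dots> \<le> z powr (\<alpha> - 2)" using z x False alpha_less_1 by (intro powr_mono2') auto
    finally have "h * ((1 - \<alpha>) * (2 powr (\<alpha> - 2) * x powr (\<alpha> - 2))) \<le> h * ((1 - \<alpha>) * z powr (\<alpha> - 2))"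
      using h alpha_less_1 by (intro mult_left_mono) auto
    also have "\<dots> = x powr (\<alpha> - 1) - (x + h) powr (\<alpha> - 1)" using z(3) by (simp add: algebra_simps)
    finally have a: "(1 - \<alpha>) * 2 powr (\<alpha> - 2) * (x powr (\<alpha> - 2) * h) \<le> x powr (\<alpha> - 1) - (x + h) powr (\<alpha> - 1)"
      by (simp add: mult_ac)
    have kd: "kern \<alpha> x - kern \<alpha> (x + h) = (x powr (\<alpha> - 1) - (x + h) powr (\<alpha> - 1)) / Gamma \<alpha>"
      using x h by (simp add: kern_def diff_divide_distrib)
    have "x powr (\<alpha> - 2) * h \<le> Gamma \<alpha> / ((1 - \<alpha>) * 2 powr (\<alpha> - 2)) * (kern \<alpha> x - kern \<alpha> (x + h))"
    proof -
      have "0 < (1 - \<alpha>) * 2 powr (\<alpha> - 2)" using alpha_less_1 by simp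
      then have "x powr (\<alpha> - 2) * h \<le> (x powr (\<alpha> - 1) - (x + h) powr (\<alpha> - 1)) / ((1 - \<alpha>) * 2 powr (\<alpha> - 2))"
        using a by (simp add: pos_le_divide_eq mult.commute)
      then show ?thesis unfolding kd using Gamma_alpha_pos by simp
    qed
    then have "ml_lip * (x powr (\<alpha> - 2) * h) \<le> ml_lip * (Gamma \<alpha> / ((1 - \<alpha>) * 2 powr (\<alpha> - 2)) * (kern \<alpha> x - kern \<alpha> (x + h)))"
      by (rule mult_left_mono[OF _ ml_lip_nonneg])
    also have "\<dots> = ml_lip * Gamma \<alpha> / ((1 - \<alpha>) * 2 powr (\<alpha> - 2)) * (kern \<alpha> x - kern \<alpha> (x + h))" by simp
    also have "\<dots> \<le> ml_var * (kern \<alpha> x - kern \<alpha> (x + h))"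
      unfolding ml_var_def using dk c1 by (intro mult_right_mono) auto
    finally show ?thesis using ml_lipschitz[OF l x, of "x + h"] h by simp
  qed
qed

end

text \<open>All constants up to \<open>Eb\<close> are defined where the weights, the final time, the
  Lipschitz constant and the data bound \<open>M\<close> are known, but no dimension, eigenvalue or
  step size. Independence of h and \<tau> is thus enforced by scoping.\<close>

locale error_params = cq_weights +
  fixes T L M Ce :: real and eps :: "nat \<Rightarrow> real"
  assumes T_pos: "0 < T" and L_pos: "0 < L" and M_nonneg: "0 \<le> M" and comp: "comparable eps Ce"
begin

text \<open>The rate for which L * mu powr (- \<alpha>) = 1/2, so that the weighted norm in
  \<open>z_bounded\<close> absorbs the nonlinearity.\<close>

definition mu :: real where "mu = (2 * L) powr (1 / \<alpha>)"
definition Zb :: real where "Zb = 2 * M * kern (1 + \<alpha>) T * exp (mu * T)"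
definition Mb :: real where "Mb = M + L * Zb"
definition Hb :: real where "Hb = Mb * ((ml_var + 1) / Gamma (1 + \<alpha>))"
definition Qb :: real where "Qb = L * Hb * kern (1 + \<alpha>) T + Ce * M + L * Hb * (Ce * T powr \<alpha>)"
definition Eb :: real where "Eb = 2 * Qb * exp ((2 * L * gron) powr (1 / \<alpha>) * T)"

lemma mu_pos: "0 < mu" and mu_powr: "mu powr (- \<alpha>) = 1 / (2 * L)"
  using L_pos alpha_pos by (auto simp: mu_def powr_powr powr_minus_divide)

lemma kern_mono: "0 \<le> s \<Longrightarrow> s \<le> t \<Longrightarrow> kern (1 + \<alpha>) s \<le> kern (1 + \<alpha>) t"
  using alpha_pos by (auto simp: kern_def Gamma_real_pos less_imp_le intro!: divide_right_mono powr_mono2)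

lemma Zb_nonneg: "0 \<le> Zb" using M_nonneg alpha_pos kern_nonneg[of "1 + \<alpha>" T] by (simp add: Zb_def)
lemma Mb_nonneg: "0 \<le> Mb" using M_nonneg L_pos Zb_nonneg by (simp add: Mb_def)
lemma Hb_nonneg: "0 \<le> Hb"
  using Mb_nonneg ml_var_nonneg alpha_pos by (auto simp: Hb_def Gamma_real_pos less_imp_le intro!: mult_nonneg_nonneg divide_nonneg_nonneg)

lemma eps_nonneg: "1 \<le> n \<Longrightarrow> 0 \<le> eps n" and eps_le: "1 \<le> n \<Longrightarrow> eps n \<le> Ce"
  and sum_eps: "(\<Sum>n=1..N. eps n) \<le> Ce * real N powr \<alpha>"
  and Aml_res: "0 \<le> lam \<Longrightarrow> 1 \<le> n \<Longrightarrow> \<bar>Aml lam (real n) - (\<Sum>m<n. res lam m)\<bar> \<le> eps n"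
  using comp by (auto simp: comparable_def)

lemma Ce_nonneg: "0 \<le> Ce" using eps_nonneg[of 1] eps_le[of 1] by simp

lemma Qb_nonneg: "0 \<le> Qb"
  using L_pos Hb_nonneg Ce_nonneg M_nonneg alpha_pos kern_nonneg[of "1 + \<alpha>" T]
  by (auto simp: Qb_def intro!: add_nonneg_nonneg mult_nonneg_nonneg)

end

text \<open>The semidiscrete problem in eigenbasis coordinates. The regularity of u_0 enters through
  \<open>start\<close>, which bounds the source at time zero independently of the
  eigenvalues.\<close>

locale error_problem = error_params +
  fixes m :: nat and lam :: "nat \<Rightarrow> real" and v :: "nat \<Rightarrow> real" and F :: "(nat \<Rightarrow> real) \<Rightarrow> nat \<Rightarrow> real"
    and u :: "real \<Rightarrow> nat \<Rightarrow> real"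
  assumes m_pos: "0 < m" and lam_nonneg: "\<And>i. i < m \<Longrightarrow> 0 \<le> lam i"
    and F_lip: "\<And>x y. nrm m (\<lambda>i. F x i - F y i) \<le> L * nrm m (\<lambda>i. x i - y i)"
    and start: "nrm m (\<lambda>i. F v i - lam i * v i) \<le> M"
    and u_0: "\<And>i. i < m \<Longrightarrow> u 0 i = v i"
    and u_cont: "\<And>i. i < m \<Longrightarrow> continuous_on {0..T} (\<lambda>t. u t i)"
    and u_volterra: "\<And>i t. i < m \<Longrightarrow> 0 < t \<Longrightarrow> t \<le> T \<Longrightarrow>
      u t i = v i + (\<integral>s. kern \<alpha> (t - s) * (indicator {0<..T} s * (F (u s) i - lam i * u s i)) \<partial>lborel)"
begin

definition z :: "real \<Rightarrow> nat \<Rightarrow> real" where "z t i = u t i - v i"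
text \<open>The source of the equation for \<open>z\<close>: subtracting the initial value
  contributes the term with lam i * v i. The cutoff allows convolutions over the whole line.\<close>

definition g :: "real \<Rightarrow> nat \<Rightarrow> real" where "g s i = indicator {0<..T} s * (F (u s) i - lam i * v i)"

lemma nrm_F_le: "nrm m (\<lambda>i. F x i - lam i * v i) \<le> M + L * nrm m (\<lambda>i. x i - v i)"
proof -
  have "nrm m (\<lambda>i. F x i - lam i * v i) = nrm m (\<lambda>i. (F v i - lam i * v i) + (F x i - F v i))"
    by (simp add: algebra_simps)
  also have "\<dots> \<le> nrm m (\<lambda>i. F v i - lam i * v i) + nrm m (\<lambda>i. F x i - F v i)" by (rule nrm_triangle)
  also have "\<dots> \<le> M + L * nrm m (\<lambda>i. x i - v i)" using start F_lip by (intro add_mono)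
  finally show ?thesis .
qed

lemma Fu_continuous:
  assumes i: "i < m"
  shows "continuous_on {0..T} (\<lambda>t. F (u t) i)"
  unfolding continuous_on_def
proof
  fix t assume t: "t \<in> {0..T}"
  have "continuous_on {0..T} (\<lambda>s. nrm m (\<lambda>i. u s i - u t i))"
    by (intro nrm_continuous continuous_intros u_cont)
  then have "((\<lambda>s. nrm m (\<lambda>i. u s i - u t i)) \<longlongrightarrow> nrm m (\<lambda>i. u t i - u t i)) (at t within {0..T})"
    using t unfolding continuous_on_def by blast
  then have "((\<lambda>s. L * nrm m (\<lambda>i. u s i - u t i)) \<longlongrightarrow> L * nrm m (\<lambda>i. u t i - u t i)) (at t within {0..T})"
    by (intro tendsto_mult tendsto_const)
  then have lim: "((\<lambda>s. L * nrm m (\<lambda>i. u s i - u t i)) \<longlongrightarrow> 0) (at t within {0..T})" by simp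
  have "norm (F (u s) i - F (u t) i) \<le> L * nrm m (\<lambda>i. u s i - u t i)" for s
    unfolding real_norm_def by (rule order_trans[OF abs_le_nrm[OF i, of "\<lambda>i. F (u s) i - F (u t) i"] F_lip])
  then have "\<forall>\<^sub>F s in at t within {0..T}. norm (F (u s) i - F (u t) i) \<le> L * nrm m (\<lambda>i. u s i - u t i)"
    by (rule always_eventually[OF allI])
  from Lim_null_comparison[OF this lim]
  have "((\<lambda>s. F (u s) i - F (u t) i) \<longlongrightarrow> 0) (at t within {0..T})" .
  then show "((\<lambda>s. F (u s) i) \<longlongrightarrow> F (u t) i) (at t within {0..T})" by (simp add: LIM_zero_cancel)
qed

lemma cut_measurable:
  fixes w :: "real \<Rightarrow> real"
  assumes "continuous_on {0..T} w"
  shows "(\<lambda>s. indicator {0<..T} s * w s) \<in> borel_measurable borel"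
proof -
  have "(\<lambda>s. indicator {0<..T} s *\<^sub>R w s) \<in> borel_measurable borel"
    by (rule borel_measurable_continuous_on_indicator) (auto intro: continuous_on_subset[OF assms])
  then show ?thesis by simp
qed

lemma cut_bounded:
  fixes w :: "real \<Rightarrow> real"
  assumes "continuous_on {0..T} w"
  obtains C where "\<And>s. \<bar>indicator {0<..T} s * w s\<bar> \<le> C * kern 1 s"
proof -
  have "compact (w ` {0..T})" by (rule compact_continuous_image[OF assms]) simp
  then obtain C where "\<forall>y\<in>w ` {0..T}. norm y \<le> C"
    using compact_imp_bounded[of "w ` {0..T}"] unfolding bounded_iff by blast
  then have C: "\<And>s. s \<in> {0..T} \<Longrightarrow> \<bar>w s\<bar> \<le> C" by auto
  have "0 \<le> C" using C[of 0] T_pos abs_ge_zero[of "w 0"] by auto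
  then show ?thesis using C by (intro that[of C]) (auto simp: indicator_def)
qed

lemma g_measurable [measurable]: "i < m \<Longrightarrow> (\<lambda>s. g s i) \<in> borel_measurable borel"
  unfolding g_def by (intro cut_measurable continuous_intros Fu_continuous)

lemma ml_g_integrable:
  assumes i: "i < m" shows "integrable lborel (\<lambda>s. ml (lam i) (t - s) * g s i)"
proof -
  have c: "continuous_on {0..T} (\<lambda>s. F (u s) i - lam i * v i)" by (intro continuous_intros Fu_continuous i)
  obtain C where C: "\<And>s. \<bar>indicator {0<..T} s * (F (u s) i - lam i * v i)\<bar> \<le> C * kern 1 s"
    using cut_bounded[OF c] by blast
  show ?thesis unfolding g_def
    by (rule integrable_kern_bounded(1)[where f = "ml (lam i)" and b = 1 and a = \<alpha>,
          OF alpha_pos zero_less_one _ cut_measurable[OF c] abs_ml_le[OF lam_nonneg[OF i]] C]) measurable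
qed

lemma z_formula:
  assumes i: "i < m" and t: "0 \<le> t" "t \<le> T"
  shows "z t i = (\<integral>s. ml (lam i) (t - s) * g s i \<partial>lborel)"
proof (cases "t = 0")
  case True
  have 0: "ml (lam i) (0 - s) * g s i = 0" for s by (cases "0 < s") (auto simp: g_def)
  show ?thesis unfolding True 0 using u_0[OF i] by (simp add: z_def)
next
  case False
  have c: "continuous_on {0..T} (\<lambda>s. F (u s) i - lam i * v i)" by (intro continuous_intros Fu_continuous i)
  have cz: "continuous_on {0..T} (\<lambda>s. z s i)" unfolding z_def by (intro continuous_intros u_cont i)
  obtain C where C: "\<And>s. \<bar>indicator {0<..T} s * (F (u s) i - lam i * v i)\<bar> \<le> C * kern 1 s"
    using cut_bounded[OF c] by blast
  obtain D where D: "\<And>s. \<bar>indicator {0<..T} s * z s i\<bar> \<le> D * kern 1 s"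
    using cut_bounded[OF cz] by blast
  have "indicator {0<..T} t * z t i = (\<integral>s. ml (lam i) (t - s) * g s i \<partial>lborel)"
  proof (rule volterra_resolvent[OF lam_nonneg[OF i] g_measurable[OF i] cut_measurable[OF cz] _ D])
    show "\<bar>g s i\<bar> \<le> C * kern 1 s" for s using C by (simp add: g_def)
    fix t assume t: "0 < t" "t \<le> T"
    have "indicator {0<..T} s * (F (u s) i - lam i * u s i) = g s i - lam i * (indicator {0<..T} s * z s i)" for s
      by (simp add: g_def z_def algebra_simps)
    then show "indicator {0<..T} t * z t i = (\<integral>s. kern \<alpha> (t - s) * (g s i - lam i * (indicator {0<..T} s * z s i)) \<partial>lborel)"
      using u_volterra[OF i t] t by (simp add: z_def)
  qed (use t False in auto)
  then show ?thesis using t False by simp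
qed

text \<open>The maximum of exp(- mu s) times the norm of z s is attained at some \<open>t0\<close>.
  There the Lipschitz part of the source contributes at most half of that maximum, by the choice of
  \<open>mu\<close>, and is absorbed.\<close>

lemma z_bounded:
  assumes t: "0 \<le> t" "t \<le> T"
  shows "nrm m (z t) \<le> Zb"
proof -
  define w where "w s = exp (- (mu * s)) * nrm m (z s)" for s
  have "continuous_on {0..T} w" unfolding w_def
    by (intro continuous_intros nrm_continuous) (auto simp: z_def intro!: continuous_intros u_cont)
  then obtain t0 where t0: "t0 \<in> {0..T}" and max: "\<And>s. s \<in> {0..T} \<Longrightarrow> w s \<le> w t0"
    using continuous_attains_sup[of "{0..T}" w] T_pos by auto
  define X where "X = w t0"
  have X0: "0 \<le> X" by (simp add: X_def w_def)
  have zX: "nrm m (z s) \<le> X * exp (mu * s)" if "s \<in> {0..T}" for s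
    using max[OF that] by (simp add: w_def X_def exp_minus field_simps)
  have "nrm m (z t0) = nrm m (\<lambda>i. \<integral>s. ml (lam i) (t0 - s) * g s i \<partial>lborel)"
    using t0 by (intro nrm_cong z_formula) auto
  also have "\<dots> \<le> (\<integral>s. kern \<alpha> (t0 - s) * (M * kern 1 s + L * X * exp (mu * s)) \<partial>lborel)"
  proof (rule nrm_integral_le[OF m_pos ml_g_integrable])
    show "AE s in lborel. \<forall>i<m. \<bar>ml (lam i) (t0 - s)\<bar> \<le> kern \<alpha> (t0 - s)"
      using abs_ml_le[OF lam_nonneg] by simp
    show "nrm m (g s) \<le> M * kern 1 s + L * X * exp (mu * s)" for s
    proof (cases "s \<in> {0<..T}")
      case True
      have "nrm m (g s) = nrm m (\<lambda>i. F (u s) i - lam i * v i)" using True by (intro nrm_cong) (simp add: g_def)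
      also have "\<dots> \<le> M + L * nrm m (z s)" unfolding z_def by (rule nrm_F_le)
      also have "\<dots> \<le> M + L * (X * exp (mu * s))" using zX[of s] True L_pos by auto
      finally show ?thesis using True by simp
    next
      case False
      then have "g s = (\<lambda>i. 0)" by (auto simp: g_def)
      then show ?thesis using M_nonneg L_pos X0 by simp
    qed
    have "has_bochner_integral lborel (\<lambda>s. M * (kern \<alpha> (t0 - s) * kern 1 s) + L * X * (kern \<alpha> (t0 - s) * exp (mu * s)))
       (M * kern (\<alpha> + 1) t0 + L * X * (exp (mu * t0) * mu powr (- \<alpha>)))"
      by (intro has_bochner_integral_add has_bochner_integral_mult_right has_bochner_integral_kern_conv kern_exp_integral mu_pos alpha_pos) simp
    then have hb: "has_bochner_integral lborel (\<lambda>s. kern \<alpha> (t0 - s) * (M * kern 1 s + L * X * exp (mu * s)))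
       (M * kern (\<alpha> + 1) t0 + L * X * (exp (mu * t0) * mu powr (- \<alpha>)))"
      by (simp only: distrib_left mult_ac)
    show "integrable lborel (\<lambda>s. kern \<alpha> (t0 - s) * (M * kern 1 s + L * X * exp (mu * s)))"
      by (rule integrable.intros[OF hb])
  qed
  also have "\<dots> = M * kern (\<alpha> + 1) t0 + L * X * (exp (mu * t0) * mu powr (- \<alpha>))"
  proof -
    have "has_bochner_integral lborel (\<lambda>s. M * (kern \<alpha> (t0 - s) * kern 1 s) + L * X * (kern \<alpha> (t0 - s) * exp (mu * s)))
       (M * kern (\<alpha> + 1) t0 + L * X * (exp (mu * t0) * mu powr (- \<alpha>)))"
      by (intro has_bochner_integral_add has_bochner_integral_mult_right has_bochner_integral_kern_conv kern_exp_integral mu_pos alpha_pos) simp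
    then have hb: "has_bochner_integral lborel (\<lambda>s. kern \<alpha> (t0 - s) * (M * kern 1 s + L * X * exp (mu * s)))
       (M * kern (\<alpha> + 1) t0 + L * X * (exp (mu * t0) * mu powr (- \<alpha>)))"
      by (simp only: distrib_left mult_ac)
    then show ?thesis by (rule has_bochner_integral_integral_eq)
  qed
  also have "L * X * (exp (mu * t0) * mu powr (- \<alpha>)) = X * exp (mu * t0) / 2"
    using L_pos by (simp add: mu_powr)
  finally have "X * exp (mu * t0) \<le> M * kern (\<alpha> + 1) t0 + X * exp (mu * t0) / 2"
    by (simp add: X_def w_def exp_minus field_simps)
  then have "X * exp (mu * t0) \<le> 2 * M * kern (1 + \<alpha>) t0" by (simp add: add.commute)
  also have "\<dots> \<le> 2 * M * kern (1 + \<alpha>) T" using M_nonneg t0 by (intro mult_left_mono kern_mono) auto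
  finally have "X * exp (mu * t0) \<le> 2 * M * kern (1 + \<alpha>) T" .
  moreover have "X * 1 \<le> X * exp (mu * t0)" using X0 mu_pos t0 by (intro mult_left_mono) auto
  ultimately have X: "X \<le> 2 * M * kern (1 + \<alpha>) T" by simp
  have "nrm m (z t) \<le> X * exp (mu * t)" using zX t by simp
  also have "\<dots> \<le> (2 * M * kern (1 + \<alpha>) T) * exp (mu * T)"
    using X X0 t mu_pos by (intro mult_mono) auto
  finally show ?thesis by (simp add: Zb_def)
qed

lemma nrm_g_le: "nrm m (g s) \<le> Mb * kern 1 s"
proof (cases "s \<in> {0<..T}")
  case True
  have "nrm m (g s) = nrm m (\<lambda>i. F (u s) i - lam i * v i)" using True by (intro nrm_cong) (simp add: g_def)
  also have "\<dots> \<le> M + L * nrm m (z s)" unfolding z_def by (rule nrm_F_le)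
  also have "\<dots> \<le> M + L * Zb" using z_bounded[of s] True L_pos by auto
  finally show ?thesis using True by (simp add: Mb_def)
next
  case False
  then have "g s = (\<lambda>i. 0)" by (auto simp: g_def)
  then show ?thesis using Mb_nonneg by simp
qed

lemma u_holder:
  assumes s: "0 \<le> s" and st: "s \<le> t" and t: "t \<le> T"
  shows "nrm m (\<lambda>i. u t i - u s i) \<le> Hb * (t - s) powr \<alpha>"
proof (cases "s = t")
  case True
  then show ?thesis by simp
next
  case False
  with st have h: "0 < t - s" by simp
  \<comment> \<open>For r < s this is the bound of \<open>ml_shift_diff\<close>. For s < r < t the
    first bracket is - kern \<alpha> (t - r), and the coefficient ml_var + 1 offsets it so that
    exactly \<open>kern \<alpha> (t - r)\<close> remains. Integrated, the first part telescopes to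
    something nonpositive and only a multiple of (t - s)^\<alpha> is left.\<close>
  define \<Phi> where "\<Phi> r = ml_var * (kern \<alpha> (s - r) - kern \<alpha> (t - r)) + (ml_var + 1) * (kern \<alpha> (t - r) * kern 1 (r - s))" for r
  have hb0: "has_bochner_integral lborel (\<lambda>r. kern \<alpha> (x - r) * kern 1 r) (kern (\<alpha> + 1) x)" for x
    by (rule has_bochner_integral_kern_conv) (use alpha_pos in auto)
  have hb1: "has_bochner_integral lborel (\<lambda>r. kern \<alpha> (t - r) * kern 1 (r - s)) (kern (\<alpha> + 1) (t - s))"
    using nn_integral_kern_conv_shift[OF alpha_pos, of 1 t s] alpha_pos
    by (intro has_bochner_integral_nn_integral) (auto intro!: mult_nonneg_nonneg kern_nonneg)
  have "has_bochner_integral lborel (\<lambda>r. Mb * (ml_var * (kern \<alpha> (s - r) * kern 1 r - kern \<alpha> (t - r) * kern 1 r) + (ml_var + 1) * (kern \<alpha> (t - r) * kern 1 (r - s))))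
    (Mb * (ml_var * (kern (\<alpha> + 1) s - kern (\<alpha> + 1) t) + (ml_var + 1) * kern (\<alpha> + 1) (t - s)))"
    by (intro has_bochner_integral_mult_right has_bochner_integral_add has_bochner_integral_diff hb0 hb1)
  moreover have "Mb * (ml_var * (kern \<alpha> (s - r) * kern 1 r - kern \<alpha> (t - r) * kern 1 r) + (ml_var + 1) * (kern \<alpha> (t - r) * kern 1 (r - s)))
    = \<Phi> r * (Mb * kern 1 r)" for r
  proof (cases "0 < r")
    case True
    then show ?thesis by (simp add: \<Phi>_def)
  next
    case False
    then have "r - s \<le> 0" using s by simp
    then show ?thesis using False by simp
  qed
  ultimately have hb: "has_bochner_integral lborel (\<lambda>r. \<Phi> r * (Mb * kern 1 r))
    (Mb * (ml_var * (kern (\<alpha> + 1) s - kern (\<alpha> + 1) t) + (ml_var + 1) * kern (\<alpha> + 1) (t - s)))" by (simp only:)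
  have "u t i - u s i = (\<integral>r. (ml (lam i) (t - r) - ml (lam i) (s - r)) * g r i \<partial>lborel)" if i: "i < m" for i
  proof -
    have "u t i - u s i = z t i - z s i" by (simp add: z_def)
    also have "\<dots> = (\<integral>r. ml (lam i) (t - r) * g r i \<partial>lborel) - (\<integral>r. ml (lam i) (s - r) * g r i \<partial>lborel)"
      using z_formula[OF i, of t] z_formula[OF i, of s] s st t by simp
    also have "\<dots> = (\<integral>r. ml (lam i) (t - r) * g r i - ml (lam i) (s - r) * g r i \<partial>lborel)"
      by (rule Bochner_Integration.integral_diff [symmetric]) (rule ml_g_integrable[OF i])+
    finally show ?thesis by (simp only: left_diff_distrib)
  qed
  then have "nrm m (\<lambda>i. u t i - u s i) = nrm m (\<lambda>i. \<integral>r. (ml (lam i) (t - r) - ml (lam i) (s - r)) * g r i \<partial>lborel)"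
    by (intro nrm_cong)
  also have "\<dots> \<le> (\<integral>r. \<Phi> r * (Mb * kern 1 r) \<partial>lborel)"
  proof (rule nrm_integral_le[OF m_pos _ _ nrm_g_le])
    show "integrable lborel (\<lambda>r. (ml (lam i) (t - r) - ml (lam i) (s - r)) * g r i)" if "i < m" for i
      unfolding left_diff_distrib by (intro Bochner_Integration.integrable_diff ml_g_integrable that)
    show "integrable lborel (\<lambda>r. \<Phi> r * (Mb * kern 1 r))" by (rule integrable.intros[OF hb])
    have "\<forall>i<m. \<bar>ml (lam i) (t - r) - ml (lam i) (s - r)\<bar> \<le> \<Phi> r" if r: "r \<noteq> s" for r
    proof (intro allI impI)
      fix i assume i: "i < m"
      note l = lam_nonneg[OF i]
      show "\<bar>ml (lam i) (t - r) - ml (lam i) (s - r)\<bar> \<le> \<Phi> r"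
      proof (cases "r < s")
        case True
        then show ?thesis using ml_shift_diff[OF l, of "s - r" "t - s"] h by (simp add: \<Phi>_def)
      next
        case False
        with r have "s < r" by simp
        then show ?thesis using abs_ml_le[OF l, of "t - r"] by (simp add: \<Phi>_def algebra_simps)
      qed
    qed
    then show "AE r in lborel. \<forall>i<m. \<bar>ml (lam i) (t - r) - ml (lam i) (s - r)\<bar> \<le> \<Phi> r"
      using AE_lborel_singleton[of s] by (rule eventually_mono[rotated])
  qed
  also have "\<dots> = Mb * (ml_var * (kern (\<alpha> + 1) s - kern (\<alpha> + 1) t) + (ml_var + 1) * kern (\<alpha> + 1) (t - s))"
    by (rule has_bochner_integral_integral_eq[OF hb])
  also have "\<dots> \<le> Mb * (0 + (ml_var + 1) * kern (\<alpha> + 1) (t - s))"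
    using kern_mono[OF s st] ml_var_nonneg Mb_nonneg
    by (intro mult_left_mono add_right_mono) (auto simp: mult_nonneg_nonpos add.commute)
  also have "\<dots> = Hb * (t - s) powr \<alpha>" using h by (simp add: Hb_def kern_def add.commute)
  finally show ?thesis .
qed

end

section \<open>Splitting and recursion of the error of the scheme\<close>

lemma abel_sum:
  fixes p x :: "nat \<Rightarrow> real"
  assumes "p 0 = 0" "1 \<le> n"
  shows "(\<Sum>j=1..n. (p (n - j + 1) - p (n - j)) * x j) = p n * x 1 + (\<Sum>j=2..n. p (n - j + 1) * (x j - x (j - 1)))"
proof -
  have "(\<Sum>j=1..n. p (n - j) * x j) = (\<Sum>j=1..n - 1. p (n - j) * x j)"
    using assms by (cases n) auto
  also have "\<dots> = (\<Sum>j=2..n. p (n - j + 1) * x (j - 1))"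
    by (rule sum.reindex_bij_witness[where i = "\<lambda>j. j - 1" and j = Suc]) (auto simp: Suc_diff_Suc)
  finally have 1: "(\<Sum>j=1..n. p (n - j) * x j) = (\<Sum>j=2..n. p (n - j + 1) * x (j - 1))" .
  have "{1..n} = insert 1 {2..n}" using assms by auto
  then have "(\<Sum>j=1..n. p (n - j + 1) * x j) = p n * x 1 + (\<Sum>j=2..n. p (n - j + 1) * x j)"
    using assms by simp
  then show ?thesis using 1 by (simp add: left_diff_distrib right_diff_distrib sum_subtractf)
qed

text \<open>The quadrature sum in \<open>U_eq\<close> starts at j = 1, because U j i - v i vanishes
  for j = 0.\<close>

locale discrete_problem = error_problem +
  fixes N :: nat and \<tau> :: real and U :: "nat \<Rightarrow> nat \<Rightarrow> real"
  assumes tau: "0 < \<tau>" and N_tau: "real N * \<tau> \<le> T"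
    and U_0: "\<And>i. i < m \<Longrightarrow> U 0 i = v i"
    and U_eq: "\<And>n i. 1 \<le> n \<Longrightarrow> n \<le> N \<Longrightarrow> i < m \<Longrightarrow>
       1 / \<tau> powr \<alpha> * (\<Sum>j=1..n. K (n - j) * (U j i - v i)) + lam i * U n i = F (U (n - 1)) i"
begin

definition t :: "nat \<Rightarrow> real" where "t n = real n * \<tau>"
text \<open>Rescaling time to unit steps turns the eigenvalue into lam i * \<tau>^\<alpha>; bounds
  that are uniform in the eigenvalue survive unchanged.\<close>

definition b :: "nat \<Rightarrow> nat \<Rightarrow> real" where "b i n = res (lam i * \<tau> powr \<alpha>) n"
definition gu :: "nat \<Rightarrow> nat \<Rightarrow> real" where "gu j i = F (u (t (j - 1))) i - lam i * v i"
definition gU :: "nat \<Rightarrow> nat \<Rightarrow> real" where "gU j i = F (U (j - 1)) i - lam i * v i"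
definition phi :: "nat \<Rightarrow> nat \<Rightarrow> real" where "phi i k = Aml (lam i * \<tau> powr \<alpha>) (real k) - (\<Sum>n<k. b i n)"
definition err :: "nat \<Rightarrow> real" where "err n = nrm m (\<lambda>i. u (t n) i - U n i)"
text \<open>The error of freezing the source at the left end of each step, the level at which the
  scheme also evaluates the nonlinearity.\<close>

definition dg :: "nat \<Rightarrow> real \<Rightarrow> nat \<Rightarrow> real" where
  "dg n s i = (\<Sum>j=1..n. indicator {t (j - 1)<..t j} s * (g s i - gu j i))"

lemma lt_nonneg: "i < m \<Longrightarrow> 0 \<le> lam i * \<tau> powr \<alpha>"
  using lam_nonneg by simp

lemma t_nonneg: "0 \<le> t n" using tau by (simp add: t_def)

lemma t_mono: "j \<le> n \<Longrightarrow> t j \<le> t n" using tau by (simp add: t_def)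

lemma t_le: "n \<le> N \<Longrightarrow> t n \<le> T"
  using t_mono[of n N] N_tau by (simp add: t_def)

lemma t_step: "1 \<le> j \<Longrightarrow> t j - t (j - 1) = \<tau>"
  by (simp add: t_def of_nat_diff algebra_simps)

lemma tau_powr_le: "n \<le> N \<Longrightarrow> \<tau> powr \<alpha> * real n powr \<alpha> \<le> T powr \<alpha>"
  using t_le[of n] tau alpha_pos by (simp add: t_def powr_mult [symmetric] mult.commute powr_mono2)

lemma cells_disjoint:
  "(\<Sum>j=1..n. indicator {t (j - 1)<..t j} s) = (indicator {0<..t n} s :: real)"
proof (induction n)
  case (Suc n)
  have "t n \<le> t (Suc n)" "0 \<le> t n" by (simp_all add: t_mono t_nonneg)
  then show ?case using Suc by (auto simp: indicator_def)
qed (simp add: t_def)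

lemma U_formula:
  assumes n: "1 \<le> n" "n \<le> N" and i: "i < m"
  shows "U n i - v i = (\<Sum>j=1..n. b i (n - j) * (\<tau> powr \<alpha> * gU j i))"
  unfolding b_def
proof (rule solution_formula[OF lt_nonneg[OF i] n(1), where x = "\<lambda>j. U j i - v i"])
  fix k assume k: "1 \<le> k" "k \<le> n"
  have "1 / \<tau> powr \<alpha> * (\<Sum>j=1..k. K (k - j) * (U j i - v i)) = F (U (k - 1)) i - lam i * U k i"
    using U_eq[of k i] k n i by simp
  then have "(\<Sum>j=1..k. K (k - j) * (U j i - v i)) = \<tau> powr \<alpha> * (F (U (k - 1)) i - lam i * U k i)"
    using tau by (simp add: field_simps)
  then show "(\<Sum>j=1..k. K (k - j) * (U j i - v i)) + lam i * \<tau> powr \<alpha> * (U k i - v i) = \<tau> powr \<alpha> * gU k i"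
    by (simp add: gU_def algebra_simps)
qed

lemma nrm_dg_le:
  assumes n: "n \<le> N"
  shows "nrm m (dg n s) \<le> L * Hb * \<tau> powr \<alpha> * kern 1 s"
proof -
  have "nrm m (dg n s) \<le> (\<Sum>j=1..n. nrm m (\<lambda>i. indicator {t (j - 1)<..t j} s * (g s i - gu j i)))"
    unfolding dg_def by (rule nrm_sum) simp
  also have "\<dots> \<le> (\<Sum>j=1..n. indicator {t (j - 1)<..t j} s * (L * Hb * \<tau> powr \<alpha>))"
  proof (rule sum_mono)
    fix j assume j: "j \<in> {1..n}"
    show "nrm m (\<lambda>i. indicator {t (j - 1)<..t j} s * (g s i - gu j i)) \<le> indicator {t (j - 1)<..t j} s * (L * Hb * \<tau> powr \<alpha>)"
    proof (cases "s \<in> {t (j - 1)<..t j}")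
      case True
      then have s: "t (j - 1) < s" "s \<le> t j" "0 < s" "s \<le> T"
        using t_nonneg[of "j - 1"] t_le[of j] j n by auto
      have "nrm m (\<lambda>i. indicator {t (j - 1)<..t j} s * (g s i - gu j i)) = nrm m (\<lambda>i. F (u s) i - F (u (t (j - 1))) i)"
        using True s by (intro nrm_cong) (simp add: g_def gu_def)
      also have "\<dots> \<le> L * nrm m (\<lambda>i. u s i - u (t (j - 1)) i)" by (rule F_lip)
      also have "\<dots> \<le> L * (Hb * (s - t (j - 1)) powr \<alpha>)"
        using L_pos s t_nonneg by (intro mult_left_mono u_holder) auto
      also have "\<dots> \<le> L * (Hb * \<tau> powr \<alpha>)"
      proof -
        have "s - t (j - 1) \<le> \<tau>" using s t_step[of j] j by auto
        then show ?thesis using L_pos Hb_nonneg s alpha_pos by (intro mult_left_mono powr_mono2) auto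
      qed
      finally show ?thesis using True by simp
    qed simp
  qed
  also have "\<dots> = indicator {0<..t n} s * (L * Hb * \<tau> powr \<alpha>)"
    unfolding sum_distrib_right [symmetric] cells_disjoint ..
  also have "\<dots> \<le> L * Hb * \<tau> powr \<alpha> * kern 1 s"
    using L_pos Hb_nonneg by (simp add: indicator_def)
  finally show ?thesis .
qed

lemma quadrature_split:
  assumes n: "1 \<le> n" "n \<le> N" and i: "i < m"
  shows "integrable lborel (\<lambda>s. ml (lam i) (t n - s) * dg n s i)"
    and "(\<integral>s. ml (lam i) (t n - s) * dg n s i \<partial>lborel) = z (t n) i -
      (\<Sum>j=1..n. \<tau> powr \<alpha> * (Aml (lam i * \<tau> powr \<alpha>) (real (n - j + 1)) - Aml (lam i * \<tau> powr \<alpha>) (real (n - j))) * gu j i)"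
proof -
  have hz: "has_bochner_integral lborel (\<lambda>s. ml (lam i) (t n - s) * g s i) (z (t n) i)"
    using ml_g_integrable[OF i, of "t n"] z_formula[OF i t_nonneg t_le[OF n(2)]] by (simp add: has_bochner_integral_iff)
  have hc: "has_bochner_integral lborel (\<lambda>s. ml (lam i) (t n - s) * indicator {t (j - 1)<..t j} s)
     (\<tau> powr \<alpha> * (Aml (lam i * \<tau> powr \<alpha>) (real (n - j + 1)) - Aml (lam i * \<tau> powr \<alpha>) (real (n - j))))"
    if j: "j \<in> {1..n}" for j
  proof -
    have "has_bochner_integral lborel (\<lambda>s. ml (lam i) (t n - s) * kern 1 (s - a)) (Aml (lam i) (t n - a))" for a
      using integrable_Aml_shift Aml_shift by (simp add: has_bochner_integral_iff)
    from has_bochner_integral_diff[OF this[of "t (j - 1)"] this[of "t j"]]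
    have "has_bochner_integral lborel (\<lambda>s. ml (lam i) (t n - s) * indicator {t (j - 1)<..t j} s)
      (Aml (lam i) (t n - t (j - 1)) - Aml (lam i) (t n - t j))"
      unfolding indicator_kern[OF t_mono[OF diff_le_self]] right_diff_distrib .
    moreover have "t n - t (j - 1) = \<tau> * real (n - j + 1)" "t n - t j = \<tau> * real (n - j)"
      using j by (auto simp: t_def of_nat_diff algebra_simps)
    ultimately show ?thesis using tau by (simp only: Aml_scale right_diff_distrib)
  qed
  have hs: "has_bochner_integral lborel (\<lambda>s. ml (lam i) (t n - s) * g s i - (\<Sum>j=1..n. ml (lam i) (t n - s) * indicator {t (j - 1)<..t j} s * gu j i))
     (z (t n) i - (\<Sum>j=1..n. \<tau> powr \<alpha> * (Aml (lam i * \<tau> powr \<alpha>) (real (n - j + 1)) - Aml (lam i * \<tau> powr \<alpha>) (real (n - j))) * gu j i))"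
    by (intro has_bochner_integral_diff has_bochner_integral_sum has_bochner_integral_mult_left hz hc)
  have "ml (lam i) (t n - s) * g s i - (\<Sum>j=1..n. ml (lam i) (t n - s) * indicator {t (j - 1)<..t j} s * gu j i)
     = ml (lam i) (t n - s) * dg n s i" for s
  proof -
    have "dg n s i = indicator {0<..t n} s * g s i - (\<Sum>j=1..n. indicator {t (j - 1)<..t j} s * gu j i)"
      unfolding dg_def right_diff_distrib sum_subtractf sum_distrib_right [symmetric] cells_disjoint ..
    moreover have "ml (lam i) (t n - s) * (indicator {0<..t n} s * g s i) = ml (lam i) (t n - s) * g s i"
      by (cases "0 < s \<and> s \<le> t n") (auto simp: g_def)
    ultimately show ?thesis by (simp only: right_diff_distrib sum_distrib_left mult.assoc)
  qed
  with hs have "has_bochner_integral lborel (\<lambda>s. ml (lam i) (t n - s) * dg n s i)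
     (z (t n) i - (\<Sum>j=1..n. \<tau> powr \<alpha> * (Aml (lam i * \<tau> powr \<alpha>) (real (n - j + 1)) - Aml (lam i * \<tau> powr \<alpha>) (real (n - j))) * gu j i))"
    by (simp only:)
  then show "integrable lborel (\<lambda>s. ml (lam i) (t n - s) * dg n s i)"
    and "(\<integral>s. ml (lam i) (t n - s) * dg n s i \<partial>lborel) = z (t n) i -
      (\<Sum>j=1..n. \<tau> powr \<alpha> * (Aml (lam i * \<tau> powr \<alpha>) (real (n - j + 1)) - Aml (lam i * \<tau> powr \<alpha>) (real (n - j))) * gu j i)"
    by (simp_all only: has_bochner_integral_iff)
qed

text \<open>Three contributions: freezing the source, the difference of the integrated resolvents,
  and errors inherited from earlier levels. Abel summation is built into the second one, since only
  \<open>phi\<close> itself and not its increments is controlled.\<close>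

lemma error_split:
  assumes n: "1 \<le> n" "n \<le> N" and i: "i < m"
  shows "u (t n) i - U n i = (\<integral>s. ml (lam i) (t n - s) * dg n s i \<partial>lborel)
     + \<tau> powr \<alpha> * (phi i n * gu 1 i + (\<Sum>j=2..n. phi i (n - j + 1) * (gu j i - gu (j - 1) i)))
     + \<tau> powr \<alpha> * (\<Sum>j=1..n. b i (n - j) * (gu j i - gU j i))"
proof -
  have "phi i (n - j + 1) - phi i (n - j) = Aml (lam i * \<tau> powr \<alpha>) (real (n - j + 1)) - Aml (lam i * \<tau> powr \<alpha>) (real (n - j)) - b i (n - j)" for j
    by (simp add: phi_def)
  then have "(\<Sum>j=1..n. (phi i (n - j + 1) - phi i (n - j)) * gu j i)
     = (\<Sum>j=1..n. (Aml (lam i * \<tau> powr \<alpha>) (real (n - j + 1)) - Aml (lam i * \<tau> powr \<alpha>) (real (n - j))) * gu j i) - (\<Sum>j=1..n. b i (n - j) * gu j i)"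
    by (simp only: left_diff_distrib sum_subtractf)
  moreover have "phi i 0 = 0" by (simp add: phi_def)
  ultimately have "phi i n * gu 1 i + (\<Sum>j=2..n. phi i (n - j + 1) * (gu j i - gu (j - 1) i))
     = (\<Sum>j=1..n. (Aml (lam i * \<tau> powr \<alpha>) (real (n - j + 1)) - Aml (lam i * \<tau> powr \<alpha>) (real (n - j))) * gu j i) - (\<Sum>j=1..n. b i (n - j) * gu j i)"
    using abel_sum[of "phi i" n "\<lambda>j. gu j i"] n by simp
  moreover have "u (t n) i - U n i = z (t n) i - (U n i - v i)" by (simp add: z_def)
  ultimately show ?thesis
    unfolding U_formula[OF n i] quadrature_split(2)[OF n i]
    by (simp add: right_diff_distrib sum_subtractf sum_distrib_left mult_ac)
qed

lemma abs_phi_le: "i < m \<Longrightarrow> 1 \<le> k \<Longrightarrow> \<bar>phi i k\<bar> \<le> eps k"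
  unfolding phi_def b_def by (rule Aml_res[OF lt_nonneg])

lemma error_recursion:
  assumes n: "1 \<le> n" "n \<le> N"
  shows "err n \<le> Qb * \<tau> powr \<alpha> + \<tau> powr \<alpha> * L * (\<Sum>j=1..n. omega (n - j) * err (j - 1))"
proof -
  define I where "I i = (\<integral>s. ml (lam i) (t n - s) * dg n s i \<partial>lborel)" for i
  define J where "J i = phi i n * gu 1 i + (\<Sum>j=2..n. phi i (n - j + 1) * (gu j i - gu (j - 1) i))" for i
  define R where "R i = (\<Sum>j=1..n. b i (n - j) * (gu j i - gU j i))" for i
  have LH: "0 \<le> L * Hb * \<tau> powr \<alpha>" using L_pos Hb_nonneg by simp
  have I: "nrm m I \<le> L * Hb * \<tau> powr \<alpha> * kern (1 + \<alpha>) T"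
  proof -
    have hb: "has_bochner_integral lborel (\<lambda>s. kern \<alpha> (t n - s) * (L * Hb * \<tau> powr \<alpha> * kern 1 s)) (L * Hb * \<tau> powr \<alpha> * kern (\<alpha> + 1) (t n))"
      using has_bochner_integral_mult_right[OF has_bochner_integral_kern_conv[OF alpha_pos zero_less_one, of "t n"], of "L * Hb * \<tau> powr \<alpha>"]
      by (simp only: mult_ac)
    have "nrm m I \<le> (\<integral>s. kern \<alpha> (t n - s) * (L * Hb * \<tau> powr \<alpha> * kern 1 s) \<partial>lborel)"
      unfolding I_def
    proof (rule nrm_integral_le[OF m_pos quadrature_split(1)[OF n] _ nrm_dg_le[OF n(2)] integrable.intros[OF hb]])
      show "AE s in lborel. \<forall>i<m. \<bar>ml (lam i) (t n - s)\<bar> \<le> kern \<alpha> (t n - s)"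
        using abs_ml_le[OF lam_nonneg] by simp
    qed
    also have "\<dots> = L * Hb * \<tau> powr \<alpha> * kern (1 + \<alpha>) (t n)"
      using has_bochner_integral_integral_eq[OF hb] by (simp add: add.commute)
    also have "\<dots> \<le> L * Hb * \<tau> powr \<alpha> * kern (1 + \<alpha>) T"
      using LH t_nonneg t_le[OF n(2)] by (intro mult_left_mono kern_mono) auto
    finally show ?thesis .
  qed
  have J: "nrm m J \<le> Ce * M + L * Hb * (Ce * T powr \<alpha>)"
  proof -
    have g1: "nrm m (gu 1) \<le> M"
    proof -
      have "nrm m (\<lambda>i. F (u 0) i - F v i) \<le> L * nrm m (\<lambda>i. u 0 i - v i)" by (rule F_lip)
      also have "nrm m (\<lambda>i. u 0 i - v i) = nrm m (\<lambda>i. 0)" using u_0 by (intro nrm_cong) simp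
      finally have 0: "nrm m (\<lambda>i. F (u 0) i - F v i) = 0" using nrm_nonneg[of m "\<lambda>i. F (u 0) i - F v i"] by simp
      have "nrm m (gu 1) = nrm m (\<lambda>i. (F v i - lam i * v i) + (F (u 0) i - F v i))"
        by (intro nrm_cong) (simp add: gu_def t_def)
      also have "\<dots> \<le> M + 0" using start 0 by (intro order_trans[OF nrm_triangle]) simp
      finally show ?thesis by simp
    qed
    \<comment> \<open>The jumps inherit the Hoelder bound over one step. Summed against
      \<open>eps\<close> they carry the factor \<tau>^\<alpha> n^\<alpha> \<le> T^\<alpha>, so no
      power of \<tau> is lost to the number of levels.\<close>
    have gd: "nrm m (\<lambda>i. gu j i - gu (j - 1) i) \<le> L * Hb * \<tau> powr \<alpha>" if j: "j \<in> {2..n}" for j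
    proof -
      have "nrm m (\<lambda>i. gu j i - gu (j - 1) i) = nrm m (\<lambda>i. F (u (t (j - 1))) i - F (u (t (j - 1 - 1))) i)"
        by (simp add: gu_def)
      also have "\<dots> \<le> L * nrm m (\<lambda>i. u (t (j - 1)) i - u (t (j - 1 - 1)) i)" by (rule F_lip)
      also have "\<dots> \<le> L * (Hb * (t (j - 1) - t (j - 1 - 1)) powr \<alpha>)"
        using L_pos j n by (intro mult_left_mono u_holder t_nonneg t_mono t_le) auto
      also have "t (j - 1) - t (j - 1 - 1) = \<tau>" using j by (intro t_step) auto
      finally show ?thesis by simp
    qed
    have "nrm m J \<le> nrm m (\<lambda>i. phi i n * gu 1 i) + nrm m (\<lambda>i. \<Sum>j=2..n. phi i (n - j + 1) * (gu j i - gu (j - 1) i))"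
      unfolding J_def by (rule nrm_triangle)
    also have "nrm m (\<lambda>i. phi i n * gu 1 i) \<le> eps n * nrm m (gu 1)"
      using abs_phi_le[of _ n] eps_nonneg[OF n(1)] n by (intro nrm_scale) (auto simp: abs_mult intro!: mult_right_mono)
    also have "eps n * nrm m (gu 1) \<le> Ce * M"
      using eps_le[OF n(1)] Ce_nonneg g1 by (intro mult_mono) auto
    also have "nrm m (\<lambda>i. \<Sum>j=2..n. phi i (n - j + 1) * (gu j i - gu (j - 1) i))
       \<le> (\<Sum>j=2..n. nrm m (\<lambda>i. phi i (n - j + 1) * (gu j i - gu (j - 1) i)))" by (rule nrm_sum) simp
    also have "\<dots> \<le> (\<Sum>j=2..n. eps (n - j + 1) * (L * Hb * \<tau> powr \<alpha>))"
    proof (rule sum_mono)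
      fix j assume j: "j \<in> {2..n}"
      have "nrm m (\<lambda>i. phi i (n - j + 1) * (gu j i - gu (j - 1) i)) \<le> eps (n - j + 1) * nrm m (\<lambda>i. gu j i - gu (j - 1) i)"
        using abs_phi_le[of _ "n - j + 1"] eps_nonneg[of "n - j + 1"]
        by (intro nrm_scale) (auto simp: abs_mult intro!: mult_right_mono)
      also have "\<dots> \<le> eps (n - j + 1) * (L * Hb * \<tau> powr \<alpha>)"
        using gd[OF j] eps_nonneg[of "n - j + 1"] by (intro mult_left_mono) auto
      finally show "nrm m (\<lambda>i. phi i (n - j + 1) * (gu j i - gu (j - 1) i)) \<le> eps (n - j + 1) * (L * Hb * \<tau> powr \<alpha>)" .
    qed
    also have "\<dots> = (\<Sum>j=2..n. eps (n - j + 1)) * (L * Hb * \<tau> powr \<alpha>)" by (rule sum_distrib_right [symmetric])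
    also have "(\<Sum>j=2..n. eps (n - j + 1)) = (\<Sum>k=1..n - 1. eps k)"
      by (rule sum.reindex_bij_witness[where i = "\<lambda>k. n - k + 1" and j = "\<lambda>j. n - j + 1"]) auto
    also have "(\<Sum>k=1..n - 1. eps k) * (L * Hb * \<tau> powr \<alpha>) \<le> (\<Sum>k=1..n. eps k) * (L * Hb * \<tau> powr \<alpha>)"
      using LH eps_nonneg by (intro mult_right_mono sum_mono2) auto
    also have "\<dots> \<le> (Ce * real n powr \<alpha>) * (L * Hb * \<tau> powr \<alpha>)"
      using LH sum_eps by (intro mult_right_mono)
    also have "\<dots> = L * Hb * (Ce * (\<tau> powr \<alpha> * real n powr \<alpha>))" by (simp add: mult_ac)
    also have "\<dots> \<le> L * Hb * (Ce * T powr \<alpha>)"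
      using L_pos Hb_nonneg Ce_nonneg tau_powr_le[OF n(2)] by (intro mult_left_mono) auto
    finally show ?thesis by simp
  qed
  have R: "nrm m R \<le> L * (\<Sum>j=1..n. omega (n - j) * err (j - 1))"
  proof -
    have "nrm m R \<le> (\<Sum>j=1..n. nrm m (\<lambda>i. b i (n - j) * (gu j i - gU j i)))"
      unfolding R_def by (rule nrm_sum) simp
    also have "\<dots> \<le> (\<Sum>j=1..n. omega (n - j) * (L * err (j - 1)))"
    proof (rule sum_mono)
      fix j assume j: "j \<in> {1..n}"
      have "nrm m (\<lambda>i. b i (n - j) * (gu j i - gU j i)) \<le> omega (n - j) * nrm m (\<lambda>i. gu j i - gU j i)"
        using res_nonneg[of 0] res_nonneg[OF lt_nonneg] res_le_omega[OF lt_nonneg]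
        by (intro nrm_scale) (auto simp: abs_mult b_def intro!: mult_right_mono)
      also have "nrm m (\<lambda>i. gu j i - gU j i) \<le> L * err (j - 1)"
        using F_lip[of "u (t (j - 1))" "U (j - 1)"] by (simp add: gu_def gU_def err_def)
      finally show "nrm m (\<lambda>i. b i (n - j) * (gu j i - gU j i)) \<le> omega (n - j) * (L * err (j - 1))"
        using res_nonneg[of 0 "n - j"] by (simp add: mult_left_mono)
    qed
    finally show ?thesis by (simp add: sum_distrib_left mult_ac)
  qed
  have "err n = nrm m (\<lambda>i. I i + \<tau> powr \<alpha> * J i + \<tau> powr \<alpha> * R i)"
    unfolding err_def I_def J_def R_def by (intro nrm_cong error_split n)
  also have "\<dots> \<le> nrm m I + nrm m (\<lambda>i. \<tau> powr \<alpha> * J i) + nrm m (\<lambda>i. \<tau> powr \<alpha> * R i)"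
    using nrm_triangle[of m "\<lambda>i. I i + \<tau> powr \<alpha> * J i" "\<lambda>i. \<tau> powr \<alpha> * R i"] nrm_triangle[of m I "\<lambda>i. \<tau> powr \<alpha> * J i"]
    by linarith
  also have "nrm m (\<lambda>i. \<tau> powr \<alpha> * J i) \<le> \<tau> powr \<alpha> * nrm m J" by (intro nrm_scale) (auto simp: abs_mult)
  also have "nrm m (\<lambda>i. \<tau> powr \<alpha> * R i) \<le> \<tau> powr \<alpha> * nrm m R" by (intro nrm_scale) (auto simp: abs_mult)
  also have "\<tau> powr \<alpha> * nrm m J \<le> \<tau> powr \<alpha> * (Ce * M + L * Hb * (Ce * T powr \<alpha>))" using J by (intro mult_left_mono) auto
  also have "\<tau> powr \<alpha> * nrm m R \<le> \<tau> powr \<alpha> * (L * (\<Sum>j=1..n. omega (n - j) * err (j - 1)))" using R by (intro mult_left_mono) auto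
  also note I
  finally show ?thesis by (simp add: Qb_def algebra_simps)
qed

lemma error_bound:
  assumes n: "n \<le> N"
  shows "nrm m (\<lambda>i. u (real n * \<tau>) i - U n i) \<le> Eb * \<tau> powr \<alpha>"
proof -
  have "nrm m (\<lambda>i. u 0 i - U 0 i) = nrm m (\<lambda>i. 0)" using u_0 U_0 by (intro nrm_cong) simp
  then have e0: "err 0 = 0" by (simp add: err_def t_def)
  have Q: "0 \<le> Qb * \<tau> powr \<alpha>" using Qb_nonneg by simp
  have "err n \<le> 2 * (Qb * \<tau> powr \<alpha>) * exp ((2 * L * gron) powr (1 / \<alpha>) * (real n * \<tau>))"
    by (rule discrete_gronwall[OF L_pos tau Q e0 error_recursion n])
  also have "\<dots> \<le> 2 * (Qb * \<tau> powr \<alpha>) * exp ((2 * L * gron) powr (1 / \<alpha>) * T)"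
    using Q t_le[OF n] by (intro mult_left_mono) (auto simp: t_def intro!: mult_left_mono)
  finally show ?thesis by (simp add: err_def t_def Eb_def mult_ac)
qed

end

section \<open>Smooth functions and mollification\<close>

lemma pderiv_dir_eqI: "(f has_derivative f') (at x) \<Longrightarrow> pderiv_dir b f x = f' b"
  unfolding pderiv_dir_def using frechet_derivative_at by metis

lemma has_derivative_pderiv_dir:
  assumes "f differentiable (at x)"
  shows "(f has_derivative (\<lambda>h. \<Sum>b\<in>Basis. (h \<bullet> b) * pderiv_dir b f x)) (at x)"
proof -
  have d: "(f has_derivative frechet_derivative f (at x)) (at x)"
    using assms by (simp add: frechet_derivative_works)
  then have l: "linear (frechet_derivative f (at x))" by (rule has_derivative_linear)
  have "frechet_derivative f (at x) h = (\<Sum>b\<in>Basis. (h \<bullet> b) * pderiv_dir b f x)" for h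
  proof -
    have "frechet_derivative f (at x) h = frechet_derivative f (at x) (\<Sum>b\<in>Basis. (h \<bullet> b) *\<^sub>R b)"
      by (simp add: euclidean_representation)
    also have "\<dots> = (\<Sum>b\<in>Basis. (h \<bullet> b) * pderiv_dir b f x)"
      by (simp add: linear_sum[OF l] linear_cmul[OF l] pderiv_dir_def)
    finally show ?thesis .
  qed
  then show ?thesis using d by (metis (no_types, lifting) ext)
qed

text \<open>In \<open>iterated_pderiv\<close> derivatives are added on the outside; here they are
  peeled off next to \<open>f\<close>, and counted. This order admits induction for sums, products
  and convolutions.\<close>

primrec Sm :: "nat \<Rightarrow> ('a::euclidean_space \<Rightarrow> real) \<Rightarrow> bool" where
  "Sm 0 f \<longleftrightarrow> (\<forall>x. f differentiable (at x))"
| "Sm (Suc k) f \<longleftrightarrow> (\<forall>x. f differentiable (at x)) \<and> (\<forall>b\<in>Basis. Sm k (pderiv_dir b f))"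

lemma iterated_pderiv_append: "iterated_pderiv (bs @ [b]) f = iterated_pderiv bs (pderiv_dir b f)"
  by (induction bs) auto

lemma Sm_iff:
  "Sm k f \<longleftrightarrow> (\<forall>bs\<in>lists Basis. length bs \<le> k \<longrightarrow> (\<forall>x. iterated_pderiv bs f differentiable (at x)))"
proof (induction k arbitrary: f)
  case (Suc k)
  show ?case
  proof
    assume S: "Sm (Suc k) f"
    show "\<forall>bs\<in>lists Basis. length bs \<le> Suc k \<longrightarrow> (\<forall>x. iterated_pderiv bs f differentiable (at x))"
    proof (intro ballI impI allI)
      fix bs :: "'a list" and x assume bs: "bs \<in> lists Basis" "length bs \<le> Suc k"
      show "iterated_pderiv bs f differentiable (at x)"
      proof (cases bs rule: rev_cases)
        case (snoc cs b)
        then have "b \<in> Basis" "cs \<in> lists Basis" "length cs \<le> k" using bs by auto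
        then show ?thesis using S Suc[of "pderiv_dir b f"] snoc by (simp add: iterated_pderiv_append)
      qed (use S in simp)
    qed
  next
    assume R: "\<forall>bs\<in>lists Basis. length bs \<le> Suc k \<longrightarrow> (\<forall>x. iterated_pderiv bs f differentiable (at x))"
    have "Sm k (pderiv_dir b f)" if b: "b \<in> Basis" for b
      unfolding Suc
    proof (intro ballI impI allI)
      fix bs :: "'a list" and x assume "bs \<in> lists Basis" "length bs \<le> k"
      then show "iterated_pderiv bs (pderiv_dir b f) differentiable (at x)"
        using R[rule_format, of "bs @ [b]" x] b by (simp add: iterated_pderiv_append)
    qed
    moreover have "f differentiable (at x)" for x using R[rule_format, of "[]" x] by simp
    ultimately show "Sm (Suc k) f" by simp
  qed
qed auto

lemma smooth_iff_Sm: "smooth f \<longleftrightarrow> (\<forall>k. Sm k f)"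
  unfolding smooth_def Sm_iff by (auto intro: order_refl)

lemma Sm_differentiable: "Sm k f \<Longrightarrow> f differentiable (at x)"
  by (cases k) auto

lemma Sm_mono: "Sm (Suc k) f \<Longrightarrow> Sm k f"
  unfolding Sm_iff by auto

lemma pderiv_dir_add:
  assumes "\<And>x. f differentiable (at x)" "\<And>x. g differentiable (at x)"
  shows "pderiv_dir b (\<lambda>x. f x + g x) = (\<lambda>x. pderiv_dir b f x + pderiv_dir b g x)"
proof
  fix x
  have "((\<lambda>x. f x + g x) has_derivative (\<lambda>h. frechet_derivative f (at x) h + frechet_derivative g (at x) h)) (at x)"
    using assms by (intro has_derivative_add) (simp_all add: frechet_derivative_works [symmetric])
  from pderiv_dir_eqI[OF this] show "pderiv_dir b (\<lambda>x. f x + g x) x = pderiv_dir b f x + pderiv_dir b g x"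
    by (simp add: pderiv_dir_def)
qed

lemma pderiv_dir_mult:
  assumes "f differentiable (at x)" "g differentiable (at x)"
  shows "pderiv_dir b (\<lambda>x. f x * g x) x = f x * pderiv_dir b g x + pderiv_dir b f x * g x"
proof -
  have "((\<lambda>x. f x * g x) has_derivative (\<lambda>h. f x * frechet_derivative g (at x) h + frechet_derivative f (at x) h * g x)) (at x)"
    using assms by (intro has_derivative_mult) (simp_all add: frechet_derivative_works [symmetric])
  from pderiv_dir_eqI[OF this] show ?thesis by (simp add: pderiv_dir_def)
qed

lemma Sm_add: "Sm k f \<Longrightarrow> Sm k g \<Longrightarrow> Sm k (\<lambda>x. f x + g x)"
proof (induction k arbitrary: f g)
  case (Suc k)
  then show ?case by (simp add: pderiv_dir_add differentiable_add)
qed (simp add: differentiable_add)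

lemma Sm_mult: "Sm k f \<Longrightarrow> Sm k g \<Longrightarrow> Sm k (\<lambda>x. f x * g x)"
proof (induction k arbitrary: f g)
  case (Suc k)
  have d: "\<And>x. f differentiable (at x)" "\<And>x. g differentiable (at x)" using Suc.prems by auto
  have "Sm k (pderiv_dir b (\<lambda>x. f x * g x))" if b: "b \<in> Basis" for b
  proof -
    have "Sm k (\<lambda>x. f x * pderiv_dir b g x + pderiv_dir b f x * g x)"
      using Suc.prems b Sm_mono[OF Suc.prems(1)] Sm_mono[OF Suc.prems(2)]
      by (intro Sm_add Suc.IH) auto
    then show ?thesis using pderiv_dir_mult[OF d] by (metis (no_types, lifting) ext)
  qed
  then show ?case using d by (simp add: differentiable_mult)
qed (simp add: differentiable_mult)

lemma Sm_const: "Sm k (\<lambda>x::'a::euclidean_space. c)"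
proof (induction k arbitrary: c)
  case (Suc k)
  have "pderiv_dir b (\<lambda>x. c) = (\<lambda>x. 0)" for b :: 'a by (simp add: pderiv_dir_def fun_eq_iff)
  then show ?case using Suc by simp
qed simp

lemma Sm_prod: "finite I \<Longrightarrow> (\<And>i. i \<in> I \<Longrightarrow> Sm k (f i)) \<Longrightarrow> Sm k (\<lambda>x. \<Prod>i\<in>I. f i x)"
proof (induction I rule: finite_induct)
  case (insert i I)
  then show ?case by (simp add: Sm_mult)
qed (simp add: Sm_const)

text \<open>The functions \<open>p(1/t) exp(-1/t)\<close> form a class closed under differentiation.\<close>

definition Ef :: "real poly \<Rightarrow> real \<Rightarrow> real" where
  "Ef p t = (if t > 0 then poly p (1 / t) * exp (- 1 / t) else 0)"

lemma poly_exp_tendsto_0: "((\<lambda>y::real. poly p y * exp (- y)) \<longlongrightarrow> 0) at_top"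
proof -
  have "((\<lambda>y::real. \<Sum>i\<le>degree p. coeff p i * (y ^ i / exp y)) \<longlongrightarrow> (\<Sum>i\<le>degree p. coeff p i * 0)) at_top"
    by (intro tendsto_sum tendsto_mult tendsto_const tendsto_power_div_exp_0)
  moreover have "(\<Sum>i\<le>degree p. coeff p i * (y ^ i / exp y)) = poly p y * exp (- y)" for y
    by (simp add: poly_altdef sum_distrib_right exp_minus divide_inverse mult.assoc)
  ultimately show ?thesis by simp
qed

text \<open>With y = 1/t one has d/dt = - y^2 d/dy, and p(y) exp(-y) has the derivative (p' - p)
  exp(-y); together they give the polynomial y^2 (p - p'). At 0 the difference quotient from the
  right is y p(y) exp(-y), which tends to 0 as y grows.\<close>

lemma Ef_deriv: "(Ef p has_real_derivative Ef ([:0, 0, 1:] * (p - pderiv p)) t) (at t)"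
proof -
  consider "t < 0" | "t > 0" | "t = 0" by linarith
  then show ?thesis
  proof cases
    case 1
    have "((\<lambda>x. 0) has_real_derivative 0) (at t)" by simp
    moreover have "\<forall>\<^sub>F x in nhds t. Ef p x = 0"
      using eventually_nhds_in_open[of "{..<0}" t] 1 by (auto elim!: eventually_mono simp: Ef_def)
    ultimately have "(Ef p has_real_derivative 0) (at t)"
      by (subst DERIV_cong_ev[OF refl _ refl]) auto
    then show ?thesis using 1 by (simp add: Ef_def)
  next
    case 2
    have "((\<lambda>x. poly p (1 / x) * exp (- 1 / x)) has_real_derivative
        (poly (pderiv p) (1 / t) * (- 1 / t\<^sup>2)) * exp (- 1 / t) + poly p (1 / t) * (exp (- 1 / t) * (1 / t\<^sup>2))) (at t)"
      using 2 by (auto intro!: derivative_eq_intros DERIV_chain2[OF poly_DERIV] simp: power2_eq_square field_simps)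
    moreover have "\<forall>\<^sub>F x in nhds t. Ef p x = poly p (1 / x) * exp (- 1 / x)"
      using eventually_nhds_in_open[of "{0<..}" t] 2 by (auto elim!: eventually_mono simp: Ef_def)
    ultimately have "(Ef p has_real_derivative
        (poly (pderiv p) (1 / t) * (- 1 / t\<^sup>2)) * exp (- 1 / t) + poly p (1 / t) * (exp (- 1 / t) * (1 / t\<^sup>2))) (at t)"
      by (subst DERIV_cong_ev[OF refl _ refl]) auto
    moreover have "(poly (pderiv p) (1 / t) * (- 1 / t\<^sup>2)) * exp (- 1 / t) + poly p (1 / t) * (exp (- 1 / t) * (1 / t\<^sup>2))
      = Ef ([:0, 0, 1:] * (p - pderiv p)) t"
      using 2 by (simp add: Ef_def power2_eq_square field_simps)
    ultimately show ?thesis by simp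
  next
    case 3
    have r: "((\<lambda>h. Ef p h / h) \<longlongrightarrow> 0) (at_right 0)"
      unfolding filterlim_at_right_to_top
    proof (rule tendsto_cong[THEN iffD1, OF _ poly_exp_tendsto_0[of "[:0, 1:] * p"]])
      show "\<forall>\<^sub>F x in at_top. poly ([:0, 1:] * p) x * exp (- x) = Ef p (inverse x) / inverse x"
        using eventually_gt_at_top[of 0] by eventually_elim (simp add: Ef_def field_simps)
    qed
    have l: "((\<lambda>h. Ef p h / h) \<longlongrightarrow> 0) (at_left 0)"
    proof (rule tendsto_eventually)
      show "\<forall>\<^sub>F h in at_left 0. Ef p h / h = 0"
        unfolding eventually_at_filter by (auto simp: Ef_def)
    qed
    have "((\<lambda>h. Ef p h / h) \<longlongrightarrow> 0) (at 0)" by (rule filterlim_split_at[OF l r])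
    then show ?thesis using 3 by (simp add: DERIV_def Ef_def[of _ 0])
  qed
qed

lemma Ef_inner_derivative:
  fixes c :: "'a::euclidean_space"
  shows "((\<lambda>x. Ef p (c \<bullet> x + a)) has_derivative (\<lambda>h. Ef ([:0, 0, 1:] * (p - pderiv p)) (c \<bullet> x + a) * (c \<bullet> h))) (at x)"
proof -
  have "((\<lambda>x. c \<bullet> x + a) has_derivative (\<lambda>h. c \<bullet> h)) (at x)" by (auto intro!: derivative_eq_intros)
  from has_derivative_compose[OF this, of "Ef p" "\<lambda>h. Ef ([:0, 0, 1:] * (p - pderiv p)) (c \<bullet> x + a) * h"]
  show ?thesis using Ef_deriv[of p "c \<bullet> x + a"] by (simp add: has_field_derivative_def)
qed

lemma Ef_inner_differentiable: "(\<lambda>x::'a::euclidean_space. Ef p (c \<bullet> x + a)) differentiable (at x)"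
  using Ef_inner_derivative unfolding differentiable_def by blast

lemma Sm_Ef: "Sm k (\<lambda>x::'a::euclidean_space. Ef p (c \<bullet> x + a))"
proof (induction k arbitrary: p)
  case (Suc k)
  have "Sm k (pderiv_dir b (\<lambda>x. Ef p (c \<bullet> x + a)))" for b
  proof -
    have "pderiv_dir b (\<lambda>x. Ef p (c \<bullet> x + a)) = (\<lambda>x. Ef ([:0, 0, 1:] * (p - pderiv p)) (c \<bullet> x + a) * (c \<bullet> b))"
      by (rule ext) (rule pderiv_dir_eqI[OF Ef_inner_derivative])
    then show ?thesis using Suc by (simp only: Sm_mult Sm_const)
  qed
  then show ?case by (simp add: Ef_inner_differentiable)
qed (simp add: Ef_inner_differentiable)

text \<open>The parameter \<open>n\<close> is a steepness: it is 1 in the mollifier, and as it tends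
  to infinity the bump tends to the indicator of the open box.\<close>

definition box_bump :: "real \<Rightarrow> 'a::euclidean_space \<Rightarrow> 'a \<Rightarrow> 'a \<Rightarrow> real" where
  "box_bump n l u x = (\<Prod>b\<in>Basis. Ef 1 (n * (x \<bullet> b - l \<bullet> b)) * Ef 1 (n * (u \<bullet> b - x \<bullet> b)))"

lemma Ef_1_bounds: "0 \<le> Ef 1 t" "Ef 1 t \<le> 1"
  by (auto simp: Ef_def)

lemma Ef_1_pos: "0 < Ef 1 t \<longleftrightarrow> 0 < t"
  by (auto simp: Ef_def)

lemma smooth_box_bump: "smooth (box_bump n l u)"
  unfolding smooth_iff_Sm box_bump_def [abs_def]
proof (intro allI Sm_prod Sm_mult)
  fix k and b :: 'a
  show "Sm k (\<lambda>x. Ef 1 (n * (x \<bullet> b - l \<bullet> b)))"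
    using Sm_Ef[of k 1 "n *\<^sub>R b" "- n * (l \<bullet> b)"] by (simp add: inner_commute algebra_simps)
  show "Sm k (\<lambda>x. Ef 1 (n * (u \<bullet> b - x \<bullet> b)))"
    using Sm_Ef[of k 1 "- n *\<^sub>R b" "n * (u \<bullet> b)"] by (simp add: inner_commute algebra_simps)
qed simp

lemma box_bump_bounds: "0 \<le> box_bump n l u x" "box_bump n l u x \<le> 1"
  unfolding box_bump_def using Ef_1_bounds
  by (auto intro!: prod_nonneg prod_le_1 mult_nonneg_nonneg mult_le_one)

lemma box_bump_pos:
  assumes "0 < n"
  shows "0 < box_bump n l u x \<longleftrightarrow> x \<in> box l u"
proof
  assume "x \<in> box l u"
  then show "0 < box_bump n l u x"
    unfolding box_bump_def using assms by (auto simp: mem_box Ef_1_pos intro!: prod_pos mult_pos_pos)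
next
  assume p: "0 < box_bump n l u x"
  show "x \<in> box l u"
  proof (rule ccontr)
    assume "x \<notin> box l u"
    then obtain b where b: "b \<in> Basis" "x \<bullet> b \<le> l \<bullet> b \<or> u \<bullet> b \<le> x \<bullet> b" by (auto simp: mem_box not_less)
    then have "Ef 1 (n * (x \<bullet> b - l \<bullet> b)) * Ef 1 (n * (u \<bullet> b - x \<bullet> b)) = 0"
      using assms by (auto simp: Ef_def zero_less_mult_iff)
    then have "box_bump n l u x = 0" unfolding box_bump_def using b by (intro prod_zero) auto
    then show False using p by simp
  qed
qed

lemma box_bump_eq_0: "0 < n \<Longrightarrow> x \<notin> box l u \<Longrightarrow> box_bump n l u x = 0"
  using box_bump_pos[of n l u x] box_bump_bounds(1)[of n l u x] by auto

lemma box_bump_test_function: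
  assumes "0 < n" "cbox l u \<subseteq> \<Omega>"
  shows "box_bump n l u \<in> test_functions \<Omega>"
proof -
  have "{x. box_bump n l u x \<noteq> 0} \<subseteq> cbox l u"
    using box_bump_eq_0[OF assms(1)] box_subset_cbox by blast
  then have "closure {x. box_bump n l u x \<noteq> 0} \<subseteq> cbox l u"
    by (intro closure_minimal) auto
  moreover from this have "bounded (closure {x. box_bump n l u x \<noteq> 0})"
    by (rule bounded_subset[OF bounded_cbox])
  ultimately show ?thesis
    unfolding test_functions_def using assms smooth_box_bump
    by (auto simp: compact_eq_bounded_closed)
qed

lemma box_bump_tendsto: "(\<lambda>k. box_bump (real (Suc k)) l u x) \<longlonglongrightarrow> indicator (box l u) x"
proof (cases "x \<in> box l u")
  case True
  have lim: "(\<lambda>k. Ef 1 (real (Suc k) * a)) \<longlonglongrightarrow> 1" if a: "0 < a" for a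
  proof -
    have "(\<lambda>k. exp (- (1 / a) * (1 / real (Suc k)))) \<longlonglongrightarrow> exp (- (1 / a) * 0)"
      by (intro tendsto_intros LIMSEQ_Suc lim_1_over_n)
    moreover have "exp (- (1 / a) * (1 / real (Suc k))) = Ef 1 (real (Suc k) * a)" for k
      using a by (simp add: Ef_def mult.commute)
    ultimately show ?thesis by simp
  qed
  have "(\<lambda>k. box_bump (real (Suc k)) l u x) \<longlonglongrightarrow> (\<Prod>b\<in>(Basis::'a set). 1 * 1)"
    unfolding box_bump_def using True by (intro tendsto_prod tendsto_mult lim) (auto simp: mem_box)
  then show ?thesis using True by simp
next
  case False
  have "box_bump (real (Suc k)) l u x = 0" for k by (rule box_bump_eq_0) (use False in auto)
  then show ?thesis using False by simp
qed

lemma smooth_differentiable: "smooth f \<Longrightarrow> f differentiable (at x)"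
  unfolding smooth_iff_Sm using Sm_differentiable by blast

lemma smooth_pderiv: "smooth f \<Longrightarrow> b \<in> Basis \<Longrightarrow> smooth (pderiv_dir b f)"
  unfolding smooth_iff_Sm by (metis Sm.simps(2))

lemma smooth_continuous: "smooth f \<Longrightarrow> continuous_on S f"
  using smooth_differentiable differentiable_imp_continuous_within
  by (metis continuous_at_imp_continuous_on)

section \<open>Convolution with smooth kernels\<close>

lemma conv_has_derivative:
  fixes \<rho> w :: "'a::euclidean_space \<Rightarrow> real"
  assumes \<rho>: "smooth \<rho>" and w: "continuous_on UNIV w"
  shows "((\<lambda>x. integral (cbox p q) (\<lambda>t. \<rho> (x - t) * w t)) has_derivative
     (\<lambda>h. \<Sum>b\<in>Basis. (h \<bullet> b) * integral (cbox p q) (\<lambda>t. pderiv_dir b \<rho> (x - t) * w t))) (at x)"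
proof -
  define fx where "fx x t = w t *\<^sub>R (\<Sum>b\<in>Basis. pderiv_dir b \<rho> (x - t) *\<^sub>R blinfun_inner_right b)" for x t :: 'a
  have cp: "continuous_on S (\<lambda>y. pderiv_dir b \<rho> (g y))" if "continuous_on S g" "b \<in> Basis" for S b and g :: "'a \<times> 'a \<Rightarrow> 'a"
    using that smooth_continuous[OF smooth_pderiv[OF \<rho>], of b UNIV] continuous_on_compose2 by blast
  have cp1: "continuous_on S (\<lambda>y. pderiv_dir b \<rho> (g y))" if "continuous_on S g" "b \<in> Basis" for S b and g :: "'a \<Rightarrow> 'a"
    using that smooth_continuous[OF smooth_pderiv[OF \<rho>], of b UNIV] continuous_on_compose2 by blast
  have cr1: "continuous_on S (\<lambda>y. \<rho> (g y))" if "continuous_on S g" for S and g :: "'a \<Rightarrow> 'a"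
    using that smooth_continuous[OF \<rho>, of UNIV] continuous_on_compose2 by blast
  have cw: "continuous_on S (\<lambda>y. w (g y))" if "continuous_on S g" for S and g :: "'a \<times> 'a \<Rightarrow> 'a"
    using that w continuous_on_compose2 by blast
  have w': "continuous_on S w" for S using w continuous_on_subset by blast
  have bf: "blinfun_apply (fx x t) = (\<lambda>h. (\<Sum>b\<in>Basis. (h \<bullet> b) * pderiv_dir b \<rho> (x - t)) * w t)" for x t
    by (rule ext) (simp add: fx_def blinfun.scaleR_left blinfun.sum_left inner_commute mult_ac)
  have "((\<lambda>x. integral (cbox p q) (\<lambda>t. \<rho> (x - t) * w t)) has_derivative blinfun_apply (integral (cbox p q) (fx x))) (at x within UNIV)"
  proof (rule leibniz_rule)
    fix x t :: 'a
    have "((\<lambda>x. x - t) has_derivative (\<lambda>h. h)) (at x)" by (auto intro!: derivative_eq_intros)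
    from has_derivative_compose[OF this has_derivative_pderiv_dir[OF smooth_differentiable[OF \<rho>]]]
    have "((\<lambda>x. \<rho> (x - t)) has_derivative (\<lambda>h. \<Sum>b\<in>Basis. (h \<bullet> b) * pderiv_dir b \<rho> (x - t))) (at x)" .
    then have "((\<lambda>x. \<rho> (x - t) * w t) has_derivative (\<lambda>h. (\<Sum>b\<in>Basis. (h \<bullet> b) * pderiv_dir b \<rho> (x - t)) * w t)) (at x)"
      by (rule has_derivative_mult_left)
    then show "((\<lambda>x. \<rho> (x - t) * w t) has_derivative blinfun_apply (fx x t)) (at x within UNIV)"
      unfolding bf by simp
  next
    fix x :: 'a
    show "(\<lambda>t. \<rho> (x - t) * w t) integrable_on cbox p q"
      by (intro integrable_continuous continuous_intros cr1 w')
  next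
    show "continuous_on (UNIV \<times> cbox p q) (\<lambda>(x, t). fx x t)"
      unfolding fx_def split_beta by (intro continuous_intros cp cw) auto
  qed auto
  moreover have "blinfun_apply (integral (cbox p q) (fx x)) h =
      (\<Sum>b\<in>Basis. (h \<bullet> b) * integral (cbox p q) (\<lambda>t. pderiv_dir b \<rho> (x - t) * w t))" for h
  proof -
    have "fx x integrable_on cbox p q"
      unfolding fx_def by (intro integrable_continuous continuous_intros cp1 w') auto
    then have "blinfun_apply (integral (cbox p q) (fx x)) h = integral (cbox p q) (\<lambda>t. blinfun_apply (fx x t) h)"
      by (rule blinfun_apply_integral)
    also have "\<dots> = integral (cbox p q) (\<lambda>t. \<Sum>b\<in>Basis. (h \<bullet> b) * (pderiv_dir b \<rho> (x - t) * w t))"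
      by (simp only: bf sum_distrib_right mult.assoc)
    also have "\<dots> = (\<Sum>b\<in>Basis. integral (cbox p q) (\<lambda>t. (h \<bullet> b) * (pderiv_dir b \<rho> (x - t) * w t)))"
      by (intro integral_sum integrable_continuous continuous_intros cp1 w') auto
    finally show ?thesis by simp
  qed
  then have "blinfun_apply (integral (cbox p q) (fx x)) = (\<lambda>h. \<Sum>b\<in>Basis. (h \<bullet> b) * integral (cbox p q) (\<lambda>t. pderiv_dir b \<rho> (x - t) * w t))"
    by (rule ext)
  ultimately show ?thesis by (simp only:)
qed

lemma smooth_conv:
  fixes \<rho> w :: "'a::euclidean_space \<Rightarrow> real"
  assumes \<rho>: "smooth \<rho>" and w: "continuous_on UNIV w"
  shows "smooth (\<lambda>x. integral (cbox p q) (\<lambda>t. \<rho> (x - t) * w t))"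
  unfolding smooth_iff_Sm
proof
  fix k
  show "Sm k (\<lambda>x. integral (cbox p q) (\<lambda>t. \<rho> (x - t) * w t))" using \<rho>
  proof (induction k arbitrary: \<rho>)
    case 0
    show ?case using conv_has_derivative[OF 0 w, of p q] unfolding Sm.simps differentiable_def by blast
  next
    case (Suc k)
    have "pderiv_dir b (\<lambda>x. integral (cbox p q) (\<lambda>t. \<rho> (x - t) * w t)) = (\<lambda>x. integral (cbox p q) (\<lambda>t. pderiv_dir b \<rho> (x - t) * w t))"
      if b: "b \<in> Basis" for b
    proof
      fix x
      show "pderiv_dir b (\<lambda>x. integral (cbox p q) (\<lambda>t. \<rho> (x - t) * w t)) x = integral (cbox p q) (\<lambda>t. pderiv_dir b \<rho> (x - t) * w t)"
        unfolding pderiv_dir_eqI[OF conv_has_derivative[OF Suc.prems w]] using b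
        by (subst sum.remove[of _ b]) (auto simp: inner_Basis intro!: sum.neutral split: if_splits)
    qed
    moreover have "(\<lambda>x. integral (cbox p q) (\<lambda>t. \<rho> (x - t) * w t)) differentiable (at x)" for x
      using conv_has_derivative[OF Suc.prems w, of p q] unfolding differentiable_def by blast
    ultimately show ?case using Suc.IH smooth_pderiv[OF Suc.prems] by simp
  qed
qed

lemma lborel_integral_reflect:
  fixes f :: "'a::euclidean_space \<Rightarrow> real"
  assumes [measurable]: "f \<in> borel_measurable borel"
  shows "(\<integral>t. f (x - t) \<partial>lborel) = (\<integral>t. f t \<partial>lborel)"
proof -
  have "lborel = density (distr lborel borel (\<lambda>t::'a. x + (-1) *\<^sub>R t)) (\<lambda>_. \<bar>-1::real\<bar> ^ DIM('a))"
    by (rule lborel_affine) simp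
  then have "lborel = distr lborel borel (\<lambda>t::'a. x - t)" by (simp add: density_1)
  then have "(\<integral>t. f t \<partial>lborel) = (\<integral>t. f t \<partial>distr lborel borel (\<lambda>t. x - t))" by simp
  also have "\<dots> = (\<integral>t. f (x - t) \<partial>lborel)" by (rule integral_distr) auto
  finally show ?thesis by simp
qed

lemma integrable_bounded_support:
  fixes f :: "'a::euclidean_space \<Rightarrow> real"
  assumes [measurable]: "f \<in> borel_measurable borel"
    and S: "bounded S" "\<And>x. x \<notin> S \<Longrightarrow> f x = 0" and B: "\<And>x. \<bar>f x\<bar> \<le> B"
  shows "integrable lborel f"
proof -
  obtain p q where pq: "S \<subseteq> cbox p q" using bounded_subset_cbox_symmetric[OF S(1)] by blast
  show ?thesis
  proof (rule integrableI_bounded_set[of "cbox p q" lborel f B])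
    show "AE x in lborel. x \<notin> cbox p q \<longrightarrow> f x = 0" using pq S by auto
  qed (use B in \<open>auto simp: emeasure_lborel_cbox_eq\<close>)
qed

definition cube :: "real \<Rightarrow> 'a::euclidean_space set" where
  "cube r = box (- (r *\<^sub>R One)) (r *\<^sub>R One)"

lemma cube_norm: "x \<in> cube (r::real) \<Longrightarrow> norm (x::'a::euclidean_space) \<le> r * DIM('a)"
proof -
  assume x: "x \<in> cube r"
  have "norm x \<le> (\<Sum>b\<in>Basis. \<bar>x \<bullet> b\<bar>)" by (rule norm_le_l1)
  also have "\<dots> \<le> (\<Sum>b\<in>(Basis::'a set). r)"
    using x by (intro sum_mono) (auto simp: cube_def mem_box abs_le_iff less_imp_le)
  finally show ?thesis by (simp add: mult.commute)
qed

text \<open>A bump of mass 1 on a cube rather than a ball, so lengths on its support are bounded by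
  r * DIM('a) through \<open>cube_norm\<close>.\<close>

definition mollifier :: "real \<Rightarrow> 'a::euclidean_space \<Rightarrow> real" where
  "mollifier r x = box_bump 1 (- (r *\<^sub>R One)) (r *\<^sub>R One) x * inverse (\<integral>y. box_bump 1 (- (r *\<^sub>R One)) (r *\<^sub>R (One::'a)) y \<partial>lborel)"

lemma borel_measurable_smooth: "smooth f \<Longrightarrow> f \<in> borel_measurable borel"
  by (intro borel_measurable_continuous_onI smooth_continuous)

lemma box_bump_integrable: "integrable lborel (box_bump 1 l u)"
  by (rule integrable_bounded_support[where S = "box l u" and B = 1])
    (use box_bump_bounds[of 1 l u] in \<open>auto simp: box_bump_eq_0 intro!: borel_measurable_smooth smooth_box_bump\<close>)

lemma box_bump_integral_pos:
  assumes r: "0 < r"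
  shows "0 < (\<integral>y. box_bump 1 (- (r *\<^sub>R One)) (r *\<^sub>R (One::'a::euclidean_space)) y \<partial>lborel)" (is "0 < ?I")
proof -
  have "0 \<le> ?I" by (intro Bochner_Integration.integral_nonneg box_bump_bounds)
  moreover have "?I \<noteq> 0"
  proof
    assume "?I = 0"
    then have "AE y in lborel. box_bump 1 (- (r *\<^sub>R One)) (r *\<^sub>R (One::'a)) y = 0"
      by (subst (asm) integral_nonneg_eq_0_iff_AE[OF box_bump_integrable]) (auto intro: box_bump_bounds)
    then have "AE y in lborel. (y::'a) \<notin> cube r"
      by (rule eventually_mono) (use box_bump_pos[of 1 "- (r *\<^sub>R One)" "r *\<^sub>R One"] in \<open>force simp: cube_def\<close>)
    then have "emeasure lborel (cube r :: 'a set) = 0"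
      by (subst (asm) AE_iff_measurable[of "cube r"]) (auto simp: cube_def)
    then show False using r by (auto simp: cube_def emeasure_lborel_box_eq inner_simps prod_zero_iff)
  qed
  ultimately show ?thesis by simp
qed

lemma smooth_mollifier: "smooth (mollifier r)"
  using smooth_box_bump[unfolded smooth_iff_Sm] unfolding smooth_iff_Sm mollifier_def [abs_def]
  by (intro allI Sm_mult Sm_const) (rule spec)

lemma mollifier_nonneg: "0 \<le> mollifier r x"
  unfolding mollifier_def by (intro mult_nonneg_nonneg box_bump_bounds) (simp add: box_bump_bounds Bochner_Integration.integral_nonneg)

lemma mollifier_eq_0: "x \<notin> cube r \<Longrightarrow> mollifier r x = 0"
  by (simp add: mollifier_def cube_def box_bump_eq_0)

lemma has_integral_mollifier:
  assumes "0 < r" shows "has_bochner_integral lborel (mollifier r :: 'a::euclidean_space \<Rightarrow> real) 1"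
proof -
  have "has_bochner_integral lborel (mollifier r :: 'a \<Rightarrow> real) ((\<integral>y. box_bump 1 (- (r *\<^sub>R One)) (r *\<^sub>R (One::'a)) y \<partial>lborel) * inverse (\<integral>y. box_bump 1 (- (r *\<^sub>R One)) (r *\<^sub>R (One::'a)) y \<partial>lborel))"
    unfolding mollifier_def [abs_def]
    by (rule has_bochner_integral_mult_left) (rule has_bochner_integral_integrable[OF box_bump_integrable])
  then show ?thesis using box_bump_integral_pos[OF assms, where 'a = 'a] by simp
qed

definition mollify :: "real \<Rightarrow> ('a::euclidean_space \<Rightarrow> real) \<Rightarrow> 'a \<Rightarrow> real" where
  "mollify r w x = (\<integral>y. mollifier r y * w (x - y) \<partial>lborel)"

lemma mollify_integrable:
  fixes w :: "'a::euclidean_space \<Rightarrow> real" and r :: real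
  assumes r: "0 < r" and w: "continuous_on UNIV w" and B: "\<And>x. \<bar>w x\<bar> \<le> B"
  shows "integrable lborel (\<lambda>y. mollifier r y * w (x - y))"
proof -
  have [measurable]: "w \<in> borel_measurable borel" by (rule borel_measurable_continuous_onI[OF w])
  have [measurable]: "mollifier r \<in> borel_measurable borel" by (rule borel_measurable_smooth[OF smooth_mollifier])
  have i: "integrable lborel (\<lambda>y. mollifier r y * B)"
    by (intro integrable_mult_left integrable.intros[OF has_integral_mollifier[OF r]])
  show ?thesis
    by (rule Bochner_Integration.integrable_bound[OF i])
      (use B mollifier_nonneg[of r] in \<open>auto simp: abs_mult intro!: mult_mono AE_I2 order_trans[OF B abs_ge_self]\<close>)
qed

text \<open>Reflection moves the variable from \<open>w\<close> to the mollifier, and the bounded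
  support of \<open>w\<close> reduces the integral to a fixed box, as the Leibniz rule behind
  \<open>smooth_conv\<close> requires.\<close>

lemma smooth_mollify:
  fixes w :: "'a::euclidean_space \<Rightarrow> real" and r :: real
  assumes r: "0 < r" and w: "continuous_on UNIV w" and S: "bounded S" "\<And>x. x \<notin> S \<Longrightarrow> w x = 0"
    and B: "\<And>x. \<bar>w x\<bar> \<le> B"
  shows "smooth (mollify r w)"
proof -
  have [measurable]: "w \<in> borel_measurable borel" by (rule borel_measurable_continuous_onI[OF w])
  have [measurable]: "mollifier r \<in> borel_measurable borel" by (rule borel_measurable_smooth[OF smooth_mollifier])
  obtain p q where pq: "S \<subseteq> cbox p q" using bounded_subset_cbox_symmetric[OF S(1)] by blast
  have "mollify r w = (\<lambda>x. integral (cbox p q) (\<lambda>t. mollifier r (x - t) * w t))"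
  proof
    fix x
    have "mollify r w x = (\<integral>t. mollifier r (x - (x - t)) * w (x - t) \<partial>lborel)" by (simp add: mollify_def)
    also have "\<dots> = (\<integral>t. mollifier r (x - t) * w t \<partial>lborel)"
      by (rule lborel_integral_reflect[where f = "\<lambda>t. mollifier r (x - t) * w t"]) measurable
    also have "\<dots> = (\<integral>t. indicator (cbox p q) t *\<^sub>R (mollifier r (x - t) * w t) \<partial>lborel)"
      using S pq by (intro Bochner_Integration.integral_cong) (auto simp: indicator_def)
    also have "\<dots> = integral (cbox p q) (\<lambda>t. mollifier r (x - t) * w t)"
    proof -
      have "continuous_on (cbox p q) (\<lambda>t. mollifier r (x - t) * w t)"
        by (intro continuous_intros continuous_on_compose2[OF smooth_continuous[OF smooth_mollifier, of UNIV]]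
              continuous_on_subset[OF w]) auto
      then have "set_integrable lborel (cbox p q) (\<lambda>t. mollifier r (x - t) * w t)" unfolding set_integrable_def by (rule borel_integrable_compact[OF compact_cbox])
      from set_borel_integral_eq_integral(2)[OF this] show ?thesis by (simp add: set_lebesgue_integral_def)
    qed
    finally show "mollify r w x = integral (cbox p q) (\<lambda>t. mollifier r (x - t) * w t)" .
  qed
  then show ?thesis using smooth_conv[OF smooth_mollifier w] by simp
qed

text \<open>An average of mass 1 stays within \<open>D\<close> of \<open>c\<close> if the averaged
  values do. The choice c = 0 gives uniform bounds, the choice c = w x gives convergence.\<close>

lemma mollify_bound:
  fixes w :: "'a::euclidean_space \<Rightarrow> real" and r c D B :: real
  assumes r: "0 < r" and w: "continuous_on UNIV w" and B: "\<And>x. \<bar>w x\<bar> \<le> B"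
    and le: "\<And>y. y \<in> cube r \<Longrightarrow> \<bar>w (x - y) - c\<bar> \<le> D"
  shows "\<bar>mollify r w x - c\<bar> \<le> D"
proof -
  have hm: "has_bochner_integral lborel (\<lambda>y::'a. mollifier r y * k) (1 * k)" for k
    by (intro has_bochner_integral_mult_left has_integral_mollifier r)
  have h: "has_bochner_integral lborel (\<lambda>y::'a. mollifier r y * w (x - y) - mollifier r y * c) (mollify r w x - 1 * c)"
    unfolding mollify_def
    by (intro has_bochner_integral_diff hm has_bochner_integral_integrable mollify_integrable[OF r w B])
  have "\<bar>mollify r w x - c\<bar> = \<bar>\<integral>y. mollifier r (y::'a) * w (x - y) - mollifier r y * c \<partial>lborel\<bar>"
    using has_bochner_integral_integral_eq[OF h] by simp
  also have "\<dots> \<le> (\<integral>y. \<bar>mollifier r (y::'a) * w (x - y) - mollifier r y * c\<bar> \<partial>lborel)" by (rule integral_abs_bound)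
  also have "\<dots> \<le> (\<integral>y. mollifier r (y::'a) * D \<partial>lborel)"
  proof (rule integral_mono)
    show "integrable lborel (\<lambda>y::'a. \<bar>mollifier r y * w (x - y) - mollifier r y * c\<bar>)"
      by (rule integrable_abs) (rule integrable.intros[OF h])
    show "integrable lborel (\<lambda>y::'a. mollifier r y * D)" by (rule integrable.intros[OF hm])
    fix y :: 'a
    show "\<bar>mollifier r y * w (x - y) - mollifier r y * c\<bar> \<le> mollifier r y * D"
    proof (cases "y \<in> cube r")
      case True
      then show ?thesis using le[OF True] mollifier_nonneg[of r y]
        by (simp add: right_diff_distrib [symmetric] abs_mult mult_left_mono)
    qed (simp add: mollifier_eq_0)
  qed
  also have "\<dots> = D" using has_bochner_integral_integral_eq[OF hm[of D]] by simp
  finally show ?thesis .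
qed

lemma mollify_lipschitz:
  fixes w :: "'a::euclidean_space \<Rightarrow> real" and r :: real
  assumes r: "0 < r" and w: "M-lipschitz_on UNIV w" and B: "\<And>x. \<bar>w x\<bar> \<le> B"
  shows "\<bar>mollify r w x - mollify r w x'\<bar> \<le> M * dist x x'"
proof -
  have c: "continuous_on UNIV w" by (rule lipschitz_on_continuous_on[OF w])
  have hm: "has_bochner_integral lborel (\<lambda>y::'a. mollifier r y * k) (1 * k)" for k
    by (intro has_bochner_integral_mult_left has_integral_mollifier r)
  have h: "has_bochner_integral lborel (\<lambda>y::'a. mollifier r y * w (x - y) - mollifier r y * w (x' - y)) (mollify r w x - mollify r w x')"
    unfolding mollify_def
    by (intro has_bochner_integral_diff has_bochner_integral_integrable mollify_integrable[OF r c B])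
  have "\<bar>mollify r w x - mollify r w x'\<bar> = \<bar>\<integral>y. mollifier r (y::'a) * w (x - y) - mollifier r y * w (x' - y) \<partial>lborel\<bar>"
    using has_bochner_integral_integral_eq[OF h] by simp
  also have "\<dots> \<le> (\<integral>y. \<bar>mollifier r (y::'a) * w (x - y) - mollifier r y * w (x' - y)\<bar> \<partial>lborel)" by (rule integral_abs_bound)
  also have "\<dots> \<le> (\<integral>y. mollifier r (y::'a) * (M * dist x x') \<partial>lborel)"
  proof (rule integral_mono)
    show "integrable lborel (\<lambda>y::'a. \<bar>mollifier r y * w (x - y) - mollifier r y * w (x' - y)\<bar>)"
      by (rule integrable_abs) (rule integrable.intros[OF h])
    show "integrable lborel (\<lambda>y::'a. mollifier r y * (M * dist x x'))" by (rule integrable.intros[OF hm])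
    fix y :: 'a
    have "\<bar>w (x - y) - w (x' - y)\<bar> \<le> M * dist x x'"
      using lipschitz_onD[OF w, of "x - y" "x' - y"] by (simp add: dist_norm)
    then show "\<bar>mollifier r y * w (x - y) - mollifier r y * w (x' - y)\<bar> \<le> mollifier r y * (M * dist x x')"
      using mollifier_nonneg[of r y] by (simp add: right_diff_distrib [symmetric] abs_mult mult_left_mono)
  qed
  also have "\<dots> = M * dist x x'" using has_bochner_integral_integral_eq[OF hm[of "M * dist x x'"]] by simp
  finally show ?thesis .
qed

text \<open>The averaged differences w (z - y) - w (x - y) equal the constant a \<bullet> (z - x),
  so the mollification is affine near \<open>x\<close> with the same slope. Half of \<open>d\<close>
  is spent on \<open>z\<close> and half on the support of the mollifier.\<close>

lemma mollify_affine:
  fixes w :: "'a::euclidean_space \<Rightarrow> real" and r d :: real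
  assumes r: "0 < r" and d: "r * DIM('a) < d / 2" and w: "continuous_on UNIV w" and B: "\<And>x. \<bar>w x\<bar> \<le> B"
    and aff: "\<And>z. z \<in> ball x d \<Longrightarrow> w z = a \<bullet> z + c"
  shows "pderiv_dir b (mollify r w) x = a \<bullet> b"
proof -
  define e where "e = mollify r w x - a \<bullet> x"
  have eq: "mollify r w z = a \<bullet> z + e" if z: "z \<in> ball x (d / 2)" for z
  proof -
    have i: "integrable lborel (\<lambda>y::'a. mollifier r y * w (z' - y))" for z' by (rule mollify_integrable[OF r w B])
    have "mollify r w z - mollify r w x = (\<integral>y. mollifier r (y::'a) * w (z - y) - mollifier r y * w (x - y) \<partial>lborel)"
      unfolding mollify_def by (rule Bochner_Integration.integral_diff [symmetric, OF i i])
    also have "\<dots> = (\<integral>y. mollifier r (y::'a) * (a \<bullet> (z - x)) \<partial>lborel)"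
    proof (rule Bochner_Integration.integral_cong)
      fix y :: 'a
      show "mollifier r y * w (z - y) - mollifier r y * w (x - y) = mollifier r y * (a \<bullet> (z - x))"
      proof (cases "y \<in> cube r")
        case True
        have y: "norm y < d / 2" using cube_norm[OF True] d by simp
        have "dist x (z - y) \<le> dist x z + norm y"
          by (metis add.commute diff_add_cancel dist_norm dist_triangle norm_minus_commute add_diff_cancel_left')
        then have "z - y \<in> ball x d" using z y by simp
        moreover have "norm y < d" using y norm_ge_zero[of y] by linarith
        then have "x - y \<in> ball x d" by (simp add: dist_norm)
        ultimately show ?thesis using aff by (simp add: inner_diff_right algebra_simps)
      qed (simp add: mollifier_eq_0)
    qed simp
    also have "\<dots> = a \<bullet> (z - x)"
      using has_bochner_integral_integral_eq[OF has_integral_mollifier[OF r, where 'a = 'a]] by simp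
    finally show ?thesis by (simp add: e_def inner_diff_right)
  qed
  have hd: "((\<lambda>z. a \<bullet> z + e) has_derivative (\<lambda>h. a \<bullet> h)) (at x)" by (auto intro!: derivative_eq_intros)
  have "0 \<le> r * DIM('a)" using r by simp
  then have "0 < d" using d by linarith
  then have "(mollify r w has_derivative (\<lambda>h. a \<bullet> h)) (at x)"
    using eq by (intro has_derivative_transform_within_open[OF hd open_ball[of x "d / 2"]]) auto
  then show ?thesis by (rule pderiv_dir_eqI)
qed

section \<open>Lipschitz functions and weak derivatives\<close>

definition dq :: "'a::euclidean_space \<Rightarrow> ('a \<Rightarrow> real) \<Rightarrow> nat \<Rightarrow> 'a \<Rightarrow> real" where
  "dq b w n x = real (Suc n) * (w (x + (1 / real (Suc n)) *\<^sub>R b) - w x)"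

text \<open>A Borel measurable directional derivative, meaningless where the limit does not exist.\<close>

definition ddir :: "'a::euclidean_space \<Rightarrow> ('a \<Rightarrow> real) \<Rightarrow> 'a \<Rightarrow> real" where
  "ddir b w x = lim (\<lambda>n. dq b w n x)"

lemma dq_tendsto:
  assumes "(w has_derivative w') (at x)"
  shows "(\<lambda>n. dq b w n x) \<longlonglongrightarrow> w' b"
proof -
  have l: "linear w'" using assms by (rule has_derivative_linear)
  have "((\<lambda>t::real. x + t *\<^sub>R b) has_derivative (\<lambda>t. t *\<^sub>R b)) (at 0)" by (auto intro!: derivative_eq_intros)
  moreover have "(w has_derivative w') (at (x + 0 *\<^sub>R b))" using assms by simp
  ultimately have "((\<lambda>t. w (x + t *\<^sub>R b)) has_derivative (\<lambda>t. w' (t *\<^sub>R b))) (at 0)" by (rule has_derivative_compose)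
  moreover have "(\<lambda>t. w' (t *\<^sub>R b)) = (*) (w' b)" by (simp add: fun_eq_iff linear_cmul[OF l])
  ultimately have "((\<lambda>t. w (x + t *\<^sub>R b)) has_real_derivative w' b) (at 0)"
    by (simp only: has_field_derivative_def)
  then have lim: "((\<lambda>h. (w (x + h *\<^sub>R b) - w x) / h) \<longlongrightarrow> w' b) (at 0)" by (simp add: DERIV_def)
  have "filterlim (\<lambda>n. 1 / real (Suc n)) (at 0) sequentially"
    unfolding filterlim_at using LIMSEQ_Suc[OF lim_1_over_n[where 'a = real]] by simp
  from filterlim_compose[OF lim this] show ?thesis by (simp add: dq_def field_simps)
qed

lemma ddir_eq: "(w has_derivative w') (at x) \<Longrightarrow> ddir b w x = w' b"
  unfolding ddir_def by (rule limI) (rule dq_tendsto)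

lemma ddir_eq_pderiv_dir: "w differentiable (at x) \<Longrightarrow> ddir b w x = pderiv_dir b w x"
  using ddir_eq[of w "frechet_derivative w (at x)" x b] by (simp add: frechet_derivative_works pderiv_dir_def)

lemma dq_bound:
  assumes "M-lipschitz_on UNIV w" "b \<in> Basis"
  shows "\<bar>dq b w n x\<bar> \<le> M"
proof -
  have "\<bar>w (x + (1 / real (Suc n)) *\<^sub>R b) - w x\<bar> \<le> M * (1 / real (Suc n))"
    using lipschitz_onD[OF assms(1), of "x + (1 / real (Suc n)) *\<^sub>R b" x] assms(2) by (simp add: dist_norm)
  then have "real (Suc n) * \<bar>w (x + (1 / real (Suc n)) *\<^sub>R b) - w x\<bar> \<le> real (Suc n) * (M * (1 / real (Suc n)))"
    by (rule mult_left_mono) simp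
  then show ?thesis by (simp add: dq_def abs_mult)
qed

lemma derivative_bound:
  assumes "M-lipschitz_on UNIV w" "b \<in> Basis" "(w has_derivative w') (at x)"
  shows "\<bar>w' b\<bar> \<le> M"
  using tendsto_rabs[OF dq_tendsto[OF assms(3), of b]] dq_bound[OF assms(1,2)]
  by (intro tendsto_upperbound[of _ _ sequentially]) auto

lemma lipschitz_measurable:
  fixes w :: "'a::euclidean_space \<Rightarrow> real"
  shows "M-lipschitz_on UNIV w \<Longrightarrow> w \<in> borel_measurable borel"
  by (intro borel_measurable_continuous_onI lipschitz_on_continuous_on)

lemma ddir_measurable:
  assumes [measurable]: "w \<in> borel_measurable borel"
  shows "ddir b w \<in> borel_measurable borel"
  unfolding ddir_def [abs_def] dq_def by (rule borel_measurable_lim_metric) measurable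

lemma lipschitz_bounded:
  fixes w :: "'a::euclidean_space \<Rightarrow> real"
  assumes w: "M-lipschitz_on UNIV w" and S: "bounded S" "\<And>x. x \<notin> S \<Longrightarrow> w x = 0"
  obtains B where "0 \<le> B" "\<And>x. \<bar>w x\<bar> \<le> B"
proof (cases "S = {}")
  case True
  then show ?thesis using S by (intro that[of 0]) auto
next
  case False
  obtain R where R: "\<And>x. x \<in> S \<Longrightarrow> norm x \<le> R" using S(1) unfolding bounded_iff by blast
  have M: "0 \<le> M" by (rule lipschitz_on_nonneg[OF w])
  have "\<bar>w x\<bar> \<le> \<bar>w 0\<bar> + M * \<bar>R\<bar>" for x
  proof (cases "x \<in> S")
    case True
    have "\<bar>w x - w 0\<bar> \<le> M * norm x" using lipschitz_onD[OF w, of x 0] by (simp add: dist_norm)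
    also have "\<dots> \<le> M * \<bar>R\<bar>" using R[OF True] M by (intro mult_left_mono) auto
    finally show ?thesis by linarith
  qed (use S M in simp)
  then show ?thesis using M by (intro that[of "\<bar>w 0\<bar> + M * \<bar>R\<bar>"]) auto
qed

text \<open>Difference quotients integrate to zero by translation invariance, and the Lipschitz
  constant dominates them on a bounded set, so the limit integrates to zero. Finite element
  functions meet the differentiability hypothesis because they are locally affine off a null
  set.\<close>

lemma integral_ddir_eq_0:
  fixes w :: "'a::euclidean_space \<Rightarrow> real"
  assumes w: "M-lipschitz_on UNIV w" and S: "bounded S" "\<And>x. x \<notin> S \<Longrightarrow> w x = 0"
    and b: "b \<in> Basis" and d: "AE x in lborel. w differentiable (at x)"
  shows "has_bochner_integral lborel (ddir b w) 0"
proof -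
  have [measurable]: "w \<in> borel_measurable borel" by (rule lipschitz_measurable[OF w])
  obtain B where B: "0 \<le> B" "\<And>x. \<bar>w x\<bar> \<le> B" using lipschitz_bounded[OF w S] by blast
  have iw: "integrable lborel w" by (rule integrable_bounded_support[OF _ S B(2)]) measurable
  obtain R where R: "\<And>x. x \<in> S \<Longrightarrow> norm x \<le> R" using S(1) unfolding bounded_iff by blast
  define G where "G x = indicator (cball 0 (R + 1)) x * M" for x :: 'a
  have M: "0 \<le> M" by (rule lipschitz_on_nonneg[OF w])
  have [measurable]: "G \<in> borel_measurable borel" unfolding G_def [abs_def] by (intro borel_measurable_times borel_measurable_indicator) auto
  have iG: "integrable lborel G"
    by (rule integrable_bounded_support[where S = "cball 0 (R + 1)" and B = M]) (use M in \<open>auto simp: G_def indicator_def\<close>)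
  have le: "norm (dq b w n x) \<le> G x" for n x
  proof (cases "norm x \<le> R + 1")
    case True
    then show ?thesis using dq_bound[OF w b, of n x] by (simp add: G_def)
  next
    case False
    have "norm x - norm ((1 / real (Suc n)) *\<^sub>R b) \<le> norm (x + (1 / real (Suc n)) *\<^sub>R b)"
      by (metis diff_conv_add_uminus norm_diff_ineq)
    moreover have "norm ((1 / real (Suc n)) *\<^sub>R b) \<le> 1" using b by simp
    ultimately have "R < norm x" "R < norm (x + (1 / real (Suc n)) *\<^sub>R b)" using False by linarith+
    then have "x \<notin> S" "x + (1 / real (Suc n)) *\<^sub>R b \<notin> S" using R leD by blast+
    then show ?thesis using S False by (simp add: dq_def G_def)
  qed
  have shift: "has_bochner_integral lborel (\<lambda>x. w (x + h)) (integral\<^sup>L lborel w)" for h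
  proof -
    have "has_bochner_integral (distr lborel borel ((+) h)) w (integral\<^sup>L lborel w)"
      using iw by (simp add: lborel_distr_plus has_bochner_integral_integrable)
    then have "has_bochner_integral lborel (\<lambda>x. w (h + x)) (integral\<^sup>L lborel w)"
      by (simp add: has_bochner_integral_iff integrable_distr_eq integral_distr)
    then show ?thesis by (simp add: add.commute)
  qed
  have zero: "integral\<^sup>L lborel (dq b w n) = 0" for n
  proof -
    have "has_bochner_integral lborel (\<lambda>x. real (Suc n) * (w (x + (1 / real (Suc n)) *\<^sub>R b) - w x))
       (real (Suc n) * (integral\<^sup>L lborel w - integral\<^sup>L lborel w))"
      by (intro has_bochner_integral_mult_right has_bochner_integral_diff shift has_bochner_integral_integrable[OF iw])
    then show ?thesis by (simp add: dq_def [abs_def] has_bochner_integral_iff)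
  qed
  have lim: "AE x in lborel. (\<lambda>n. dq b w n x) \<longlonglongrightarrow> ddir b w x"
    using d
  proof eventually_elim
    case (elim x)
    then have "(w has_derivative frechet_derivative w (at x)) (at x)" by (simp add: frechet_derivative_works)
    from dq_tendsto[OF this] ddir_eq[OF this] show ?case by simp
  qed
  have meas: "ddir b w \<in> borel_measurable lborel" "dq b w n \<in> borel_measurable lborel" for n
    using ddir_measurable[of w b] by (auto simp: dq_def [abs_def])
  have "(\<lambda>n. integral\<^sup>L lborel (dq b w n)) \<longlonglongrightarrow> integral\<^sup>L lborel (ddir b w)"
    by (rule integral_dominated_convergence[OF meas iG lim]) (use le in auto)
  then have "integral\<^sup>L lborel (ddir b w) = 0" unfolding zero by (simp add: LIMSEQ_const_iff)
  moreover have "integrable lborel (ddir b w)"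
    by (rule integrable_dominated_convergence[OF meas iG lim]) (use le in auto)
  ultimately show ?thesis by (simp add: has_bochner_integral_iff)
qed

text \<open>The second factor is bounded only on the support of the first. This admits the unbounded
  coordinate function needed in \<open>poincare\<close>.\<close>

lemma lipschitz_mult:
  fixes f g :: "'a::euclidean_space \<Rightarrow> real"
  assumes f: "Mf-lipschitz_on UNIV f" and Bf: "0 \<le> Bf" "\<And>x. \<bar>f x\<bar> \<le> Bf" and S: "\<And>x. x \<notin> S \<Longrightarrow> f x = 0"
    and g: "Mg-lipschitz_on UNIV g" and Bg: "0 \<le> Bg" "\<And>x. x \<in> S \<Longrightarrow> \<bar>g x\<bar> \<le> Bg"
  shows "(Mf * Bg + Bf * Mg)-lipschitz_on UNIV (\<lambda>x. f x * g x)"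
proof (rule lipschitz_onI)
  have M: "0 \<le> Mf" "0 \<le> Mg" using lipschitz_on_nonneg f g by blast+
  then show "0 \<le> Mf * Bg + Bf * Mg" using Bf Bg by simp
  have key: "\<bar>f x * g x - f y * g y\<bar> \<le> (Mf * Bg + Bf * Mg) * dist x y" if x: "x \<in> S" for x y
  proof -
    have "\<bar>f x * g x - f y * g y\<bar> = \<bar>(f x - f y) * g x + f y * (g x - g y)\<bar>" by (simp add: algebra_simps)
    also have "\<dots> \<le> \<bar>f x - f y\<bar> * \<bar>g x\<bar> + \<bar>f y\<bar> * \<bar>g x - g y\<bar>" by (metis abs_mult abs_triangle_ineq)
    also have "\<dots> \<le> (Mf * dist x y) * Bg + Bf * (Mg * dist x y)"
      using lipschitz_onD[OF f, of x y] lipschitz_onD[OF g, of x y] Bf Bg x M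
      by (intro add_mono mult_mono) (auto simp: dist_real_def)
    finally show ?thesis by (simp add: algebra_simps)
  qed
  fix x y :: 'a
  show "dist (f x * g x) (f y * g y) \<le> (Mf * Bg + Bf * Mg) * dist x y"
  proof (cases "x \<in> S")
    case True
    then show ?thesis using key by (simp add: dist_real_def)
  next
    case False
    show ?thesis
    proof (cases "y \<in> S")
      case True
      then show ?thesis using key[of y x] by (simp add: dist_real_def abs_minus_commute dist_commute)
    next
      case F2: False
      have "0 \<le> (Mf * Bg + Bf * Mg) * dist x y" using M Bf Bg by simp
      then show ?thesis using S[OF False] S[OF F2] by simp
    qed
  qed
qed

lemma test_function_lipschitz:
  assumes \<phi>: "\<phi> \<in> test_functions \<Omega>"
  obtains M where "M-lipschitz_on UNIV \<phi>"
proof -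
  define S where "S = closure {x. \<phi> x \<noteq> 0}"
  have sm: "smooth \<phi>" and cS: "compact S" using \<phi> by (auto simp: test_functions_def S_def)
  have "\<exists>B. \<forall>x. \<bar>pderiv_dir b \<phi> x\<bar> \<le> B" if b: "b \<in> Basis" for b
  proof -
    have "compact (pderiv_dir b \<phi> ` S)"
      by (intro compact_continuous_image smooth_continuous smooth_pderiv sm b cS)
    then obtain B where B: "\<forall>y\<in>pderiv_dir b \<phi> ` S. norm y \<le> B"
      using compact_imp_bounded[of "pderiv_dir b \<phi> ` S"] unfolding bounded_iff by blast
    have "\<bar>pderiv_dir b \<phi> x\<bar> \<le> max B 0" for x
    proof (cases "x \<in> S")
      case False
      have "open (- S)" by (simp add: S_def open_Compl)
      moreover have "\<phi> y = 0" if "y \<in> - S" for y using that closure_subset[of "{x. \<phi> x \<noteq> 0}"] by (auto simp: S_def)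
      ultimately have "(\<phi> has_derivative (\<lambda>h. 0)) (at x)"
        using False by (intro has_derivative_transform_within_open[OF has_derivative_const[of 0], of "- S"]) auto
      from pderiv_dir_eqI[OF this] show ?thesis by simp
    qed (use B in force)
    then show ?thesis by blast
  qed
  then obtain B where B: "\<And>b x. b \<in> Basis \<Longrightarrow> \<bar>pderiv_dir b \<phi> x\<bar> \<le> B b" by metis
  define M where "M = (\<Sum>b\<in>(Basis::'a set). B b)"
  have Bn: "0 \<le> B b" if "b \<in> Basis" for b using B[OF that, of undefined] abs_ge_zero order_trans by blast
  have "M-lipschitz_on UNIV \<phi>"
  proof (rule bounded_derivative_imp_lipschitz)
    show "(\<phi> has_derivative (\<lambda>h. \<Sum>b\<in>Basis. (h \<bullet> b) * pderiv_dir b \<phi> x)) (at x within UNIV)" for x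
      using has_derivative_pderiv_dir[OF smooth_differentiable[OF sm]] by simp
    show "onorm (\<lambda>h. \<Sum>b\<in>Basis. (h \<bullet> b) * pderiv_dir b \<phi> x) \<le> M" for x
    proof (rule onorm_bound)
      fix h :: 'a
      have "norm (\<Sum>b\<in>Basis. (h \<bullet> b) * pderiv_dir b \<phi> x) \<le> (\<Sum>b\<in>Basis. norm h * B b)"
        using B by (intro order_trans[OF norm_sum] sum_mono) (auto simp: abs_mult intro!: mult_mono Basis_le_norm)
      then show "norm (\<Sum>b\<in>Basis. (h \<bullet> b) * pderiv_dir b \<phi> x) \<le> M * norm h"
        by (simp add: M_def sum_distrib_right mult.commute[of _ "norm h"] sum_distrib_left)
    qed (simp add: M_def sum_nonneg Bn)
  qed (simp_all add: M_def sum_nonneg Bn)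
  then show ?thesis by (rule that)
qed

lemma test_function_support:
  assumes "\<phi> \<in> test_functions \<Omega>"
  shows "x \<notin> \<Omega> \<Longrightarrow> \<phi> x = 0"
  using assms closure_subset[of "{x. \<phi> x \<noteq> 0}"] by (auto simp: test_functions_def)

lemma test_function_smooth: "\<phi> \<in> test_functions \<Omega> \<Longrightarrow> smooth \<phi>"
  by (simp add: test_functions_def)

lemma ddir_product:
  assumes "f differentiable (at x)" "g differentiable (at x)"
  shows "ddir b (\<lambda>x. f x * g x) x = f x * ddir b g x + ddir b f x * g x"
proof -
  have "(\<lambda>x. f x * g x) differentiable (at x)" using assms by (rule differentiable_mult)
  then show ?thesis using assms by (simp add: ddir_eq_pderiv_dir pderiv_dir_mult)
qed

lemma integral_product_rule:
  fixes f g :: "'a::euclidean_space \<Rightarrow> real"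
  assumes f: "Mf-lipschitz_on UNIV f" and S: "bounded S" "\<And>x. x \<notin> S \<Longrightarrow> f x = 0"
    and g: "Mg-lipschitz_on UNIV g" and b: "b \<in> Basis"
    and df: "AE x in lborel. f differentiable (at x)" and dg: "AE x in lborel. g differentiable (at x)"
  shows "has_bochner_integral lborel (\<lambda>x. f x * ddir b g x + ddir b f x * g x) 0"
proof -
  have [measurable]: "f \<in> borel_measurable borel" "g \<in> borel_measurable borel"
    using f g by (auto intro: lipschitz_measurable)
  have m [measurable]: "ddir b f \<in> borel_measurable borel" "ddir b g \<in> borel_measurable borel" "ddir b (\<lambda>x. f x * g x) \<in> borel_measurable borel"
    by (intro ddir_measurable; measurable)+
  obtain Bf where Bf: "0 \<le> Bf" "\<And>x. \<bar>f x\<bar> \<le> Bf" using lipschitz_bounded[OF f S] by blast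
  obtain R where R: "\<And>x. x \<in> S \<Longrightarrow> norm x \<le> R" using S(1) unfolding bounded_iff by blast
  define Bg where "Bg = \<bar>g 0\<bar> + Mg * \<bar>R\<bar>"
  have Mg: "0 \<le> Mg" by (rule lipschitz_on_nonneg[OF g])
  have Bg: "0 \<le> Bg" "\<And>x. x \<in> S \<Longrightarrow> \<bar>g x\<bar> \<le> Bg"
  proof -
    show "0 \<le> Bg" using Mg by (simp add: Bg_def)
    fix x assume x: "x \<in> S"
    have "\<bar>g x - g 0\<bar> \<le> Mg * norm x" using lipschitz_onD[OF g, of x 0] by (simp add: dist_norm)
    also have "\<dots> \<le> Mg * \<bar>R\<bar>" using R[OF x] Mg by (intro mult_left_mono) auto
    finally show "\<bar>g x\<bar> \<le> Bg" by (simp add: Bg_def)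
  qed
  have L: "(Mf * Bg + Bf * Mg)-lipschitz_on UNIV (\<lambda>x. f x * g x)"
    using S(2) by (rule lipschitz_mult[OF f Bf _ g Bg])
  have d: "AE x in lborel. (\<lambda>x. f x * g x) differentiable (at x)"
    using df dg by eventually_elim (rule differentiable_mult)
  have h: "has_bochner_integral lborel (ddir b (\<lambda>x. f x * g x)) 0"
    by (rule integral_ddir_eq_0[OF L S(1) _ b d]) (use S in simp)
  have "AE x in lborel. ddir b (\<lambda>x. f x * g x) x = f x * ddir b g x + ddir b f x * g x"
    using df dg by eventually_elim (rule ddir_product)
  from has_bochner_integral_cong_AE[OF _ _ this] h show ?thesis by simp
qed

text \<open>Dilate \<open>v\<close> about a point of the convex domain, so that its support moves into the interior,
  and mollify.\<close>

lemma test_function_approximation: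
  fixes v :: "'a::euclidean_space \<Rightarrow> real" and \<Omega> :: "'a set"
  assumes om: "open \<Omega>" "convex \<Omega>" "bounded \<Omega>" and x0: "x0 \<in> \<Omega>"
    and v: "M-lipschitz_on UNIV v" and v0: "\<And>x. x \<notin> \<Omega> \<Longrightarrow> v x = 0"
    and aff: "AE x in lborel. \<exists>a c d. 0 < d \<and> (\<forall>z\<in>ball x d. v z = a \<bullet> z + c)"
  obtains \<phi> B where "\<And>n. \<phi> n \<in> test_functions \<Omega>" "0 \<le> B" "\<And>n x. \<bar>\<phi> n x\<bar> \<le> B"
    "\<And>x. (\<lambda>n. \<phi> n x) \<longlonglongrightarrow> v x"
    "\<And>n x b. b \<in> Basis \<Longrightarrow> \<bar>pderiv_dir b (\<phi> n) x\<bar> \<le> 2 * M"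
    "AE x in lborel. \<forall>b\<in>Basis. (\<lambda>n. pderiv_dir b (\<phi> n) x) \<longlonglongrightarrow> ddir b v x"
proof -
  \<comment> \<open>Composing with a dilation by a factor above 1 shrinks the support towards
    \<open>x0\<close>; the factors tend to 1.\<close>
  define s where "s n = 1 + 1 / real (Suc n)" for n
  define w where "w n z = v (x0 + s n *\<^sub>R (z - x0))" for n z
  define T where "T n = {z. x0 + s n *\<^sub>R (z - x0) \<in> closure \<Omega>}" for n
  have M: "0 \<le> M" by (rule lipschitz_on_nonneg[OF v])
  have s1: "1 < s n" "s n \<le> 2" for n by (auto simp: s_def)
  have slim: "(\<lambda>n. s n) \<longlonglongrightarrow> 1"
    unfolding s_def using tendsto_add[OF tendsto_const LIMSEQ_Suc[OF lim_1_over_n], of "1::real"] by simp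
  obtain B where B: "0 \<le> B" "\<And>x. \<bar>v x\<bar> \<le> B" using lipschitz_bounded[OF v om(3) v0] by blast
  have wB: "\<bar>w n x\<bar> \<le> B" for n x by (simp add: w_def B)
  have wlip: "(2 * M)-lipschitz_on UNIV (w n)" for n
  proof (rule lipschitz_onI)
    fix x y :: 'a
    have "dist (w n x) (w n y) \<le> M * dist (x0 + s n *\<^sub>R (x - x0)) (x0 + s n *\<^sub>R (y - x0))"
      unfolding w_def by (rule lipschitz_onD[OF v]) auto
    also have "dist (x0 + s n *\<^sub>R (x - x0)) (x0 + s n *\<^sub>R (y - x0)) = s n * dist x y"
    proof -
      have "(x0 + s n *\<^sub>R (x - x0)) - (x0 + s n *\<^sub>R (y - x0)) = s n *\<^sub>R (x - y)" by (simp add: algebra_simps)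
      then show ?thesis using s1(1)[of n] by (simp add: dist_norm)
    qed
    also have "M * (s n * dist x y) \<le> M * (2 * dist x y)" using M s1 by (intro mult_left_mono mult_right_mono) auto
    finally show "dist (w n x) (w n y) \<le> 2 * M * dist x y" by simp
  qed (use M in simp)
  have wcont: "continuous_on UNIV (w n)" for n by (rule lipschitz_on_continuous_on[OF wlip])
  have Tsub: "T n \<subseteq> \<Omega>" for n
  proof
    fix z assume z: "z \<in> T n"
    define y where "y = x0 + s n *\<^sub>R (z - x0)"
    have y: "y \<in> closure \<Omega>" using z by (simp add: T_def y_def)
    have zy: "z - x0 = (1 / s n) *\<^sub>R (y - x0)" using s1(1)[of n] by (simp add: y_def)
    \<comment> \<open>Convexity enters here: a point strictly between an interior point and a point
      of the closure is interior.\<close>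
    have "y - (1 - 1 / s n) *\<^sub>R (y - x0) \<in> interior \<Omega>"
      using s1(1)[of n] om x0 y by (intro mem_interior_closure_convex_shrink) (auto simp: interior_open)
    moreover have "y - (1 - 1 / s n) *\<^sub>R (y - x0) = z"
      using zy by (simp add: algebra_simps)
    ultimately show "z \<in> \<Omega>" using interior_subset by auto
  qed
  have Tcl: "closed (T n)" for n
  proof -
    have "T n = (\<lambda>z. x0 + s n *\<^sub>R (z - x0)) -` closure \<Omega>" by (auto simp: T_def)
    moreover have "closed ((\<lambda>z. x0 + s n *\<^sub>R (z - x0)) -` closure \<Omega>)"
      by (rule closed_vimage) (auto intro!: continuous_intros)
    ultimately show ?thesis by simp
  qed
  have Tbd: "bounded (T n)" for n using Tsub om(3) bounded_subset by blast
  have Tcomp: "compact (T n)" for n using Tcl Tbd by (simp add: compact_eq_bounded_closed)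
  have x0T: "x0 \<in> T n" for n using x0 closure_subset by (auto simp: T_def)
  have w0: "w n z = 0" if "z \<notin> T n" for n z
    using that v0 closure_subset[of \<Omega>] by (auto simp: T_def w_def)
  have "\<exists>e>0. {x. infdist x (T n) \<le> e} \<subseteq> \<Omega>" for n
    using compact_in_open_separated[OF _ Tcomp om(1) Tsub] x0T by blast
  then obtain e where e: "\<And>n. 0 < e n" "\<And>n. {x. infdist x (T n) \<le> e n} \<subseteq> \<Omega>" by metis
  \<comment> \<open>The division by the dimension accounts for the cube; displacements then stay
    within the safety margin \<open>e n\<close> and tend to 0.\<close>
  define r where "r n = min (1 / real (Suc n)) (e n) / DIM('a)" for n
  have r: "0 < r n" for n using e(1) by (simp add: r_def)
  have rD: "r n * DIM('a) \<le> e n" "r n * DIM('a) \<le> 1 / real (Suc n)" for n by (simp_all add: r_def)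
  define \<phi> where "\<phi> n = mollify (r n) (w n)" for n
  have smooth: "smooth (\<phi> n)" for n
    unfolding \<phi>_def by (rule smooth_mollify[OF r wcont Tbd w0 wB])
  have supp: "{x. \<phi> n x \<noteq> 0} \<subseteq> {x. infdist x (T n) \<le> e n}" for n
  proof
    fix x assume x: "x \<in> {x. \<phi> n x \<noteq> 0}"
    have "\<exists>y\<in>cube (r n). x - y \<in> T n"
    proof (rule ccontr)
      assume "\<not> ?thesis"
      then have 0: "mollifier (r n) y * w n (x - y) = 0" for y
        using w0[of "x - y" n] mollifier_eq_0[of y "r n"] by (cases "y \<in> cube (r n)") auto
      have "\<phi> n x = 0" unfolding \<phi>_def mollify_def 0 by simp
      then show False using x by simp
    qed
    then obtain y where y: "y \<in> cube (r n)" "x - y \<in> T n" by blast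
    have "infdist x (T n) \<le> dist x (x - y)" by (rule infdist_le[OF y(2)])
    also have "\<dots> \<le> e n" using cube_norm[OF y(1)] rD(1)[of n] by (simp add: dist_norm)
    finally show "x \<in> {x. infdist x (T n) \<le> e n}" by simp
  qed
  have test: "\<phi> n \<in> test_functions \<Omega>" for n
  proof -
    have "closed {x. infdist x (T n) \<le> e n}"
      by (intro closed_Collect_le continuous_intros)
    then have c: "closure {x. \<phi> n x \<noteq> 0} \<subseteq> {x. infdist x (T n) \<le> e n}" by (rule closure_minimal[OF supp])
    then have "closure {x. \<phi> n x \<noteq> 0} \<subseteq> \<Omega>" using e(2) by blast
    moreover from this have "bounded (closure {x. \<phi> n x \<noteq> 0})" using om(3) bounded_subset by blast
    ultimately show ?thesis unfolding test_functions_def using smooth by (simp add: compact_eq_bounded_closed)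
  qed
  have bnd: "\<bar>\<phi> n x\<bar> \<le> B" for n x
    unfolding \<phi>_def using mollify_bound[OF r[of n] wcont[of n] wB[of n], where x = x and c = 0 and D = B] wB by simp
  have lim: "(\<lambda>n. \<phi> n x) \<longlonglongrightarrow> v x" for x
  proof -
    have le: "\<bar>\<phi> n x - v x\<bar> \<le> 2 * M * (1 / real (Suc n)) + M * ((s n - 1) * norm (x - x0))" for n
    proof -
      have "\<bar>\<phi> n x - w n x\<bar> \<le> 2 * M * (1 / real (Suc n))"
        unfolding \<phi>_def
      proof (rule mollify_bound[OF r wcont wB])
        fix y :: 'a assume y: "y \<in> cube (r n)"
        have "\<bar>w n (x - y) - w n x\<bar> \<le> 2 * M * dist (x - y) x" using lipschitz_onD[OF wlip[of n], of "x - y" x] by (simp add: dist_real_def)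
        also have "\<dots> \<le> 2 * M * (1 / real (Suc n))"
          using cube_norm[OF y] rD(2)[of n] M by (intro mult_left_mono) (auto simp: dist_norm)
        finally show "\<bar>w n (x - y) - w n x\<bar> \<le> 2 * M * (1 / real (Suc n))" .
      qed
      moreover have "\<bar>w n x - v x\<bar> \<le> M * ((s n - 1) * norm (x - x0))"
      proof -
        have "x0 + s n *\<^sub>R (x - x0) - x = (s n - 1) *\<^sub>R (x - x0)" by (simp add: algebra_simps)
        then have "dist (x0 + s n *\<^sub>R (x - x0)) x = (s n - 1) * norm (x - x0)" using s1(1)[of n] by (simp add: dist_norm)
        then show ?thesis using lipschitz_onD[OF v, of "x0 + s n *\<^sub>R (x - x0)" x] by (simp add: w_def dist_real_def)
      qed
      ultimately show ?thesis by linarith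
    qed
    have "(\<lambda>n. 2 * M * (1 / real (Suc n)) + M * ((s n - 1) * norm (x - x0))) \<longlonglongrightarrow> 2 * M * 0 + M * ((1 - 1) * norm (x - x0))"
      by (intro tendsto_intros slim LIMSEQ_Suc[OF lim_1_over_n])
    then have z: "(\<lambda>n. 2 * M * (1 / real (Suc n)) + M * ((s n - 1) * norm (x - x0))) \<longlonglongrightarrow> 0" by simp
    have "(\<lambda>n. \<phi> n x - v x) \<longlonglongrightarrow> 0"
      by (rule Lim_null_comparison[OF always_eventually z]) (use le in simp)
    then show ?thesis by (simp add: LIM_zero_iff)
  qed
  have dbnd: "\<bar>pderiv_dir b (\<phi> n) x\<bar> \<le> 2 * M" if b: "b \<in> Basis" for n x b
  proof -
    have "(2 * M)-lipschitz_on UNIV (\<phi> n)"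
      unfolding \<phi>_def using mollify_lipschitz[OF r wlip wB] M by (intro lipschitz_onI) (auto simp: dist_real_def)
    moreover have "(\<phi> n has_derivative frechet_derivative (\<phi> n) (at x)) (at x)"
      using smooth_differentiable[OF smooth] by (simp add: frechet_derivative_works)
    ultimately show ?thesis unfolding pderiv_dir_def by (intro derivative_bound[OF _ b])
  qed
  have dlim: "(\<lambda>n. pderiv_dir b (\<phi> n) x) \<longlonglongrightarrow> ddir b v x"
    if d: "0 < d" and a: "\<And>z. z \<in> ball x d \<Longrightarrow> v z = a \<bullet> z + c" for x d a c b
  proof -
    have hd: "((\<lambda>z. a \<bullet> z + c) has_derivative (\<lambda>h. a \<bullet> h)) (at x)" by (auto intro!: derivative_eq_intros)
    have "(v has_derivative (\<lambda>h. a \<bullet> h)) (at x)"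
      using a d by (intro has_derivative_transform_within_open[OF hd open_ball[of x d]]) auto
    then have dv: "ddir b v x = a \<bullet> b" by (rule ddir_eq)
    have "(\<lambda>n. (s n - 1) * (norm (x - x0) + d)) \<longlonglongrightarrow> (1 - 1) * (norm (x - x0) + d)"
      by (intro tendsto_intros slim)
    then have ev1: "\<forall>\<^sub>F n in sequentially. (s n - 1) * (norm (x - x0) + d) < d / 2"
      using d by (intro order_tendstoD(2)) auto
    have ev2: "\<forall>\<^sub>F n in sequentially. 1 / real (Suc n) < d / 2 / 2"
      using LIMSEQ_Suc[OF lim_1_over_n[where 'a = real]] d by (intro order_tendstoD(2)) auto
    \<comment> \<open>For large n the neighbourhood seen by the mollifier is dilated into the ball
      on which \<open>v\<close> is affine, so the derivative is exactly \<open>s n\<close> times the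
      slope.\<close>
    have ev: "\<forall>\<^sub>F n in sequentially. s n * (a \<bullet> b) = pderiv_dir b (\<phi> n) x"
      using ev1 ev2
    proof eventually_elim
      case (elim n)
      have "pderiv_dir b (\<phi> n) x = (s n *\<^sub>R a) \<bullet> b"
        unfolding \<phi>_def
      proof (rule mollify_affine[OF r _ wcont wB])
        show "r n * DIM('a) < d / 2 / 2" using rD(2)[of n] elim by linarith
        fix z assume z: "z \<in> ball x (d / 2)"
        have "dist x (x0 + s n *\<^sub>R (z - x0)) < d"
        proof -
          have "x0 + s n *\<^sub>R (z - x0) - x = (z - x) + (s n - 1) *\<^sub>R (z - x0)" by (simp add: algebra_simps)
          then have "dist x (x0 + s n *\<^sub>R (z - x0)) = norm ((z - x) + (s n - 1) *\<^sub>R (z - x0))"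
            by (metis dist_commute dist_norm)
          moreover have "\<dots> \<le> norm (z - x) + (s n - 1) * norm (z - x0)"
            using s1(1)[of n] norm_triangle_ineq[of "z - x" "(s n - 1) *\<^sub>R (z - x0)"] by simp
          moreover have zx: "norm (z - x) < d / 2" using z by (simp add: dist_norm norm_minus_commute)
          moreover have "norm (z - x0) \<le> norm (z - x) + norm (x - x0)" by (metis diff_add_cancel add_diff_eq norm_triangle_ineq)
          moreover have "(s n - 1) * norm (z - x0) \<le> (s n - 1) * (norm (x - x0) + d)"
            using calculation zx d s1(1)[of n] by (intro mult_left_mono) linarith+
          ultimately show ?thesis using elim by linarith
        qed
        then have "w n z = a \<bullet> (x0 + s n *\<^sub>R (z - x0)) + c" unfolding w_def by (intro a) simp
        then show "w n z = (s n *\<^sub>R a) \<bullet> z + (a \<bullet> x0 - s n * (a \<bullet> x0) + c)"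
          by (simp add: inner_diff_right inner_add_right algebra_simps)
      qed
      then show ?case by simp
    qed
    have "(\<lambda>n. s n * (a \<bullet> b)) \<longlonglongrightarrow> 1 * (a \<bullet> b)" by (intro tendsto_intros slim)
    then show ?thesis using tendsto_cong[OF ev] dv by simp
  qed
  have "AE x in lborel. \<forall>b\<in>Basis. (\<lambda>n. pderiv_dir b (\<phi> n) x) \<longlonglongrightarrow> ddir b v x"
    using aff by (rule eventually_mono) (use dlim in blast)
  then show ?thesis using that[of \<phi> B] test B(1) bnd lim dbnd by blast
qed

text \<open>As \<open>ennreal\<close> cuts off negative values, \<open>D1\<close> and
  \<open>D2\<close> have the positive and the negative part of \<open>h\<close> as densities. They
  agree on boxes, an intersection-stable generator, hence are equal as measures; where one density
  is positive the other is zero, so both vanish almost everywhere.\<close>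

lemma AE_zero_if_box_integrals_zero:
  fixes h :: "'a::euclidean_space \<Rightarrow> real"
  assumes h: "integrable lborel h" and z: "\<And>a b. (\<integral>x. indicator (box a b) x * h x \<partial>lborel) = 0"
  shows "AE x in lborel. h x = 0"
proof -
  have [measurable]: "h \<in> borel_measurable borel" using h by auto
  define D1 where "D1 = density lborel (\<lambda>x. ennreal (h x))"
  define D2 where "D2 = density lborel (\<lambda>x. ennreal (- h x))"
  have fin: "(\<integral>\<^sup>+x. ennreal (h x) * indicator A x \<partial>lborel) < \<infinity>" if "A \<in> sets borel" for A
  proof -
    have "(\<integral>\<^sup>+x. ennreal (h x) * indicator A x \<partial>lborel) \<le> (\<integral>\<^sup>+x. ennreal (norm (h x)) \<partial>lborel)"
      by (intro nn_integral_mono) (auto simp: indicator_def intro!: ennreal_leI)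
    also have "\<dots> < \<infinity>" using h by (simp add: integrable_iff_bounded)
    finally show ?thesis .
  qed
  have eq: "emeasure D1 X = emeasure D2 X" if X: "X \<in> range (\<lambda>(a, b). box a b)" for X
  proof -
    obtain a b where X': "X = box a b" using X by auto
    have i: "integrable lborel (\<lambda>x. indicator X x * h x)"
      using integrable_mult_indicator[of X lborel h] h X' by simp
    have 0: "(\<integral>\<^sup>+x. ennreal (indicator X x * h x) \<partial>lborel) = (\<integral>\<^sup>+x. ennreal (- (indicator X x * h x)) \<partial>lborel)"
    proof -
      have "enn2real (\<integral>\<^sup>+x. ennreal (indicator X x * h x) \<partial>lborel) = enn2real (\<integral>\<^sup>+x. ennreal (- (indicator X x * h x)) \<partial>lborel)"
        using real_lebesgue_integral_def[OF i] z[of a b] X' by simp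
      moreover have "(\<integral>\<^sup>+x. ennreal (indicator X x * h x) \<partial>lborel) \<noteq> \<infinity>" "(\<integral>\<^sup>+x. ennreal (- (indicator X x * h x)) \<partial>lborel) \<noteq> \<infinity>"
        using i real_integrable_def[of lborel "\<lambda>x. indicator X x * h x"] by auto
      ultimately show ?thesis by (metis ennreal_enn2real infinity_ennreal_def less_top)
    qed
    have "emeasure D1 X = (\<integral>\<^sup>+x. ennreal (indicator X x * h x) \<partial>lborel)"
      unfolding D1_def using X' by (subst emeasure_density) (auto intro!: nn_integral_cong simp: indicator_def)
    moreover have "emeasure D2 X = (\<integral>\<^sup>+x. ennreal (- (indicator X x * h x)) \<partial>lborel)"
      unfolding D2_def using X' by (subst emeasure_density) (auto intro!: nn_integral_cong simp: indicator_def)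
    ultimately show ?thesis using 0 by simp
  qed
  have D: "D1 = D2"
  proof (rule measure_eqI_generator_eq[where E = "range (\<lambda>(a, b). box a b::'a set)" and \<Omega> = UNIV
        and A = "\<lambda>n. box (- (real n *\<^sub>R One)) (real n *\<^sub>R One)"])
    show "Int_stable (range (\<lambda>(a, b). box a b::'a set))" by (auto simp: Int_stable_def box_Int_box)
    show "sets D1 = sigma_sets UNIV (range (\<lambda>(a, b). box a b))" "sets D2 = sigma_sets UNIV (range (\<lambda>(a, b). box a b))"
      by (simp_all add: D1_def D2_def borel_eq_box)
    show "(\<Union>n. box (- (real n *\<^sub>R One)) (real n *\<^sub>R One)) = (UNIV :: 'a set)"
      unfolding UN_box_eq_UNIV ..
    show "emeasure D1 (box (- (real n *\<^sub>R One)) (real n *\<^sub>R One)) \<noteq> \<infinity>" for n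
      unfolding D1_def using fin[of "box (- (real n *\<^sub>R One)) (real n *\<^sub>R One)"] by (subst emeasure_density) auto
  qed (use eq in auto)
  have ae: "AE x in lborel. \<not> 0 < k x"
    if [measurable]: "k \<in> borel_measurable borel" and e: "density lborel (\<lambda>x. ennreal (k x)) = density lborel (\<lambda>x. ennreal (- k x))" for k :: "'a \<Rightarrow> real"
  proof -
    define A where "A = {x. 0 < k x}"
    have [measurable]: "A \<in> sets borel" unfolding A_def by measurable
    have "(\<integral>\<^sup>+x. ennreal (k x) * indicator A x \<partial>lborel) = emeasure (density lborel (\<lambda>x. ennreal (k x))) A"
      by (subst emeasure_density) auto
    also have "\<dots> = (\<integral>\<^sup>+x. ennreal (- k x) * indicator A x \<partial>lborel)" unfolding e by (subst emeasure_density) auto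
    also have "\<dots> = (\<integral>\<^sup>+(x::'a). 0 \<partial>lborel)" by (intro nn_integral_cong) (auto simp: A_def indicator_def ennreal_neg)
    finally have "AE x in lborel. ennreal (k x) * indicator A x = 0" by (simp add: nn_integral_0_iff_AE)
    then show ?thesis by (rule eventually_mono) (auto simp: A_def indicator_def split: if_splits)
  qed
  have "AE x in lborel. \<not> 0 < h x" "AE x in lborel. \<not> 0 < - h x"
    using ae[of h] ae[of "\<lambda>x. - h x"] D by (simp_all add: D1_def D2_def)
  then show ?thesis by eventually_elim auto
qed

lemma integral_lebesgue_on:
  fixes f :: "'a::euclidean_space \<Rightarrow> real"
  assumes "\<Omega> \<in> sets lebesgue"
  shows "(LINT x|lebesgue_on \<Omega>. f x) = (LINT x|lebesgue. indicator \<Omega> x * f x)"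
  using assms by (subst integral_restrict_space) auto

lemma integrable_lebesgue_on:
  fixes f :: "'a::euclidean_space \<Rightarrow> real"
  assumes "\<Omega> \<in> sets lebesgue"
  shows "integrable (lebesgue_on \<Omega>) f \<longleftrightarrow> integrable lebesgue (\<lambda>x. indicator \<Omega> x * f x)"
  using assms by (subst integrable_restrict_space) auto

text \<open>Test against smooth bumps that increase to the indicators of boxes.\<close>

lemma fundamental_lemma:
  fixes g :: "'a::euclidean_space \<Rightarrow> real"
  assumes om: "open \<Omega>" and g: "integrable (lebesgue_on \<Omega>) g"
    and z: "\<And>\<phi>. \<phi> \<in> test_functions \<Omega> \<Longrightarrow> (LINT x|lebesgue_on \<Omega>. g x * \<phi> x) = 0"
  shows "AE x in lebesgue_on \<Omega>. g x = 0"
proof -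
  have os: "\<Omega> \<in> sets lebesgue" using om by auto
  define h where "h x = indicator \<Omega> x * g x" for x
  have ih: "integrable lebesgue h" unfolding h_def using g integrable_lebesgue_on[OF os] by simp
  have box0: "(LINT x|lebesgue. indicator (box l u) x * h x) = 0" if lu: "cbox l u \<subseteq> \<Omega>" for l u
  proof -
    have "(\<lambda>k. LINT x|lebesgue. box_bump (real (Suc k)) l u x * h x) \<longlonglongrightarrow> (LINT x|lebesgue. indicator (box l u) x * h x)"
    proof (rule integral_dominated_convergence[where w = "\<lambda>x. \<bar>h x\<bar>"])
      have [measurable]: "h \<in> borel_measurable lebesgue" using ih by auto
      have [measurable]: "box_bump (real (Suc k)) l u \<in> borel_measurable lebesgue" for k
        using borel_measurable_smooth[OF smooth_box_bump] by (intro measurable_completion) simp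
      show "(\<lambda>x. indicator (box l u) x * h x) \<in> borel_measurable lebesgue"
        by (intro borel_measurable_times borel_measurable_indicator \<open>h \<in> borel_measurable lebesgue\<close>) auto
      show "(\<lambda>x. box_bump (real (Suc k)) l u x * h x) \<in> borel_measurable lebesgue" for k
        by (intro borel_measurable_times) fact+
      show "integrable lebesgue (\<lambda>x. \<bar>h x\<bar>)" using ih by simp
      show "AE x in lebesgue. (\<lambda>k. box_bump (real (Suc k)) l u x * h x) \<longlonglongrightarrow> indicator (box l u) x * h x"
        by (intro AE_I2 tendsto_mult box_bump_tendsto tendsto_const)
      show "AE x in lebesgue. norm (box_bump (real (Suc k)) l u x * h x) \<le> \<bar>h x\<bar>" for k
        using box_bump_bounds(1)[of "real (Suc k)" l u] box_bump_bounds(2)[of "real (Suc k)" l u]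
        by (intro AE_I2) (simp only: real_norm_def abs_mult abs_of_nonneg abs_ge_zero mult_left_le_one_le)
    qed
    moreover have "(LINT x|lebesgue. box_bump (real (Suc k)) l u x * h x) = 0" for k
    proof -
      have "(LINT x|lebesgue. box_bump (real (Suc k)) l u x * h x) = (LINT x|lebesgue_on \<Omega>. g x * box_bump (real (Suc k)) l u x)"
        unfolding integral_lebesgue_on[OF os] h_def by (simp add: mult_ac)
      then show ?thesis using z[OF box_bump_test_function[of "real (Suc k)" l u \<Omega>]] lu by simp
    qed
    ultimately show ?thesis by (simp add: LIMSEQ_const_iff)
  qed
  \<comment> \<open>A Borel representative: the criterion on boxes is stated for
    \<open>lborel\<close>, while \<open>g\<close> is only Lebesgue measurable.\<close>
  obtain h' where h': "h' \<in> borel_measurable lborel" and hh: "AE x in lborel. h x = h' x"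
    using completion_ex_borel_measurable_real[of h lborel] ih by auto
  have [measurable]: "h' \<in> borel_measurable borel" using h' by simp
  have hhl: "AE x in lebesgue. h x = h' x" using hh by (rule AE_completion)
  have ih': "integrable lborel h'"
  proof -
    have "integrable lebesgue h'" using ih hhl by (subst integrable_cong_AE[of _ _ h, OF _ _ ]) (auto intro!: measurable_completion)
    then show ?thesis using h' by (simp add: integrable_completion)
  qed
  have AEQ: "AE x in lborel. x \<in> box l u \<longrightarrow> h' x = 0" if lu: "cbox l u \<subseteq> \<Omega>" for l u
  proof -
    have "AE x in lborel. indicator (box l u) x * h' x = 0"
    proof (rule AE_zero_if_box_integrals_zero)
      show "integrable lborel (\<lambda>x. indicator (box l u) x * h' x)"
        using integrable_mult_indicator[of "box l u" lborel h'] ih' by simp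
      fix a b :: 'a
      obtain c d where cd: "box a b \<inter> box l u = box c d" "cbox c d \<subseteq> cbox l u \<or> box c d = {}"
      proof -
        define c where "c = (\<Sum>i\<in>Basis. max (a \<bullet> i) (l \<bullet> i) *\<^sub>R i)"
        define d where "d = (\<Sum>i\<in>Basis. min (b \<bullet> i) (u \<bullet> i) *\<^sub>R i)"
        have "box a b \<inter> box l u = box c d" unfolding box_Int_box c_def d_def ..
        moreover have "cbox c d \<subseteq> cbox l u" by (auto simp: c_def d_def mem_box)
        ultimately show ?thesis using that by blast
      qed
      have "(\<integral>x. indicator (box a b) x * (indicator (box l u) x * h' x) \<partial>lborel) = (\<integral>x. indicator (box c d) x * h' x \<partial>lborel)"
        unfolding cd(1) [symmetric] by (simp add: indicator_inter_arith mult.assoc)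
      also have "\<dots> = (LINT x|lebesgue. indicator (box c d) x * h' x)"
        by (rule integral_completion [symmetric]) measurable
      also have "\<dots> = (LINT x|lebesgue. indicator (box c d) x * h x)"
      proof (rule integral_cong_AE)
        have [measurable]: "h \<in> borel_measurable lebesgue" "h' \<in> borel_measurable lebesgue" using ih h' by (auto intro: measurable_completion)
        show "(\<lambda>x. indicator (box c d) x * h x) \<in> borel_measurable lebesgue" "(\<lambda>x. indicator (box c d) x * h' x) \<in> borel_measurable lebesgue"
          by (intro borel_measurable_times borel_measurable_indicator \<open>h \<in> _\<close> \<open>h' \<in> borel_measurable lebesgue\<close>; simp)+
        show "AE x in lebesgue. indicator (box c d) x * h' x = indicator (box c d) x * h x"
          using hhl by eventually_elim simp
      qed
      also have "\<dots> = 0"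
      proof (cases "box c d = {}")
        case True
        then show ?thesis by simp
      next
        case False
        then show ?thesis using cd(2) lu by (intro box0) auto
      qed
      finally show "(\<integral>x. indicator (box a b) x * (indicator (box l u) x * h' x) \<partial>lborel) = 0" .
    qed
    then show ?thesis by (rule eventually_mono) (auto simp: indicator_def)
  qed
  \<comment> \<open>An open set is a countable union of closed boxes, and their faces are null sets,
    so the result on open boxes suffices.\<close>
  obtain D where D: "countable D" "D \<subseteq> Pow \<Omega>" "\<And>X. X \<in> D \<Longrightarrow> \<exists>a b. X = cbox a b" "\<Union>D = \<Omega>"
    using open_countable_Union_open_cbox[OF om] by metis
  have "AE x in lborel. x \<in> X \<longrightarrow> h' x = 0" if X: "X \<in> D" for X
  proof -
    obtain l u where lu: "X = cbox l u" using D(3)[OF X] by blast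
    have "cbox l u \<subseteq> \<Omega>" using D(2) X lu by blast
    from AEQ[OF this] have a1: "AE x in lborel. x \<in> box l u \<longrightarrow> h' x = 0" .
    have "negligible (cbox l u - box l u)" by (rule negligible_frontier_interval)
    then have "AE x in lebesgue. x \<notin> cbox l u - box l u"
      unfolding negligible_iff_null_sets by (rule AE_not_in)
    then have "AE x in lborel. x \<notin> cbox l u - box l u" unfolding AE_completion_iff .
    with a1 show ?thesis by eventually_elim (auto simp: lu)
  qed
  then have "AE x in lborel. \<forall>X\<in>D. x \<in> X \<longrightarrow> h' x = 0" unfolding AE_ball_countable[OF D(1)] by blast
  then have "AE x in lebesgue. \<forall>X\<in>D. x \<in> X \<longrightarrow> h' x = 0" by (rule AE_completion)
  with hhl have "AE x in lebesgue. x \<in> \<Omega> \<longrightarrow> g x = 0"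
    by eventually_elim (use D(4) in \<open>auto simp: h_def indicator_def split: if_splits\<close>)
  then show ?thesis using os by (simp add: AE_restrict_space_iff)
qed

section \<open>Finite element functions\<close>

lemma L2_mult_integrable:
  assumes "f \<in> L2_space \<Omega>" "g \<in> L2_space \<Omega>"
  shows "integrable (lebesgue_on \<Omega>) (\<lambda>x. f x * g x)"
proof (rule Bochner_Integration.integrable_bound)
  show "integrable (lebesgue_on \<Omega>) (\<lambda>x. (f x)\<^sup>2 + (g x)\<^sup>2)" using assms by (simp add: L2_space_def)
  show "(\<lambda>x. f x * g x) \<in> borel_measurable (lebesgue_on \<Omega>)" using assms by (auto simp: L2_space_def)
  have "\<bar>a * b\<bar> \<le> a\<^sup>2 + b\<^sup>2" for a b :: real
  proof -
    have "0 \<le> (\<bar>a\<bar> - \<bar>b\<bar>)\<^sup>2" "0 \<le> \<bar>a\<bar> * \<bar>b\<bar>" by simp_all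
    then show ?thesis unfolding power2_diff power2_abs abs_mult by linarith
  qed
  then show "AE x in lebesgue_on \<Omega>. norm (f x * g x) \<le> norm ((f x)\<^sup>2 + (g x)\<^sup>2)" by simp
qed

lemma L2_lin:
  assumes "f \<in> L2_space \<Omega>" "g \<in> L2_space \<Omega>"
  shows "(\<lambda>x. c * f x + g x) \<in> L2_space \<Omega>"
proof -
  have "integrable (lebesgue_on \<Omega>) (\<lambda>x. c\<^sup>2 * (f x)\<^sup>2 + 2 * c * (f x * g x) + (g x)\<^sup>2)"
    using assms L2_mult_integrable[OF assms] by (auto simp: L2_space_def)
  moreover have "(\<lambda>x. c\<^sup>2 * (f x)\<^sup>2 + 2 * c * (f x * g x) + (g x)\<^sup>2) = (\<lambda>x. (c * f x + g x)\<^sup>2)"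
    by (simp add: fun_eq_iff power2_eq_square algebra_simps)
  moreover have "(\<lambda>x. c * f x + g x) \<in> borel_measurable (lebesgue_on \<Omega>)"
    using assms by (intro borel_measurable_add borel_measurable_times) (auto simp: L2_space_def)
  ultimately show ?thesis by (simp add: L2_space_def)
qed

lemma L2_zero: "(\<lambda>x. 0) \<in> L2_space \<Omega>"
  by (simp add: L2_space_def)

lemma L2_scale: "f \<in> L2_space \<Omega> \<Longrightarrow> (\<lambda>x. c * f x) \<in> L2_space \<Omega>"
  using L2_lin[OF _ L2_zero] by force

lemma L2_diff: "f \<in> L2_space \<Omega> \<Longrightarrow> g \<in> L2_space \<Omega> \<Longrightarrow> (\<lambda>x. f x - g x) \<in> L2_space \<Omega>"
  using L2_lin[of g \<Omega> f "-1"] by simp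

lemma L2_sum:
  "finite I \<Longrightarrow> (\<And>i. i \<in> I \<Longrightarrow> f i \<in> L2_space \<Omega>) \<Longrightarrow> (\<lambda>x. \<Sum>i\<in>I. f i x) \<in> L2_space \<Omega>"
proof (induction I rule: finite_induct)
  case (insert i I)
  then show ?case using L2_lin[of "f i" \<Omega> "\<lambda>x. \<Sum>i\<in>I. f i x" 1] by simp
qed (simp add: L2_zero)

lemma L2_inner_sym: "L2_inner \<Omega> f g = L2_inner \<Omega> g f"
  by (simp add: L2_inner_def mult.commute)

lemma L2_inner_lin:
  assumes "f \<in> L2_space \<Omega>" "g \<in> L2_space \<Omega>" "h \<in> L2_space \<Omega>"
  shows "L2_inner \<Omega> (\<lambda>x. c * f x + g x) h = c * L2_inner \<Omega> f h + L2_inner \<Omega> g h"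
  using L2_mult_integrable[OF assms(1,3)] L2_mult_integrable[OF assms(2,3)]
  by (simp add: L2_inner_def distrib_right mult.assoc)

lemma L2_inner_scale: "L2_inner \<Omega> (\<lambda>x. c * f x) h = c * L2_inner \<Omega> f h"
  by (simp add: L2_inner_def mult.assoc)

lemma L2_inner_sum:
  assumes "finite I" "\<And>i. i \<in> I \<Longrightarrow> f i \<in> L2_space \<Omega>" "h \<in> L2_space \<Omega>"
  shows "L2_inner \<Omega> (\<lambda>x. \<Sum>i\<in>I. f i x) h = (\<Sum>i\<in>I. L2_inner \<Omega> (f i) h)"
  unfolding L2_inner_def sum_distrib_right
  using assms by (intro Bochner_Integration.integral_sum L2_mult_integrable) auto

lemma L2_inner_nonneg: "0 \<le> L2_inner \<Omega> f f"
  by (simp add: L2_inner_def)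

lemma L2_inner_cong_AE:
  assumes "f \<in> L2_space \<Omega>" "g \<in> L2_space \<Omega>" "h \<in> L2_space \<Omega>" "k \<in> L2_space \<Omega>"
    and "AE x in lebesgue_on \<Omega>. f x = g x" "AE x in lebesgue_on \<Omega>. h x = k x"
  shows "L2_inner \<Omega> f h = L2_inner \<Omega> g k"
  unfolding L2_inner_def
proof (rule integral_cong_AE)
  show "AE x in lebesgue_on \<Omega>. f x * h x = g x * k x" using assms(5,6) by eventually_elim simp
qed (use assms in \<open>auto simp: L2_space_def\<close>)

lemma borel_lebesgue_on:
  fixes f :: "'a::euclidean_space \<Rightarrow> real"
  shows "f \<in> borel_measurable borel \<Longrightarrow> f \<in> borel_measurable (lebesgue_on \<Omega>)"
  by (intro measurable_restrict_space1 measurable_completion) simp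

lemma AE_lebesgue_onI:
  fixes \<Omega> :: "'a::euclidean_space set"
  shows "\<Omega> \<in> sets lebesgue \<Longrightarrow> AE x in lborel. P x \<Longrightarrow> AE x in lebesgue_on \<Omega>. P x"
  using AE_completion[of P lborel] by (subst AE_restrict_space_iff) auto

lemma L2_bounded:
  fixes f :: "'a::euclidean_space \<Rightarrow> real"
  assumes "\<Omega> \<in> lmeasurable" "f \<in> borel_measurable borel" "AE x in lborel. \<bar>f x\<bar> \<le> B"
  shows "f \<in> L2_space \<Omega>"
proof -
  interpret finite_measure "lebesgue_on \<Omega>" by (rule finite_measure_lebesgue_on[OF assms(1)])
  have [measurable]: "f \<in> borel_measurable (lebesgue_on \<Omega>)" by (rule borel_lebesgue_on[OF assms(2)])
  have "AE x in lebesgue_on \<Omega>. \<bar>f x\<bar> \<le> B" using assms(1,3) by (intro AE_lebesgue_onI) auto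
  then have "AE x in lebesgue_on \<Omega>. norm ((f x)\<^sup>2) \<le> B\<^sup>2"
  proof eventually_elim
    case (elim x)
    then show ?case using power_mono[OF elim, of 2] by simp
  qed
  then have "integrable (lebesgue_on \<Omega>) (\<lambda>x. (f x)\<^sup>2)" by (rule integrable_const_bound) measurable
  then show ?thesis by (simp add: L2_space_def)
qed

lemma L2_integrable:
  fixes f :: "'a::euclidean_space \<Rightarrow> real"
  assumes "\<Omega> \<in> lmeasurable" "f \<in> L2_space \<Omega>"
  shows "integrable (lebesgue_on \<Omega>) f"
  using L2_mult_integrable[OF assms(2) L2_bounded[OF assms(1), of "\<lambda>x. 1" 1]] by simp

lemma integral_lebesgue_on_lborel:
  fixes f :: "'a::euclidean_space \<Rightarrow> real"
  assumes \<Omega>: "\<Omega> \<in> sets lebesgue" and [measurable]: "f \<in> borel_measurable borel"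
    and z: "AE x in lborel. x \<notin> \<Omega> \<longrightarrow> f x = 0"
  shows "(LINT x|lebesgue_on \<Omega>. f x) = (\<integral>x. f x \<partial>lborel)"
proof -
  have m: "f \<in> borel_measurable lebesgue" by (intro measurable_completion) simp
  have "(LINT x|lebesgue_on \<Omega>. f x) = (LINT x|lebesgue. f x)"
    unfolding integral_lebesgue_on[OF \<Omega>]
  proof (rule integral_cong_AE)
    show "(\<lambda>x. indicator \<Omega> x * f x) \<in> borel_measurable lebesgue"
      using \<Omega> m by (intro borel_measurable_times borel_measurable_indicator) auto
    show "AE x in lebesgue. indicator \<Omega> x * f x = f x"
      using AE_completion[OF z] by eventually_elim (auto simp: indicator_def)
  qed (rule m)
  also have "\<dots> = (\<integral>x. f x \<partial>lborel)" by (rule integral_completion) simp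
  finally show ?thesis .
qed

lemma test_function_L2:
  fixes \<Omega> :: "'a::euclidean_space set"
  assumes "\<phi> \<in> test_functions \<Omega>" "\<Omega> \<in> lmeasurable" "bounded \<Omega>"
  shows "\<phi> \<in> L2_space \<Omega>" and "b \<in> Basis \<Longrightarrow> pderiv_dir b \<phi> \<in> L2_space \<Omega>"
proof -
  note sm = test_function_smooth[OF assms(1)]
  obtain M where M: "M-lipschitz_on UNIV \<phi>" using test_function_lipschitz[OF assms(1)] .
  obtain B where "\<And>x. \<bar>\<phi> x\<bar> \<le> B" using lipschitz_bounded[OF M assms(3) test_function_support[OF assms(1)]] by blast
  then show "\<phi> \<in> L2_space \<Omega>" using assms(2) by (intro L2_bounded borel_measurable_smooth[OF sm] AE_I2) auto
  assume b: "b \<in> Basis"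
  have "\<bar>pderiv_dir b \<phi> x\<bar> \<le> M" for x
    unfolding pderiv_dir_def
    by (rule derivative_bound[OF M b frechet_derivative_works[THEN iffD1, OF smooth_differentiable[OF sm]]])
  then show "pderiv_dir b \<phi> \<in> L2_space \<Omega>"
    using assms(2) by (intro L2_bounded borel_measurable_smooth smooth_pderiv sm b AE_I2) auto
qed

lemma weak_pderiv_unique:
  fixes \<Omega> :: "'a::euclidean_space set"
  assumes om: "open \<Omega>" "bounded \<Omega>" and g: "g \<in> L2_space \<Omega>" "h \<in> L2_space \<Omega>"
    and w: "is_weak_pderiv \<Omega> b f g" "is_weak_pderiv \<Omega> b f h"
  shows "AE x in lebesgue_on \<Omega>. g x = h x"
proof -
  have lm: "\<Omega> \<in> lmeasurable" using om by (intro lmeasurable_open)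
  have "AE x in lebesgue_on \<Omega>. g x - h x = 0"
  proof (rule fundamental_lemma[OF om(1) L2_integrable[OF lm L2_diff[OF g]]])
    fix \<phi> :: "'a \<Rightarrow> real" assume \<phi>: "\<phi> \<in> test_functions \<Omega>"
    have "(LINT x|lebesgue_on \<Omega>. (g x - h x) * \<phi> x) = L2_inner \<Omega> g \<phi> - L2_inner \<Omega> h \<phi>"
      using L2_inner_lin[OF g(2,1) test_function_L2(1)[OF \<phi> lm om(2)], of "-1"] by (simp add: L2_inner_def)
    then show "(LINT x|lebesgue_on \<Omega>. (g x - h x) * \<phi> x) = 0"
      using w \<phi> by (simp add: is_weak_pderiv_def)
  qed
  then show ?thesis by eventually_elim simp
qed

lemma weak_pderiv_L2:
  assumes "g \<in> L2_space \<Omega>" "is_weak_pderiv \<Omega> b f g"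
  shows "weak_pderiv \<Omega> b f \<in> L2_space \<Omega>" "is_weak_pderiv \<Omega> b f (weak_pderiv \<Omega> b f)"
  using someI[of "\<lambda>g. g \<in> L2_space \<Omega> \<and> is_weak_pderiv \<Omega> b f g" g] assms
  by (auto simp: weak_pderiv_def)

lemma ddir_lin:
  assumes "v differentiable (at x)" "w differentiable (at x)"
  shows "ddir b (\<lambda>x. c * v x + w x) x = c * ddir b v x + ddir b w x"
proof -
  obtain v' w' where d: "(v has_derivative v') (at x)" "(w has_derivative w') (at x)"
    using assms by (auto simp: differentiable_def)
  have "((\<lambda>x. c * v x + w x) has_derivative (\<lambda>h. c * v' h + w' h)) (at x)"
    by (intro derivative_intros d)
  from ddir_eq[OF this] ddir_eq[OF d(1)] ddir_eq[OF d(2)] show ?thesis by simp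
qed

section \<open>Piecewise affine functions: regularity, weak derivatives and integration by
  parts\<close>

locale fe_setting =
  fixes \<Omega> :: "'a::euclidean_space set" and \<T> :: "'a set set"
  assumes dom: "convex_polytopal_domain \<Omega>" and tri: "triangulates \<T> \<Omega>"
begin

abbreviation S where "S \<equiv> fe_space \<Omega> \<T>"

lemma domain: "open \<Omega>" "\<Omega> \<noteq> {}" "bounded \<Omega>" "convex \<Omega>"
  using dom by (auto simp: convex_polytopal_domain_def)

lemma lmeas: "\<Omega> \<in> lmeasurable" and lsets: "\<Omega> \<in> sets lebesgue"
  using lmeasurable_open[OF domain(3,1)] by auto

lemma cells: "finite \<T>" "\<Union>\<T> = closure \<Omega>" "K \<in> \<T> \<Longrightarrow> closed K" "K \<in> \<T> \<Longrightarrow> convex K"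
proof -
  show "finite \<T>" "\<Union>\<T> = closure \<Omega>" using tri by (auto simp: triangulates_def triangulation_def)
  assume "K \<in> \<T>"
  then have "polytope K" using tri simplex_imp_polytope by (auto simp: triangulates_def)
  then show "closed K" "convex K" using polytope_imp_closed polytope_imp_convex by auto
qed

lemma fe_affine:
  assumes "v \<in> S" "K \<in> \<T>"
  obtains a c where "\<And>x. x \<in> K \<Longrightarrow> v x = a \<bullet> x + c"
proof -
  have "\<exists>a c. \<forall>x\<in>K. v x = a \<bullet> x + c" using assms by (simp add: fe_space_def)
  then show ?thesis using that by metis
qed

lemma fe_lin: "v \<in> S \<Longrightarrow> w \<in> S \<Longrightarrow> (\<lambda>x. c * v x + w x) \<in> S"
proof -
  assume v: "v \<in> S" and w: "w \<in> S"
  have "\<exists>a d. \<forall>x\<in>K. c * v x + w x = a \<bullet> x + d" if K: "K \<in> \<T>" for K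
  proof -
    obtain a d where "\<And>x. x \<in> K \<Longrightarrow> v x = a \<bullet> x + d" by (rule fe_affine[OF v K]) blast
    moreover obtain a' d' where "\<And>x. x \<in> K \<Longrightarrow> w x = a' \<bullet> x + d'" by (rule fe_affine[OF w K]) blast
    ultimately have "\<forall>x\<in>K. c * v x + w x = (c *\<^sub>R a + a') \<bullet> x + (c * d + d')" by (simp add: inner_add_left algebra_simps)
    then show ?thesis by blast
  qed
  then show ?thesis using v w unfolding fe_space_def mem_Collect_eq
    by (intro conjI ballI allI impI continuous_intros) simp_all
qed

lemma fe_zero: "(\<lambda>x. 0) \<in> S"
  unfolding fe_space_def by (auto intro!: exI[of _ "0::'a"])

lemma fe_off: "v \<in> S \<Longrightarrow> x \<notin> \<Omega> \<Longrightarrow> v x = 0"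
  by (simp add: fe_space_def)

text \<open>Finite dimensionality in the form used later: the vertices of all simplices separate the
  functions, since an affine function that vanishes at the vertices vanishes on their convex
  hull.\<close>

lemma fe_determined:
  obtains V where "finite V" "\<And>v x. v \<in> S \<Longrightarrow> (\<And>p. p \<in> V \<Longrightarrow> v p = 0) \<Longrightarrow> v x = 0"
proof -
  have "\<exists>C. finite C \<and> K = convex hull C" if "K \<in> \<T>" for K
    using tri that by (auto simp: triangulates_def simplex)
  then obtain C where C: "\<And>K. K \<in> \<T> \<Longrightarrow> finite (C K) \<and> K = convex hull (C K)" by metis
  show ?thesis
  proof
    show "finite (\<Union>K\<in>\<T>. C K)" using cells(1) C by auto
    fix v x assume v: "v \<in> S" and z: "\<And>p. p \<in> (\<Union>K\<in>\<T>. C K) \<Longrightarrow> v p = 0"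
    show "v x = 0"
    proof (cases "x \<in> \<Omega>")
      case True
      then obtain K where K: "K \<in> \<T>" "x \<in> K" using cells(2) closure_subset[of \<Omega>] by blast
      obtain a d where ad: "\<And>x. x \<in> K \<Longrightarrow> v x = a \<bullet> x + d" by (rule fe_affine[OF v K(1)]) blast
      have "C K \<subseteq> {x. a \<bullet> x = - d}"
      proof
        fix p assume p: "p \<in> C K"
        then have "p \<in> K" using C[OF K(1)] hull_inc[of p "C K" convex] by simp
        then have "v p = a \<bullet> p + d" by (rule ad)
        moreover have "v p = 0" by (rule z) (use p K(1) in blast)
        ultimately show "p \<in> {x. a \<bullet> x = - d}" by simp
      qed
      then have "K \<subseteq> {x. a \<bullet> x = - d}"
        using C[OF K(1)] hull_minimal[of "C K" "{x. a \<bullet> x = - d}" convex] convex_hyperplane by metis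
      then show ?thesis using ad K(2) by auto
    qed (simp add: fe_off[OF v])
  qed
qed

text \<open>Along a segment in the closed domain the function is Lipschitz on finitely many closed
  pieces that cover the segment. \<open>M\<close> is the sum of the gradient norms over all
  simplices; only its finiteness matters.\<close>

lemma fe_lipschitz:
  assumes v: "v \<in> S"
  obtains M where "M-lipschitz_on UNIV v"
proof -
  have "\<exists>a d. \<forall>x\<in>K. v x = a \<bullet> x + d" if "K \<in> \<T>" for K
    using v that by (simp add: fe_space_def)
  then obtain a d where ad: "\<And>K x. K \<in> \<T> \<Longrightarrow> x \<in> K \<Longrightarrow> v x = a K \<bullet> x + d K" by metis
  define M where "M = (\<Sum>K\<in>\<T>. norm (a K))"
  have M: "0 \<le> M" by (simp add: M_def sum_nonneg)
  have aM: "norm (a K) \<le> M" if "K \<in> \<T>" for K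
    unfolding M_def using that cells(1) by (intro member_le_sum) auto
  have inside: "\<bar>v x - v y\<bar> \<le> M * dist x y" if x: "x \<in> closure \<Omega>" and y: "y \<in> closure \<Omega>" for x y
  proof -
    define p where "p t = x + t *\<^sub>R (y - x)" for t :: real
    have "(M * dist x y)-lipschitz_on {0..1} (\<lambda>t. v (p t))"
    proof (rule lipschitz_on_closed_Union[where I = \<T> and U = "\<lambda>K. p -` K"])
      fix K assume K: "K \<in> \<T>"
      show "(M * dist x y)-lipschitz_on (p -` K) (\<lambda>t. v (p t))"
      proof (rule lipschitz_onI)
        fix s t assume st: "s \<in> p -` K" "t \<in> p -` K"
        have "v (p s) - v (p t) = (s - t) * (a K \<bullet> (y - x))"
          using st ad[OF K] by (simp add: p_def inner_add_right algebra_simps)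
        then have "dist (v (p s)) (v (p t)) = \<bar>a K \<bullet> (y - x)\<bar> * dist s t" by (simp add: dist_real_def abs_mult)
        also have "\<bar>a K \<bullet> (y - x)\<bar> \<le> norm (a K) * norm (y - x)" by (rule Cauchy_Schwarz_ineq2)
        also have "\<dots> \<le> M * dist x y" using aM[OF K] by (simp add: dist_norm norm_minus_commute mult_right_mono)
        finally show "dist (v (p s)) (v (p t)) \<le> M * dist x y * dist s t" by (simp add: mult_right_mono)
      qed (use M in simp)
      show "closed (p -` K)" using cells(3)[OF K] by (rule closed_vimage) (auto simp: p_def intro!: continuous_intros)
    next
      have "p t \<in> closure \<Omega>" if "t \<in> {0..1}" for t
      proof -
        have "p t = (1 - t) *\<^sub>R x + t *\<^sub>R y" by (simp add: p_def algebra_simps)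
        then show ?thesis using convex_closure[OF domain(4)] x y that by (simp add: convex_alt)
      qed
      then show "{0..1} \<subseteq> (\<Union>K\<in>\<T>. p -` K)" using cells(2) by blast
    qed (use M cells(1) in auto)
    from lipschitz_onD[OF this, of 0 1] show ?thesis by (simp add: p_def dist_real_def)
  qed
  \<comment> \<open>A segment leaving the domain meets the frontier, where \<open>v\<close> is zero;
    this carries the bound over to the zero extension.\<close>
  have half: "\<bar>v x - v y\<bar> \<le> M * dist x y" if x: "x \<in> \<Omega>" for x y
  proof (cases "y \<in> \<Omega>")
    case True
    then show ?thesis using x closure_subset by (intro inside) auto
  next
    case False
    have "closed_segment x y \<inter> frontier \<Omega> \<noteq> {}"
      by (rule connected_Int_frontier) (use x False in auto)
    then obtain z where z: "z \<in> closed_segment x y" "z \<in> frontier \<Omega>" by blast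
    have "z \<notin> \<Omega>" "z \<in> closure \<Omega>" using z(2) domain(1) by (auto simp: frontier_def interior_open)
    then have "\<bar>v x - v y\<bar> = \<bar>v x - v z\<bar>" using False fe_off[OF v] by simp
    also have "\<dots> \<le> M * dist x z" using x closure_subset \<open>z \<in> closure \<Omega>\<close> by (intro inside) auto
    also have "\<dots> \<le> M * dist x y"
      using dist_in_closed_segment[OF z(1)] M by (intro mult_left_mono) (auto simp: dist_commute)
    finally show ?thesis .
  qed
  have "M-lipschitz_on UNIV v"
  proof (rule lipschitz_onI)
    fix x y :: 'a
    show "dist (v x) (v y) \<le> M * dist x y"
      using half[of x y] half[of y x] fe_off[OF v, of x] fe_off[OF v, of y] M
      by (cases "x \<in> \<Omega>"; cases "y \<in> \<Omega>") (auto simp: dist_real_def dist_commute abs_minus_commute)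
  qed (rule M)
  then show ?thesis by (rule that)
qed

lemma AE_frontier: "AE x in lborel. x \<notin> frontier \<Omega> \<and> (\<forall>K\<in>\<T>. x \<notin> frontier K)"
proof -
  have n: "AE x in lborel. x \<notin> frontier K" if "convex K" for K :: "'a set"
  proof -
    have "AE x in lebesgue. x \<notin> frontier K"
      using negligible_convex_frontier[OF that] unfolding negligible_iff_null_sets by (rule AE_not_in)
    then show ?thesis unfolding AE_completion_iff .
  qed
  have "AE x in lborel. \<forall>K\<in>\<T>. x \<notin> frontier K"
    using n cells by (intro AE_finite_allI) auto
  with n[OF domain(4)] show ?thesis by eventually_elim simp
qed

lemma fe_locally_affine:
  assumes v: "v \<in> S"
  shows "AE x in lborel. \<exists>a c d. 0 < d \<and> (\<forall>z\<in>ball x d. v z = a \<bullet> z + c)"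
  using AE_frontier
proof eventually_elim
  case (elim x)
  show ?case
  proof (cases "x \<in> closure \<Omega>")
    case True
    then obtain K where K: "K \<in> \<T>" "x \<in> K" using cells(2) by blast
    then have "x \<in> interior K" using elim closure_subset[of K] by (auto simp: frontier_def)
    then obtain d where "0 < d" "ball x d \<subseteq> K" using mem_interior by blast
    moreover obtain a c where "\<And>x. x \<in> K \<Longrightarrow> v x = a \<bullet> x + c" by (rule fe_affine[OF v K(1)]) blast
    ultimately show ?thesis by (intro exI[of _ a] exI[of _ c] exI[of _ d]) auto
  next
    case False
    then have "x \<in> - closure \<Omega>" "open (- closure \<Omega>)" by auto
    then obtain d where d: "0 < d" "ball x d \<subseteq> - closure \<Omega>" using openE by blast
    have "v z = 0 \<bullet> z + 0" if "z \<in> ball x d" for z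
    proof -
      have "z \<notin> \<Omega>" using that d(2) closure_subset[of \<Omega>] by blast
      then show ?thesis by (simp add: fe_off[OF v])
    qed
    then show ?thesis using d(1) by blast
  qed
qed

lemma fe_differentiable:
  assumes v: "v \<in> S"
  shows "AE x in lborel. v differentiable (at x)"
  using fe_locally_affine[OF v]
proof eventually_elim
  case (elim x)
  then obtain a c d where d: "0 < d" "\<And>z. z \<in> ball x d \<Longrightarrow> v z = a \<bullet> z + c" by blast
  have "((\<lambda>z. a \<bullet> z + c) has_derivative (\<lambda>h. a \<bullet> h)) (at x)" by (auto intro!: derivative_eq_intros)
  then have "(v has_derivative (\<lambda>h. a \<bullet> h)) (at x)"
    by (rule has_derivative_transform_within_open[of _ _ _ UNIV "ball x d"]) (use d in auto)
  then show ?case by (auto simp: differentiable_def)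
qed

lemma fe_measurable: "v \<in> S \<Longrightarrow> v \<in> borel_measurable borel"
  using fe_lipschitz lipschitz_measurable by metis

lemma fe_L2: "v \<in> S \<Longrightarrow> v \<in> L2_space \<Omega>"
proof -
  assume v: "v \<in> S"
  obtain M where M: "M-lipschitz_on UNIV v" using fe_lipschitz[OF v] .
  obtain B where "\<And>x. \<bar>v x\<bar> \<le> B" using lipschitz_bounded[OF M domain(3) fe_off[OF v]] by blast
  then show ?thesis by (intro L2_bounded[OF lmeas fe_measurable[OF v]] AE_I2) auto
qed

lemma fe_ddir_L2:
  assumes v: "v \<in> S" and b: "b \<in> Basis"
  shows "ddir b v \<in> L2_space \<Omega>"
proof -
  obtain M where M: "M-lipschitz_on UNIV v" using fe_lipschitz[OF v] .
  show ?thesis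
  proof (rule L2_bounded[OF lmeas ddir_measurable[OF fe_measurable[OF v]]])
    show "AE x in lborel. \<bar>ddir b v x\<bar> \<le> M" using fe_differentiable[OF v]
    proof eventually_elim
      case (elim x)
      then obtain v' where "(v has_derivative v') (at x)" by (auto simp: differentiable_def)
      from ddir_eq[OF this] derivative_bound[OF M b this] show ?case by simp
    qed
  qed
qed

text \<open>Both factors are Lipschitz on the whole space and vanish off the domain, so
  \<open>integral_product_rule\<close> applies globally; jumps of the gradient across faces produce
  no extra terms.\<close>

lemma fe_weak_pderiv:
  assumes v: "v \<in> S" and b: "b \<in> Basis"
  shows "is_weak_pderiv \<Omega> b v (ddir b v)"
  unfolding is_weak_pderiv_def
proof
  fix \<phi> assume \<phi>: "\<phi> \<in> test_functions \<Omega>"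
  note sm = test_function_smooth[OF \<phi>]
  obtain M where M: "M-lipschitz_on UNIV v" using fe_lipschitz[OF v] .
  obtain M' where M': "M'-lipschitz_on UNIV \<phi>" using test_function_lipschitz[OF \<phi>] .
  have e: "pderiv_dir b \<phi> = ddir b \<phi>" by (simp add: fun_eq_iff ddir_eq_pderiv_dir[OF smooth_differentiable[OF sm]])
  note L = fe_L2[OF v] fe_ddir_L2[OF v b] test_function_L2[OF \<phi> lmeas domain(3)]
  have [measurable]: "v \<in> borel_measurable borel" "\<phi> \<in> borel_measurable borel" by (intro fe_measurable v borel_measurable_smooth sm)+
  have [measurable]: "ddir b v \<in> borel_measurable borel" "ddir b \<phi> \<in> borel_measurable borel" by (intro ddir_measurable; measurable)+
  have "L2_inner \<Omega> v (pderiv_dir b \<phi>) + L2_inner \<Omega> (ddir b v) \<phi>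
      = (LINT x|lebesgue_on \<Omega>. v x * ddir b \<phi> x + ddir b v x * \<phi> x)"
    using L2_mult_integrable[OF L(1) L(4)[OF b]] L2_mult_integrable[OF L(2,3)] by (simp add: L2_inner_def e)
  also have "\<dots> = (\<integral>x. v x * ddir b \<phi> x + ddir b v x * \<phi> x \<partial>lborel)"
    by (rule integral_lebesgue_on_lborel[OF lsets])
      (measurable, use fe_off[OF v] test_function_support[OF \<phi>] in auto)
  also have "\<dots> = 0"
    by (rule has_bochner_integral_integral_eq, rule integral_product_rule[OF M domain(3) fe_off[OF v] M' b fe_differentiable[OF v]])
      (simp_all add: smooth_differentiable[OF sm])
  finally show "L2_inner \<Omega> v (pderiv_dir b \<phi>) = - L2_inner \<Omega> (ddir b v) \<phi>" by simp
qed

lemma fe_weak_pderiv_AE: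
  assumes v: "v \<in> S" and b: "b \<in> Basis"
  shows "AE x in lebesgue_on \<Omega>. weak_pderiv \<Omega> b v x = ddir b v x" "weak_pderiv \<Omega> b v \<in> L2_space \<Omega>"
proof -
  note w = weak_pderiv_L2[OF fe_ddir_L2[OF v b] fe_weak_pderiv[OF v b]]
  show "weak_pderiv \<Omega> b v \<in> L2_space \<Omega>" by (rule w)
  show "AE x in lebesgue_on \<Omega>. weak_pderiv \<Omega> b v x = ddir b v x"
    by (rule weak_pderiv_unique[OF domain(1,3) w(1) fe_ddir_L2[OF v b] w(2) fe_weak_pderiv[OF v b]])
qed

lemma grad_inner_fe:
  assumes v: "v \<in> S" and w: "w \<in> S"
  shows "grad_inner \<Omega> v w = (\<Sum>b\<in>Basis. L2_inner \<Omega> (ddir b v) (ddir b w))"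
  unfolding grad_inner_def
  by (intro sum.cong refl L2_inner_cong_AE fe_weak_pderiv_AE fe_ddir_L2 v w)

lemma grad_inner_sym: "grad_inner \<Omega> v w = grad_inner \<Omega> w v"
  by (simp add: grad_inner_def L2_inner_sym)

lemma grad_inner_lin:
  assumes v: "v \<in> S" "w \<in> S" "z \<in> S"
  shows "grad_inner \<Omega> (\<lambda>x. c * v x + w x) z = c * grad_inner \<Omega> v z + grad_inner \<Omega> w z"
proof -
  have "L2_inner \<Omega> (ddir b (\<lambda>x. c * v x + w x)) (ddir b z)
      = c * L2_inner \<Omega> (ddir b v) (ddir b z) + L2_inner \<Omega> (ddir b w) (ddir b z)" if b: "b \<in> Basis" for b
  proof -
    have "AE x in lborel. ddir b (\<lambda>x. c * v x + w x) x = c * ddir b v x + ddir b w x"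
      using fe_differentiable[OF v(1)] fe_differentiable[OF v(2)] by eventually_elim (rule ddir_lin)
    then have "L2_inner \<Omega> (ddir b (\<lambda>x. c * v x + w x)) (ddir b z) = L2_inner \<Omega> (\<lambda>x. c * ddir b v x + ddir b w x) (ddir b z)"
      by (intro L2_inner_cong_AE AE_lebesgue_onI lsets fe_ddir_L2 fe_lin L2_lin v b) auto
    also have "\<dots> = c * L2_inner \<Omega> (ddir b v) (ddir b z) + L2_inner \<Omega> (ddir b w) (ddir b z)"
      by (intro L2_inner_lin fe_ddir_L2 v b)
    finally show ?thesis .
  qed
  then show ?thesis using v by (simp add: grad_inner_fe fe_lin sum.distrib sum_distrib_left)
qed

text \<open>With the derivative d_b in one coordinate direction, integrating d_b (v^2) times x_b by
  parts shows that v^2 and - 2 v (d_b v) x_b have the same integral, and half of it is absorbed. The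
  constant involves the size of the domain only, so eigenvalues are bounded below uniformly in the
  mesh.\<close>

lemma poincare:
  assumes v: "v \<in> S" and R: "0 < R" "\<And>x. x \<in> \<Omega> \<Longrightarrow> norm x \<le> R"
  shows "L2_inner \<Omega> v v \<le> 4 * R\<^sup>2 * grad_inner \<Omega> v v"
proof -
  obtain b :: 'a where b: "b \<in> Basis" using nonempty_Basis by blast
  obtain M where M: "M-lipschitz_on UNIV v" using fe_lipschitz[OF v] .
  obtain B where B: "0 \<le> B" "\<And>x. \<bar>v x\<bar> \<le> B" using lipschitz_bounded[OF M domain(3) fe_off[OF v]] by blast
  note d = fe_differentiable[OF v]
  have lg: "1-lipschitz_on UNIV (\<lambda>x. x \<bullet> b)"
    using Basis_le_norm[OF b] by (intro lipschitz_onI) (auto simp: dist_norm simp flip: inner_diff_left)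
  have dg: "((\<lambda>x. x \<bullet> b) has_derivative (\<lambda>h. h \<bullet> b)) (at x)" for x by (auto intro!: derivative_eq_intros)
  have ddg: "ddir b (\<lambda>x. x \<bullet> b) x = 1" for x using ddir_eq[OF dg, of b] b by simp
  have [measurable]: "v \<in> borel_measurable borel" "ddir b v \<in> borel_measurable borel" "ddir b (\<lambda>x. v x * v x) \<in> borel_measurable borel"
    using fe_measurable[OF v] by (auto intro!: ddir_measurable)
  have lv: "(M * B + B * M)-lipschitz_on UNIV (\<lambda>x. v x * v x)"
    by (rule lipschitz_mult[OF M B fe_off[OF v] M B])
  have dvv: "AE x in lborel. (\<lambda>x. v x * v x) differentiable (at x)" using d by eventually_elim (rule differentiable_mult)
  have dgg: "AE x in lborel. (\<lambda>x. x \<bullet> b) differentiable (at x)" using dg by (auto simp: differentiable_def)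
  have I0: "has_bochner_integral lborel (\<lambda>x. v x * v x * ddir b (\<lambda>x. x \<bullet> b) x + ddir b (\<lambda>x. v x * v x) x * (x \<bullet> b)) 0"
    by (rule integral_product_rule[OF lv domain(3) _ lg b dvv dgg]) (simp add: fe_off[OF v])
  have ae: "AE x in lborel. v x * v x * ddir b (\<lambda>x. x \<bullet> b) x + ddir b (\<lambda>x. v x * v x) x * (x \<bullet> b)
      = v x * v x + 2 * v x * ddir b v x * (x \<bullet> b)"
    using d by eventually_elim (simp add: ddg ddir_product)
  have I: "(\<integral>x. v x * v x + 2 * v x * ddir b v x * (x \<bullet> b) \<partial>lborel) = 0"
    using I0 has_bochner_integral_cong_AE[OF _ _ ae, of 0] by (simp add: has_bochner_integral_iff ddg)
  have I\<Omega>: "(LINT x|lebesgue_on \<Omega>. v x * v x + 2 * v x * ddir b v x * (x \<bullet> b)) = 0"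
    unfolding I [symmetric] by (rule integral_lebesgue_on_lborel[OF lsets]) (measurable, use fe_off[OF v] in auto)
  note L = L2_mult_integrable[OF fe_L2[OF v] fe_L2[OF v]] L2_mult_integrable[OF fe_ddir_L2[OF v b] fe_ddir_L2[OF v b]]
  \<comment> \<open>Young's inequality, from the square of v + 2 x_b d_b v. It gives 2 R^2, and 4
    R^2 after doubling.\<close>
  have low: "v x * v x / 2 - 2 * R\<^sup>2 * (ddir b v x * ddir b v x) \<le> v x * v x + 2 * v x * ddir b v x * (x \<bullet> b)" if x: "x \<in> \<Omega>" for x
  proof -
    have "\<bar>x \<bullet> b\<bar> \<le> R" using Basis_le_norm[OF b, of x] R(2)[OF x] by simp
    then have "(x \<bullet> b)\<^sup>2 \<le> R\<^sup>2" by (rule abs_le_square_iff[THEN iffD1, OF order_trans]) (use R in simp)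
    then have "(ddir b v x)\<^sup>2 * (x \<bullet> b)\<^sup>2 \<le> (ddir b v x)\<^sup>2 * R\<^sup>2" by (rule mult_left_mono) simp
    moreover have "0 \<le> (v x + 2 * (ddir b v x * (x \<bullet> b)))\<^sup>2" by simp
    ultimately show ?thesis by (simp add: power2_eq_square algebra_simps)
  qed
  have "(LINT x|lebesgue_on \<Omega>. v x * v x / 2 - 2 * R\<^sup>2 * (ddir b v x * ddir b v x)) \<le> 0"
    unfolding I\<Omega> [symmetric]
  proof (rule integral_mono)
    show "integrable (lebesgue_on \<Omega>) (\<lambda>x. v x * v x / 2 - 2 * R\<^sup>2 * (ddir b v x * ddir b v x))" using L by simp
    show "integrable (lebesgue_on \<Omega>) (\<lambda>x. v x * v x + 2 * v x * ddir b v x * (x \<bullet> b))"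
    proof -
      have "integrable lborel (\<lambda>x. v x * v x + 2 * v x * ddir b v x * (x \<bullet> b))"
        using I0 has_bochner_integral_cong_AE[OF _ _ ae, of 0] by (simp add: has_bochner_integral_iff ddg)
      then have "integrable lebesgue (\<lambda>x. v x * v x + 2 * v x * ddir b v x * (x \<bullet> b))" by (intro integrable_completion[THEN iffD2]) auto
      moreover have "(\<lambda>x. indicator \<Omega> x * (v x * v x + 2 * v x * ddir b v x * (x \<bullet> b))) = (\<lambda>x. v x * v x + 2 * v x * ddir b v x * (x \<bullet> b))"
        using fe_off[OF v] by (auto simp: fun_eq_iff indicator_def)
      ultimately show ?thesis by (simp add: integrable_lebesgue_on[OF lsets])
    qed
    fix x assume "x \<in> space (lebesgue_on \<Omega>)"
    then show "v x * v x / 2 - 2 * R\<^sup>2 * (ddir b v x * ddir b v x) \<le> v x * v x + 2 * v x * ddir b v x * (x \<bullet> b)"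
      by (intro low) (simp add: space_restrict_space)
  qed
  then have "L2_inner \<Omega> v v \<le> 4 * R\<^sup>2 * L2_inner \<Omega> (ddir b v) (ddir b v)"
    using L by (simp add: L2_inner_def)
  also have "\<dots> \<le> 4 * R\<^sup>2 * grad_inner \<Omega> v v"
    unfolding grad_inner_fe[OF v v] using b
    by (intro mult_left_mono member_le_sum[where f = "\<lambda>b. L2_inner \<Omega> (ddir b v) (ddir b v)"]) (auto simp: L2_inner_nonneg)
  finally show ?thesis .
qed

text \<open>The set where \<open>v\<close> is nonzero is open and null, hence empty. With the zero
  extension, equality in S_h is therefore equality of functions.\<close>

lemma fe_pos_def:
  assumes v: "v \<in> S" and z: "L2_inner \<Omega> v v = 0"
  shows "v x = 0"
proof -
  obtain M where M: "M-lipschitz_on UNIV v" using fe_lipschitz[OF v] .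
  have "AE x in lebesgue_on \<Omega>. v x * v x = 0"
    using z integral_nonneg_eq_0_iff_AE[OF L2_mult_integrable[OF fe_L2[OF v] fe_L2[OF v]]] by (simp add: L2_inner_def)
  then have "AE x in lebesgue. x \<in> \<Omega> \<longrightarrow> v x = 0" using lsets by (simp add: AE_restrict_space_iff)
  then have "AE x in lebesgue. v x = 0" by eventually_elim (use fe_off[OF v] in auto)
  then have "{x. v x \<noteq> 0} \<in> null_sets lebesgue" by (simp add: AE_iff_null_sets completion.AE_iff_null_sets)
  moreover have "open {x. v x \<noteq> 0}"
    by (intro open_Collect_neq lipschitz_on_continuous_on[OF M] continuous_intros)
  ultimately have "{x. v x \<noteq> 0} = {}" using open_not_negligible[of "{x. v x \<noteq> 0}"] by (auto simp: negligible_iff_null_sets)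
  then show ?thesis by blast
qed

text \<open>Test functions approximate \<open>v\<close> with uniformly bounded values and
  derivatives, so dominated convergence carries the definition of the weak derivative to the limit.
  The approximants have compact support, hence no boundary term and no trace occurs.\<close>

lemma fe_integration_by_parts:
  assumes g: "g \<in> L2_space \<Omega>" and h: "h \<in> L2_space \<Omega>" and w: "is_weak_pderiv \<Omega> b g h"
    and v: "v \<in> S" and b: "b \<in> Basis"
  shows "L2_inner \<Omega> g (ddir b v) = - L2_inner \<Omega> h v"
proof -
  obtain M where M: "M-lipschitz_on UNIV v" using fe_lipschitz[OF v] .
  obtain x0 where x0: "x0 \<in> \<Omega>" using domain(2) by blast
  obtain \<phi> B where \<phi>: "\<And>n. \<phi> n \<in> test_functions \<Omega>" "0 \<le> B" "\<And>n x. \<bar>\<phi> n x\<bar> \<le> B"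
    "\<And>x. (\<lambda>n. \<phi> n x) \<longlonglongrightarrow> v x" "\<And>n x b. b \<in> Basis \<Longrightarrow> \<bar>pderiv_dir b (\<phi> n) x\<bar> \<le> 2 * M"
    "AE x in lborel. \<forall>b\<in>Basis. (\<lambda>n. pderiv_dir b (\<phi> n) x) \<longlonglongrightarrow> ddir b v x"
    using test_function_approximation[OF domain(1,4,3) x0 M fe_off[OF v] fe_locally_affine[OF v]] by blast
  have m: "f \<in> borel_measurable (lebesgue_on \<Omega>)" if "f \<in> L2_space \<Omega>" for f using that by (simp add: L2_space_def)
  note m' = m[OF test_function_L2(1)[OF \<phi>(1) lmeas domain(3)]] m[OF test_function_L2(2)[OF \<phi>(1) lmeas domain(3) b]]
    m[OF fe_L2[OF v]] m[OF fe_ddir_L2[OF v b]] m[OF g] m[OF h]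
  have "(\<lambda>n. L2_inner \<Omega> g (pderiv_dir b (\<phi> n))) \<longlonglongrightarrow> L2_inner \<Omega> g (ddir b v)"
    unfolding L2_inner_def
  proof (rule integral_dominated_convergence[where w = "\<lambda>x. \<bar>g x\<bar> * (2 * M)"])
    show "integrable (lebesgue_on \<Omega>) (\<lambda>x. \<bar>g x\<bar> * (2 * M))" using L2_integrable[OF lmeas g] by simp
    have "AE x in lebesgue_on \<Omega>. \<forall>b\<in>Basis. (\<lambda>n. pderiv_dir b (\<phi> n) x) \<longlonglongrightarrow> ddir b v x"
      by (rule AE_lebesgue_onI[OF lsets \<phi>(6)])
    then show "AE x in lebesgue_on \<Omega>. (\<lambda>n. g x * pderiv_dir b (\<phi> n) x) \<longlonglongrightarrow> g x * ddir b v x"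
      by eventually_elim (use b in \<open>auto intro!: tendsto_intros\<close>)
    show "AE x in lebesgue_on \<Omega>. norm (g x * pderiv_dir b (\<phi> n) x) \<le> \<bar>g x\<bar> * (2 * M)" for n
      using \<phi>(5)[OF b] by (intro AE_I2) (simp add: abs_mult mult_left_mono)
  qed (use m' in \<open>auto intro!: borel_measurable_times\<close>)
  moreover have "(\<lambda>n. L2_inner \<Omega> h (\<phi> n)) \<longlonglongrightarrow> L2_inner \<Omega> h v"
    unfolding L2_inner_def
  proof (rule integral_dominated_convergence[where w = "\<lambda>x. \<bar>h x\<bar> * B"])
    show "integrable (lebesgue_on \<Omega>) (\<lambda>x. \<bar>h x\<bar> * B)" using L2_integrable[OF lmeas h] by simp
    show "AE x in lebesgue_on \<Omega>. (\<lambda>n. h x * \<phi> n x) \<longlonglongrightarrow> h x * v x"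
      by (intro AE_I2 tendsto_intros \<phi>(4))
    show "AE x in lebesgue_on \<Omega>. norm (h x * \<phi> n x) \<le> \<bar>h x\<bar> * B" for n
      using \<phi>(3) by (intro AE_I2) (simp add: abs_mult mult_left_mono)
  qed (use m' in \<open>auto intro!: borel_measurable_times\<close>)
  then have "(\<lambda>n. - L2_inner \<Omega> h (\<phi> n)) \<longlonglongrightarrow> - L2_inner \<Omega> h v" by (rule tendsto_minus)
  moreover have "L2_inner \<Omega> g (pderiv_dir b (\<phi> n)) = - L2_inner \<Omega> h (\<phi> n)" for n
    using w \<phi>(1) by (simp add: is_weak_pderiv_def)
  ultimately show ?thesis by (simp add: LIMSEQ_unique)
qed

end

text \<open>The function \<open>w\<close> is \<open>- \<Delta> u\<^sub>0\<close>.\<close>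

lemma H2_laplacian:
  fixes \<Omega> :: "'a::euclidean_space set"
  assumes dom: "convex_polytopal_domain \<Omega>" and u0: "u0 \<in> sobolev_H 2 \<Omega>"
  obtains w where "w \<in> L2_space \<Omega>"
    "\<And>\<T> v. triangulates \<T> \<Omega> \<Longrightarrow> v \<in> fe_space \<Omega> \<T> \<Longrightarrow> grad_inner \<Omega> u0 v = L2_inner \<Omega> w v"
proof -
  have "\<exists>g h. g \<in> L2_space \<Omega> \<and> h \<in> L2_space \<Omega> \<and> is_weak_pderiv \<Omega> b u0 g \<and> is_weak_pderiv \<Omega> b g h"
    if b: "b \<in> Basis" for b
  proof -
    obtain g where g: "g \<in> sobolev_H (Suc 0) \<Omega>" "is_weak_pderiv \<Omega> b u0 g"
      using u0 b unfolding numeral_2_eq_2 by auto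
    moreover obtain h where "h \<in> L2_space \<Omega>" "is_weak_pderiv \<Omega> b g h" using g(1) b by auto
    ultimately show ?thesis by auto
  qed
  then obtain g h where gh: "\<And>b. b \<in> Basis \<Longrightarrow> g b \<in> L2_space \<Omega>" "\<And>b. b \<in> Basis \<Longrightarrow> h b \<in> L2_space \<Omega>"
    "\<And>b. b \<in> Basis \<Longrightarrow> is_weak_pderiv \<Omega> b u0 (g b)" "\<And>b. b \<in> Basis \<Longrightarrow> is_weak_pderiv \<Omega> b (g b) (h b)"
    by metis
  define w where "w x = (\<Sum>b\<in>Basis. - 1 * h b x)" for x
  show ?thesis
  proof
    show "w \<in> L2_space \<Omega>" unfolding w_def [abs_def] by (intro L2_sum L2_scale gh(2)) auto
    fix \<T> v assume tri: "triangulates \<T> \<Omega>" and v: "v \<in> fe_space \<Omega> \<T>"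
    interpret fe_setting \<Omega> \<T> by unfold_locales (fact dom tri)+
    have "L2_inner \<Omega> (weak_pderiv \<Omega> b u0) (weak_pderiv \<Omega> b v) = - 1 * L2_inner \<Omega> (h b) v" if b: "b \<in> Basis" for b
    proof -
      note p = weak_pderiv_L2[OF gh(1)[OF b] gh(3)[OF b]]
      have "L2_inner \<Omega> (weak_pderiv \<Omega> b u0) (weak_pderiv \<Omega> b v) = L2_inner \<Omega> (g b) (ddir b v)"
        by (intro L2_inner_cong_AE p fe_weak_pderiv_AE fe_ddir_L2 v b gh weak_pderiv_unique[OF domain(1,3) p(1) gh(1)[OF b] p(2) gh(3)[OF b]])
      also have "\<dots> = - L2_inner \<Omega> (h b) v" by (rule fe_integration_by_parts[OF gh(1,2,4)[OF b] v b])
      finally show ?thesis by simp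
    qed
    then have "grad_inner \<Omega> u0 v = (\<Sum>b\<in>Basis. L2_inner \<Omega> (\<lambda>x. - 1 * h b x) v)"
      unfolding grad_inner_def L2_inner_scale by (intro sum.cong) auto
    also have "\<dots> = L2_inner \<Omega> w v"
      unfolding w_def [abs_def] by (rule L2_inner_sum [symmetric]) (rule finite_Basis L2_scale gh(2) fe_L2[OF v] | assumption)+
    finally show "grad_inner \<Omega> u0 v = L2_inner \<Omega> w v" .
  qed
qed

section \<open>Spectral theorem for spaces of functions\<close>

locale form_space =
  fixes S :: "('a \<Rightarrow> real) set" and B :: "('a \<Rightarrow> real) \<Rightarrow> ('a \<Rightarrow> real) \<Rightarrow> real"
  assumes S_zero: "(\<lambda>x. 0) \<in> S"
    and S_lin: "v \<in> S \<Longrightarrow> w \<in> S \<Longrightarrow> (\<lambda>x. c * v x + w x) \<in> S"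
    and B_sym: "B v w = B w v"
    and B_lin: "v \<in> S \<Longrightarrow> w \<in> S \<Longrightarrow> z \<in> S \<Longrightarrow> B (\<lambda>x. c * v x + w x) z = c * B v z + B w z"
begin

lemma S_scale: "v \<in> S \<Longrightarrow> (\<lambda>x. c * v x) \<in> S"
  using S_lin[OF _ S_zero] by force

lemma S_diff: "v \<in> S \<Longrightarrow> w \<in> S \<Longrightarrow> (\<lambda>x. v x - c * w x) \<in> S"
  using S_lin[of w v "- c"] by simp

lemma S_sum: "finite I \<Longrightarrow> (\<And>i. i \<in> I \<Longrightarrow> e i \<in> S) \<Longrightarrow> (\<lambda>x. \<Sum>i\<in>I. c i * e i x) \<in> S"
  by (induction I rule: finite_induct) (simp_all add: S_zero S_lin)

lemma B_zero: "z \<in> S \<Longrightarrow> B (\<lambda>x. 0) z = 0"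
  using B_lin[OF S_zero S_zero, of z 1] by simp

lemma B_scale: "v \<in> S \<Longrightarrow> z \<in> S \<Longrightarrow> B (\<lambda>x. c * v x) z = c * B v z"
  using B_lin[OF _ S_zero, of v z c] by (simp add: B_zero)

lemma B_diff: "v \<in> S \<Longrightarrow> w \<in> S \<Longrightarrow> z \<in> S \<Longrightarrow> B (\<lambda>x. v x - c * w x) z = B v z - c * B w z"
  using B_lin[of w v z "- c"] by simp

lemma B_sum:
  assumes "finite I" "\<And>i. i \<in> I \<Longrightarrow> e i \<in> S" "z \<in> S"
  shows "B (\<lambda>x. \<Sum>i\<in>I. c i * e i x) z = (\<Sum>i\<in>I. c i * B (e i) z)"
  using assms(1,2)
proof (induction I rule: finite_induct)
  case (insert i I)
  then show ?case using B_lin[of "e i" "\<lambda>x. \<Sum>i\<in>I. c i * e i x" z "c i"] S_sum[of I e c] assms(3) by simp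
qed (simp add: B_zero assms(3))

lemma B_sum2:
  fixes m :: nat
  assumes e: "\<And>i. i < m \<Longrightarrow> e i \<in> S"
  shows "B (\<lambda>x. \<Sum>i<m. a i * e i x) (\<lambda>x. \<Sum>i<m. b i * e i x) = (\<Sum>i<m. \<Sum>j<m. a i * b j * B (e i) (e j))"
proof -
  have s: "(\<lambda>x. \<Sum>i<m. b i * e i x) \<in> S" using e by (intro S_sum) auto
  have r: "B (e i) (\<lambda>x. \<Sum>i<m. b i * e i x) = (\<Sum>j<m. b j * B (e i) (e j))" if "i < m" for i
    using B_sum[of "{..<m}" e "e i" b] e that by (simp add: B_sym)
  show ?thesis using B_sum[of "{..<m}" e _ a, OF _ _ s] e by (simp add: r sum_distrib_left mult.assoc)
qed

end

lemma form_space_subset: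
  assumes "form_space S B" "T \<subseteq> S" "(\<lambda>x. 0) \<in> T" "\<And>v w c. v \<in> T \<Longrightarrow> w \<in> T \<Longrightarrow> (\<lambda>x. c * v x + w x) \<in> T"
  shows "form_space T B"
proof -
  interpret form_space S B by fact
  show ?thesis using assms(2-) by unfold_locales (auto intro: B_sym intro!: B_lin)
qed

locale fun_inner = form_space S B for S :: "('a \<Rightarrow> real) set" and B +
  assumes B_nonneg: "0 \<le> B v v" and B_def: "v \<in> S \<Longrightarrow> B v v = 0 \<Longrightarrow> v x = 0"

lemma fun_inner_subset:
  assumes "fun_inner S B" "T \<subseteq> S" "(\<lambda>x. 0) \<in> T" "\<And>v w c. v \<in> T \<Longrightarrow> w \<in> T \<Longrightarrow> (\<lambda>x. c * v x + w x) \<in> T"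
  shows "fun_inner T B"
proof -
  interpret fun_inner S B by fact
  show ?thesis using form_space_subset[OF form_space_axioms assms(2-)] assms(2) B_nonneg B_def
    unfolding fun_inner_def fun_inner_axioms_def by blast
qed

text \<open>Spanning is expressed by the expansion itself, as an equality of functions, so no vector
  space type or notion of dimension is attached to \<open>S\<close>.\<close>

definition onb :: "('a \<Rightarrow> real) set \<Rightarrow> (('a \<Rightarrow> real) \<Rightarrow> ('a \<Rightarrow> real) \<Rightarrow> real) \<Rightarrow> nat \<Rightarrow> (nat \<Rightarrow> 'a \<Rightarrow> real) \<Rightarrow> bool" where
  "onb S B m e \<longleftrightarrow> (\<forall>i<m. e i \<in> S) \<and> (\<forall>i<m. \<forall>j<m. B (e i) (e j) = (if i = j then 1 else 0)) \<and>
     (\<forall>v\<in>S. v = (\<lambda>x. \<Sum>i<m. B v (e i) * e i x))"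

lemma onbD:
  assumes "onb S B m e"
  shows "i < m \<Longrightarrow> e i \<in> S" "i < m \<Longrightarrow> j < m \<Longrightarrow> B (e i) (e j) = (if i = j then 1 else 0)"
    "v \<in> S \<Longrightarrow> (\<lambda>x. \<Sum>i<m. B v (e i) * e i x) = v"
  using assms unfolding onb_def by (blast, blast, metis)

context fun_inner
begin

lemma onb_coeff:
  assumes e: "onb S B m e" and j: "j < m"
  shows "B (\<lambda>x. \<Sum>i<m. c i * e i x) (e j) = c j"
proof -
  have "B (\<lambda>x. \<Sum>i<m. c i * e i x) (e j) = (\<Sum>i<m. c i * B (e i) (e j))"
    using e j by (intro B_sum) (auto simp: onbD)
  also have "\<dots> = (\<Sum>i<m. if i = j then c j else 0)" using e j by (intro sum.cong) (auto simp: onbD)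
  finally show ?thesis using j by simp
qed

lemma onb_parseval:
  assumes e: "onb S B m e" and v: "v \<in> S" "w \<in> S"
  shows "B v w = (\<Sum>i<m. B v (e i) * B w (e i))"
proof -
  have "B v w = B (\<lambda>x. \<Sum>i<m. B v (e i) * e i x) w" using onbD(3)[OF e v(1)] by simp
  also have "\<dots> = (\<Sum>i<m. B v (e i) * B (e i) w)" using e v by (intro B_sum) (auto simp: onbD)
  finally show ?thesis by (simp add: B_sym)
qed

text \<open>Parseval in both bases: the double sum of the squared inner products counts either
  basis.\<close>

lemma onb_unique_size:
  assumes e: "onb S B m e" and f: "onb S B n f"
  shows "m = n"
proof -
  have "(\<Sum>i<m. B (e i) (e i)) = (\<Sum>i<m. \<Sum>j<n. B (e i) (f j) * B (e i) (f j))"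
    using e by (intro sum.cong refl onb_parseval[OF f]) (auto simp: onbD)
  also have "\<dots> = (\<Sum>j<n. \<Sum>i<m. B (f j) (e i) * B (f j) (e i))"
    by (subst sum.swap) (simp add: B_sym)
  also have "\<dots> = (\<Sum>j<n. B (f j) (f j))"
    using f by (intro sum.cong refl onb_parseval[OF e, symmetric]) (auto simp: onbD)
  finally show ?thesis using e f by (simp add: onbD)
qed

text \<open>The common step of Gram-Schmidt and of the spectral theorem: a subspace and one unit
  vector orthogonal to it that together span.\<close>

lemma onb_extend:
  assumes f: "onb T B m f" and T: "T \<subseteq> S" and g: "g \<in> S" "B g g = 1" "\<And>i. i < m \<Longrightarrow> B (f i) g = 0"
    and split: "\<And>w. w \<in> S \<Longrightarrow> \<exists>c. (\<lambda>x. w x - c * g x) \<in> T"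
  shows "onb S B (Suc m) (f(m := g))"
proof -
  have fS: "f i \<in> S" if "i < m" for i using onbD(1)[OF f that] T by blast
  have gf: "B g (f i) = 0" if "i < m" for i using g(3)[OF that] by (simp add: B_sym)
  have "w = (\<lambda>x. \<Sum>i<Suc m. B w ((f(m := g)) i) * (f(m := g)) i x)" if w: "w \<in> S" for w
  proof -
    obtain c where c: "(\<lambda>x. w x - c * g x) \<in> T" using split[OF w] by blast
    define w0 where "w0 x = w x - c * g x" for x
    have w0: "w0 \<in> T" using c by (simp add: w0_def [abs_def])
    have cf: "B w0 (f i) = B w (f i)" if "i < m" for i
      using B_diff[OF w g(1) fS[OF that], of c] gf[OF that] by (simp add: w0_def [abs_def])
    have ex: "(\<lambda>x. \<Sum>i<m. B w0 (f i) * f i x) = w0" by (rule onbD(3)[OF f w0])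
    have "B w0 g = (\<Sum>i<m. B w0 (f i) * B (f i) g)"
      using B_sum[of "{..<m}" f g "\<lambda>i. B w0 (f i)"] fS g(1) unfolding ex by simp
    also have "\<dots> = 0" using g(3) by simp
    finally have "c = B w g" using B_diff[OF w g(1) g(1), of c] g(2) by (simp add: w0_def [abs_def])
    show ?thesis
    proof
      fix x
      have "w x = w0 x + c * g x" by (simp add: w0_def)
      also have "w0 x = (\<Sum>i<m. B w (f i) * f i x)" using fun_cong[OF ex, of x] cf by simp
      finally show "w x = (\<Sum>i<Suc m. B w ((f(m := g)) i) * (f(m := g)) i x)" using \<open>c = B w g\<close> by simp
    qed
  qed
  then show ?thesis unfolding onb_def
    using fS g gf onbD(2)[OF f] by (auto simp: less_Suc_eq)
qed

end

text \<open>Induction over the separating points: the functions vanishing at \<open>p\<close> form a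
  subspace of codimension at most one, separated by the remaining points. A function not vanishing
  at \<open>p\<close> is orthogonalised against its basis and normalised.\<close>

lemma onb_exists:
  assumes "finite V" "fun_inner S B" "\<And>v x. v \<in> S \<Longrightarrow> (\<And>p. p \<in> V \<Longrightarrow> v p = 0) \<Longrightarrow> v x = 0"
  shows "\<exists>m e. onb S B m e"
  using assms
proof (induction V arbitrary: S rule: finite_induct)
  case empty
  then have "onb S B 0 (\<lambda>_ _. 0)" by (auto simp: onb_def fun_eq_iff)
  then show ?case by blast
next
  case (insert p V)
  interpret fun_inner S B by fact
  define T where "T = {v \<in> S. v p = 0}"
  have TS: "T \<subseteq> S" by (auto simp: T_def)
  have T: "fun_inner T B"
    by (rule fun_inner_subset[OF fun_inner_axioms TS]) (auto simp: T_def S_zero S_lin)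
  have "\<exists>m e. onb T B m e"
    by (rule insert.IH[OF T]) (use insert.prems(2) in \<open>auto simp: T_def\<close>)
  then obtain m e where e: "onb T B m e" by blast
  have eS: "e i \<in> S" "e i p = 0" if "i < m" for i using onbD(1)[OF e that] by (auto simp: T_def)
  show ?case
  proof (cases "S = T")
    case True
    then show ?thesis using e by blast
  next
    case False
    then obtain s where s: "s \<in> S" "s p \<noteq> 0" by (auto simp: T_def)
    define q where "q x = (\<Sum>i<m. B s (e i) * e i x)" for x
    define r where "r x = s x - 1 * q x" for x
    have qS: "q \<in> S" unfolding q_def [abs_def] using eS by (intro S_sum) auto
    have rS: "r \<in> S" unfolding r_def [abs_def] by (rule S_diff[OF s(1) qS])
    have rp: "r p = s p" by (simp add: r_def q_def eS)
    have rr: "B r r \<noteq> 0" using B_def[OF rS] rp s(2) by metis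
    have orth: "B r (e j) = 0" if j: "j < m" for j
    proof -
      have "B q (e j) = (\<Sum>i<m. B s (e i) * B (e i) (e j))"
        unfolding q_def [abs_def] using eS j by (intro B_sum) auto
      also have "\<dots> = (\<Sum>i<m. if i = j then B s (e j) else 0)" using onbD(2)[OF e] j by (intro sum.cong) auto
      finally have "B q (e j) = B s (e j)" using j by simp
      then show ?thesis using B_diff[OF s(1) qS eS(1)[OF j], of 1] by (simp add: r_def [abs_def])
    qed
    define n where "n = sqrt (B r r)"
    have n: "n \<noteq> 0" "n * n = B r r" using rr B_nonneg[of r] by (auto simp: n_def)
    define g where "g x = (1 / n) * r x" for x
    have gS: "g \<in> S" unfolding g_def [abs_def] by (rule S_scale[OF rS])
    have gB: "B g z = (1 / n) * B r z" if "z \<in> S" for z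
      unfolding g_def [abs_def] by (rule B_scale[OF rS that])
    have "onb S B (Suc m) (e(m := g))"
    proof (rule onb_extend[OF e TS gS])
      have "B g g = (1 / n) * B g r" using gB[OF gS] by (simp add: B_sym)
      also have "\<dots> = (1 / n) * ((1 / n) * (n * n))" using gB[OF rS] n by simp
      finally show "B g g = 1" using n(1) by simp
      show "B (e i) g = 0" if "i < m" for i using gB[OF eS(1)[OF that]] orth[OF that] by (simp add: B_sym)
      fix w assume w: "w \<in> S"
      have "g p \<noteq> 0" using rp s(2) n(1) by (simp add: g_def)
      then have "(\<lambda>x. w x - (w p / g p) * g x) \<in> T" using S_diff[OF w gS, of "w p / g p"] by (simp add: T_def)
      then show "\<exists>c. (\<lambda>x. w x - c * g x) \<in> T" by blast
    qed
    then show ?thesis by blast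
  qed
qed

text \<open>The maximiser \<open>g\<close> of the Rayleigh quotient is an eigenvector: it is isotropic for the positive
  semidefinite form \<open>E g g * B - E\<close>.\<close>

lemma top_eigenvector:
  assumes "fun_inner S B" "form_space S E" and e: "onb S B m e" and m: "0 < m"
  obtains g where "g \<in> S" "B g g = 1" "\<And>v. v \<in> S \<Longrightarrow> E v g = E g g * B v g"
proof -
  interpret fun_inner S B by fact
  interpret E: form_space S E by fact
  define Q where "Q x = (\<Sum>i<m. \<Sum>j<m. x i * x j * E (e i) (e j))" for x :: "nat \<Rightarrow> real"
  define lift where "lift x = (\<lambda>y. \<Sum>i<m. x i * e i y)" for x
  have eS: "e i \<in> S" if "i < m" for i using onbD(1)[OF e that] .
  have lS: "lift x \<in> S" for x unfolding lift_def using eS by (intro S_sum) auto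
  have lE: "E (lift x) (lift x) = Q x" for x unfolding lift_def Q_def by (rule E.B_sum2) (rule eS)
  have lB: "B (lift x) (lift x) = (\<Sum>i<m. (x i)\<^sup>2)" for x
    using onb_parseval[OF e lS lS] onb_coeff[OF e] by (simp add: lift_def power2_eq_square)
  \<comment> \<open>Coordinates from \<open>m\<close> on are pinned to 0, which makes the unit
    sphere compact in the product topology on sequences.\<close>
  define C where "C i = (if i < m then {-1..1} else {0::real})" for i
  define K where "K = (\<Pi>\<^sub>E i\<in>UNIV. C i) \<inter> {x. (\<Sum>i<m. (x i)\<^sup>2) = 1}"
  have "compactin (product_topology (\<lambda>i. euclidean) UNIV) (\<Pi>\<^sub>E i\<in>UNIV. C i)"
    by (auto simp: compactin_PiE C_def)
  then have "compact (\<Pi>\<^sub>E i\<in>UNIV. C i)" by (simp add: euclidean_product_topology)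
  moreover have "closed {x :: nat \<Rightarrow> real. (\<Sum>i<m. (x i)\<^sup>2) = 1}"
    by (intro closed_Collect_eq continuous_intros continuous_on_product_coordinates)
  ultimately have "compact K" unfolding K_def by (rule compact_Int_closed)
  moreover have "(\<lambda>i. if i = 0 then 1 else 0) \<in> K"
    using m by (auto simp: K_def C_def if_distrib[of "\<lambda>x. x\<^sup>2"] cong: if_cong)
  then have "K \<noteq> {}" by blast
  moreover have "continuous_on K Q"
    unfolding Q_def by (intro continuous_intros continuous_on_subset[OF continuous_on_product_coordinates]) auto
  ultimately obtain x0 where x0: "x0 \<in> K" "\<And>y. y \<in> K \<Longrightarrow> Q y \<le> Q x0"
    using continuous_attains_sup[of K Q] by blast
  define g where "g = lift x0"
  have gS: "g \<in> S" by (simp add: g_def lS)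
  have gg: "B g g = 1" using x0(1) by (simp add: g_def lB K_def)
  define D where "D v w = E g g * B v w - E v w" for v w
  have D: "form_space S D"
  proof
    show "D v w = D w v" for v w unfolding D_def B_sym[of v w] E.B_sym[of v w] ..
    show "D (\<lambda>x. c * v x + w x) z = c * D v z + D w z" if "v \<in> S" "w \<in> S" "z \<in> S" for v w z c
      unfolding D_def B_lin[OF that] E.B_lin[OF that] by (simp add: algebra_simps)
  qed (rule S_zero S_lin; assumption)+
  interpret D: form_space S D by (rule D)
  have Dn: "0 \<le> D v v" if v: "v \<in> S" for v
  proof (cases "B v v = 0")
    case True
    then have "v = (\<lambda>x. 0)" using B_def[OF v] by auto
    then show ?thesis using D.B_zero[OF S_zero] by simp
  next
    case False
    define n where "n = sqrt (B v v)"
    have n: "0 < n" "n * n = B v v" using False B_nonneg[of v] by (auto simp: n_def)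
    define y where "y i = (if i < m then B v (e i) / n else 0)" for i
    have ex: "(\<lambda>x. \<Sum>i<m. B v (e i) * e i x) = v" by (rule onbD(3)[OF e v])
    have lv: "lift y = (\<lambda>x. (1 / n) * v x)"
    proof (intro ext)
      fix x
      have "lift y x = (\<Sum>i<m. B v (e i) * e i x) / n"
        unfolding lift_def sum_divide_distrib by (intro sum.cong) (auto simp: y_def)
      also have "\<dots> = v x / n" using fun_cong[OF ex, of x] by simp
      finally show "lift y x = (1 / n) * v x" by simp
    qed
    have sc: "F (lift y) (lift y) = F v v / (n * n)" if "form_space S F" for F
    proof -
      interpret F: form_space S F by fact
      have w: "(\<lambda>x. (1 / n) * v x) \<in> S" by (rule S_scale[OF v])
      have "F (\<lambda>x. (1 / n) * v x) (\<lambda>x. (1 / n) * v x) = (1 / n) * F (\<lambda>x. (1 / n) * v x) v"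
        unfolding F.B_sym[of "\<lambda>x. (1 / n) * v x" v] by (rule F.B_scale[OF v w])
      also have "F (\<lambda>x. (1 / n) * v x) v = (1 / n) * F v v" by (rule F.B_scale[OF v v])
      finally show ?thesis unfolding lv by simp
    qed
    have y1: "(\<Sum>i<m. (y i)\<^sup>2) = 1" using sc[OF form_space_axioms] False unfolding n(2) lB by simp
    have "y \<in> K"
    proof -
      have "\<bar>y i\<bar> \<le> 1" if "i < m" for i
      proof -
        have "(y i)\<^sup>2 \<le> (\<Sum>i<m. (y i)\<^sup>2)" using that by (intro member_le_sum) auto
        then show ?thesis using y1 by (simp add: abs_square_le_1)
      qed
      then have "y i \<in> C i" for i
        by (cases "i < m") (force simp: C_def abs_le_iff, simp add: C_def y_def)
      then show ?thesis using y1 by (auto simp: K_def PiE_iff)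
    qed
    then have "E (lift y) (lift y) \<le> E g g" using x0(2) by (simp add: lE g_def)
    then have "E v v / (n * n) \<le> E g g" using sc[OF E.form_space_axioms] by simp
    then have "E v v \<le> E g g * (n * n)" using n(1) by (simp add: divide_le_eq)
    then show ?thesis using n by (simp add: D_def)
  qed
  have "D v g = 0" if v: "v \<in> S" for v
  proof (rule ccontr)
    assume a: "D v g \<noteq> 0"
    \<comment> \<open>The form at t v + g is t^2 D v v + 2 t D v g, which is negative for this t;
      the 1 in the denominator avoids division by zero.\<close>
    define t where "t = - D v g / (D v v + 1)"
    have Dgg: "D g g = 0" by (simp add: D_def gg)
    define w where "w x = t * v x + g x" for x
    have wS: "w \<in> S" unfolding w_def [abs_def] by (rule S_lin[OF v gS])
    have wz: "D w z = t * D v z + D g z" if "z \<in> S" for z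
      unfolding w_def [abs_def] by (rule D.B_lin[OF v gS that])
    have "D w w = t * D w v + D w g" using wz[OF wS] by (simp add: D.B_sym)
    also have "\<dots> = t * t * D v v + 2 * t * D v g"
      using wz[OF v] wz[OF gS] Dgg by (simp add: D.B_sym algebra_simps)
    also have "\<dots> = - (D v g)\<^sup>2 * (D v v + 2) / (D v v + 1)\<^sup>2"
      using Dn[OF v] by (simp add: t_def power2_eq_square divide_simps) (simp add: algebra_simps)
    also have "\<dots> < 0" using a Dn[OF v] by (simp add: divide_simps zero_less_mult_iff add_pos_nonneg)
    finally show False using Dn[OF wS] by simp
  qed
  then show ?thesis using that[OF gS gg] by (simp add: D_def)
qed

text \<open>Induction on the dimension. The complement of the top eigenvector is separated by the
  same points, so it has an orthonormal basis, whose length \<open>onb_unique_size\<close>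
  determines. The form decouples because E v g is a multiple of B v g.\<close>

lemma spectral_theorem:
  assumes "fun_inner S B" "form_space S E" "onb S B m e"
    and V: "finite V" "\<And>v x. v \<in> S \<Longrightarrow> (\<And>p. p \<in> V \<Longrightarrow> v p = 0) \<Longrightarrow> v x = 0"
  shows "\<exists>f lam. onb S B m f \<and> (\<forall>i<m. \<forall>j<m. E (f i) (f j) = (if i = j then lam i else 0))"
  using assms(1-3) V(2)
proof (induction m arbitrary: S e)
  case 0
  then show ?case by auto
next
  case (Suc m)
  interpret fun_inner S B by fact
  interpret E: form_space S E by fact
  obtain g where g: "g \<in> S" "B g g = 1" "\<And>v. v \<in> S \<Longrightarrow> E v g = E g g * B v g"
    using top_eigenvector[OF Suc.prems(1-3)] by blast
  define T where "T = {v \<in> S. B v g = 0}"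
  have TS: "T \<subseteq> S" by (auto simp: T_def)
  have Tc: "(\<lambda>x. 0) \<in> T" "\<And>v w c. v \<in> T \<Longrightarrow> w \<in> T \<Longrightarrow> (\<lambda>x. c * v x + w x) \<in> T"
    by (auto simp: T_def S_zero S_lin B_zero B_lin g(1))
  have T: "fun_inner T B" "form_space T E"
    by (rule fun_inner_subset[OF fun_inner_axioms TS Tc(1)], erule (1) Tc(2))
      (rule form_space_subset[OF E.form_space_axioms TS Tc(1)], erule (1) Tc(2))
  have ext: "onb S B (Suc n) (f(n := g))" if f: "onb T B n f" for n f
  proof (rule onb_extend[OF f TS g(1,2)])
    show "B (f i) g = 0" if "i < n" for i using onbD(1)[OF f that] by (simp add: T_def)
    fix w assume w: "w \<in> S"
    have "(\<lambda>x. w x - B w g * g x) \<in> T" using S_diff[OF w g(1)] B_diff[OF w g(1) g(1)] g(2) by (simp add: T_def)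
    then show "\<exists>c. (\<lambda>x. w x - c * g x) \<in> T" by blast
  qed
  have det: "v x = 0" if "v \<in> T" "\<And>p. p \<in> V \<Longrightarrow> v p = 0" for v x using Suc.prems(4) that TS by blast
  obtain n e' where e': "onb T B n e'" using onb_exists[where V = V, OF V(1) T(1)] det by blast
  have "n = m" using onb_unique_size[OF Suc.prems(3) ext[OF e']] by simp
  then obtain f lam where f: "onb T B m f" "\<forall>i<m. \<forall>j<m. E (f i) (f j) = (if i = j then lam i else 0)"
    using Suc.IH[OF T, of e'] e' det by blast
  have fg: "E (f i) g = 0" "E g (f i) = 0" if "i < m" for i
  proof -
    have "f i \<in> S" "B (f i) g = 0" using onbD(1)[OF f(1) that] by (auto simp: T_def)
    then show "E (f i) g = 0" using g(3) by simp
    then show "E g (f i) = 0" by (simp add: E.B_sym)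
  qed
  have "\<forall>i<Suc m. \<forall>j<Suc m. E ((f(m := g)) i) ((f(m := g)) j) = (if i = j then (lam(m := E g g)) i else 0)"
    using f(2) fg by (auto simp: less_Suc_eq)
  with ext[OF f(1)] show ?case by blast
qed

text \<open>The link between the pointwise formulation in time and coordinates: a coefficient
  becomes a finite combination of point values, which can be differentiated and integrated in time
  termwise. The induction is that of \<open>onb_exists\<close>, with the coefficient at
  \<open>p\<close> fixed by one function not vanishing there.\<close>

lemma functional_eq_sum_values:
  assumes "finite V" "form_space S B" "\<And>v x. v \<in> S \<Longrightarrow> (\<And>p. p \<in> V \<Longrightarrow> v p = 0) \<Longrightarrow> v x = 0"
    and "\<And>v w c. v \<in> S \<Longrightarrow> w \<in> S \<Longrightarrow> l (\<lambda>x. c * v x + w x) = c * l v + l w"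
  shows "\<exists>c. \<forall>v\<in>S. l v = (\<Sum>p\<in>V. c p * v p :: real)"
  using assms
proof (induction V arbitrary: S rule: finite_induct)
  case empty
  interpret form_space S B by fact
  have "l (\<lambda>x. 0) = 0" using empty.prems(3)[OF S_zero S_zero, of 1] by simp
  moreover have "v = (\<lambda>x. 0)" if "v \<in> S" for v using empty.prems(2)[OF that] by auto
  ultimately show ?case by auto
next
  case (insert p V)
  interpret form_space S B by fact
  define T where "T = {v \<in> S. v p = 0}"
  have TS: "T \<subseteq> S" by (auto simp: T_def)
  have T: "form_space T B"
    by (rule form_space_subset[OF form_space_axioms TS]) (auto simp: T_def S_zero S_lin)
  have "\<exists>c. \<forall>v\<in>T. l v = (\<Sum>p\<in>V. c p * v p)"
  proof (rule insert.IH[OF T])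
    show "v x = 0" if "v \<in> T" "\<And>p. p \<in> V \<Longrightarrow> v p = 0" for v x
      by (rule insert.prems(2)) (use that in \<open>auto simp: T_def\<close>)
    show "l (\<lambda>x. c * v x + w x) = c * l v + l w" if "v \<in> T" "w \<in> T" for v w c
      using insert.prems(3) that TS by blast
  qed
  then obtain c where c: "\<And>v. v \<in> T \<Longrightarrow> l v = (\<Sum>p\<in>V. c p * v p)" by blast
  show ?case
  proof (cases "S = T")
    case True
    have "\<forall>v\<in>S. l v = (\<Sum>q\<in>insert p V. (c(p := 0)) q * v q)"
      using c True insert.hyps by (auto intro!: sum.cong)
    then show ?thesis by blast
  next
    case False
    then obtain s where s: "s \<in> S" "s p \<noteq> 0" by (auto simp: T_def)
    define k where "k = (l s - (\<Sum>q\<in>V. c q * s q)) / s p"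
    have "l v = (\<Sum>q\<in>insert p V. (c(p := k)) q * v q)" if v: "v \<in> S" for v
    proof -
      define a where "a = v p / s p"
      have "(\<lambda>x. - a * s x + v x) \<in> T" using S_lin[OF s(1) v, of "- a"] s(2) by (simp add: T_def a_def)
      then have "- a * l s + l v = (\<Sum>q\<in>V. c q * (- a * s q + v q))"
        using c insert.prems(3)[OF s(1) v, of "- a"] by metis
      also have "\<dots> = - a * (\<Sum>q\<in>V. c q * s q) + (\<Sum>q\<in>V. c q * v q)"
        by (simp add: sum_distrib_left sum.distrib [symmetric] algebra_simps)
      finally have "l v = k * v p + (\<Sum>q\<in>V. c q * v q)"
        using s(2) by (simp add: k_def a_def field_simps)
      also have "(\<Sum>q\<in>V. c q * v q) = (\<Sum>q\<in>V. (c(p := k)) q * v q)" using insert.hyps by (intro sum.cong) auto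
      finally show ?thesis using insert.hyps by simp
    qed
    then show ?thesis by blast
  qed
qed

section \<open>Convolution quadrature weights\<close>

text \<open>A power series that vanishes on the punctured disc has zero coefficients: they are
  removed one at a time, dividing by \<zeta>^n and letting \<zeta> tend to 0. This gives the
  uniqueness behind the definite description.\<close>

lemma cq_weight_eqI:
  assumes "\<And>\<zeta>. 0 < norm \<zeta> \<Longrightarrow> norm \<zeta> < 1 \<Longrightarrow> (\<lambda>j. of_real (K j) * \<zeta> ^ j) sums generating_function sch \<alpha> \<zeta>"
  shows "cq_weight sch \<alpha> = K"
  unfolding cq_weight_def
proof (rule the_equality)
  fix K' assume K': "\<forall>\<zeta>. 0 < norm \<zeta> \<and> norm \<zeta> < 1 \<longrightarrow> (\<lambda>j. of_real (K' j) * \<zeta> ^ j) sums generating_function sch \<alpha> \<zeta>"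
  define d :: "nat \<Rightarrow> complex" where "d j = of_real (K' j - K j)" for j
  have d: "(\<lambda>j. d j * \<zeta> ^ j) sums 0" if "\<zeta> \<noteq> 0" "norm \<zeta> < 1" for \<zeta>
  proof -
    have "0 < norm \<zeta>" using that by simp
    then have "(\<lambda>j. of_real (K' j) * \<zeta> ^ j - of_real (K j) * \<zeta> ^ j) sums
        (generating_function sch \<alpha> \<zeta> - generating_function sch \<alpha> \<zeta>)"
      using K' assms[of \<zeta>] that(2) by (intro sums_diff) blast+
    then show ?thesis by (simp add: d_def left_diff_distrib)
  qed
  have "d n = 0" for n
  proof (induction n rule: less_induct)
    case (less n)
    have "((\<lambda>_. 0) \<longlongrightarrow> d (0 + n)) (at (0::complex))"
    proof (rule powser_limit_0_strong[of 1 "\<lambda>j. d (j + n)"])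
      fix \<zeta> :: complex assume z: "\<zeta> \<noteq> 0" "norm \<zeta> < 1"
      have "(\<lambda>j. d (j + n) * \<zeta> ^ (j + n)) sums 0"
        using d[OF z] less by (subst sums_iff_shift) simp
      then have "(\<lambda>j. inverse (\<zeta> ^ n) * (d (j + n) * \<zeta> ^ (j + n))) sums (inverse (\<zeta> ^ n) * 0)" by (rule sums_mult)
      then show "(\<lambda>j. d (j + n) * \<zeta> ^ j) sums 0" using z(1) by (simp add: power_add field_simps)
    qed simp
    then show ?case by (simp add: tendsto_const_iff)
  qed
  then show "K' = K" unfolding d_def by (intro ext) (simp only: of_real_eq_0_iff right_minus_eq)
qed (use assms in blast)

lemma powr_diff_le:
  fixes c a b :: real
  assumes c: "0 < c" "c \<le> 1" and ab: "0 < a" "a < b"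
  shows "b powr c - a powr c \<le> c * a powr (c - 1) * (b - a)"
proof -
  have "\<exists>z>a. z < b \<and> b powr c - a powr c = (b - a) * (c * z powr (c - 1))"
    using ab by (intro MVT2) (auto intro!: derivative_eq_intros simp: has_real_derivative_powr)
  then obtain z where z: "a < z" "b powr c - a powr c = (b - a) * (c * z powr (c - 1))" by blast
  have "z powr (c - 1) \<le> a powr (c - 1)" using z(1) ab c by (intro powr_mono2') auto
  then have "(b - a) * (c * z powr (c - 1)) \<le> (b - a) * (c * a powr (c - 1))" using ab c by (intro mult_left_mono) auto
  then show ?thesis using z(2) by (simp add: mult_ac)
qed

section \<open>The weights of backward Euler and of the L1 scheme\<close>

context frac_order
begin

lemma be_coeff_Suc: "be_coeff (Suc j) = be_coeff j * (real j - \<alpha>) / (real j + 1)"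
proof -
  have "real (Suc j) * (\<alpha> gchoose Suc j) = (\<alpha> - real j) * (\<alpha> gchoose j)"
    using gbinomial_mult_1[of \<alpha> j] by (simp add: algebra_simps)
  then have *: "(\<alpha> gchoose Suc j) = (\<alpha> - real j) * (\<alpha> gchoose j) / (real j + 1)"
    by (simp add: eq_divide_eq mult.commute add.commute)
  have "(-1) ^ Suc j * (a * g / c) = (-1) ^ j * g * (- a) / c" for a g c :: real by simp
  from this[of "\<alpha> - real j"] show ?thesis unfolding be_coeff_def * by simp
qed

text \<open>Partial sums of the coefficients of (1 - \<zeta>)^\<alpha> are those of (1 -
  \<zeta>)^(\<alpha>-1), hence multiples of single weights. A product recursion for the partial sums
  follows.\<close>

lemma be_coeff_sum: "(\<Sum>j\<le>n. be_coeff j) = - (real n + 1) / \<alpha> * be_coeff (Suc n)"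
proof (induction n)
  case 0
  then show ?case using alpha_pos by (simp add: be_coeff_Suc)
next
  case (Suc n)
  define b where "b = be_coeff (Suc n)"
  have e: "be_coeff (Suc (Suc n)) = b * (real n + 1 - \<alpha>) / (real n + 2)"
    unfolding be_coeff_Suc[of "Suc n"] b_def by (simp add: add.commute)
  have "- (real n + 1) / \<alpha> * b + b = - (b * (real n + 1 - \<alpha>)) / \<alpha>"
    using alpha_pos by (simp add: divide_simps) (simp add: algebra_simps)
  also have "\<dots> = - (real n + 2) / \<alpha> * be_coeff (Suc (Suc n))"
  proof -
    have "- (y / a) = - c / a * (y / c)" if "c \<noteq> 0" for a c y :: real using that by simp
    from this[of "real n + 2" "b * (real n + 1 - \<alpha>)" \<alpha>] show ?thesis unfolding e by simp
  qed
  finally show ?case unfolding sum.atMost_Suc Suc b_def by (simp add: add.commute)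
qed

lemma be_coeff_nonpos: "be_coeff (Suc j) \<le> 0"
proof (induction j)
  case 0
  then show ?case using alpha_pos by (simp add: be_coeff_Suc) (simp add: be_coeff_def)
next
  case (Suc j)
  then show ?case using alpha_less_1 unfolding be_coeff_Suc[of "Suc j"]
    by (intro divide_nonpos_pos mult_nonpos_nonneg) auto
qed

lemma be_coeff_sum_ge: "(1 - \<alpha>) * (real n + 1) powr (- \<alpha>) \<le> (\<Sum>j\<le>n. be_coeff j)"
proof -
  have step: "(\<Sum>j\<le>Suc n. be_coeff j) = (\<Sum>j\<le>n. be_coeff j) * (1 - \<alpha> / (real n + 1))" for n
  proof -
    have "be_coeff (Suc n) = - (\<alpha> / (real n + 1)) * (\<Sum>j\<le>n. be_coeff j)"
    proof -
      have "- (a / c) * (- c / a * b) = b" if "a \<noteq> 0" "c \<noteq> 0" for a b c :: real using that by simp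
      from this[of \<alpha> "real n + 1"] show ?thesis unfolding be_coeff_sum using alpha_pos by simp
    qed
    then show ?thesis by (simp add: algebra_simps)
  qed
  \<comment> \<open>Sharper than the claim by one index, and the form that the induction preserves:
    by concavity of t^\<alpha> each factor of the product recursion is at least the ratio of
    consecutive powers. It starts from the sum 1 - \<alpha> of the first two weights, whence the
    constant.\<close>
  have main: "(1 - \<alpha>) * real (Suc n) powr (- \<alpha>) \<le> (\<Sum>j\<le>Suc n. be_coeff j)" for n
  proof (induction n)
    case 0
    then show ?case by (simp add: be_coeff_Suc) (simp add: be_coeff_def)
  next
    case (Suc n)
    define a where "a = real (Suc n)"
    have a: "0 < a" by (simp add: a_def)
    have "\<alpha> * (a + 1) powr (\<alpha> - 1) * ((a + 1) - a) \<le> (a + 1) powr \<alpha> - a powr \<alpha>"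
      using alpha_pos alpha_less_1 a by (intro powr_diff_ge) auto
    then have "a powr \<alpha> \<le> (a + 1) powr \<alpha> * (1 - \<alpha> / (a + 1))"
      using a by (simp add: powr_diff algebra_simps)
    have "inverse q \<le> inverse p * k" if "0 < p" "0 < q" "p \<le> q * k" for p q k :: real
      using that by (simp add: field_simps)
    from this[OF _ _ \<open>a powr \<alpha> \<le> _\<close>] have le: "(a + 1) powr (- \<alpha>) \<le> a powr (- \<alpha>) * (1 - \<alpha> / (a + 1))"
      using a by (simp add: powr_minus)
    have "(1 - \<alpha>) * (a + 1) powr (- \<alpha>) \<le> (1 - \<alpha>) * (a powr (- \<alpha>) * (1 - \<alpha> / (a + 1)))"
      using le alpha_less_1 by (intro mult_left_mono) auto
    also have "\<dots> = (1 - \<alpha>) * a powr (- \<alpha>) * (1 - \<alpha> / (a + 1))" by simp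
    also have "\<dots> \<le> (\<Sum>j\<le>Suc n. be_coeff j) * (1 - \<alpha> / (a + 1))"
      using Suc a alpha_less_1 by (intro mult_right_mono) (auto simp: a_def divide_le_eq)
    also have "\<dots> = (\<Sum>j\<le>Suc (Suc n). be_coeff j)" using step[of "Suc n"] by (simp add: a_def)
    finally show ?case by (simp add: a_def add.commute)
  qed
  show ?thesis
  proof (cases n)
    case 0
    then show ?thesis using alpha_pos by (simp add: be_coeff_def)
  next
    case (Suc k)
    have "(real n + 1) powr (- \<alpha>) \<le> real n powr (- \<alpha>)" using Suc alpha_pos by (intro powr_mono2') auto
    then have "(1 - \<alpha>) * (real n + 1) powr (- \<alpha>) \<le> (1 - \<alpha>) * real n powr (- \<alpha>)" using alpha_less_1 by (intro mult_left_mono) auto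
    then show ?thesis using main[of k] Suc by simp
  qed
qed

lemma cq_weight_be: "cq_weight Backward_Euler_CQ \<alpha> = be_coeff"
proof (rule cq_weight_eqI)
  fix \<zeta> :: complex assume "norm \<zeta> < 1"
  then have "(\<lambda>n. (complex_of_real \<alpha> gchoose n) * (- \<zeta>) ^ n) sums (1 + - \<zeta>) powr \<alpha>"
    by (intro gen_binomial_complex) simp
  moreover have "complex_of_real (\<alpha> gchoose n) = (complex_of_real \<alpha> gchoose n)" for n
    by (simp add: gbinomial_prod_rev of_real_prod)
  ultimately show "(\<lambda>j. complex_of_real (be_coeff j) * \<zeta> ^ j) sums generating_function Backward_Euler_CQ \<alpha> \<zeta>"
    by (simp add: be_coeff_def power_minus[of \<zeta>] mult_ac)
qed

lemma be_weights: "be_weights \<alpha> (cq_weight Backward_Euler_CQ \<alpha>) (1 - \<alpha>)"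
proof unfold_locales
  fix j :: nat assume "1 \<le> j"
  then show "cq_weight Backward_Euler_CQ \<alpha> j \<le> 0" using be_coeff_nonpos[of "j - 1"] by (simp add: cq_weight_be)
qed (use alpha_less_1 be_coeff_sum_ge in \<open>simp_all add: cq_weight_be\<close>, simp add: be_coeff_def)

text \<open>Second differences of j^(1-\<alpha>). At j = 0 truncated subtraction and 0 powr (1 -
  \<alpha>) = 0 make the formula give 1 / \<Gamma>(2 - \<alpha>), the correct first weight.\<close>

definition l1_coeff :: "nat \<Rightarrow> real" where
  "l1_coeff j = (real (Suc j) powr (1 - \<alpha>) - 2 * real j powr (1 - \<alpha>) + real (j - 1) powr (1 - \<alpha>)) / Gamma (2 - \<alpha>)"

lemma Gamma_2_minus: "0 < Gamma (2 - \<alpha>)"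
  using alpha_less_1 by (intro Gamma_real_pos) simp

lemma l1_coeff_sum:
  "(\<Sum>j\<le>n. l1_coeff j) = (real (Suc n) powr (1 - \<alpha>) - real n powr (1 - \<alpha>)) / Gamma (2 - \<alpha>)"
proof (induction n)
  case 0
  then show ?case by (simp add: l1_coeff_def)
next
  case (Suc n)
  show ?case unfolding sum.atMost_Suc Suc by (simp add: l1_coeff_def diff_divide_distrib add_divide_distrib)
qed

text \<open>Multiplying the series of j^(1-\<alpha>) by (1 - \<zeta>)^2 takes second differences;
  division by \<zeta> shifts them by one index and removes the singularity.\<close>

lemma cq_weight_l1: "cq_weight L1_Scheme \<alpha> = l1_coeff"
proof (rule cq_weight_eqI)
  fix \<zeta> :: complex assume z: "0 < norm \<zeta>" "norm \<zeta> < 1"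
  define q where "q j = complex_of_real (real j powr (1 - \<alpha>))" for j
  have "summable (\<lambda>n. of_nat (Suc n) * (norm \<zeta>) ^ n)"
    using z geometric_deriv_sums[of "norm \<zeta>"] by (simp add: sums_iff)
  then have "summable (\<lambda>j. q (Suc j) * \<zeta> ^ j)"
  proof (rule summable_comparison_test'[where N = 0])
    fix n
    have "real (Suc n) powr (1 - \<alpha>) \<le> real (Suc n) powr 1" using alpha_pos by (intro powr_mono) auto
    then show "norm (q (Suc n) * \<zeta> ^ n) \<le> of_nat (Suc n) * (norm \<zeta>) ^ n"
      by (simp add: q_def norm_mult norm_power mult_right_mono)
  qed
  then obtain A where A: "(\<lambda>j. q (Suc j) * \<zeta> ^ j) sums A" by (auto simp: summable_def)
  have q0: "q 0 = 0" by (simp add: q_def)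
  have A1: "(\<lambda>j. q j * \<zeta> ^ j) sums (\<zeta> * A)"
  proof -
    have "(\<lambda>j. \<zeta> * (q (Suc j) * \<zeta> ^ j)) sums (\<zeta> * A)" by (rule sums_mult[OF A])
    then have "(\<lambda>j. q (Suc j) * \<zeta> ^ Suc j) sums (\<zeta> * A)" by (simp add: mult_ac)
    from sums_Suc[OF this] show ?thesis by (simp add: q0)
  qed
  have A2: "(\<lambda>j. q (j - 1) * \<zeta> ^ j) sums (\<zeta> * (\<zeta> * A))"
  proof -
    have "(\<lambda>j. \<zeta> * (q j * \<zeta> ^ j)) sums (\<zeta> * (\<zeta> * A))" by (rule sums_mult[OF A1])
    then have "(\<lambda>j. q (Suc j - 1) * \<zeta> ^ Suc j) sums (\<zeta> * (\<zeta> * A))" by (simp add: mult_ac)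
    from sums_Suc[OF this] show ?thesis by (simp add: q0)
  qed
  have "polylog (\<alpha> - 1) \<zeta> = \<zeta> * A"
  proof -
    have "\<zeta> ^ Suc j / of_real (real (Suc j) powr (\<alpha> - 1)) = \<zeta> * (q (Suc j) * \<zeta> ^ j)" for j
    proof -
      have "real (Suc j) powr (1 - \<alpha>) = 1 / real (Suc j) powr (\<alpha> - 1)"
        using powr_minus_divide[of "real (Suc j)" "\<alpha> - 1"] by simp
      then show ?thesis by (simp add: q_def)
    qed
    then show ?thesis using sums_mult[OF A, of \<zeta>] by (simp add: polylog_def sums_iff)
  qed
  then have "generating_function L1_Scheme \<alpha> \<zeta> = ((1 - \<zeta>)\<^sup>2 * A) / of_real (Gamma (2 - \<alpha>))" using z by simp
  then have g: "generating_function L1_Scheme \<alpha> \<zeta> = (A - 2 * (\<zeta> * A) + \<zeta> * (\<zeta> * A)) / of_real (Gamma (2 - \<alpha>))"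
    by (simp add: power2_eq_square algebra_simps)
  have "(\<lambda>j. (q (Suc j) * \<zeta> ^ j - 2 * (q j * \<zeta> ^ j) + q (j - 1) * \<zeta> ^ j) / of_real (Gamma (2 - \<alpha>))) sums
      ((A - 2 * (\<zeta> * A) + \<zeta> * (\<zeta> * A)) / of_real (Gamma (2 - \<alpha>)))"
    by (intro sums_divide sums_add sums_diff sums_mult A A1 A2)
  then show "(\<lambda>j. complex_of_real (l1_coeff j) * \<zeta> ^ j) sums generating_function L1_Scheme \<alpha> \<zeta>"
    unfolding g by (simp add: l1_coeff_def q_def algebra_simps add_divide_distrib diff_divide_distrib)
qed

text \<open>Everything comes from concavity of t^(1-\<alpha>): the tangent at n, compared with the
  chords to its right and to its left, gives K n \<le> 0, and the tangent at n + 1 bounds the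
  partial sums below.\<close>

lemma l1_weights: "l1_weights \<alpha> (cq_weight L1_Scheme \<alpha>) ((1 - \<alpha>) / Gamma (2 - \<alpha>))"
proof unfold_locales
  note c = alpha_pos alpha_less_1 Gamma_2_minus
  show "0 < cq_weight L1_Scheme \<alpha> 0" "0 < (1 - \<alpha>) / Gamma (2 - \<alpha>)" using c by (simp_all add: cq_weight_l1 l1_coeff_def)
  fix n :: nat
  have "(1 - \<alpha>) * (real n + 1) powr ((1 - \<alpha>) - 1) * ((real n + 1) - real n) \<le> (real n + 1) powr (1 - \<alpha>) - real n powr (1 - \<alpha>)"
    using c by (intro powr_diff_ge) auto
  then show "(1 - \<alpha>) / Gamma (2 - \<alpha>) * (real n + 1) powr (- \<alpha>) \<le> (\<Sum>j\<le>n. cq_weight L1_Scheme \<alpha> j)"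
    using c by (simp add: cq_weight_l1 l1_coeff_sum divide_right_mono add.commute)
  show "(\<Sum>j\<le>n. cq_weight L1_Scheme \<alpha> j) = kern (2 - \<alpha>) (real n + 1) - kern (2 - \<alpha>) (real n)"
    by (simp add: cq_weight_l1 l1_coeff_sum kern_def diff_divide_distrib add.commute)
  assume n: "1 \<le> n"
  have "(real n + 1) powr (1 - \<alpha>) - real n powr (1 - \<alpha>) \<le> (1 - \<alpha>) * real n powr ((1 - \<alpha>) - 1) * ((real n + 1) - real n)"
    using c n by (intro powr_diff_le) auto
  moreover have "(1 - \<alpha>) * real n powr ((1 - \<alpha>) - 1) * (real n - (real n - 1)) \<le> real n powr (1 - \<alpha>) - (real n - 1) powr (1 - \<alpha>)"
    using c n by (intro powr_diff_ge) auto
  ultimately have "real (Suc n) powr (1 - \<alpha>) - 2 * real n powr (1 - \<alpha>) + real (n - 1) powr (1 - \<alpha>) \<le> 0"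
    using n by (simp add: of_nat_diff add.commute)
  then show "cq_weight L1_Scheme \<alpha> n \<le> 0" using c by (simp add: cq_weight_l1 l1_coeff_def divide_nonpos_pos)
qed

lemma cq_weight_comparable:
  obtains c0 eps C where "cq_weights \<alpha> (cq_weight sch \<alpha>) c0" "cq_weights.comparable \<alpha> (cq_weight sch \<alpha>) eps C"
proof (cases sch)
  case L1_Scheme
  interpret l1_weights \<alpha> "cq_weight L1_Scheme \<alpha>" "(1 - \<alpha>) / Gamma (2 - \<alpha>)" by (rule l1_weights)
  show ?thesis using l1_comparable that cq_weights_axioms L1_Scheme by blast
next
  case Backward_Euler_CQ
  interpret be_weights \<alpha> "cq_weight Backward_Euler_CQ \<alpha>" "1 - \<alpha>" by (rule be_weights)
  show ?thesis using be_comparable that cq_weights_axioms Backward_Euler_CQ by blast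
qed

end

section \<open>Spectral form of the two problems\<close>

text \<open>Applying \<open>kern \<alpha>\<close> to the equation leaves the integral of the
  derivative, because the orders \<alpha> and 1 - \<alpha> add up to 1. The work lies in
  measurability and integrability of a derivative that is only given pointwise in the open
  interval.\<close>

lemma (in frac_order) caputo_volterra:
  fixes y h :: "real \<Rightarrow> real"
  assumes T: "0 < T" and yc: "continuous_on {0..T} y"
    and yd: "\<And>s. s \<in> {0<..<T} \<Longrightarrow> y differentiable (at s)"
    and ai: "\<And>t. t \<in> {0<..T} \<Longrightarrow> (\<lambda>s. (t - s) powr (- \<alpha>) * deriv y s) absolutely_integrable_on {0<..<t}"
    and eq: "\<And>t. t \<in> {0<..T} \<Longrightarrow>
      1 / Gamma (1 - \<alpha>) * (LINT s:{0<..<t}|lebesgue. (t - s) powr (- \<alpha>) * deriv y s) = h t"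
    and t: "t \<in> {0<..T}"
  shows "y t = y 0 + (\<integral>s. kern \<alpha> (t - s) * (indicator {0<..T} s * h s) \<partial>lborel)"
proof -
  have G: "0 < Gamma (1 - \<alpha>)" using alpha_less_1 by (intro Gamma_real_pos) simp
  \<comment> \<open>Clamping the argument to [0,T] gives a continuous function on the line; its
    limit of difference quotients is Borel measurable and equals \<open>deriv y\<close>
    inside.\<close>
  define Y where "Y s = y (max 0 (min T s))" for s
  have "continuous_on UNIV Y"
    unfolding Y_def by (rule continuous_on_compose2[OF yc]) (use T in \<open>auto intro!: continuous_intros\<close>)
  then have [measurable]: "Y \<in> borel_measurable borel" by (rule borel_measurable_continuous_onI)
  have [measurable]: "ddir (1::real) Y \<in> borel_measurable borel" by (rule ddir_measurable) measurable
  define d where "d s = indicator {0<..<T} s * ddir 1 Y s" for s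
  have dm [measurable]: "d \<in> borel_measurable borel" unfolding d_def [abs_def] by measurable
  have yder: "(y has_real_derivative deriv y s) (at s)" if "s \<in> {0<..<T}" for s
    using yd[OF that] by (simp add: DERIV_deriv_iff_real_differentiable)
  have d_eq: "d s = deriv y s" if s: "s \<in> {0<..<T}" for s
  proof -
    have "(Y has_derivative (*) (deriv y s)) (at s)"
      using yder[OF s] unfolding has_field_derivative_def
      by (rule has_derivative_transform_within_open[of _ _ _ UNIV "{0<..<T}"]) (use s in \<open>auto simp: Y_def\<close>)
    from ddir_eq[OF this, of 1] show ?thesis using s by (simp add: d_def)
  qed
  have d0: "d s = 0" if "s \<le> 0" for s using that by (simp add: d_def)
  have conv: "integrable lborel (\<lambda>r. kern (1 - \<alpha>) (t - r) * d r)" "(\<integral>r. kern (1 - \<alpha>) (t - r) * d r \<partial>lborel) = h t"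
    if t: "t \<in> {0<..T}" for t
  proof -
    have "indicator {0<..<t} s * ((t - s) powr (- \<alpha>) * deriv y s) = Gamma (1 - \<alpha>) * (kern (1 - \<alpha>) (t - s) * d s)" for s
    proof (cases "s \<in> {0<..<t}")
      case True
      then show ?thesis using t G d_eq[of s] by (simp add: kern_def)
    next
      case False
      then show ?thesis using d0[of s] by (cases "s \<le> 0") auto
    qed
    then have e: "(\<lambda>s. indicator {0<..<t} s *\<^sub>R ((t - s) powr (- \<alpha>) * deriv y s)) = (\<lambda>s. Gamma (1 - \<alpha>) * (kern (1 - \<alpha>) (t - s) * d s))"
      by (simp add: fun_eq_iff)
    have "integrable lebesgue (\<lambda>s. Gamma (1 - \<alpha>) * (kern (1 - \<alpha>) (t - s) * d s))"
      using ai[OF t] unfolding set_integrable_def e .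
    then have "integrable lborel (\<lambda>s. Gamma (1 - \<alpha>) * (kern (1 - \<alpha>) (t - s) * d s))"
      by (subst (asm) integrable_completion) measurable
    then show "integrable lborel (\<lambda>r. kern (1 - \<alpha>) (t - r) * d r)" using G by simp
    have "(LINT s:{0<..<t}|lebesgue. (t - s) powr (- \<alpha>) * deriv y s) = (\<integral>s. Gamma (1 - \<alpha>) * (kern (1 - \<alpha>) (t - s) * d s) \<partial>lborel)"
      unfolding set_lebesgue_integral_def e by (rule integral_completion) measurable
    then show "(\<integral>r. kern (1 - \<alpha>) (t - r) * d r \<partial>lborel) = h t" using eq[OF t] G by simp
  qed
  \<comment> \<open>On (0,T) the kernel of the condition at t = T is at least \<open>k\<close>, so
    that condition already makes the derivative itself integrable.\<close>
  define k where "k = T powr (- \<alpha>) / Gamma (1 - \<alpha>)"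
  have k: "0 < k" using T G by (simp add: k_def)
  have id: "integrable lborel d"
  proof (rule Bochner_Integration.integrable_bound)
    show "integrable lborel (\<lambda>r. (1 / k) * (kern (1 - \<alpha>) (T - r) * d r))" using conv(1)[of T] T by simp
    show "AE r in lborel. norm (d r) \<le> norm ((1 / k) * (kern (1 - \<alpha>) (T - r) * d r))"
    proof (intro AE_I2)
      fix r
      show "norm (d r) \<le> norm ((1 / k) * (kern (1 - \<alpha>) (T - r) * d r))"
      proof (cases "r \<in> {0<..<T}")
        case True
        have "T powr (- \<alpha>) \<le> (T - r) powr (- \<alpha>)" using True alpha_pos by (intro powr_mono2') auto
        then have "k \<le> kern (1 - \<alpha>) (T - r)" using True G by (simp add: k_def kern_def divide_right_mono)
        then have "k * \<bar>d r\<bar> \<le> kern (1 - \<alpha>) (T - r) * \<bar>d r\<bar>" by (rule mult_right_mono) simp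
        moreover have "0 \<le> kern (1 - \<alpha>) (T - r)" using alpha_less_1 by (intro kern_nonneg) simp
        ultimately show ?thesis using k by (simp add: abs_mult field_simps)
      qed (simp add: d_def)
    qed
  qed measurable
  have i1: "integrable lborel (\<lambda>r. kern 1 (t - r) * d r)"
    by (rule Bochner_Integration.integrable_bound[OF id]) auto
  have "(\<integral>s. kern \<alpha> (t - s) * (\<integral>r. kern (1 - \<alpha>) (s - r) * d r \<partial>lborel) \<partial>lborel)
      = (\<integral>r. (\<integral>s. kern \<alpha> (t - r - s) * kern (1 - \<alpha>) s \<partial>lborel) * d r \<partial>lborel)"
    by (rule conv_assoc[where a = \<alpha> and b = "1 - \<alpha>" and F = 1 and G = 1])
      (use alpha_pos alpha_less_1 i1 in \<open>auto simp: kern_nonneg\<close>)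
  also have "\<dots> = (\<integral>r. kern 1 (t - r) * d r \<partial>lborel)"
    using has_bochner_integral_integral_eq[OF has_bochner_integral_kern_conv[of \<alpha> "1 - \<alpha>"]] alpha_pos alpha_less_1 by simp
  also have "\<dots> = y t - y 0"
  proof -
    \<comment> \<open>Continuity up to the endpoints and a derivative inside are enough here; at 0
      the derivative may blow up.\<close>
    have "(deriv y has_integral y t - y 0) {0..t}"
    proof (rule fundamental_theorem_of_calculus_interior)
      show "continuous_on {0..t} y" by (rule continuous_on_subset[OF yc]) (use t in auto)
      show "(y has_vector_derivative deriv y s) (at s)" if "s \<in> {0<..<t}" for s
        using yder[of s] that t by (auto simp: has_real_derivative_iff_has_vector_derivative)
    qed (use t in auto)
    then have "((\<lambda>r. if r \<in> {0..t} then deriv y r else 0) has_integral y t - y 0) UNIV"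
      by (simp only: has_integral_restrict_UNIV)
    then have "((\<lambda>r. kern 1 (t - r) * d r) has_integral y t - y 0) UNIV"
    proof (rule has_integral_spike[where S = "{0, t}", rotated 2])
      show "kern 1 (t - r) * d r = (if r \<in> {0..t} then deriv y r else 0)" if "r \<in> UNIV - {0, t}" for r
        using that t d_eq[of r] d0[of r] by (cases "r < 0"; cases "r < t") auto
    qed auto
    moreover have "((\<lambda>r. kern 1 (t - r) * d r) has_integral (\<integral>r. kern 1 (t - r) * d r \<partial>lborel)) UNIV"
      by (rule has_integral_integral_lborel[OF i1])
    ultimately show ?thesis by (simp add: has_integral_unique)
  qed
  also have "(\<integral>s. kern \<alpha> (t - s) * (\<integral>r. kern (1 - \<alpha>) (s - r) * d r \<partial>lborel) \<partial>lborel)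
      = (\<integral>s. kern \<alpha> (t - s) * (indicator {0<..T} s * h s) \<partial>lborel)"
  proof (rule Bochner_Integration.integral_cong)
    fix s
    show "kern \<alpha> (t - s) * (\<integral>r. kern (1 - \<alpha>) (s - r) * d r \<partial>lborel) = kern \<alpha> (t - s) * (indicator {0<..T} s * h s)"
    proof (cases "s \<in> {0<..T}")
      case True
      then show ?thesis by (simp only: conv(2)) simp
    next
      case False
      show ?thesis
      proof (cases "s \<le> 0")
        case True
        then have "kern (1 - \<alpha>) (s - r) * d r = 0" for r using d0[of r] by (cases "r \<le> 0") auto
        then have "(\<integral>r. kern (1 - \<alpha>) (s - r) * d r \<partial>lborel) = 0" by (simp only: Bochner_Integration.integral_zero)
        then show ?thesis using False by simp
      qed (use False t in simp)
    qed
  qed simp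
  finally show ?thesis by simp
qed

text \<open>One level of the scheme solved for its unknown. The stiff part \<open>lam\<close> is
  implicit and \<open>F\<close> is explicit, so in the eigenbasis each level is a closed formula and
  existence needs no fixed point argument.\<close>

fun imex :: "(nat \<Rightarrow> real) \<Rightarrow> real \<Rightarrow> (nat \<Rightarrow> real) \<Rightarrow> ((nat \<Rightarrow> real) \<Rightarrow> nat \<Rightarrow> real) \<Rightarrow> (nat \<Rightarrow> real) \<Rightarrow> nat \<Rightarrow> nat \<Rightarrow> real" where
  "imex K k lam F v n = (if n = 0 then v else
     (\<lambda>i. (F (imex K k lam F v (n - 1)) i - k * (\<Sum>j=1..<n. K (n - j) * (imex K k lam F v j i - v i)) + k * K 0 * v i)
       / (k * K 0 + lam i)))"

declare imex.simps [simp del]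

lemma imex_step:
  fixes n :: nat and k :: real
  assumes n: "1 \<le> n" and pos: "0 < k * K 0 + lam i"
  shows "k * (\<Sum>j=1..n. K (n - j) * (x j - v i)) + lam i * x n = r \<longleftrightarrow>
    x n = (r - k * (\<Sum>j=1..<n. K (n - j) * (x j - v i)) + k * K 0 * v i) / (k * K 0 + lam i)"
proof -
  have "{1..n} = insert n {1..<n}" using n by auto
  then have eq: "(\<Sum>j=1..n. K (n - j) * (x j - v i)) = K 0 * (x n - v i) + (\<Sum>j=1..<n. K (n - j) * (x j - v i))" by simp
  have alg: "k * (K0 * (a - b) + A) + l * a = r \<longleftrightarrow> a * (k * K0 + l) = r - k * A + k * K0 * b" for K0 a b A l
    by (auto simp: algebra_simps)
  have ne: "k * K 0 + lam i \<noteq> 0" using pos by simp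
  show ?thesis unfolding eq alg eq_divide_eq using ne by simp
qed

context fe_setting
begin

sublocale L2: fun_inner S "L2_inner \<Omega>"
  by unfold_locales (auto simp: fe_zero L2_inner_nonneg fe_pos_def intro: fe_lin L2_inner_sym L2_inner_lin fe_L2)

sublocale grad: form_space S "grad_inner \<Omega>"
  by unfold_locales (auto simp: fe_zero intro: fe_lin grad_inner_sym grad_inner_lin)

lemma fe_eigenbasis:
  obtains m e lam where "onb S (L2_inner \<Omega>) m e"
    "\<And>i j. i < m \<Longrightarrow> j < m \<Longrightarrow> grad_inner \<Omega> (e i) (e j) = (if i = j then lam i else 0)"
proof -
  obtain V where V: "finite V" "\<And>v x. v \<in> S \<Longrightarrow> (\<And>p. p \<in> V \<Longrightarrow> v p = 0) \<Longrightarrow> v x = 0"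
    using fe_determined by blast
  obtain m e where "onb S (L2_inner \<Omega>) m e"
    using onb_exists[where V = V, OF V(1) L2.fun_inner_axioms] V(2) by blast
  from spectral_theorem[where V = V, OF L2.fun_inner_axioms grad.form_space_axioms this V(1)] V(2)
  show ?thesis using that by blast
qed

end

section \<open>Coordinates in the discrete eigenbasis\<close>

locale fe_spectral = fe_setting \<Omega> \<T> for \<Omega> :: "'a::euclidean_space set" and \<T> +
  fixes m :: nat and e :: "nat \<Rightarrow> 'a \<Rightarrow> real" and lam :: "nat \<Rightarrow> real" and R :: real
  assumes onb: "onb S (L2_inner \<Omega>) m e"
    and eig: "\<And>i j. i < m \<Longrightarrow> j < m \<Longrightarrow> grad_inner \<Omega> (e i) (e j) = (if i = j then lam i else 0)"
    and R: "0 < R" "\<And>x. x \<in> \<Omega> \<Longrightarrow> norm x \<le> R"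
begin

definition cf :: "('a \<Rightarrow> real) \<Rightarrow> nat \<Rightarrow> real" where "cf v i = L2_inner \<Omega> v (e i)"

definition lift :: "(nat \<Rightarrow> real) \<Rightarrow> 'a \<Rightarrow> real" where "lift x = (\<lambda>y. \<Sum>i<m. x i * e i y)"

lemma e_S: "i < m \<Longrightarrow> e i \<in> S"
  by (rule onbD(1)[OF onb])

lemma lift_S: "lift x \<in> S"
  unfolding lift_def by (rule L2.S_sum) (auto simp: e_S)

lemma cf_lift: "i < m \<Longrightarrow> cf (lift x) i = x i"
  unfolding cf_def lift_def by (rule L2.onb_coeff[OF onb])

lemma lift_cf: "v \<in> S \<Longrightarrow> lift (cf v) = v"
  unfolding cf_def lift_def by (rule onbD(3)[OF onb])

lemma lift_cong: "(\<And>i. i < m \<Longrightarrow> x i = y i) \<Longrightarrow> lift x = lift y"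
  unfolding lift_def by (intro ext sum.cong) auto

lemma cf_eqI: "v \<in> S \<Longrightarrow> w \<in> S \<Longrightarrow> (\<And>i. i < m \<Longrightarrow> cf v i = cf w i) \<Longrightarrow> v = w"
  using lift_cong[of "cf v" "cf w"] by (simp add: lift_cf)

lemma cf_lin: "v \<in> L2_space \<Omega> \<Longrightarrow> w \<in> L2_space \<Omega> \<Longrightarrow> i < m \<Longrightarrow> cf (\<lambda>x. c * v x + w x) i = c * cf v i + cf w i"
  unfolding cf_def by (rule L2_inner_lin) (auto intro: fe_L2 e_S)

lemma cf_diff: "v \<in> L2_space \<Omega> \<Longrightarrow> w \<in> L2_space \<Omega> \<Longrightarrow> i < m \<Longrightarrow> cf (\<lambda>x. v x - w x) i = cf v i - cf w i"
  using cf_lin[of w v i "-1"] by simp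

lemma cf_sum: "finite I \<Longrightarrow> (\<And>j. j \<in> I \<Longrightarrow> v j \<in> S) \<Longrightarrow> i < m \<Longrightarrow> cf (\<lambda>x. \<Sum>j\<in>I. c j * v j x) i = (\<Sum>j\<in>I. c j * cf (v j) i)"
  unfolding cf_def by (rule L2.B_sum) (auto intro: e_S)

lemma L2_norm_fe: "v \<in> S \<Longrightarrow> L2_norm \<Omega> v = nrm m (cf v)"
  using L2.onb_parseval[OF onb, of v v] by (simp add: L2_norm_def nrm_def L2_set_def cf_def power2_eq_square)

lemma L2_inner_fe:
  assumes w: "w \<in> L2_space \<Omega>" and v: "v \<in> S"
  shows "L2_inner \<Omega> w v = (\<Sum>i<m. cf w i * cf v i)"
proof -
  have "L2_inner \<Omega> w v = L2_inner \<Omega> (lift (cf v)) w" by (simp add: lift_cf[OF v] L2_inner_sym)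
  also have "\<dots> = (\<Sum>i<m. L2_inner \<Omega> (\<lambda>x. cf v i * e i x) w)"
    unfolding lift_def by (rule L2_inner_sum) (auto intro: w L2_scale[OF fe_L2[OF e_S]])
  also have "\<dots> = (\<Sum>i<m. cf w i * cf v i)"
    unfolding L2_inner_scale cf_def by (intro sum.cong refl) (simp only: L2_inner_sym[of \<Omega> w] mult.commute)
  finally show ?thesis .
qed

text \<open>Needed for functions outside S_h, such as f(u_h): subtracting the projection leaves a
  nonnegative square.\<close>

lemma bessel:
  assumes w: "w \<in> L2_space \<Omega>"
  shows "nrm m (cf w) \<le> L2_norm \<Omega> w"
proof -
  define p where "p = lift (cf w)"
  have p: "p \<in> S" "\<And>i. i < m \<Longrightarrow> cf p i = cf w i" by (simp_all add: p_def lift_S cf_lift)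
  note pL = fe_L2[OF p(1)]
  have wp: "L2_inner \<Omega> w p = (\<Sum>i<m. cf w i * cf w i)" unfolding L2_inner_fe[OF w p(1)] using p(2) by simp
  have pp: "L2_inner \<Omega> p p = (\<Sum>i<m. cf w i * cf w i)" unfolding L2_inner_fe[OF pL p(1)] using p(2) by simp
  define z where "z x = -1 * p x + w x" for x
  have zL: "z \<in> L2_space \<Omega>" unfolding z_def [abs_def] by (rule L2_lin[OF pL w])
  have ze: "L2_inner \<Omega> z h = -1 * L2_inner \<Omega> p h + L2_inner \<Omega> w h" if "h \<in> L2_space \<Omega>" for h
    unfolding z_def [abs_def] by (rule L2_inner_lin[OF pL w that])
  have "0 \<le> L2_inner \<Omega> z z" by (rule L2_inner_nonneg)
  also have "\<dots> = - L2_inner \<Omega> z p + L2_inner \<Omega> z w"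
    using ze[OF zL] by (simp add: L2_inner_sym[of \<Omega> p z] L2_inner_sym[of \<Omega> w z])
  also have "\<dots> = L2_inner \<Omega> w w - L2_inner \<Omega> w p"
    using ze[OF pL] ze[OF w] wp pp by (simp add: L2_inner_sym[of \<Omega> p w])
  finally show ?thesis using wp by (simp add: nrm_def L2_set_def L2_norm_def power2_eq_square)
qed

text \<open>The inequality \<open>poincare\<close> for an eigenfunction; the bound does not see the
  triangulation.\<close>

lemma lam_ge:
  assumes i: "i < m"
  shows "1 \<le> 4 * R\<^sup>2 * lam i" and "0 < lam i"
proof -
  show "1 \<le> 4 * R\<^sup>2 * lam i" using poincare[OF e_S[OF i] R] onbD(2)[OF onb i i] eig[OF i i] by simp
  then have "0 < R\<^sup>2 * lam i" by linarith
  then show "0 < lam i" using R(1) by (simp add: zero_less_mult_iff)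
qed

lemma grad_fe: "v \<in> S \<Longrightarrow> w \<in> S \<Longrightarrow> grad_inner \<Omega> v w = (\<Sum>i<m. lam i * cf v i * cf w i)"
proof -
  assume v: "v \<in> S" and w: "w \<in> S"
  have "grad_inner \<Omega> v w = grad_inner \<Omega> (lift (cf v)) (lift (cf w))" by (simp add: lift_cf v w)
  also have "\<dots> = (\<Sum>i<m. \<Sum>j<m. cf v i * cf w j * grad_inner \<Omega> (e i) (e j))"
    unfolding lift_def by (rule grad.B_sum2) (rule e_S)
  also have "\<dots> = (\<Sum>i<m. \<Sum>j<m. if i = j then lam i * cf v i * cf w i else 0)"
    by (intro sum.cong) (auto simp: eig)
  also have "\<dots> = (\<Sum>i<m. lam i * cf v i * cf w i)" by (intro sum.cong) auto
  finally show ?thesis .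
qed

text \<open>Evaluates at once the definite descriptions behind the discrete Laplacian and the L2
  projection.\<close>

lemma riesz:
  assumes "\<And>v. v \<in> S \<Longrightarrow> l v = (\<Sum>i<m. a i * cf v i)"
  shows "(THE z. z \<in> S \<and> (\<forall>v\<in>S. L2_inner \<Omega> z v = l v)) = lift a"
proof (rule the_equality)
  show "lift a \<in> S \<and> (\<forall>v\<in>S. L2_inner \<Omega> (lift a) v = l v)"
    using assms by (auto simp: lift_S L2_inner_fe fe_L2 cf_lift)
  fix z assume z: "z \<in> S \<and> (\<forall>v\<in>S. L2_inner \<Omega> z v = l v)"
  have "cf z i = a i" if i: "i < m" for i
  proof -
    have "cf z i = l (e i)" using z e_S[OF i] by (simp add: cf_def)
    also have "\<dots> = (\<Sum>j<m. if j = i then a i else 0)"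
      unfolding assms[OF e_S[OF i]] cf_def using onbD(2)[OF onb i] by (intro sum.cong) auto
    finally show ?thesis using i by simp
  qed
  then show "z = lift a" using z by (intro cf_eqI lift_S) (auto simp: cf_lift)
qed

lemma discrete_laplacian_fe: "w \<in> S \<Longrightarrow> discrete_laplacian \<Omega> \<T> w = lift (\<lambda>i. - lam i * cf w i)"
  unfolding discrete_laplacian_def by (rule riesz) (simp add: grad_fe sum_negf)

lemma L2_projection_fe: "w \<in> L2_space \<Omega> \<Longrightarrow> L2_projection \<Omega> \<T> w = lift (cf w)"
  unfolding L2_projection_def by (rule riesz) (simp add: L2_inner_fe)

text \<open>When \<open>w\<close> represents - \<Delta> u_0, the coefficients of R_h u_0 times lam i
  are those of \<open>w\<close>, that is, - \<Delta>_h R_h u_0 = P_h w.\<close>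

lemma ritz_projection_fe:
  assumes w: "w \<in> L2_space \<Omega>" and g: "\<And>v. v \<in> S \<Longrightarrow> grad_inner \<Omega> u0 v = L2_inner \<Omega> w v"
  shows "ritz_projection \<Omega> \<T> u0 = lift (\<lambda>i. cf w i / lam i)"
  unfolding ritz_projection_def
proof (rule the_equality)
  have "grad_inner \<Omega> (lift (\<lambda>i. cf w i / lam i)) v = grad_inner \<Omega> u0 v" if v: "v \<in> S" for v
    unfolding g[OF v] L2_inner_fe[OF w v] grad_fe[OF lift_S v] using lam_ge(2)
    by (intro sum.cong) (auto simp: cf_lift less_le)
  then show "lift (\<lambda>i. cf w i / lam i) \<in> S \<and> (\<forall>v\<in>S. grad_inner \<Omega> (lift (\<lambda>i. cf w i / lam i)) v = grad_inner \<Omega> u0 v)"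
    by (simp add: lift_S)
  fix z assume z: "z \<in> S \<and> (\<forall>v\<in>S. grad_inner \<Omega> z v = grad_inner \<Omega> u0 v)"
  have "cf z i = cf w i / lam i" if i: "i < m" for i
  proof -
    have "cf w i = grad_inner \<Omega> z (e i)" using z g e_S[OF i] by (simp add: cf_def)
    also have "\<dots> = (\<Sum>j<m. if j = i then lam i * cf z i else 0)"
      unfolding grad_fe[OF conjunct1[OF z] e_S[OF i]] using onbD(2)[OF onb i] by (intro sum.cong) (auto simp: cf_def)
    finally show ?thesis using i lam_ge(2)[OF i] by (simp add: field_simps)
  qed
  then show "z = lift (\<lambda>i. cf w i / lam i)" using z by (intro cf_eqI lift_S) (auto simp: cf_lift)
qed

end

context fe_spectral
begin

definition reaction :: "(real \<Rightarrow> real) \<Rightarrow> (nat \<Rightarrow> real) \<Rightarrow> nat \<Rightarrow> real" where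
  "reaction f x = cf (\<lambda>y. f (lift x y))"

lemma nonlinearity_L2:
  assumes f: "L-lipschitz_on UNIV f" and v: "v \<in> S"
  shows "(\<lambda>x. f (v x)) \<in> L2_space \<Omega>"
proof -
  obtain M where M: "M-lipschitz_on UNIV v" using fe_lipschitz[OF v] .
  obtain B where B: "\<And>x. \<bar>v x\<bar> \<le> B" using lipschitz_bounded[OF M domain(3) fe_off[OF v]] by blast
  have m: "f \<in> borel_measurable borel" by (rule lipschitz_measurable[OF f])
  show ?thesis
  proof (rule L2_bounded[OF lmeas measurable_compose[OF fe_measurable[OF v] m]], rule AE_I2)
    fix x
    have "\<bar>f (v x) - f 0\<bar> \<le> L * \<bar>v x\<bar>" using lipschitz_onD[OF f, of "v x" 0] by (simp add: dist_real_def)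
    also have "\<dots> \<le> L * B" using B lipschitz_on_nonneg[OF f] by (intro mult_left_mono)
    finally show "\<bar>f (v x)\<bar> \<le> \<bar>f 0\<bar> + L * B" by linarith
  qed
qed

lemma reaction_cf: "v \<in> S \<Longrightarrow> reaction f (cf v) = cf (\<lambda>y. f (v y))"
  by (simp add: reaction_def lift_cf)

lemma reaction_cong: "(\<And>i. i < m \<Longrightarrow> x i = y i) \<Longrightarrow> reaction f x = reaction f y"
  unfolding reaction_def using lift_cong[of x y] by simp

text \<open>Bessel's inequality, the pointwise Lipschitz bound and Parseval; the projection does not
  enlarge the constant of \<open>f\<close>.\<close>

lemma reaction_lipschitz:
  assumes f: "L-lipschitz_on UNIV f"
  shows "nrm m (\<lambda>i. reaction f x i - reaction f y i) \<le> L * nrm m (\<lambda>i. x i - y i)"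
proof -
  have L: "0 \<le> L" by (rule lipschitz_on_nonneg[OF f])
  note l = nonlinearity_L2[OF f lift_S]
  define d where "d z = lift x z - lift y z" for z
  have dS: "d \<in> S" unfolding d_def [abs_def] using L2.S_diff[OF lift_S lift_S, of x 1 y] by simp
  have dL: "d \<in> L2_space \<Omega>" by (rule fe_L2[OF dS])
  define k where "k z = f (lift x z) - f (lift y z)" for z
  have kL: "k \<in> L2_space \<Omega>" unfolding k_def [abs_def] by (rule L2_diff[OF l l])
  have "nrm m (\<lambda>i. reaction f x i - reaction f y i) = nrm m (cf k)"
    by (rule nrm_cong) (simp add: reaction_def k_def [abs_def] cf_diff[OF l l])
  also have "\<dots> \<le> L2_norm \<Omega> k" by (rule bessel[OF kL])
  also have "\<dots> \<le> L * L2_norm \<Omega> d"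
  proof -
    have "L2_inner \<Omega> k k \<le> L\<^sup>2 * L2_inner \<Omega> d d"
      unfolding L2_inner_def integral_mult_right_zero [symmetric]
    proof (rule integral_mono)
      fix z
      have "\<bar>k z\<bar> \<le> L * \<bar>d z\<bar>"
        using lipschitz_onD[OF f, of "lift x z" "lift y z"] by (simp add: k_def d_def dist_real_def)
      then have "\<bar>k z\<bar>\<^sup>2 \<le> (L * \<bar>d z\<bar>)\<^sup>2" by (rule power_mono) simp
      then show "k z * k z \<le> L\<^sup>2 * (d z * d z)" by (simp add: power2_eq_square mult_ac)
    qed (use L2_mult_integrable[OF kL kL] L2_mult_integrable[OF dL dL] in auto)
    then have "sqrt (L2_inner \<Omega> k k) \<le> sqrt (L\<^sup>2 * L2_inner \<Omega> d d)" by (rule real_sqrt_le_mono)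
    then show ?thesis using L by (simp add: L2_norm_def real_sqrt_mult)
  qed
  also have "L2_norm \<Omega> d = nrm m (cf d)" by (rule L2_norm_fe[OF dS])
  also have "\<dots> = nrm m (\<lambda>i. x i - y i)"
    by (rule nrm_cong) (simp add: d_def [abs_def] cf_diff[OF fe_L2[OF lift_S] fe_L2[OF lift_S]] cf_lift)
  finally show ?thesis .
qed

text \<open>The product of lam i and cf w i / lam i is cf w i, so no eigenvalue survives; the
  division by lam i costs 4 R^2 through \<open>lam_ge\<close>. The right-hand side depends on data
  and domain only.\<close>

lemma start_bound:
  assumes f: "L-lipschitz_on UNIV f" and w: "w \<in> L2_space \<Omega>"
  shows "nrm m (\<lambda>i. reaction f (\<lambda>i. cf w i / lam i) i - lam i * (cf w i / lam i))
    \<le> L2_norm \<Omega> (\<lambda>x. f 0) + L * (4 * R\<^sup>2 * L2_norm \<Omega> w) + L2_norm \<Omega> w"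
proof -
  define v where "v i = cf w i / lam i" for i
  have L: "0 \<le> L" by (rule lipschitz_on_nonneg[OF f])
  have cL: "(\<lambda>x. f 0) \<in> L2_space \<Omega>" by (rule L2_bounded[OF lmeas, of _ "\<bar>f 0\<bar>"]) auto
  have "lift (\<lambda>i. 0) = (\<lambda>y. 0)" by (simp add: lift_def)
  then have r0: "nrm m (reaction f (\<lambda>i. 0)) \<le> L2_norm \<Omega> (\<lambda>x. f 0)" using bessel[OF cL] by (simp add: reaction_def)
  have vw: "nrm m v \<le> 4 * R\<^sup>2 * nrm m (cf w)"
  proof (rule nrm_scale)
    fix i assume i: "i < m"
    note l = lam_ge[OF i]
    have "\<bar>cf w i\<bar> * 1 \<le> \<bar>cf w i\<bar> * (4 * R\<^sup>2 * lam i)" using l(1) by (rule mult_left_mono) simp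
    then show "\<bar>v i\<bar> \<le> 4 * R\<^sup>2 * \<bar>cf w i\<bar>" using l(2) by (simp add: v_def divide_le_eq mult_ac)
  qed simp
  have "nrm m (\<lambda>i. reaction f v i - lam i * v i)
      = nrm m (\<lambda>i. reaction f (\<lambda>i. 0) i + ((reaction f v i - reaction f (\<lambda>i. 0) i) + - cf w i))"
    using lam_ge(2) by (intro nrm_cong) (auto simp: v_def less_le)
  also have "\<dots> \<le> nrm m (reaction f (\<lambda>i. 0)) + (nrm m (\<lambda>i. reaction f v i - reaction f (\<lambda>i. 0) i) + nrm m (\<lambda>i. - cf w i))"
    by (rule order_trans[OF nrm_triangle add_left_mono[OF nrm_triangle]])
  also have "nrm m (\<lambda>i. - cf w i) \<le> 1 * nrm m (cf w)" by (rule nrm_scale) auto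
  also have "nrm m (\<lambda>i. reaction f v i - reaction f (\<lambda>i. 0) i) \<le> L * nrm m v"
    using reaction_lipschitz[OF f, of v "\<lambda>i. 0"] by simp
  also have "L * nrm m v \<le> L * (4 * R\<^sup>2 * L2_norm \<Omega> w)"
    using vw bessel[OF w] L R by (intro mult_left_mono) (auto intro: order_trans mult_left_mono)
  finally show ?thesis using r0 bessel[OF w] by (simp add: v_def [abs_def])
qed

lemma semidiscrete_volterra:
  assumes \<alpha>: "0 < \<alpha>" "\<alpha> < 1" and T: "0 < T" and f: "L-lipschitz_on UNIV f"
    and sol: "semidiscrete_solution \<alpha> T \<Omega> \<T> f u0 u" and i: "i < m"
  shows "continuous_on {0..T} (\<lambda>t. cf (u t) i)"
    and "t \<in> {0<..T} \<Longrightarrow> cf (u t) i = cf (u 0) i +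
      (\<integral>s. kern \<alpha> (t - s) * (indicator {0<..T} s * (reaction f (cf (u s)) i - lam i * cf (u s) i)) \<partial>lborel)"
proof -
  interpret frac_order \<alpha> by unfold_locales (fact \<alpha>)+
  have uS: "u t \<in> S" if "t \<in> {0..T}" for t using sol that by (simp add: semidiscrete_solution_def)
  show cont: "continuous_on {0..T} (\<lambda>t. cf (u t) i)"
    unfolding continuous_on_def
  proof
    fix t assume t: "t \<in> {0..T}"
    have lim: "((\<lambda>s. L2_norm \<Omega> (\<lambda>x. u s x - u t x)) \<longlongrightarrow> 0) (at t within {0..T})"
      using sol t by (simp add: semidiscrete_solution_def)
    have "((\<lambda>s. cf (u s) i - cf (u t) i) \<longlongrightarrow> 0) (at t within {0..T})"
    proof (rule Lim_null_comparison[OF _ lim])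
      have "norm (cf (u s) i - cf (u t) i) \<le> L2_norm \<Omega> (\<lambda>x. u s x - u t x)" if s: "s \<in> {0..T}" for s
      proof -
        note l = fe_L2[OF uS[OF s]] fe_L2[OF uS[OF t]]
        have "\<bar>cf (u s) i - cf (u t) i\<bar> = \<bar>cf (\<lambda>x. u s x - u t x) i\<bar>" by (simp add: cf_diff[OF l i])
        also have "\<dots> \<le> nrm m (cf (\<lambda>x. u s x - u t x))" by (rule abs_le_nrm[OF i])
        also have "\<dots> \<le> L2_norm \<Omega> (\<lambda>x. u s x - u t x)" by (rule bessel[OF L2_diff[OF l]])
        finally show ?thesis by simp
      qed
      then show "\<forall>\<^sub>F s in at t within {0..T}. norm (cf (u s) i - cf (u t) i) \<le> L2_norm \<Omega> (\<lambda>x. u s x - u t x)"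
        by (simp add: eventually_at_filter)
    qed
    then show "((\<lambda>s. cf (u s) i) \<longlongrightarrow> cf (u t) i) (at t within {0..T})" by (simp add: LIM_zero_iff)
  qed
  obtain V where V: "finite V" "\<And>v x. v \<in> S \<Longrightarrow> (\<And>p. p \<in> V \<Longrightarrow> v p = 0) \<Longrightarrow> v x = 0"
    using fe_determined by blast
  \<comment> \<open>Time derivatives are given at fixed x. Finitely many point values make the
    coefficient differentiable in time and carry the Caputo integrals over to it.\<close>
  have "\<exists>c. \<forall>v\<in>S. cf v i = (\<Sum>p\<in>V. c p * v p)"
  proof (rule functional_eq_sum_values[OF V(1) L2.form_space_axioms])
    show "v x = 0" if "v \<in> S" "\<And>p. p \<in> V \<Longrightarrow> v p = 0" for v x using V(2) that .
    show "cf (\<lambda>x. c * v x + w x) i = c * cf v i + cf w i" if "v \<in> S" "w \<in> S" for v w c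
      using that i by (intro cf_lin fe_L2)
  qed
  then obtain c where c: "\<And>v. v \<in> S \<Longrightarrow> cf v i = (\<Sum>p\<in>V. c p * v p)" by blast
  define y where "y t = (\<Sum>p\<in>V. c p * u t p)" for t
  have y: "y t = cf (u t) i" if "t \<in> {0..T}" for t using c[OF uS[OF that]] by (simp add: y_def)
  have ud: "((\<lambda>r. u r p) has_real_derivative deriv (\<lambda>r. u r p) s) (at s)" if "s \<in> {0<..<T}" for s p
    using sol that by (simp add: semidiscrete_solution_def caputo_differentiable_def DERIV_deriv_iff_real_differentiable)
  have yd: "(y has_real_derivative (\<Sum>p\<in>V. c p * deriv (\<lambda>r. u r p) s)) (at s)" if "s \<in> {0<..<T}" for s
    unfolding y_def [abs_def] by (intro DERIV_sum DERIV_cmult ud[OF that])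
  have ydv: "deriv y s = (\<Sum>p\<in>V. c p * deriv (\<lambda>r. u r p) s)" if "s \<in> {0<..<T}" for s
    by (rule DERIV_imp_deriv[OF yd[OF that]])
  have ci: "caputo_integrand \<alpha> u t p absolutely_integrable_on {0<..<t}" if "t \<in> {0<..T}" for t p
    using sol that by (simp add: semidiscrete_solution_def caputo_differentiable_def)
  have e: "indicator {0<..<t} s *\<^sub>R ((t - s) powr (- \<alpha>) * deriv y s)
      = (\<Sum>p\<in>V. c p * (indicator {0<..<t} s *\<^sub>R caputo_integrand \<alpha> u t p s))" if "t \<in> {0<..T}" for t s
  proof (cases "s \<in> {0<..<t}")
    case True
    then show ?thesis using that by (simp add: ydv caputo_integrand_def sum_distrib_left mult_ac)
  qed simp
  have ai: "(\<lambda>s. (t - s) powr (- \<alpha>) * deriv y s) absolutely_integrable_on {0<..<t}" if t: "t \<in> {0<..T}" for t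
    unfolding set_integrable_def e[OF t]
    using ci[OF t] by (intro Bochner_Integration.integrable_sum integrable_mult_right) (simp add: set_integrable_def)
  have eq: "1 / Gamma (1 - \<alpha>) * (LINT s:{0<..<t}|lebesgue. (t - s) powr (- \<alpha>) * deriv y s)
      = reaction f (cf (u t)) i - lam i * cf (u t) i" if t: "t \<in> {0<..T}" for t
  proof -
    have tS: "u t \<in> S" using uS t by simp
    note l = nonlinearity_L2[OF f tS]
    have "(\<lambda>x. caputo_deriv \<alpha> u t x - lift (\<lambda>i. - lam i * cf (u t) i) x) = lift (cf (\<lambda>x. f (u t x)))"
      using sol t unfolding semidiscrete_solution_def discrete_laplacian_fe[OF tS, symmetric] L2_projection_fe[OF l, symmetric] by blast
    then have "caputo_deriv \<alpha> u t x = 1 * lift (\<lambda>i. - lam i * cf (u t) i) x + lift (cf (\<lambda>x. f (u t x))) x" for x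
      by (metis add.commute diff_add_cancel mult_1)
    then have cap: "caputo_deriv \<alpha> u t = (\<lambda>x. 1 * lift (\<lambda>i. - lam i * cf (u t) i) x + lift (cf (\<lambda>x. f (u t x))) x)"
      by blast
    \<comment> \<open>The equation itself places the Caputo derivative in S_h, so the formula by
      point values applies to it.\<close>
    have cS: "caputo_deriv \<alpha> u t \<in> S" unfolding cap by (rule fe_lin[OF lift_S lift_S])
    have "(LINT s:{0<..<t}|lebesgue. (t - s) powr (- \<alpha>) * deriv y s)
        = (\<Sum>p\<in>V. c p * (LINT s:{0<..<t}|lebesgue. caputo_integrand \<alpha> u t p s))"
      unfolding set_lebesgue_integral_def e[OF t]
      using ci[OF t] by (subst Bochner_Integration.integral_sum) (simp_all add: set_integrable_def)
    then have "1 / Gamma (1 - \<alpha>) * (LINT s:{0<..<t}|lebesgue. (t - s) powr (- \<alpha>) * deriv y s)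
        = (\<Sum>p\<in>V. c p * caputo_deriv \<alpha> u t p)"
      by (simp add: caputo_deriv_def sum_divide_distrib)
    also have "\<dots> = cf (caputo_deriv \<alpha> u t) i" by (rule c[OF cS, symmetric])
    also have "\<dots> = reaction f (cf (u t)) i - lam i * cf (u t) i"
      unfolding cap cf_lin[OF fe_L2[OF lift_S] fe_L2[OF lift_S] i] reaction_cf[OF tS] by (simp add: cf_lift[OF i])
    finally show ?thesis .
  qed
  assume t: "t \<in> {0<..T}"
  have "y t = y 0 + (\<integral>s. kern \<alpha> (t - s) * (indicator {0<..T} s * (reaction f (cf (u s)) i - lam i * cf (u s) i)) \<partial>lborel)"
  proof (rule caputo_volterra[OF T _ _ ai eq t])
    show "continuous_on {0..T} y" using cont by (rule continuous_on_eq) (simp add: y)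
    show "y differentiable (at s)" if "s \<in> {0<..<T}" for s
      using yd[OF that] by (auto simp: real_differentiable_def)
  qed
  then show "cf (u t) i = cf (u 0) i +
      (\<integral>s. kern \<alpha> (t - s) * (indicator {0<..T} s * (reaction f (cf (u s)) i - lam i * cf (u s) i)) \<partial>lborel)"
    using y[of t] y[of 0] t by simp
qed

text \<open>Both sides lie in S_h and can be compared coordinatewise; the term j = 0 of the
  quadrature vanishes.\<close>

lemma scheme_equation:
  assumes f: "L-lipschitz_on UNIV f" and U: "\<And>j. j \<le> n \<Longrightarrow> U j \<in> S" and n: "1 \<le> n"
  shows "(\<lambda>x. discrete_frac_deriv sch \<alpha> \<tau> (\<lambda>j y. U j y - U 0 y) n x - discrete_laplacian \<Omega> \<T> (U n) x)
      = L2_projection \<Omega> \<T> (\<lambda>x. f (U (n - 1) x)) \<longleftrightarrow>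
    (\<forall>i<m. 1 / \<tau> powr \<alpha> * (\<Sum>j=1..n. cq_weight sch \<alpha> (n - j) * (cf (U j) i - cf (U 0) i)) + lam i * cf (U n) i
      = reaction f (cf (U (n - 1))) i)"
proof -
  define K where "K = cq_weight sch \<alpha>"
  define k where "k = 1 / \<tau> powr \<alpha>"
  define D where "D x = (\<Sum>j=0..n. k * K (n - j) * (U j x - 1 * U 0 x))" for x
  have UD: "(\<lambda>x. U j x - 1 * U 0 x) \<in> S" if "j \<in> {0..n}" for j using that by (intro L2.S_diff U) auto
  have DS: "D \<in> S" unfolding D_def [abs_def] by (rule L2.S_sum) (use UD in auto)
  have D: "discrete_frac_deriv sch \<alpha> \<tau> (\<lambda>j y. U j y - U 0 y) n x = D x" for x
    by (simp add: discrete_frac_deriv_def D_def K_def k_def sum_distrib_left mult.assoc sum_divide_distrib)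
  have cD: "cf D i = k * (\<Sum>j=1..n. K (n - j) * (cf (U j) i - cf (U 0) i))" if i: "i < m" for i
  proof -
    have "cf D i = (\<Sum>j=0..n. k * K (n - j) * cf (\<lambda>x. U j x - 1 * U 0 x) i)"
      unfolding D_def [abs_def] by (rule cf_sum) (use UD i in auto)
    also have "\<dots> = (\<Sum>j=0..n. k * K (n - j) * (cf (U j) i - cf (U 0) i))"
      using U i by (intro sum.cong refl) (simp add: cf_diff fe_L2)
    also have "\<dots> = k * (\<Sum>j=1..n. K (n - j) * (cf (U j) i - cf (U 0) i))"
      by (simp add: sum.atLeast_Suc_atMost sum_distrib_left mult.assoc)
    finally show ?thesis .
  qed
  have Un: "U n \<in> S" "U (n - 1) \<in> S" using U by auto
  have l: "cf (lift (\<lambda>i. - lam i * cf (U n) i)) i = - lam i * cf (U n) i" if "i < m" for i using that by (rule cf_lift)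
  define Z where "Z x = D x - 1 * lift (\<lambda>i. - lam i * cf (U n) i) x" for x
  have ZS: "Z \<in> S" unfolding Z_def [abs_def] by (rule L2.S_diff[OF DS lift_S])
  have cZ: "cf Z i = cf D i + lam i * cf (U n) i" if i: "i < m" for i
    unfolding Z_def [abs_def] using cf_diff[OF fe_L2[OF DS] fe_L2[OF lift_S] i] l[OF i] by simp
  have "(\<lambda>x. discrete_frac_deriv sch \<alpha> \<tau> (\<lambda>j y. U j y - U 0 y) n x - discrete_laplacian \<Omega> \<T> (U n) x) = Z"
    by (simp add: D Z_def discrete_laplacian_fe[OF Un(1)] fun_eq_iff)
  moreover have "L2_projection \<Omega> \<T> (\<lambda>x. f (U (n - 1) x)) = lift (reaction f (cf (U (n - 1))))"
    unfolding reaction_cf[OF Un(2)] by (rule L2_projection_fe[OF nonlinearity_L2[OF f Un(2)]])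
  moreover have "Z = lift x \<longleftrightarrow> (\<forall>i<m. cf Z i = x i)" for x
    using cf_eqI[OF ZS lift_S, of x] cf_lift by metis
  ultimately show ?thesis by (simp add: cZ cD K_def k_def)
qed

text \<open>Each level is a diagonal linear system with positive entries, so one recursion yields
  existence and uniqueness together.\<close>

lemma fully_discrete_imex:
  assumes f: "L-lipschitz_on UNIV f" and K: "0 < cq_weight sch \<alpha> 0" and \<tau>: "0 < \<tau>"
    and r: "ritz_projection \<Omega> \<T> u0 = lift v"
  shows "fully_discrete_solution sch \<alpha> \<tau> N \<Omega> \<T> f u0 (\<lambda>n. lift (imex (cq_weight sch \<alpha>) (1 / \<tau> powr \<alpha>) lam (reaction f) v n))"
    and "fully_discrete_solution sch \<alpha> \<tau> N \<Omega> \<T> f u0 U \<Longrightarrow> n \<le> N \<Longrightarrow> i < m \<Longrightarrow>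
      cf (U n) i = imex (cq_weight sch \<alpha>) (1 / \<tau> powr \<alpha>) lam (reaction f) v n i"
proof -
  define W where "W = imex (cq_weight sch \<alpha>) (1 / \<tau> powr \<alpha>) lam (reaction f) v"
  have W0: "W 0 = v" by (simp add: W_def imex.simps)
  have pos: "0 < 1 / \<tau> powr \<alpha> * cq_weight sch \<alpha> 0 + lam i" if "i < m" for i
    using K \<tau> lam_ge(2)[OF that] by (simp add: add_pos_pos)
  have Wn: "W n i = (reaction f (W (n - 1)) i - 1 / \<tau> powr \<alpha> * (\<Sum>j=1..<n. cq_weight sch \<alpha> (n - j) * (W j i - v i))
      + 1 / \<tau> powr \<alpha> * cq_weight sch \<alpha> 0 * v i) / (1 / \<tau> powr \<alpha> * cq_weight sch \<alpha> 0 + lam i)" if "1 \<le> n" for n i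
    unfolding W_def by (subst imex.simps) (use that in simp)
  have "(\<lambda>x. discrete_frac_deriv sch \<alpha> \<tau> (\<lambda>j y. lift (W j) y - lift (W 0) y) n x - discrete_laplacian \<Omega> \<T> (lift (W n)) x)
      = L2_projection \<Omega> \<T> (\<lambda>x. f (lift (W (n - 1)) x))" if n: "1 \<le> n" for n
  proof (subst scheme_equation[OF f lift_S n], intro allI impI)
    fix i assume i: "i < m"
    have "reaction f (cf (lift (W (n - 1)))) = reaction f (W (n - 1))" by (rule reaction_cong) (rule cf_lift)
    then show "1 / \<tau> powr \<alpha> * (\<Sum>j=1..n. cq_weight sch \<alpha> (n - j) * (cf (lift (W j)) i - cf (lift (W 0)) i)) + lam i * cf (lift (W n)) i
      = reaction f (cf (lift (W (n - 1)))) i"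
      unfolding cf_lift[OF i] W0 imex_step[where k = "1 / \<tau> powr \<alpha>" and K = "cq_weight sch \<alpha>" and x = "\<lambda>j. W j i" and v = v and i = i and lam = lam, OF n pos[OF i]]
      using Wn[OF n] by simp
  qed
  then show "fully_discrete_solution sch \<alpha> \<tau> N \<Omega> \<T> f u0 (\<lambda>n. lift (imex (cq_weight sch \<alpha>) (1 / \<tau> powr \<alpha>) lam (reaction f) v n))"
    unfolding W_def [symmetric] fully_discrete_solution_def using r W0 by (simp add: lift_S)
  assume U: "fully_discrete_solution sch \<alpha> \<tau> N \<Omega> \<T> f u0 U" and n: "n \<le> N" and i: "i < m"
  have U0: "U 0 = lift v" using U r by (simp add: fully_discrete_solution_def)
  have "U 0 \<in> S" by (simp only: U0 lift_S)
  then have US: "U j \<in> S" if "j \<le> N" for j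
    using U that by (cases "j = 0") (auto simp: fully_discrete_solution_def)
  have "\<forall>i<m. cf (U n) i = W n i" if "n \<le> N" for n
    using that
  proof (induction n rule: less_induct)
    case (less n)
    show ?case
    proof (cases "n = 0")
      case True
      then show ?thesis by (simp add: U0 W0 cf_lift)
    next
      case False
      then have n: "1 \<le> n" by simp
      have eq: "\<forall>i<m. 1 / \<tau> powr \<alpha> * (\<Sum>j=1..n. cq_weight sch \<alpha> (n - j) * (cf (U j) i - cf (U 0) i)) + lam i * cf (U n) i
          = reaction f (cf (U (n - 1))) i"
        using U n less.prems by (subst scheme_equation[OF f US n, symmetric]) (auto simp: fully_discrete_solution_def)
      show ?thesis
      proof (intro allI impI)
        fix i assume i: "i < m"
        have prev: "reaction f (cf (U (n - 1))) = reaction f (W (n - 1))"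
          using less n by (intro reaction_cong) auto
        have sum: "(\<Sum>j=1..<n. cq_weight sch \<alpha> (n - j) * (cf (U j) i - v i)) = (\<Sum>j=1..<n. cq_weight sch \<alpha> (n - j) * (W j i - v i))"
          using less i by (intro sum.cong) auto
        have "1 / \<tau> powr \<alpha> * (\<Sum>j=1..n. cq_weight sch \<alpha> (n - j) * (cf (U j) i - v i)) + lam i * cf (U n) i
            = reaction f (W (n - 1)) i"
          using eq i prev by (simp add: U0 cf_lift)
        then show "cf (U n) i = W n i"
          unfolding imex_step[where k = "1 / \<tau> powr \<alpha>" and K = "cq_weight sch \<alpha>" and x = "\<lambda>j. cf (U j) i" and v = v and i = i and lam = lam, OF n pos[OF i]]
            sum Wn[OF n] .
      qed
    qed
  qed
  then show "cf (U n) i = imex (cq_weight sch \<alpha>) (1 / \<tau> powr \<alpha>) lam (reaction f) v n i"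
    using n i by (simp add: W_def)
qed

end

theorem theorem4p4:
  fixes \<alpha> T \<kappa> \<sigma> :: real
    and \<Omega> :: "'a::euclidean_space set"
    and u0 :: "'a \<Rightarrow> real"
    and f :: "real \<Rightarrow> real"
    and sch :: time_scheme
  assumes "0 < \<alpha>" and "\<alpha> < 1" and "0 < T"
    and "convex_polytopal_domain \<Omega>"
    and "u0 \<in> sobolev_H10 \<Omega> \<inter> sobolev_H 2 \<Omega>"
    and "\<exists>L. L-lipschitz_on UNIV f"
  shows "\<exists>c::real. \<forall>\<T> (N::nat) (\<tau>::real).
           triangulates \<T> \<Omega> \<and> shape_regular \<kappa> \<T> \<and> quasi_uniform \<sigma> \<T> \<and>
           1 \<le> N \<and> \<tau> = T / real N \<longrightarrow>
           (\<exists>U. fully_discrete_solution sch \<alpha> \<tau> N \<Omega> \<T> f u0 U) \<and>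
           (\<forall>U V. fully_discrete_solution sch \<alpha> \<tau> N \<Omega> \<T> f u0 U \<and>
                  fully_discrete_solution sch \<alpha> \<tau> N \<Omega> \<T> f u0 V \<longrightarrow>
                  (\<forall>n\<in>{1..N}. U n = V n)) \<and>
           (\<forall>u U. semidiscrete_solution \<alpha> T \<Omega> \<T> f u0 u \<and>
                  fully_discrete_solution sch \<alpha> \<tau> N \<Omega> \<T> f u0 U \<longrightarrow>
                  (MAX n\<in>{1..N}. L2_norm \<Omega> (\<lambda>x. u (real n * \<tau>) x - U n x)) \<le> c * \<tau> powr \<alpha>)"
proof -
  interpret frac_order \<alpha> by unfold_locales (fact assms(1,2))+
  obtain L0 where "L0-lipschitz_on UNIV f" using assms(6) by blast
  \<comment> \<open>Enlarged to be strictly positive, since the choice of \<open>mu\<close> involves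
    1 / (2 * L).\<close>
  then have f: "(\<bar>L0\<bar> + 1)-lipschitz_on UNIV f" by (rule lipschitz_on_mono) auto
  define L where "L = \<bar>L0\<bar> + 1"
  have f: "L-lipschitz_on UNIV f" and L: "0 < L" using f by (auto simp: L_def)
  have dom: "convex_polytopal_domain \<Omega>" by (fact assms(4))
  obtain w where w: "w \<in> L2_space \<Omega>"
    "\<And>\<T> v. triangulates \<T> \<Omega> \<Longrightarrow> v \<in> fe_space \<Omega> \<T> \<Longrightarrow> grad_inner \<Omega> u0 v = L2_inner \<Omega> w v"
    using H2_laplacian[OF dom, of u0] assms(5) by blast
  have "bounded \<Omega>" using dom by (simp add: convex_polytopal_domain_def)
  then obtain R where R: "0 < R" "\<And>x. x \<in> \<Omega> \<Longrightarrow> norm x \<le> R" unfolding bounded_pos by blast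
  define M where "M = L2_norm \<Omega> (\<lambda>x. f 0) + L * (4 * R\<^sup>2 * L2_norm \<Omega> w) + L2_norm \<Omega> w"
  have M: "0 \<le> M" using L by (simp add: M_def L2_norm_def L2_inner_nonneg)
  obtain c0 eps C where K: "cq_weights \<alpha> (cq_weight sch \<alpha>) c0" "cq_weights.comparable \<alpha> (cq_weight sch \<alpha>) eps C"
    by (rule cq_weight_comparable)
  interpret cq_weights \<alpha> "cq_weight sch \<alpha>" c0 by (rule K)
  \<comment> \<open>Instantiated before the triangulation and the step size are introduced, so
    \<open>Eb\<close> can depend on neither.\<close>
  interpret error_params \<alpha> "cq_weight sch \<alpha>" c0 T L M C eps
    by unfold_locales (fact assms(3) L M K(2))+
  have "(\<exists>U. fully_discrete_solution sch \<alpha> \<tau> N \<Omega> \<T> f u0 U) \<and>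
      (\<forall>U V. fully_discrete_solution sch \<alpha> \<tau> N \<Omega> \<T> f u0 U \<and> fully_discrete_solution sch \<alpha> \<tau> N \<Omega> \<T> f u0 V \<longrightarrow>
        (\<forall>n\<in>{1..N}. U n = V n)) \<and>
      (\<forall>u U. semidiscrete_solution \<alpha> T \<Omega> \<T> f u0 u \<and> fully_discrete_solution sch \<alpha> \<tau> N \<Omega> \<T> f u0 U \<longrightarrow>
        (MAX n\<in>{1..N}. L2_norm \<Omega> (\<lambda>x. u (real n * \<tau>) x - U n x)) \<le> \<bar>Eb\<bar> * \<tau> powr \<alpha>)"
    if tri: "triangulates \<T> \<Omega>" and N: "1 \<le> N" and \<tau>: "\<tau> = T / real N" for \<T> N \<tau>
  proof -
    interpret fe: fe_setting \<Omega> \<T> by unfold_locales (fact dom tri)+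
    obtain m e lam where "onb (fe_space \<Omega> \<T>) (L2_inner \<Omega>) m e"
      "\<And>i j. i < m \<Longrightarrow> j < m \<Longrightarrow> grad_inner \<Omega> (e i) (e j) = (if i = j then lam i else 0)"
      using fe.fe_eigenbasis by blast
    then interpret fe: fe_spectral \<Omega> \<T> m e lam R using R by unfold_locales
    have \<tau>_pos: "0 < \<tau>" "real N * \<tau> = T" using \<tau> N assms(3) by auto
    define v where "v i = fe.cf w i / lam i" for i
    have r: "ritz_projection \<Omega> \<T> u0 = fe.lift v"
      unfolding v_def using w tri by (intro fe.ritz_projection_fe) auto
    note sol = fe.fully_discrete_imex[OF f K0_pos \<tau>_pos(1) r]
    have US: "U n \<in> fe_space \<Omega> \<T>" if "fully_discrete_solution sch \<alpha> \<tau> N \<Omega> \<T> f u0 U" "n \<le> N" for U n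
      using that r fe.lift_S by (cases "n = 0") (auto simp: fully_discrete_solution_def)
    have unique: "U n = V n" if U: "fully_discrete_solution sch \<alpha> \<tau> N \<Omega> \<T> f u0 U"
      and V: "fully_discrete_solution sch \<alpha> \<tau> N \<Omega> \<T> f u0 V" and n: "n \<in> {1..N}" for U V n
      using n sol(2)[OF U] sol(2)[OF V] by (intro fe.cf_eqI US[OF U] US[OF V]) auto
    have bound: "L2_norm \<Omega> (\<lambda>x. u (real n * \<tau>) x - U n x) \<le> \<bar>Eb\<bar> * \<tau> powr \<alpha>"
      if u: "semidiscrete_solution \<alpha> T \<Omega> \<T> f u0 u" and U: "fully_discrete_solution sch \<alpha> \<tau> N \<Omega> \<T> f u0 U"
        and n: "n \<in> {1..N}" for u U n
    proof -
      have "real n * \<tau> \<le> real N * \<tau>" using n \<tau>_pos(1) by (intro mult_right_mono) auto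
      then have "real n * \<tau> \<in> {0..T}" using \<tau>_pos by simp
      then have uS: "u (real n * \<tau>) \<in> fe_space \<Omega> \<T>" using u by (simp add: semidiscrete_solution_def)
      have UnS: "U n \<in> fe_space \<Omega> \<T>" using US[OF U] n by simp
      have "L2_norm \<Omega> (\<lambda>x. u (real n * \<tau>) x - U n x) = nrm m (fe.cf (\<lambda>x. u (real n * \<tau>) x - U n x))"
        using fe.L2.S_diff[OF uS UnS, of 1] by (intro fe.L2_norm_fe) simp
      also have "\<dots> = nrm m (\<lambda>i. fe.cf (u (real n * \<tau>)) i - fe.cf (U n) i)"
        by (intro nrm_cong fe.cf_diff fe.fe_L2 uS UnS)
      also have "\<dots> \<le> \<bar>Eb\<bar> * \<tau> powr \<alpha>"
      \<comment> \<open>S_h may be trivial, as for a mesh without interior vertices. Then the error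
        is 0, and the absolute value around \<open>Eb\<close> keeps the bound valid.\<close>
      proof (cases "m = 0")
        case True
        then show ?thesis by (simp add: nrm_def)
      next
        case False
        have u0v: "fe.cf (u 0) i = v i" if "i < m" for i
          using u r fe.cf_lift[OF that] by (simp add: semidiscrete_solution_def)
        have U0v: "fe.cf (U 0) i = v i" if "i < m" for i
          using U r fe.cf_lift[OF that] by (simp add: fully_discrete_solution_def)
        interpret discrete_problem \<alpha> "cq_weight sch \<alpha>" c0 T L M C eps m lam v "fe.reaction f" "\<lambda>t. fe.cf (u t)" N \<tau> "\<lambda>n. fe.cf (U n)"
        proof
          show "0 < m" using False by simp
          show "0 \<le> lam i" if "i < m" for i using fe.lam_ge(2)[OF that] by simp
          show "nrm m (\<lambda>i. fe.reaction f x i - fe.reaction f y i) \<le> L * nrm m (\<lambda>i. x i - y i)" for x y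
            by (rule fe.reaction_lipschitz[OF f])
          show "nrm m (\<lambda>i. fe.reaction f v i - lam i * v i) \<le> M"
            unfolding M_def v_def [abs_def] by (rule fe.start_bound[OF f w(1)])
          show "fe.cf (u 0) i = v i" if "i < m" for i by (rule u0v[OF that])
          show "continuous_on {0..T} (\<lambda>t. fe.cf (u t) i)" if "i < m" for i
            by (rule fe.semidiscrete_volterra(1)[OF assms(1-3) f u that])
          show "fe.cf (u t) i = v i + (\<integral>s. kern \<alpha> (t - s) * (indicator {0<..T} s * (fe.reaction f (fe.cf (u s)) i - lam i * fe.cf (u s) i)) \<partial>lborel)"
            if "i < m" "0 < t" "t \<le> T" for i t
            using fe.semidiscrete_volterra(2)[OF assms(1-3) f u that(1), of t] that u0v by simp
          show "0 < \<tau>" "real N * \<tau> \<le> T" using \<tau>_pos by auto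
          show "fe.cf (U 0) i = v i" if "i < m" for i by (rule U0v[OF that])
          show "1 / \<tau> powr \<alpha> * (\<Sum>j=1..k. cq_weight sch \<alpha> (k - j) * (fe.cf (U j) i - v i)) + lam i * fe.cf (U k) i
              = fe.reaction f (fe.cf (U (k - 1))) i" if k: "1 \<le> k" "k \<le> N" and i: "i < m" for k i
          proof -
            have "(\<lambda>x. discrete_frac_deriv sch \<alpha> \<tau> (\<lambda>j y. U j y - U 0 y) k x - discrete_laplacian \<Omega> \<T> (U k) x)
                = L2_projection \<Omega> \<T> (\<lambda>x. f (U (k - 1) x))"
            proof -
              have "k \<in> {1..N}" using k by simp
              then show ?thesis using U unfolding fully_discrete_solution_def by blast
            qed
            then have "\<forall>i<m. 1 / \<tau> powr \<alpha> * (\<Sum>j=1..k. cq_weight sch \<alpha> (k - j) * (fe.cf (U j) i - fe.cf (U 0) i)) + lam i * fe.cf (U k) i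
                = fe.reaction f (fe.cf (U (k - 1))) i"
              by (subst (asm) fe.scheme_equation[where U = U, OF f US[OF U] k(1)]) (use k in simp)
            from this[rule_format, OF i] show ?thesis unfolding U0v[OF i] .
          qed
        qed
        have "nrm m (\<lambda>i. fe.cf (u (real n * \<tau>)) i - fe.cf (U n) i) \<le> Eb * \<tau> powr \<alpha>"
          by (rule error_bound) (use n in simp)
        also have "\<dots> \<le> \<bar>Eb\<bar> * \<tau> powr \<alpha>" by (intro mult_right_mono) auto
        finally show ?thesis .
      qed
      finally show ?thesis .
    qed
    have "(MAX n\<in>{1..N}. L2_norm \<Omega> (\<lambda>x. u (real n * \<tau>) x - U n x)) \<le> \<bar>Eb\<bar> * \<tau> powr \<alpha>"
      if "semidiscrete_solution \<alpha> T \<Omega> \<T> f u0 u" "fully_discrete_solution sch \<alpha> \<tau> N \<Omega> \<T> f u0 U" for u U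
      using bound[OF that] N by (intro Max.boundedI) auto
    then show ?thesis using sol(1)[of N] unique by blast
  qed
  then show ?thesis by blast
qed

end
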